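(* Let $0<p,q<\infty$, $\omega\in\widehat{\mathcal D}$, $\nu\in\mathcal D$ and $\mu\in M^+([0,1))$. Then the following holds. (i) If $p\le q$, the following conditions are equivalent: (a) $C_{\mu,\omega}:A^p_\nu\to A^q_\nu$ is bounded; (b) $\|\mu^{(p,q)}_{\omega,\nu}\|_{L^\infty}:=\sup_{0\le r<1}\frac{\widehat\mu(r)}{\widehat\omega(r)\widehat\nu(r)^{\frac1p-\frac1q}(1-r)^{1+\frac1p-\frac1q}}<\infty$; (c) $\|\mu^{(p,q)}_{\omega,\nu}\|_{\ell^\infty}:=\sup_{n\in\mathbb N_0}\frac{\mu_n(n+1)^{1+\frac1p-\frac1q}}{\omega_n\nu_n^{\frac1p-\frac1q}}<\infty$; (d) for every fixed $\beta>0$, $D^{\beta+\frac1p-\frac1q}D^{\nu^{\frac1p-\frac1q}}F_{\mu,\omega}\in X_\beta$. Moreover, $\|C_{\mu,\omega}\|_{A^p_\nu\to A^q_\nu}\asymp\|\mu^{(p,q)}_{\omega,\nu}\|_{L^\infty}\asymp\|\mu^{(p,q)}_{\omega,\nu}\|_{\ell^\infty}\asymp\|D^{\beta+\frac1p-\frac1q}D^{\nu^{\frac1p-\frac1q}}F_{\mu,\omega}\|_{X_\beta}$. (ii) If $q<p$, the following conditions are equivalent: (a) $C_{\mu,\omega}:A^p_\nu\to A^q_\nu$ is bounded; (b) $\|\mu_\omega\|_{L^{\frac{qp}{p-q}}_{\widehat\nu}}^{\frac{qp}{p-q}}:=\int_0^1\left(\frac{\widehat\mu(r)}{\widehat\omega(r)(1-r)}\right)^{\frac{qp}{p-q}}\widehat\nu(r)\,dr+\widehat\mu(0)^{\frac{qp}{p-q}}<\infty$;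 (c) $\|\mu_\omega\|_{\ell^{\frac{qp}{p-q}}_{\nu_n/(n+1)^2}}^{\frac{qp}{p-q}}:=\sum_{n=0}^\infty\left(\frac{\mu_n(n+1)}{\omega_n}\right)^{\frac{qp}{p-q}}\frac{\nu_n}{(n+1)^2}<\infty$; (d) $F_{\mu,\omega}\in A^{\frac{qp}{p-q}}_\nu$. Moreover, $\|C_{\mu,\omega}\|_{A^p_\nu\to A^q_\nu}\asymp\|\mu_\omega\|_{L^{\frac{qp}{p-q}}_{\widehat\nu}}\asymp\|\mu_\omega\|_{\ell^{\frac{qp}{p-q}}_{\nu_n/(n+1)^2}}\asymp\|F_{\mu,\omega}\|_{A^{\frac{qp}{p-q}}_\nu}$.
   Context: $\mathcal H(\mathbb D)$ is the space of analytic functions in the unit disc $\mathbb D$. A weight is an integrable function $\omega:\mathbb D\to[0,\infty)$; it is radial if $\omega(z)=\omega(|z|)$. For a radial weight, $\widehat\omega(r)=\int_r^1\omega(s)\,ds$ and $\omega_x=\int_0^1 r^x\omega(r)\,dr$. $\omega\in\widehat{\mathcal D}$ means: $\omega$ is a radial weight, not a.e. zero, and there is $C>1$ with $\widehat\omega(r)\le C\,\widehat\omega\left(\frac{1+r}2\right)$ for all $0\le r<1$. $\omega\in\check{\mathcal D}$ means: $\omega$ is a radial weight and there are $C'>1$, $K>1$ with $\widehat\omega(r)\ge C'\widehat\omega\left(1-\frac{1-r}K\right)$ for all $0\le r<1$. $\mathcal D=\widehat{\mathcal D}\cap\check{\mathcal D}$. $M^+([0,1))$ is the set of finite positive Borel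 measures on $[0,1)$; $\widehat\mu(r)=\mu([r,1))$, $\mu_x=\int_{[0,1)}r^x\,d\mu(r)$ (with $0^0=1$). Kernel: $B^\omega_t(z)=\sum_{n=0}^\infty\frac{(tz)^n}{2\omega_{2n+1}}$, $0\le t<1$, $z\in\mathbb D$. Operator: $C_{\mu,\omega}(f)(z)=\int_0^1 f(tz)B^\omega_t(z)\,d\mu(t)$ for $f\in\mathcal H(\mathbb D)$. Fundamental function: $F_{\mu,\omega}(z)=C_{\mu,\omega}(1)(z)=\sum_{n=0}^\infty\frac{\mu_n}{2\omega_{2n+1}}z^n$. For $f(z)=\sum a_kz^k$: $D^\nu f(z)=\sum_k\frac{a_k}{\nu_{2k+1}}z^k$; for $\alpha>0$, $D^\alpha:=D^{\omega_{\alpha-1}}$ where $\omega_{\alpha-1}(z)=\alpha(1-|z|^2)^{\alpha-1}$ is the standard weight; for $s\ge0$, $D^{\nu^s}f(z)=\sum_k\frac{a_k}{\nu_{2k+1}^s}z^k$ (the identity if $s=0$). $A^p_\nu$ is the space of $f\in\mathcal H(\mathbb D)$ with $\|f\|_{A^p_\nu}^p=\int_{\mathbb D}|f|^p\nu\,dA<\infty$, $dA$ being normalized area measure. For $\beta>0$, $X_\beta$ is the space of $f\in\mathcal H(\mathbb D)$ with $\|f\|_{X_\beta}=\sup_{0\le r<1}(1-r)^\beta\max_{|z|=r}|f(z)|<\infty$. Bounded $X\to Y$ means $\|C_{\mu,\omega}f\|_Y\le C\|f\|_X$ for all $f\in X$; the operator norm is the least such $C$ (infinite if unbounded). $A\asymp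 B$ means $c^{-1}B\le A\le cB$ with $c>0$ independent of $\mu$ (it may depend on $p,q,\omega,\nu,\beta$). *)

theory Defs
  imports "HOL-Analysis.Analysis"
begin

text \<open>Functions on the disc are modelled as total functions on the complex plane; only their
  values on \<open>ball 0 1\<close> matter.\<close>

definition weight :: "(complex \<Rightarrow> real) \<Rightarrow> bool" where
  "weight \<omega> \<longleftrightarrow> (\<forall>z\<in>ball 0 1. 0 \<le> \<omega> z) \<and> set_integrable lebesgue (ball 0 1) \<omega>"

definition radial_weight :: "(complex \<Rightarrow> real) \<Rightarrow> bool" where
  "radial_weight \<omega> \<longleftrightarrow> weight \<omega> \<and> (\<forall>z\<in>ball 0 1. \<omega> z = \<omega> (complex_of_real (norm z)))"

text \<open>The tail integral is taken in \<open>[0,\<infinity>]\<close>: integrability over the disc only controls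
  \<open>r * \<omega> r\<close> near the origin, so the value at \<open>r = 0\<close> may be infinite for a
  general radial weight (but not for a member of \<open>D_hat\<close>).\<close>

definition weight_hat :: "(complex \<Rightarrow> real) \<Rightarrow> real \<Rightarrow> ennreal" where
  "weight_hat \<omega> r = (\<integral>\<^sup>+ s\<in>{r..<1}. ennreal (\<omega> (complex_of_real s)) \<partial>lebesgue)"

definition weight_moment :: "(complex \<Rightarrow> real) \<Rightarrow> nat \<Rightarrow> real" where
  "weight_moment \<omega> n = (LINT r:{0..<1}|lebesgue. r ^ n * \<omega> (complex_of_real r))"

definition D_hat :: "(complex \<Rightarrow> real) set" where
  "D_hat = {\<omega>. radial_weight \<omega> \<and> \<not> (AE z in lebesgue. z \<in> ball 0 1 \<longrightarrow> \<omega> z = 0) \<and>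
     (\<exists>C::real. C > 1 \<and>
        (\<forall>r. 0 \<le> r \<and> r < 1 \<longrightarrow> weight_hat \<omega> r \<le> ennreal C * weight_hat \<omega> ((1 + r) / 2)))}"

definition D_check :: "(complex \<Rightarrow> real) set" where
  "D_check = {\<omega>. radial_weight \<omega> \<and>
     (\<exists>C K::real. C > 1 \<and> K > 1 \<and>
        (\<forall>r. 0 \<le> r \<and> r < 1 \<longrightarrow> weight_hat \<omega> r \<ge> ennreal C * weight_hat \<omega> (1 - (1 - r) / K)))}"

definition D_reg :: "(complex \<Rightarrow> real) set" where
  "D_reg = D_hat \<inter> D_check"

text \<open>The standard weight \<open>\<omega>\<^bsub>\<alpha>-1\<^esub>\<close>, indexed here by \<open>\<alpha>\<close>.\<close>

definition standard_weight :: "real \<Rightarrow> complex \<Rightarrow> real" where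
  "standard_weight \<alpha> z = \<alpha> * (1 - (norm z)\<^sup>2) powr (\<alpha> - 1)"

definition M_plus :: "real measure set" where
  "M_plus = {\<mu>. finite_measure \<mu> \<and> sets \<mu> = sets (restrict_space borel {0..<1::real})}"

definition measure_hat :: "real measure \<Rightarrow> real \<Rightarrow> real" where
  "measure_hat \<mu> r = measure \<mu> {r..<1}"

definition measure_moment :: "real measure \<Rightarrow> nat \<Rightarrow> real" where
  "measure_moment \<mu> n = (LINT t|\<mu>. t ^ n)"

definition kernel :: "(complex \<Rightarrow> real) \<Rightarrow> real \<Rightarrow> complex \<Rightarrow> complex" where
  "kernel \<omega> t z =
     (\<Sum>n. (complex_of_real t * z) ^ n / complex_of_real (2 * weight_moment \<omega> (2 * n + 1)))"

definition cesaro_op ::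
  "real measure \<Rightarrow> (complex \<Rightarrow> real) \<Rightarrow> (complex \<Rightarrow> complex) \<Rightarrow> complex \<Rightarrow> complex" where
  "cesaro_op \<mu> \<omega> f z = (LINT t|\<mu>. f (complex_of_real t * z) * kernel \<omega> t z)"

definition fundamental_fun :: "real measure \<Rightarrow> (complex \<Rightarrow> real) \<Rightarrow> complex \<Rightarrow> complex" where
  "fundamental_fun \<mu> \<omega> = cesaro_op \<mu> \<omega> (\<lambda>_. 1)"

definition taylor_coeff :: "(complex \<Rightarrow> complex) \<Rightarrow> nat \<Rightarrow> complex" where
  "taylor_coeff f k = (deriv ^^ k) f 0 / fact k"

definition frac_deriv :: "(complex \<Rightarrow> real) \<Rightarrow> (complex \<Rightarrow> complex) \<Rightarrow> complex \<Rightarrow> complex" where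
  "frac_deriv \<nu> f z =
     (\<Sum>k. taylor_coeff f k / complex_of_real (weight_moment \<nu> (2 * k + 1)) * z ^ k)"

definition std_frac_deriv :: "real \<Rightarrow> (complex \<Rightarrow> complex) \<Rightarrow> complex \<Rightarrow> complex" where
  "std_frac_deriv \<alpha> = frac_deriv (standard_weight \<alpha>)"

definition frac_deriv_pow ::
  "(complex \<Rightarrow> real) \<Rightarrow> real \<Rightarrow> (complex \<Rightarrow> complex) \<Rightarrow> complex \<Rightarrow> complex" where
  "frac_deriv_pow \<nu> s f z =
     (\<Sum>k. taylor_coeff f k / complex_of_real (weight_moment \<nu> (2 * k + 1) powr s) * z ^ k)"

text \<open>Power with exponent \<open>a > 0\<close> on \<open>[0,\<infinity>]\<close>.\<close>

definition epowr :: "ennreal \<Rightarrow> real \<Rightarrow> ennreal" where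
  "epowr x a = (if x = \<infinity> then \<infinity> else ennreal (enn2real x powr a))"

text \<open>The area measure is normalised, hence the division by \<open>\<pi>\<close>.\<close>

definition bergman_norm :: "(complex \<Rightarrow> real) \<Rightarrow> real \<Rightarrow> (complex \<Rightarrow> complex) \<Rightarrow> ennreal" where
  "bergman_norm \<nu> p f =
     epowr ((\<integral>\<^sup>+ z\<in>ball 0 1. ennreal (norm (f z) powr p * \<nu> z) \<partial>lebesgue) / ennreal pi) (1 / p)"

definition bergman_space :: "(complex \<Rightarrow> real) \<Rightarrow> real \<Rightarrow> (complex \<Rightarrow> complex) set" where
  "bergman_space \<nu> p = {f. f holomorphic_on ball 0 1 \<and> bergman_norm \<nu> p f < \<infinity>}"

definition growth_norm :: "real \<Rightarrow> (complex \<Rightarrow> complex) \<Rightarrow> ennreal" where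
  "growth_norm \<beta> f =
     (SUP r\<in>{0..<1}. ennreal ((1 - r) powr \<beta>) * (SUP z\<in>sphere 0 r. ennreal (norm (f z))))"

definition growth_space :: "real \<Rightarrow> (complex \<Rightarrow> complex) set" where
  "growth_space \<beta> = {f. f holomorphic_on ball 0 1 \<and> growth_norm \<beta> f < \<infinity>}"

definition bergman_bound ::
  "(complex \<Rightarrow> real) \<Rightarrow> real \<Rightarrow> real \<Rightarrow> ((complex \<Rightarrow> complex) \<Rightarrow> complex \<Rightarrow> complex) \<Rightarrow> real \<Rightarrow> bool" where
  "bergman_bound \<nu> p q T C \<longleftrightarrow> 0 \<le> C \<and>
     (\<forall>f\<in>bergman_space \<nu> p. T f \<in> bergman_space \<nu> q \<and>
        bergman_norm \<nu> q (T f) \<le> ennreal C * bergman_norm \<nu> p f)"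

definition bergman_bounded ::
  "(complex \<Rightarrow> real) \<Rightarrow> real \<Rightarrow> real \<Rightarrow> ((complex \<Rightarrow> complex) \<Rightarrow> complex \<Rightarrow> complex) \<Rightarrow> bool" where
  "bergman_bounded \<nu> p q T \<longleftrightarrow> (\<exists>C. bergman_bound \<nu> p q T C)"

text \<open>If no bound exists, this is the infimum of the empty set, that is \<open>\<infinity>\<close>.\<close>

definition bergman_opnorm ::
  "(complex \<Rightarrow> real) \<Rightarrow> real \<Rightarrow> real \<Rightarrow> ((complex \<Rightarrow> complex) \<Rightarrow> complex \<Rightarrow> complex) \<Rightarrow> ennreal" where
  "bergman_opnorm \<nu> p q T = (INF C\<in>{C. bergman_bound \<nu> p q T C}. ennreal C)"

definition mu_Linf ::
  "real \<Rightarrow> real \<Rightarrow> (complex \<Rightarrow> real) \<Rightarrow> (complex \<Rightarrow> real) \<Rightarrow> real measure \<Rightarrow> ennreal" where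
  "mu_Linf p q \<omega> \<nu> \<mu> =
     (SUP r\<in>{0..<1}. ennreal (measure_hat \<mu> r /
        (enn2real (weight_hat \<omega> r) * enn2real (weight_hat \<nu> r) powr (1 / p - 1 / q)
          * (1 - r) powr (1 + 1 / p - 1 / q))))"

definition mu_linf ::
  "real \<Rightarrow> real \<Rightarrow> (complex \<Rightarrow> real) \<Rightarrow> (complex \<Rightarrow> real) \<Rightarrow> real measure \<Rightarrow> ennreal" where
  "mu_linf p q \<omega> \<nu> \<mu> =
     (SUP n. ennreal (measure_moment \<mu> n * real (n + 1) powr (1 + 1 / p - 1 / q) /
        (weight_moment \<omega> n * weight_moment \<nu> n powr (1 / p - 1 / q))))"

definition mu_Ls ::
  "real \<Rightarrow> (complex \<Rightarrow> real) \<Rightarrow> (complex \<Rightarrow> real) \<Rightarrow> real measure \<Rightarrow> ennreal" where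
  "mu_Ls s \<omega> \<nu> \<mu> =
     epowr ((\<integral>\<^sup>+ r\<in>{0..<1}. ennreal ((measure_hat \<mu> r / (enn2real (weight_hat \<omega> r) * (1 - r))) powr s
                 * enn2real (weight_hat \<nu> r)) \<partial>lebesgue)
            + ennreal (measure_hat \<mu> 0 powr s)) (1 / s)"

definition mu_ls ::
  "real \<Rightarrow> (complex \<Rightarrow> real) \<Rightarrow> (complex \<Rightarrow> real) \<Rightarrow> real measure \<Rightarrow> ennreal" where
  "mu_ls s \<omega> \<nu> \<mu> =
     epowr (\<Sum>n. ennreal ((measure_moment \<mu> n * real (n + 1) / weight_moment \<omega> n) powr s
                 * (weight_moment \<nu> n / (real (n + 1))\<^sup>2))) (1 / s)"

text \<open>Comparability of two quantities depending on a finite measure, with a constant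
  independent of the measure; infinite values are allowed.\<close>

definition comparable :: "(real measure \<Rightarrow> ennreal) \<Rightarrow> (real measure \<Rightarrow> ennreal) \<Rightarrow> bool" where
  "comparable A B \<longleftrightarrow>
     (\<exists>c::real. c > 0 \<and>
        (\<forall>\<mu>\<in>M_plus. ennreal (1 / c) * B \<mu> \<le> A \<mu> \<and> A \<mu> \<le> ennreal c * B \<mu>))"

end

theory Submission
  imports Defs "HOL-Complex_Analysis.Complex_Analysis"
begin

text \<open>Everything is reduced to the dyadic radii \<open>dy k = 1 - 1 / 2 ^ k\<close>. The kernel is \<open>G (t * z)\<close> for a
  power series \<open>G\<close> whose coefficients \<open>1 / (2 * \<omega>\<^bsub>2n+1\<^esub>)\<close> behave so regularly that repeated summation by
  parts gives \<open>norm (G z) \<le> B * kd k\<close> as soon as \<open>norm (1 - z) \<ge> 1 / 2 ^ k\<close>, where \<open>kd k\<close> is \<open>2 ^ k\<close>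
  divided by the tail of \<open>\<omega>\<close> at \<open>dy k\<close>. Since the powers of the modulus of an analytic function are dominated by
  Poisson integrals, a function in the Bergman space is controlled on each dyadic disc by numbers
  \<open>Amax\<close> whose weighted sum is bounded by the norm; together with the kernel estimate and a discrete Schur
  test this bounds the operator by the \<open>\<ell>\<^sup>\<infinity>\<close> norm (if \<open>p \<le> q\<close>) or a weighted \<open>\<ell>\<^sup>s\<close> norm (if \<open>q < p\<close>) of
  the sequence \<open>lam \<mu> k\<close>. Conversely, superpositions of \<open>1 / (1 - dy k * z) ^ \<eta>\<close> with nonnegative
  coefficients, on which no cancellation can occur, show that these norms are necessary. All remaining
  conditions are discretised to the same two sequence norms.\<close>

section \<open>Rotation invariance and polar coordinates\<close>

text \<open>The exponents may be smaller than 1, so duality and the triangle inequality for the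
  norms cannot be relied on. Their place is taken by selecting a largest term
  (\<open>schur_powr\<close>) and by a pointwise Young inequality. The kernel is singular only at
  the boundary point 1, and its bound at \<open>t * z\<close> depends on the smaller of the dyadic
  levels of \<open>1 - t\<close> and \<open>norm (1 - z)\<close>. The levels of \<open>t\<close>
  below that of \<open>z\<close> therefore produce a function of \<open>lev z\<close> alone, for
  which a one-dimensional Hardy inequality is enough; on the other levels the bound no longer grows
  and a radial maximal function of \<open>f\<close> takes over. The two halves of
  \<open>D_reg\<close> have separate tasks. Doubling makes moments comparable with tails and limits
  all growth to a fixed factor per level, which a large power of decay defeats. The reverse
  condition puts a fixed part of each tail into boundedly many dyadic annuli; as the weight may
  vanish on some annuli, integrals are moved to dyadic radii by monotonicity of circular
  means.\<close>

lemma nn_integral_complex_iterated: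
  assumes [measurable]: "g \<in> borel_measurable (borel :: complex measure)"
  shows "(\<integral>\<^sup>+z. g z \<partial>lborel) = (\<integral>\<^sup>+x. (\<integral>\<^sup>+y. g (Complex x y) \<partial>lborel) \<partial>lborel)"
proof -
  have mC[measurable]: "(\<lambda>(x,y). Complex x y) \<in> borel_measurable (borel \<Otimes>\<^sub>M borel)"
    unfolding borel_prod by (intro borel_measurable_continuous_onI) (auto simp: case_prod_beta' intro!: continuous_intros)
  \<comment> \<open>Lebesgue measure is determined by its values on boxes. After this
    identification, plane integrals are accessible to one-dimensional arguments.\<close>
  have "lborel = distr (lborel \<Otimes>\<^sub>M lborel) borel (\<lambda>(x,y). Complex x y)"
  proof (rule lborel_eqI)
    fix l u :: complex
    assume le: "\<And>b. b \<in> Basis \<Longrightarrow> l \<bullet> b \<le> u \<bullet> b"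
    have le': "Re l \<le> Re u" "Im l \<le> Im u"
      using le[of 1] le[of \<i>] by (auto simp: Basis_complex_def)
    have *: "(\<lambda>(x,y). Complex x y) -` box l u \<inter> space (lborel \<Otimes>\<^sub>M lborel) = {Re l<..<Re u} \<times> {Im l<..<Im u}"
      by (auto simp: box_def Basis_complex_def space_pair_measure)
    show "emeasure (distr (lborel \<Otimes>\<^sub>M lborel) borel (\<lambda>(x,y). Complex x y)) (box l u) = (\<Prod>b\<in>Basis. (u - l) \<bullet> b)"
      using le' by (subst emeasure_distr)
        (auto simp: * lborel.emeasure_pair_measure_Times Basis_complex_def ennreal_mult)
  qed simp
  then have "(\<integral>\<^sup>+z. g z \<partial>lborel) = (\<integral>\<^sup>+z. g z \<partial>distr (lborel \<Otimes>\<^sub>M lborel) borel (\<lambda>(x,y). Complex x y))"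
    by simp
  also have "\<dots> = (\<integral>\<^sup>+p. g ((\<lambda>(x,y). Complex x y) p) \<partial>(lborel \<Otimes>\<^sub>M lborel))"
    by (rule nn_integral_distr) simp_all
  also have "\<dots> = (\<integral>\<^sup>+x. (\<integral>\<^sup>+y. g (Complex x y) \<partial>lborel) \<partial>lborel)"
    by (subst lborel.nn_integral_fst[symmetric]) auto
  finally show ?thesis .
qed

lemma nn_integral_lborel_translate:
  assumes [measurable]: "g \<in> borel_measurable (borel :: real measure)"
  shows "(\<integral>\<^sup>+x. g (x + a) \<partial>lborel) = (\<integral>\<^sup>+x. g x \<partial>lborel)"
  using nn_integral_real_affine[of g 1 a] by (simp add: add.commute)

lemma Complex_measurable [measurable]:
  assumes [measurable]: "f \<in> borel_measurable M" "g \<in> borel_measurable M"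
  shows "(\<lambda>x. Complex (f x) (g x)) \<in> borel_measurable M"
proof -
  have "(\<lambda>x. Complex (f x) (g x)) = (\<lambda>x. complex_of_real (f x) + \<i> * complex_of_real (g x))"
    by (auto simp: Complex_eq)
  then show ?thesis by simp
qed

text \<open>A shear moves every vertical line within itself, so translation invariance of the inner
  integral suffices and no determinant appears.\<close>

lemma nn_integral_complex_shear_y:
  assumes [measurable]: "g \<in> borel_measurable (borel :: complex measure)"
  shows "(\<integral>\<^sup>+z. g (Complex (Re z) (Im z + b * Re z)) \<partial>lborel) = (\<integral>\<^sup>+z. g z \<partial>lborel)"
proof -
  have "(\<integral>\<^sup>+z. g (Complex (Re z) (Im z + b * Re z)) \<partial>lborel)
      = (\<integral>\<^sup>+x. (\<integral>\<^sup>+y. g (Complex x (y + b * x)) \<partial>lborel) \<partial>lborel)"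
    by (subst nn_integral_complex_iterated) simp_all
  also have "\<dots> = (\<integral>\<^sup>+x. (\<integral>\<^sup>+y. g (Complex x y) \<partial>lborel) \<partial>lborel)"
    by (subst nn_integral_lborel_translate) simp_all
  also have "\<dots> = (\<integral>\<^sup>+z. g z \<partial>lborel)"
    by (subst nn_integral_complex_iterated) simp_all
  finally show ?thesis .
qed

lemma nn_integral_complex_shear_x:
  assumes [measurable]: "g \<in> borel_measurable (borel :: complex measure)"
  shows "(\<integral>\<^sup>+z. g (Complex (Re z + a * Im z) (Im z)) \<partial>lborel) = (\<integral>\<^sup>+z. g z \<partial>lborel)"
proof -
  have "(\<integral>\<^sup>+z. g (Complex (Re z + a * Im z) (Im z)) \<partial>lborel)
      = (\<integral>\<^sup>+x. (\<integral>\<^sup>+y. g (Complex (x + a * y) y) \<partial>lborel) \<partial>lborel)"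
    by (subst nn_integral_complex_iterated) simp_all
  also have "\<dots> = (\<integral>\<^sup>+y. (\<integral>\<^sup>+x. g (Complex (x + a * y) y) \<partial>lborel) \<partial>lborel)"
    by (rule lborel_pair.Fubini'[symmetric]) simp
  also have "\<dots> = (\<integral>\<^sup>+y. (\<integral>\<^sup>+x. g (Complex x y) \<partial>lborel) \<partial>lborel)"
    by (subst nn_integral_lborel_translate) simp_all
  also have "\<dots> = (\<integral>\<^sup>+x. (\<integral>\<^sup>+y. g (Complex x y) \<partial>lborel) \<partial>lborel)"
    by (rule lborel_pair.Fubini') simp
  also have "\<dots> = (\<integral>\<^sup>+z. g z \<partial>lborel)"
    by (subst nn_integral_complex_iterated) simp_all
  finally show ?thesis .
qed

text \<open>A rotation other than \<open>z \<mapsto> -z\<close> is a product of three shears.\<close>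

lemma nn_integral_complex_rotate_aux:
  assumes [measurable]: "g \<in> borel_measurable (borel :: complex measure)" and w: "norm w = 1" "Re w \<noteq> -1"
  shows "(\<integral>\<^sup>+z. g (w * z) \<partial>lborel) = (\<integral>\<^sup>+z. g z \<partial>lborel)"
proof -
  define c s where "c = Re w" and "s = Im w"
  \<comment> \<open>For a rotation by the angle \<theta> this is
    \<open>- tan (\<theta> / 2)\<close>, the coefficient of the two outer shears; the middle shear
    has coefficient \<open>s\<close>. The denominator is the reason for excluding the half
    turn.\<close>
  define a where "a = - s / (1 + c)"
  have c1: "1 + c \<noteq> 0" using w(2) unfolding c_def by auto
  have cs: "c * c + s * s = 1"
    using w(1) unfolding c_def s_def by (simp add: cmod_def power2_eq_square)
  have as: "1 + s * a = c"
  proof -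
    have "s * s = (1 + c) * (1 - c)" using cs by (simp add: algebra_simps)
    then show ?thesis unfolding a_def using c1 by (simp add: divide_simps)
  qed
  have "a * (1 + c) = - s" unfolding a_def using c1 by simp
  then have ac: "a + a * c = - s" by (simp add: distrib_left)
  have wz: "w * z = Complex ((Re z + a * Im z) + a * (Im z + s * (Re z + a * Im z))) (Im z + s * (Re z + a * Im z))" for z
  proof (rule complex_eqI)
    have "(Re z + a * Im z) + a * (Im z + s * (Re z + a * Im z)) = (1 + s * a) * Re z + (a + a * (1 + s * a)) * Im z"
      by (simp add: algebra_simps)
    also have "\<dots> = c * Re z - s * Im z" unfolding as ac by simp
    finally show "Re (w * z) = Re (Complex ((Re z + a * Im z) + a * (Im z + s * (Re z + a * Im z))) (Im z + s * (Re z + a * Im z)))"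
      by (simp add: c_def s_def)
    have "Im z + s * (Re z + a * Im z) = s * Re z + (1 + s * a) * Im z" by (simp add: algebra_simps)
    then show "Im (w * z) = Im (Complex ((Re z + a * Im z) + a * (Im z + s * (Re z + a * Im z))) (Im z + s * (Re z + a * Im z)))"
      unfolding as by (simp add: c_def s_def)
  qed
  define X Y where "X = (\<lambda>z. Complex (Re z + a * Im z) (Im z))" and "Y = (\<lambda>z. Complex (Re z) (Im z + s * Re z))"
  have [measurable]: "X \<in> borel_measurable borel" "Y \<in> borel_measurable borel"
    unfolding X_def Y_def by measurable
  have "w * z = X (Y (X z))" for z unfolding wz by (simp add: X_def Y_def)
  then have "(\<integral>\<^sup>+z. g (w * z) \<partial>lborel) = (\<integral>\<^sup>+z. g (X (Y (X z))) \<partial>lborel)" by simp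
  also have "\<dots> = (\<integral>\<^sup>+z. g (X (Y z)) \<partial>lborel)"
    using nn_integral_complex_shear_x[of "\<lambda>z. g (X (Y z))" a] unfolding X_def by simp
  also have "\<dots> = (\<integral>\<^sup>+z. g (X z) \<partial>lborel)"
    using nn_integral_complex_shear_y[of "\<lambda>z. g (X z)" s] unfolding Y_def by simp
  also have "\<dots> = (\<integral>\<^sup>+z. g z \<partial>lborel)"
    using nn_integral_complex_shear_x[of g a] unfolding X_def by simp
  finally show ?thesis .
qed

lemma nn_integral_complex_rotate:
  assumes [measurable]: "g \<in> borel_measurable (borel :: complex measure)" and w: "norm w = 1"
  shows "(\<integral>\<^sup>+z. g (w * z) \<partial>lborel) = (\<integral>\<^sup>+z. g z \<partial>lborel)"
proof (cases "Re w = -1")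
  case False then show ?thesis using nn_integral_complex_rotate_aux assms by blast
next
  case True
  then have "Im w = 0" using w by (simp add: cmod_def power2_eq_square)
  \<comment> \<open>Only the half turn is left. It is composed of two quarter turns, each covered by
    the three shears.\<close>
  then have "w = \<i> * \<i>" using True by (simp add: complex_eq_iff)
  then have "(\<integral>\<^sup>+z. g (w * z) \<partial>lborel) = (\<integral>\<^sup>+z. g (\<i> * (\<i> * z)) \<partial>lborel)" by (simp add: mult.assoc)
  also have "\<dots> = (\<integral>\<^sup>+z. g (\<i> * z) \<partial>lborel)"
    by (rule nn_integral_complex_rotate_aux) simp_all
  also have "\<dots> = (\<integral>\<^sup>+z. g z \<partial>lborel)"
    by (rule nn_integral_complex_rotate_aux) simp_all
  finally show ?thesis .
qed

text \<open>The period is normalised to 1, so that integrals over \<open>{0..<1}\<close> are already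
  mean values over the circle.\<close>

definition rot :: "real \<Rightarrow> complex" where "rot u = cis (2 * pi * u)"

lemma norm_rot [simp]: "norm (rot u) = 1" by (simp add: rot_def)

lemma rot_measurable [measurable]: "rot \<in> borel_measurable borel"
  unfolding rot_def by (intro borel_measurable_continuous_onI continuous_intros)

lemma continuous_on_rot [continuous_intros]: "continuous_on S f \<Longrightarrow> continuous_on S (\<lambda>x. rot (f x))"
  unfolding rot_def by (intro continuous_intros)

lemma rot_add: "rot (u + v) = rot u * rot v"
  by (simp add: rot_def cis_mult ring_distribs)

lemma rot_add_one [simp]: "rot (u + 1) = rot u"
  unfolding rot_add by (simp add: rot_def)

lemma rot_polar: "\<exists>a. 0 \<le> a \<and> a < 1 \<and> z = complex_of_real (norm z) * rot a"
proof -
  define a where "a = Arg2pi z / (2 * pi)"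
  have "0 \<le> a" "a < 1" unfolding a_def using Arg2pi[of z] by auto
  moreover have "z = complex_of_real (norm z) * rot a"
    using Arg2pi_eq[of z] unfolding a_def rot_def by (simp add: cis_conv_exp mult.commute)
  ultimately show ?thesis by blast
qed

definition circ_avg :: "(complex \<Rightarrow> ennreal) \<Rightarrow> real \<Rightarrow> ennreal" where
  "circ_avg g r = (\<integral>\<^sup>+u\<in>{0..<1}. g (complex_of_real r * rot u) \<partial>lborel)"

lemma circ_avg_measurable [measurable]:
  assumes [measurable]: "g \<in> borel_measurable borel"
  shows "circ_avg g \<in> borel_measurable borel"
  unfolding circ_avg_def[abs_def] by measurable

text \<open>The argument of \<open>z\<close> only shifts the parameter: the interval becomes
  \<open>{a..<a+1}\<close>, and the part beyond 1 is moved back by periodicity.\<close>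

lemma circ_avg_rotate:
  assumes [measurable]: "g \<in> borel_measurable borel"
  shows "(\<integral>\<^sup>+u\<in>{0..<1}. g (z * rot u) \<partial>lborel) = circ_avg g (norm z)"
proof -
  obtain a where a: "0 \<le> a" "a < 1" "z = complex_of_real (norm z) * rot a"
    using rot_polar by blast
  define G where "G = (\<lambda>u. g (complex_of_real (norm z) * rot u))"
  have [measurable]: "G \<in> borel_measurable borel" unfolding G_def by measurable
  have G1: "G (u + 1) = G u" for u by (simp add: G_def)
  have "g (z * rot u) = G (u + a)" for u
    unfolding G_def by (subst a(3)) (simp add: rot_add mult_ac)
  then have "(\<integral>\<^sup>+u\<in>{0..<1}. g (z * rot u) \<partial>lborel) = (\<integral>\<^sup>+u. G (u + a) * indicator {a..<a+1} (u + a) \<partial>lborel)"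
    by (intro nn_integral_cong) (auto simp: indicator_def)
  also have "\<dots> = (\<integral>\<^sup>+u. G u * indicator {a..<a+1} u \<partial>lborel)"
    by (rule nn_integral_lborel_translate[of "\<lambda>u. G u * indicator {a..<a+1} u"]) simp
  also have "\<dots> = (\<integral>\<^sup>+u. G u * indicator {a..<1} u + G u * indicator {1..<a+1} u \<partial>lborel)"
    by (intro nn_integral_cong) (use a in \<open>auto simp: indicator_def\<close>)
  also have "\<dots> = (\<integral>\<^sup>+u. G u * indicator {a..<1} u \<partial>lborel) + (\<integral>\<^sup>+u. G u * indicator {1..<a+1} u \<partial>lborel)"
    by (rule nn_integral_add) simp_all
  also have "(\<integral>\<^sup>+u. G u * indicator {1..<a+1} u \<partial>lborel) = (\<integral>\<^sup>+u. G (u + 1) * indicator {1..<a+1} (u + 1) \<partial>lborel)"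
    by (rule nn_integral_lborel_translate[of "\<lambda>u. G u * indicator {1..<a+1} u", symmetric]) simp
  also have "\<dots> = (\<integral>\<^sup>+u. G u * indicator {0..<a} u \<partial>lborel)"
    by (intro nn_integral_cong) (auto simp: indicator_def G1)
  also have "(\<integral>\<^sup>+u. G u * indicator {a..<1} u \<partial>lborel) + \<dots> = (\<integral>\<^sup>+u. G u * indicator {a..<1} u + G u * indicator {0..<a} u \<partial>lborel)"
    by (rule nn_integral_add[symmetric]) simp_all
  also have "\<dots> = (\<integral>\<^sup>+u. G u * indicator {0..<1} u \<partial>lborel)"
    by (intro nn_integral_cong) (use a in \<open>auto simp: indicator_def\<close>)
  finally show ?thesis unfolding circ_avg_def G_def .
qed

text \<open>Sublevel sets of the norm are discs of area \<open>pi * a^2\<close>, whose derivative is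
  the density, and half-lines determine a measure on the line.\<close>

lemma distr_norm_complex:
  "distr lborel borel (norm :: complex \<Rightarrow> real) = density lborel (\<lambda>r. ennreal (2 * pi * r) * indicator {0..} r)"
proof (rule measure_eqI_generator_eq[where E = "range atMost" and \<Omega> = UNIV and A = "\<lambda>n. {..real n}"])
  show "Int_stable (range (atMost :: real \<Rightarrow> real set))"
    by (auto simp: Int_stable_def Int_atMost)
  show "range atMost \<subseteq> Pow (UNIV :: real set)" by simp
  show "sets (distr lborel borel (norm :: complex \<Rightarrow> real)) = sigma_sets UNIV (range atMost)"
    by (subst sets_distr, subst borel_eq_atMost) (simp add: sets_measure_of)
  show "sets (density lborel (\<lambda>r::real. ennreal (2 * pi * r) * indicator {0..} r)) = sigma_sets UNIV (range atMost)"
    by (subst sets_density, subst sets_lborel, subst borel_eq_atMost) (simp add: sets_measure_of)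
  show "range (\<lambda>n. {..real n}) \<subseteq> range atMost" by auto
  show "(\<Union>i. {..real i}) = UNIV" by (auto intro: real_arch_simple)
  have norm_atMost: "emeasure (distr lborel borel (norm :: complex \<Rightarrow> real)) {..a} = (if a < 0 then 0 else ennreal (pi * a\<^sup>2))" for a :: real
  proof -
    have "(norm :: complex \<Rightarrow> real) -` {..a} \<inter> space lborel = cball 0 a" by auto
    then have "emeasure (distr lborel borel (norm :: complex \<Rightarrow> real)) {..a} = emeasure lborel (cball (0::complex) a)"
      by (subst emeasure_distr) auto
    then show ?thesis
      by (auto simp: emeasure_cball unit_ball_vol_2)
  qed
  then show "emeasure (distr lborel borel (norm :: complex \<Rightarrow> real)) {..real i} \<noteq> \<infinity>" for i by simp
  fix X assume "X \<in> range (atMost :: real \<Rightarrow> real set)"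
  then obtain a where X: "X = {..a}" by auto
  have "emeasure (density lborel (\<lambda>r. ennreal (2 * pi * r) * indicator {0..} r)) {..a}
      = (\<integral>\<^sup>+r\<in>{0..a}. ennreal (2 * pi * r) \<partial>lborel)"
    by (subst emeasure_density) (auto intro!: nn_integral_cong simp: indicator_def)
  also have "\<dots> = (if a < 0 then 0 else ennreal (pi * a\<^sup>2))"
  proof (cases "a < 0")
    case False
    then have "(\<integral>\<^sup>+r\<in>{0..a}. ennreal (2 * pi * r) \<partial>lborel) = ennreal (pi * a\<^sup>2 - pi * 0\<^sup>2)"
      by (intro nn_integral_FTC_Icc[where F = "\<lambda>r. pi * r\<^sup>2"]) (auto intro!: derivative_eq_intros)
    then show ?thesis using False by simp
  qed simp
  finally show "emeasure (distr lborel borel (norm :: complex \<Rightarrow> real)) X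
      = emeasure (density lborel (\<lambda>r. ennreal (2 * pi * r) * indicator {0..} r)) X"
    unfolding X norm_atMost by simp
qed

lemma nn_integral_norm_complex:
  assumes [measurable]: "Q \<in> borel_measurable (borel :: real measure)"
  shows "(\<integral>\<^sup>+z. Q (norm (z::complex)) \<partial>lborel) = (\<integral>\<^sup>+r\<in>{0..}. ennreal (2 * pi * r) * Q r \<partial>lborel)"
proof -
  have "(\<integral>\<^sup>+z. Q (norm (z::complex)) \<partial>lborel) = (\<integral>\<^sup>+r. Q r \<partial>distr lborel borel (norm :: complex \<Rightarrow> real))"
    by (subst nn_integral_distr) auto
  also have "\<dots> = (\<integral>\<^sup>+r. ennreal (2 * pi * r) * indicator {0..} r * Q r \<partial>lborel)"
    unfolding distr_norm_complex by (subst nn_integral_density) auto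
  finally show ?thesis by (simp add: mult_ac)
qed

text \<open>By rotation invariance the integral may be averaged over all rotations. After
  interchanging the integrals the integrand is a circular mean, which depends on
  \<open>norm z\<close> only, and the law of the norm finishes the computation.\<close>

lemma nn_integral_complex_polar:
  assumes [measurable]: "g \<in> borel_measurable (borel :: complex measure)"
  shows "(\<integral>\<^sup>+z. g z \<partial>lborel) = (\<integral>\<^sup>+r\<in>{0..}. ennreal (2 * pi * r) * circ_avg g r \<partial>lborel)"
proof -
  have "(\<integral>\<^sup>+z. g z \<partial>lborel) = (\<integral>\<^sup>+u\<in>{0..<1::real}. (\<integral>\<^sup>+z. g z \<partial>lborel) \<partial>lborel)"
    by (simp add: nn_integral_cmult_indicator)
  also have "\<dots> = (\<integral>\<^sup>+u. (\<integral>\<^sup>+z. g (z * rot u) * indicator {0..<1} u \<partial>lborel) \<partial>lborel)"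
  proof (intro nn_integral_cong)
    fix u :: real
    have "(\<integral>\<^sup>+z. g (z * rot u) * indicator {0..<1} u \<partial>lborel) = (\<integral>\<^sup>+z. g (rot u * z) \<partial>lborel) * indicator {0..<1} u"
      by (subst nn_integral_multc[symmetric]) (simp_all add: mult.commute)
    then show "(\<integral>\<^sup>+z. g z \<partial>lborel) * indicator {0..<1} u = (\<integral>\<^sup>+z. g (z * rot u) * indicator {0..<1} u \<partial>lborel)"
      using nn_integral_complex_rotate[of g "rot u"] by simp
  qed
  also have "\<dots> = (\<integral>\<^sup>+z. (\<integral>\<^sup>+u. g (z * rot u) * indicator {0..<1} u \<partial>lborel) \<partial>lborel)"
    by (rule lborel_pair.Fubini') simp
  also have "\<dots> = (\<integral>\<^sup>+z. circ_avg g (norm (z::complex)) \<partial>lborel)"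
    by (simp add: circ_avg_rotate)
  finally show ?thesis by (simp add: nn_integral_norm_complex)
qed

text \<open>A radial Lebesgue measurable function need not be Borel measurable on the radius, but
  polar coordinates show that it agrees there almost everywhere with the circular averages of a
  Borel version on the disc.\<close>

lemma radial_weight_profile:
  assumes "radial_weight \<nu>"
  obtains h where "h \<in> borel_measurable borel" "\<And>r. 0 \<le> h r"
    "AE r in lborel. r \<in> {0..<1} \<longrightarrow> \<nu> (complex_of_real r) = h r"
    "\<And>g. g \<in> borel_measurable borel \<Longrightarrow>
      (\<integral>\<^sup>+z\<in>ball 0 1. g z * ennreal (\<nu> z) \<partial>lebesgue) = (\<integral>\<^sup>+r\<in>{0..<1}. ennreal (2 * pi * r * h r) * circ_avg g r \<partial>lborel)"
proof -
  have w: "\<And>z. z \<in> ball 0 1 \<Longrightarrow> 0 \<le> \<nu> z" and int: "set_integrable lebesgue (ball 0 1) \<nu>"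
    and rad: "\<And>z. z \<in> ball 0 1 \<Longrightarrow> \<nu> z = \<nu> (complex_of_real (norm z))"
    using assms unfolding radial_weight_def weight_def by blast+
  define f where "f = (\<lambda>z. indicator (ball 0 1) z *\<^sub>R \<nu> z)"
  have "f \<in> borel_measurable lebesgue"
    using int unfolding f_def set_integrable_def by (rule borel_measurable_integrable)
  then obtain f' where f'[measurable]: "f' \<in> borel_measurable lborel" and ff': "AE z in lborel. f z = f' z"
    using completion_ex_borel_measurable_real by blast
  have [measurable]: "ball (0::complex) 1 \<in> sets borel" by simp
  obtain N where N: "N \<in> null_sets lborel" "\<And>z. z \<notin> N \<Longrightarrow> f z = f' z"
    by (rule AE_E3[OF ff']) auto
  have [measurable]: "N \<in> sets borel" using N(1) by auto
  have "(\<integral>\<^sup>+z. indicator N z \<partial>(lborel :: complex measure)) = 0" using N(1) by auto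
  then have "(\<integral>\<^sup>+r\<in>{0..}. ennreal (2 * pi * r) * circ_avg (indicator N) r \<partial>lborel) = 0"
    by (subst (asm) nn_integral_complex_polar) auto
  \<comment> \<open>Almost every circle meets the exceptional set \<open>N\<close> in angular
    measure zero. The factor \<open>2 * pi * r\<close> leaves the radius 0 undecided, which is
    itself negligible.\<close>
  then have AEN: "AE r in lborel. ennreal (2 * pi * r) * circ_avg (indicator N) r * indicator {0..} r = 0"
    by (subst (asm) nn_integral_0_iff_AE) auto
  define h where "h r = enn2real (circ_avg (\<lambda>z. ennreal (f' z)) r)" for r
  have [measurable]: "h \<in> borel_measurable borel"
    unfolding h_def[abs_def] by measurable
  have AEh: "AE r in lborel. r \<in> {0..<1} \<longrightarrow> \<nu> (complex_of_real r) = h r"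
    using AEN AE_lborel_singleton[of 0]
  proof eventually_elim
    case (elim r)
    show ?case
    proof
      assume r: "r \<in> {0..<1}"
      with elim have "circ_avg (indicator N) r = 0"
        using pi_gt_zero by (auto simp: ennreal_eq_0_iff mult_eq_0_iff mult_le_0_iff not_le)
      then have "AE u in lborel. indicator N (complex_of_real r * rot u) * indicator {0..<1} u = (0::ennreal)"
        unfolding circ_avg_def by (subst (asm) nn_integral_0_iff_AE) auto
      then have AEu: "AE u in lborel. ennreal (f' (complex_of_real r * rot u)) * indicator {0..<1} u
          = ennreal (\<nu> (complex_of_real r)) * indicator {0..<1} u"
      proof eventually_elim
        case (elim u)
        show ?case
        proof (cases "u \<in> {0..<1::real}")
          case True
          with elim have "complex_of_real r * rot u \<notin> N" by (auto simp: indicator_def)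
          then have "f' (complex_of_real r * rot u) = f (complex_of_real r * rot u)" using N(2) by auto
          also have "\<dots> = \<nu> (complex_of_real r)"
            unfolding f_def using r rad[of "complex_of_real r * rot u"] by (simp add: norm_mult)
          finally show ?thesis by simp
        qed simp
      qed
      have "circ_avg (\<lambda>z. ennreal (f' z)) r = (\<integral>\<^sup>+u\<in>{0..<1::real}. ennreal (\<nu> (complex_of_real r)) \<partial>lborel)"
        unfolding circ_avg_def using AEu by (intro nn_integral_cong_AE) simp
      also have "\<dots> = ennreal (\<nu> (complex_of_real r))"
        by (subst nn_integral_cmult_indicator) simp_all
      finally show "\<nu> (complex_of_real r) = h r"
        using w[of "complex_of_real r"] r by (simp add: h_def)
    qed
  qed
  have polar: "(\<integral>\<^sup>+z\<in>ball 0 1. g z * ennreal (\<nu> z) \<partial>lebesgue) = (\<integral>\<^sup>+r\<in>{0..<1}. ennreal (2 * pi * r * h r) * circ_avg g r \<partial>lborel)"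
    if [measurable]: "g \<in> borel_measurable borel" for g
  proof -
    obtain E where E: "E \<in> null_sets lborel" "\<And>r. r \<notin> E \<Longrightarrow> r \<in> {0..<1} \<longrightarrow> \<nu> (complex_of_real r) = h r"
      by (rule AE_E3[OF AEh]) auto
    have [measurable]: "E \<in> sets borel" using E(1) by auto
    have "(\<integral>\<^sup>+r\<in>{0..}. ennreal (2 * pi * r) * indicator E r \<partial>lborel) = 0"
      using AE_not_in[OF E(1)] by (subst nn_integral_0_iff_AE) (auto elim!: eventually_mono)
    then have "(\<integral>\<^sup>+z. indicator E (norm (z::complex)) \<partial>lborel) = 0"
      by (subst nn_integral_norm_complex) auto
    then have "AE z in lborel. indicator E (norm (z::complex)) = (0::ennreal)"
      by (subst (asm) nn_integral_0_iff_AE) auto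
    \<comment> \<open>A null set of radii sweeps out a null set of the plane, again by the law of
      the norm.\<close>
    then have AEz: "AE z in lborel. z \<in> ball (0::complex) 1 \<longrightarrow> \<nu> z = h (norm z)"
    proof eventually_elim
      case (elim z)
      show ?case
      proof
        assume z: "z \<in> ball 0 1"
        have "norm z \<notin> E" using elim by (auto simp: indicator_def)
        then have "\<nu> (complex_of_real (norm z)) = h (norm z)" using E(2) z by auto
        then show "\<nu> z = h (norm z)" using rad[OF z] by simp
      qed
    qed
    have "(\<integral>\<^sup>+z\<in>ball 0 1. g z * ennreal (\<nu> z) \<partial>lebesgue) = (\<integral>\<^sup>+z. g z * ennreal (h (norm z)) * indicator (ball 0 1) z \<partial>lebesgue)"
      by (rule nn_integral_cong_AE) (use AE_completion[OF AEz] in \<open>auto elim!: eventually_mono simp: indicator_def\<close>)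
    also have "\<dots> = (\<integral>\<^sup>+z. g z * ennreal (h (norm z)) * indicator (ball 0 1) z \<partial>lborel)"
      by (rule nn_integral_completion)
    also have "\<dots> = (\<integral>\<^sup>+r\<in>{0..}. ennreal (2 * pi * r) * circ_avg (\<lambda>z. g z * ennreal (h (norm z)) * indicator (ball 0 1) z) r \<partial>lborel)"
      by (rule nn_integral_complex_polar, measurable)
    also have "\<dots> = (\<integral>\<^sup>+r\<in>{0..<1}. ennreal (2 * pi * r * h r) * circ_avg g r \<partial>lborel)"
    proof (rule nn_integral_cong)
      fix r :: real
      show "ennreal (2 * pi * r) * circ_avg (\<lambda>z. g z * ennreal (h (norm z)) * indicator (ball 0 1) z) r * indicator {0..} r
        = ennreal (2 * pi * r * h r) * circ_avg g r * indicator {0..<1} r"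
      proof (cases "r \<in> {0..<1}")
        case True
        then have "circ_avg (\<lambda>z. g z * ennreal (h (norm z)) * indicator (ball 0 1) z) r = ennreal (h r) * circ_avg g r"
          unfolding circ_avg_def by (subst nn_integral_cmult[symmetric])
            (auto intro!: nn_integral_cong simp: norm_mult mult_ac)
        then show ?thesis using True by (simp add: ennreal_mult h_def mult_ac)
      next
        case False
        then have "r < 0 \<or> circ_avg (\<lambda>z. g z * ennreal (h (norm z)) * indicator (ball 0 1) z) r = 0"
          unfolding circ_avg_def by (auto simp: norm_mult indicator_def)
        then show ?thesis using False by auto
      qed
    qed
    finally show ?thesis .
  qed
  show thesis
    by (rule that[of h]) (use AEh polar in \<open>auto simp: h_def[abs_def]\<close>)
qed

section \<open>Poisson domination of powers of analytic functions\<close>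

text \<open>The Poisson kernel of the disc of radius \<rho>, for the inner point \<open>w\<close>
  and the boundary point with parameter \<open>u\<close>. No factor \<open>1 / (2 * pi)\<close>
  occurs because \<open>u\<close> has period 1.\<close>

definition pois :: "real \<Rightarrow> complex \<Rightarrow> real \<Rightarrow> real" where
  "pois \<rho> w u = (\<rho>\<^sup>2 - (norm w)\<^sup>2) / (norm (complex_of_real \<rho> * rot u - w))\<^sup>2"

lemma pois_measurable [measurable]:
  assumes [measurable]: "w \<in> borel_measurable M" "u \<in> borel_measurable M"
  shows "(\<lambda>x. pois \<rho> (w x) (u x)) \<in> borel_measurable M"
  unfolding pois_def by measurable

lemma pois_denominator: "norm w < \<rho> \<Longrightarrow> \<rho> - norm w \<le> norm (complex_of_real \<rho> * rot u - w)"
  using norm_triangle_ineq2[of "complex_of_real \<rho> * rot u" w] by (simp add: norm_mult)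

lemma pois_nonneg: "norm w < \<rho> \<Longrightarrow> 0 \<le> pois \<rho> w u"
  unfolding pois_def by (intro divide_nonneg_nonneg) (auto intro: power_mono)

lemma pois_upper: assumes "norm w < \<rho>" "\<rho> < 1" shows "pois \<rho> w u \<le> 2 / (\<rho> - norm w)"
proof -
  have d: "0 < \<rho> - norm w" using assms by simp
  have N: "0 < norm (complex_of_real \<rho> * rot u - w)"
    using pois_denominator[OF assms(1), of u] d by linarith
  have "pois \<rho> w u \<le> (\<rho>\<^sup>2 - (norm w)\<^sup>2) / (\<rho> - norm w)\<^sup>2"
    unfolding pois_def using assms d N
    by (intro divide_left_mono power_mono pois_denominator zero_less_power mult_pos_pos) (auto intro!: power_mono)
  also have "\<dots> = (\<rho> + norm w) / (\<rho> - norm w)"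
    using d by (simp add: power2_eq_square square_diff_square_factored)
  also have "\<dots> \<le> 2 / (\<rho> - norm w)"
    using assms d by (intro divide_right_mono) auto
  finally show ?thesis .
qed

text \<open>Cauchy's formula is applied to \<open>h\<close> times a factor that equals 1 at
  \<open>w\<close>. On the circle, where \<open>\<rho>^2 = \<zeta> * cnj \<zeta>\<close>, this
  factor turns the Cauchy kernel into the Poisson kernel; its denominator has no zero in the closed
  disc.\<close>

lemma has_integral_poisson:
  assumes "continuous_on (cball 0 \<rho>) h" "h holomorphic_on ball 0 \<rho>" "norm w < \<rho>"
  shows "((\<lambda>u. complex_of_real (pois \<rho> w u) * h (complex_of_real \<rho> * rot u)) has_integral h w) {0..1}"
proof -
  define f where "f \<zeta> = h \<zeta> * complex_of_real (\<rho>\<^sup>2 - (norm w)\<^sup>2) / (complex_of_real (\<rho>\<^sup>2) - cnj w * \<zeta>)" for \<zeta>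
  have \<rho>: "0 < \<rho>" using assms(3) norm_ge_zero[of w] by linarith
  have nz: "complex_of_real (\<rho>\<^sup>2) - cnj w * \<zeta> \<noteq> 0" if "norm \<zeta> \<le> \<rho>" for \<zeta>
  proof
    assume "complex_of_real (\<rho>\<^sup>2) - cnj w * \<zeta> = 0"
    then have "norm (complex_of_real (\<rho>\<^sup>2)) = norm (cnj w * \<zeta>)" by simp
    then have "\<rho>\<^sup>2 = norm w * norm \<zeta>" by (simp add: norm_mult norm_power)
    also have "\<dots> \<le> norm w * \<rho>" using that by (intro mult_left_mono) auto
    also have "\<dots> < \<rho> * \<rho>" using assms(3) \<rho> by simp
    finally show False by (simp add: power2_eq_square)
  qed
  have "continuous_on (cball 0 \<rho>) f" "f holomorphic_on ball 0 \<rho>"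
    unfolding f_def using nz assms(1,2) by (auto intro!: continuous_intros holomorphic_intros)
  then have "((\<lambda>u. f u / (u - w)) has_contour_integral (2 * of_real pi * \<i> * f w)) (circlepath 0 \<rho>)"
    using Cauchy_integral_circlepath[of 0 \<rho> f w] assms(3) by simp
  then have "((\<lambda>u. f (circlepath 0 \<rho> u) / (circlepath 0 \<rho> u - w) * vector_derivative (circlepath 0 \<rho>) (at u within {0..1}))
      has_integral (2 * of_real pi * \<i> * f w)) {0..1}"
    unfolding has_contour_integral_def .
  then have *: "((\<lambda>u. (1 / (2 * of_real pi * \<i>)) * (f (circlepath 0 \<rho> u) / (circlepath 0 \<rho> u - w) * vector_derivative (circlepath 0 \<rho>) (at u within {0..1})))
      has_integral ((1 / (2 * of_real pi * \<i>)) * (2 * of_real pi * \<i> * f w))) {0..1}"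
    by (rule has_integral_mult_right)
  have fw: "(1 / (2 * of_real pi * \<i>)) * (2 * of_real pi * \<i> * f w) = h w"
  proof -
    have "complex_of_real (\<rho>\<^sup>2 - (norm w)\<^sup>2) = complex_of_real (\<rho>\<^sup>2) - cnj w * w"
      using complex_norm_square[of w] by (simp add: mult.commute)
    then have "f w = h w" unfolding f_def using nz[of w] assms(3) by simp
    then show ?thesis by simp
  qed
  show ?thesis
  proof (rule has_integral_eq[OF _ *[unfolded fw]])
    fix u :: real assume u: "u \<in> {0..1}"
    define \<zeta> where "\<zeta> = complex_of_real \<rho> * rot u"
    have c: "circlepath 0 \<rho> u = \<zeta>"
      by (simp add: circlepath \<zeta>_def rot_def cis_conv_exp mult_ac)
    have v: "vector_derivative (circlepath 0 \<rho>) (at u within {0..1}) = 2 * of_real pi * \<i> * \<zeta>"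
      using u by (simp add: vector_derivative_circlepath01 \<zeta>_def rot_def cis_conv_exp mult_ac)
    have n\<zeta>: "norm \<zeta> = \<rho>" using \<rho> by (simp add: \<zeta>_def norm_mult)
    then have \<zeta>0: "\<zeta> \<noteq> 0" "\<zeta> - w \<noteq> 0" using \<rho> assms(3) by auto
    have q: "complex_of_real (\<rho>\<^sup>2) - cnj w * \<zeta> = \<zeta> * cnj (\<zeta> - w)"
      using complex_norm_square[of \<zeta>] n\<zeta> by (simp add: algebra_simps)
    have "complex_of_real (pois \<rho> w u) = complex_of_real (\<rho>\<^sup>2 - (norm w)\<^sup>2) / ((\<zeta> - w) * cnj (\<zeta> - w))"
      unfolding pois_def \<zeta>_def complex_norm_square[symmetric] by simp
    have alg: "1 / k * (x * y / (s * e) / d * (k * s)) = y / (d * e) * x" if "k \<noteq> 0" "s \<noteq> 0" for k s x y d e :: complex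
      using that by (simp add: field_simps)
    from \<open>complex_of_real (pois \<rho> w u) = _\<close> show "1 / (2 * of_real pi * \<i>) * (f (circlepath 0 \<rho> u) / (circlepath 0 \<rho> u - w) * vector_derivative (circlepath 0 \<rho>) (at u within {0..1}))
        = complex_of_real (pois \<rho> w u) * h (complex_of_real \<rho> * rot u)"
      unfolding c v f_def q \<zeta>_def[symmetric] using \<zeta>0 by (subst alg) auto
  qed
qed

lemma has_integral_pois:
  assumes "norm w < \<rho>" shows "(pois \<rho> w has_integral 1) {0..1}"
proof -
  have "((\<lambda>u. complex_of_real (pois \<rho> w u) * 1) has_integral 1) {0..1}"
    using assms by (intro has_integral_poisson) auto
  then have "((\<lambda>u. Re (complex_of_real (pois \<rho> w u) * 1)) has_integral Re 1) {0..1}"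
    by (rule has_integral_Re)
  then show ?thesis by simp
qed

lemma continuous_on_pois:
  assumes "\<And>x. x \<in> S \<Longrightarrow> norm w < r x" "continuous_on S r" "continuous_on S u"
  shows "continuous_on S (\<lambda>x. pois (r x) w (u x))"
proof -
  have "norm (complex_of_real (r x) * rot (u x) - w) \<noteq> 0" if "x \<in> S" for x
    using pois_denominator[OF assms(1)[OF that], of "u x"] assms(1)[OF that] by linarith
  then show ?thesis
    unfolding pois_def by (intro continuous_intros assms) auto
qed

lemma continuous_on_norm_powr:
  fixes f :: "'a::topological_space \<Rightarrow> complex"
  assumes "continuous_on S f" "0 < p"
  shows "continuous_on S (\<lambda>x. norm (f x) powr p)"
  by (intro continuous_on_powr' continuous_intros assms) (use assms in auto)

definition pint :: "real \<Rightarrow> (complex \<Rightarrow> complex) \<Rightarrow> real \<Rightarrow> complex \<Rightarrow> real" where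
  "pint p f \<rho> w = integral {0..1} (\<lambda>u. pois \<rho> w u * norm (f (complex_of_real \<rho> * rot u)) powr p)"

lemma continuous_pint_integrand:
  assumes "f holomorphic_on ball 0 R" "\<rho> < R" "norm w < \<rho>" "0 < p"
  shows "continuous_on {0..1} (\<lambda>u. pois \<rho> w u * norm (f (complex_of_real \<rho> * rot u)) powr p)"
proof -
  have \<rho>: "0 < \<rho>" using assms(3) norm_ge_zero[of w] by linarith
  have "continuous_on (cball 0 \<rho>) f"
    using assms(2) by (intro holomorphic_on_imp_continuous_on holomorphic_on_subset[OF assms(1)]) auto
  then have "continuous_on {0..1} (\<lambda>u. f (complex_of_real \<rho> * rot u))"
    by (rule continuous_on_compose2) (use \<rho> in \<open>auto intro!: continuous_intros simp: norm_mult\<close>)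
  then show ?thesis
    by (intro continuous_intros continuous_on_pois continuous_on_norm_powr assms)
qed

text \<open>A zero-free \<open>f\<close> has a holomorphic logarithm \<open>g\<close>, and
  \<open>exp (p * g)\<close> is holomorphic with modulus \<open>norm (f z) powr p\<close>. The
  Poisson formula for this function, with absolute values taken inside the integral, gives the bound
  for every positive \<open>p\<close>.\<close>

lemma powr_le_pint_zero_free:
  assumes f: "f holomorphic_on ball 0 R" "\<rho> < R" "norm w < \<rho>" "0 < p"
    and nz: "\<And>z. z \<in> cball 0 \<rho> \<Longrightarrow> f z \<noteq> 0"
  shows "norm (f w) powr p \<le> pint p f \<rho> w"
proof -
  have \<rho>: "0 < \<rho>" using f(3) norm_ge_zero[of w] by linarith
  have "f holomorphic_on cball 0 \<rho>"
    using f(2) by (intro holomorphic_on_subset[OF f(1)]) auto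
  then obtain g where g: "g holomorphic_on cball 0 \<rho>" "\<And>z. z \<in> cball 0 \<rho> \<Longrightarrow> f z = exp (g z)"
    using contractible_imp_holomorphic_log[of f "cball 0 \<rho>"] nz by (auto simp: convex_imp_contractible)
  define h where "h z = exp (complex_of_real p * g z)" for z
  have nh: "norm (h z) = norm (f z) powr p" if "z \<in> cball 0 \<rho>" for z
    using g(2)[OF that] by (simp add: h_def powr_def)
  have "h holomorphic_on cball 0 \<rho>" unfolding h_def by (intro holomorphic_intros g)
  then have hi: "((\<lambda>u. complex_of_real (pois \<rho> w u) * h (complex_of_real \<rho> * rot u)) has_integral h w) {0..1}"
    using f(3) by (intro has_integral_poisson)
      (auto intro: holomorphic_on_imp_continuous_on holomorphic_on_subset[OF _ ball_subset_cball])
  have "norm (h w) = norm (integral {0..1} (\<lambda>u. complex_of_real (pois \<rho> w u) * h (complex_of_real \<rho> * rot u)))"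
    using integral_unique[OF hi] by simp
  also have "\<dots> \<le> pint p f \<rho> w"
    unfolding pint_def
  proof (rule integral_norm_bound_integral)
    show "(\<lambda>u. complex_of_real (pois \<rho> w u) * h (complex_of_real \<rho> * rot u)) integrable_on {0..1}"
      using hi by blast
    show "(\<lambda>u. pois \<rho> w u * norm (f (complex_of_real \<rho> * rot u)) powr p) integrable_on {0..1}"
      by (intro integrable_continuous_real continuous_pint_integrand[OF f])
    show "norm (complex_of_real (pois \<rho> w u) * h (complex_of_real \<rho> * rot u)) \<le> pois \<rho> w u * norm (f (complex_of_real \<rho> * rot u)) powr p"
      if "u \<in> {0..1}" for u
      using nh[of "complex_of_real \<rho> * rot u"] \<rho> pois_nonneg[OF f(3), of u] by (simp add: norm_mult)
  qed
  finally show ?thesis using nh[of w] f(3) by simp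
qed

text \<open>Divided by \<open>\<rho>^2\<close>, this compares the factor \<open>w - a\<close> with
  its reflection in the circle of radius \<rho>: the moduli agree on the circle, and inside it the
  reflected factor is the larger one if \<open>a\<close> lies inside as well.\<close>

lemma blaschke_identity:
  "(norm (complex_of_real (\<rho>\<^sup>2) - cnj a * w))\<^sup>2 = \<rho>\<^sup>2 * (norm (w - a))\<^sup>2 + (\<rho>\<^sup>2 - (norm w)\<^sup>2) * (\<rho>\<^sup>2 - (norm a)\<^sup>2)"
  unfolding cmod_power2 by (simp add: power2_eq_square algebra_simps)

text \<open>The quotient \<open>f z / (z - a) ^ n\<close> and the local factor \<open>g\<close>
  agree where both make sense, so gluing them removes the singularity on all of
  \<open>S\<close>.\<close>

lemma holomorphic_divide_zero:
  assumes f: "f holomorphic_on S" "open S" "connected S" "a \<in> S" "f a = 0" "\<not> f constant_on S"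
  obtains n G where "G holomorphic_on S" "G a \<noteq> 0" "\<And>z. z \<in> S \<Longrightarrow> f z = (z - a) ^ n * G z" "0 < n"
proof -
  obtain g r n where g: "0 < n" "0 < r" "ball a r \<subseteq> S" "g holomorphic_on ball a r"
    "\<And>w. w \<in> ball a r \<Longrightarrow> f w = (w - a) ^ n * g w" "\<And>w. w \<in> ball a r \<Longrightarrow> g w \<noteq> 0"
    using holomorphic_factor_zero_nonconstant[OF f] by metis
  define G where "G z = (if z = a then g a else f z / (z - a) ^ n)" for z
  have Gg: "G z = g z" if "z \<in> ball a r" for z
    using g(5)[OF that] by (simp add: G_def)
  have "G holomorphic_on ball a r"
    by (rule holomorphic_transform[OF g(4)]) (simp add: Gg del: mem_ball)
  moreover have "G holomorphic_on (S - {a})"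
  proof -
    have "(\<lambda>z. f z / (z - a) ^ n) holomorphic_on (S - {a})"
      by (intro holomorphic_intros holomorphic_on_subset[OF f(1)]) auto
    then show ?thesis by (rule holomorphic_transform) (simp add: G_def)
  qed
  ultimately have "G holomorphic_on (ball a r \<union> (S - {a}))"
    using f(2) by (intro holomorphic_on_Un) auto
  moreover have "ball a r \<union> (S - {a}) = S" using g(2,3) f(4) by auto
  ultimately have "G holomorphic_on S" by simp
  moreover have "f z = (z - a) ^ n * G z" if "z \<in> S" for z
    using that g(1) f(5) by (auto simp: G_def)
  moreover have "G a \<noteq> 0" using g(6)[of a] g(2) by (simp add: G_def)
  ultimately show thesis using that g(1) by blast
qed

text \<open>Induction on the number of distinct zeros in the closed disc. The factor
  \<open>(z - a) ^ m\<close> of a zero is replaced by its reflection \<open>b z ^ m\<close>, which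
  does not vanish there; the modulus is unchanged on the circle and does not decrease inside, so the
  inequality for \<open>f1\<close> implies the one for \<open>f\<close>.\<close>

lemma powr_le_pint_aux:
  assumes "f holomorphic_on ball 0 R" "\<rho> < R" "norm w < \<rho>" "0 < p"
    and "\<And>z. norm z = \<rho> \<Longrightarrow> f z \<noteq> 0" "card {z \<in> cball 0 \<rho>. f z = 0} = n" "finite {z \<in> cball 0 \<rho>. f z = 0}"
  shows "norm (f w) powr p \<le> pint p f \<rho> w"
  using assms
proof (induction n arbitrary: f)
  case 0
  then have "{z \<in> cball 0 \<rho>. f z = 0} = {}" by simp
  then show ?case using powr_le_pint_zero_free[OF 0(1,2,3,4)] by blast
next
  case (Suc n)
  have \<rho>: "0 < \<rho>" using Suc(4) norm_ge_zero[of w] by linarith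
  have "card {z \<in> cball 0 \<rho>. f z = 0} > 0" using Suc(7) by linarith
  then have "{z \<in> cball 0 \<rho>. f z = 0} \<noteq> {}" by (metis card_gt_0_iff)
  then obtain a where a: "a \<in> cball 0 \<rho>" "f a = 0" by blast
  have na: "norm a < \<rho>" using a Suc(6)[of a] by force
  have "f (complex_of_real \<rho>) \<noteq> 0" using Suc(6)[of "complex_of_real \<rho>"] \<rho> by simp
  moreover have aR: "a \<in> ball 0 R" and "complex_of_real \<rho> \<in> ball 0 R" using na \<rho> Suc(3) by auto
  ultimately have nc: "\<not> f constant_on ball 0 R"
    using a(2) unfolding constant_on_def by metis
  obtain m G where G: "G holomorphic_on ball 0 R" "G a \<noteq> 0" "\<And>z. z \<in> ball 0 R \<Longrightarrow> f z = (z - a) ^ m * G z" "0 < m"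
    by (rule holomorphic_divide_zero[OF Suc(2) open_ball _ aR a(2) nc]) auto
  define b where "b z = (complex_of_real (\<rho>\<^sup>2) - cnj a * z) / complex_of_real \<rho>" for z
  define f1 where "f1 z = G z * b z ^ m" for z
  have bz: "(norm (b z))\<^sup>2 = (norm (z - a))\<^sup>2 + (\<rho>\<^sup>2 - (norm z)\<^sup>2) * (\<rho>\<^sup>2 - (norm a)\<^sup>2) / \<rho>\<^sup>2" for z
    using blaschke_identity[of \<rho> a z] \<rho> by (simp add: b_def norm_divide power_divide add_divide_distrib)
  have a2: "(norm a)\<^sup>2 < \<rho>\<^sup>2" using na by (intro power_strict_mono) auto
  have ble: "norm (z - a) \<le> norm (b z)" if "norm z \<le> \<rho>" for z
  proof (rule power2_le_imp_le)
    have "(norm z)\<^sup>2 \<le> \<rho>\<^sup>2" using that by (intro power_mono) auto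
    then show "(norm (z - a))\<^sup>2 \<le> (norm (b z))\<^sup>2" unfolding bz using a2 by simp
  qed simp
  have beq: "norm (b z) = norm (z - a)" if "norm z = \<rho>" for z
    using bz[of z] that by (simp add: power2_eq_iff_nonneg)
  have bnz: "b z \<noteq> 0" if "norm z \<le> \<rho>" for z
  proof
    assume b0: "b z = 0"
    then have "z = a" using ble[OF that] by simp
    then have "(\<rho>\<^sup>2 - (norm a)\<^sup>2) * (\<rho>\<^sup>2 - (norm a)\<^sup>2) / \<rho>\<^sup>2 = 0" using bz[of z] b0 by simp
    then show False using a2 \<rho> by simp
  qed
  have inR: "z \<in> ball 0 R" if "norm z \<le> \<rho>" for z :: complex using that Suc(3) by simp
  have zeros: "{z \<in> cball 0 \<rho>. f1 z = 0} = {z \<in> cball 0 \<rho>. f z = 0} - {a}"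
    using bnz G inR by (auto simp: f1_def)
  have f1s: "norm (f1 z) = norm (f z)" if "norm z = \<rho>" for z
    using beq[OF that] G(3)[of z] inR[of z] that by (simp add: f1_def norm_mult norm_power)
  have "norm (f w) \<le> norm (f1 w)"
    using ble[of w] G(3)[of w] inR[of w] Suc(4) by (simp add: f1_def norm_mult norm_power mult.commute mult_left_mono power_mono)
  then have "norm (f w) powr p \<le> norm (f1 w) powr p"
    using Suc(5) by (intro powr_mono2) auto
  also have "\<dots> \<le> pint p f1 \<rho> w"
  proof (rule Suc.IH)
    show "f1 holomorphic_on ball 0 R" unfolding f1_def b_def by (intro holomorphic_intros G) (use \<rho> in auto)
    show "f1 z \<noteq> 0" if "norm z = \<rho>" for z using f1s[OF that] Suc(6)[OF that] by auto
    show "card {z \<in> cball 0 \<rho>. f1 z = 0} = n" unfolding zeros using a Suc(7,8) by simp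
    show "finite {z \<in> cball 0 \<rho>. f1 z = 0}" unfolding zeros using Suc(8) by simp
  qed (use Suc in auto)
  also have "pint p f1 \<rho> w = pint p f \<rho> w"
    unfolding pint_def by (rule integral_cong) (use f1s \<rho> in \<open>simp add: norm_mult\<close>)
  finally show ?case .
qed

text \<open>Zeros on the circle of radius \<rho> itself are avoided by a slightly larger radius:
  only finitely many radii in \<open>{\<rho>..r1}\<close> carry zeros, and the Poisson integral is
  continuous in the radius, so the inequality survives the limit.\<close>

lemma powr_le_pint:
  assumes f: "f holomorphic_on ball 0 1" "\<rho> < 1" "norm w < \<rho>" "0 < p"
  shows "norm (f w) powr p \<le> pint p f \<rho> w"
proof (cases "f constant_on ball 0 1")
  case True
  then obtain c where c: "\<And>z. z \<in> ball 0 1 \<Longrightarrow> f z = c" unfolding constant_on_def by blast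
  show ?thesis
  proof (cases "c = 0")
    case True
    then have "norm (f w) powr p = 0" using c[of w] f by simp
    also have "0 \<le> pint p f \<rho> w"
      unfolding pint_def using pois_nonneg[OF f(3)] by (intro integral_nonneg integrable_continuous_real continuous_pint_integrand[OF f]) auto
    finally show ?thesis .
  next
    case False
    then show ?thesis using c f by (intro powr_le_pint_zero_free[OF f]) auto
  qed
next
  case False
  have \<rho>: "0 < \<rho>" using f(3) norm_ge_zero[of w] by linarith
  define r1 where "r1 = (1 + \<rho>) / 2"
  have r1: "\<rho> < r1" "r1 < 1" using f(2) by (auto simp: r1_def)
  define Z where "Z = {z \<in> cball 0 r1. f z = 0}"
  have finZ: "finite Z" unfolding Z_def
    by (rule holomorphic_compact_finite_zeros[OF f(1)]) (use r1 False in auto)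
  have ineq: "norm (f w) powr p \<le> pint p f r w" if r: "r \<in> {\<rho>..r1}" "r \<notin> norm ` Z" for r
  proof -
    have fin: "finite {z \<in> cball 0 r. f z = 0}"
      by (rule finite_subset[OF _ finZ]) (use r in \<open>auto simp: Z_def\<close>)
    show ?thesis
      by (rule powr_le_pint_aux[OF f(1) _ _ f(4) _ refl fin]) (use r r1 f(3) in \<open>auto simp: Z_def\<close>)
  qed
  have "continuous_on {\<rho>..r1} (\<lambda>r. integral (cbox 0 1) (\<lambda>u. pois r w u * norm (f (complex_of_real r * rot u)) powr p))"
  proof (rule integral_continuous_on_param)
    have "continuous_on (cball 0 r1) f"
      using r1 by (intro holomorphic_on_imp_continuous_on holomorphic_on_subset[OF f(1)]) auto
    then have "continuous_on ({\<rho>..r1} \<times> {0..1}) (\<lambda>x. f (complex_of_real (fst x) * rot (snd x)))"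
      by (rule continuous_on_compose2) (use \<rho> in \<open>auto intro!: continuous_intros simp: norm_mult\<close>)
    then have "continuous_on ({\<rho>..r1} \<times> {0..1}) (\<lambda>x. pois (fst x) w (snd x) * norm (f (complex_of_real (fst x) * rot (snd x))) powr p)"
      using f(3,4) by (intro continuous_intros continuous_on_pois continuous_on_norm_powr) auto
    then show "continuous_on ({\<rho>..r1} \<times> cbox 0 1) (\<lambda>(r, u). pois r w u * norm (f (complex_of_real r * rot u)) powr p)"
      by (simp add: case_prod_beta')
  qed
  then have "((\<lambda>r. pint p f r w) \<longlongrightarrow> pint p f \<rho> w) (at \<rho> within {\<rho>..r1})"
    using r1 unfolding pint_def continuous_on_def by simp
  moreover have "\<not> \<rho> islimpt (norm ` Z)" using finZ by (simp add: islimpt_finite)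
  then have "\<forall>\<^sub>F r in at \<rho> within {\<rho>..r1}. norm (f w) powr p \<le> pint p f r w"
    unfolding islimpt_iff_eventually eventually_at_filter by (auto elim!: eventually_mono intro!: ineq)
  moreover have "at \<rho> within {\<rho>..r1} \<noteq> bot" using r1 by (simp add: trivial_limit_within)
  ultimately show ?thesis by (intro tendsto_lowerbound)
qed

lemma nn_integral_unit_interval:
  fixes f :: "real \<Rightarrow> real"
  assumes I: "(f has_integral I) {0..1}" and nonneg: "\<And>u. 0 \<le> f u"
  shows "(\<integral>\<^sup>+u\<in>{0..<1}. ennreal (f u) \<partial>lborel) = ennreal I"
proof -
  have "(\<integral>\<^sup>+u\<in>{0..<1}. ennreal (f u) \<partial>lborel) = (\<integral>\<^sup>+u. ennreal (indicator {0..1} u * f u) \<partial>lborel)"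
    by (rule nn_integral_cong_AE, use AE_lborel_singleton[of 1] in eventually_elim)
      (auto simp: indicator_def less_le)
  then show ?thesis
    using nn_integral_has_integral_lebesgue[OF _ I] nonneg by simp
qed

lemma nn_integral_pois:
  assumes "norm w < \<rho>"
  shows "(\<integral>\<^sup>+u\<in>{0..<1}. ennreal (pois \<rho> w u) \<partial>lborel) = 1"
  using nn_integral_unit_interval[OF has_integral_pois[OF assms] pois_nonneg[OF assms]] by simp

text \<open>The distance between the two points depends on their radii and on the difference of the
  angles only. Hence the kernel has total mass 1 also when integrated over the angle of the inner
  point.\<close>

lemma pois_swap: "pois \<rho> (complex_of_real r * rot v) u = pois \<rho> (complex_of_real r * rot u) v"
proof -
  have "(norm (complex_of_real \<rho> * rot u - complex_of_real r * rot v))\<^sup>2 = \<rho>\<^sup>2 + r\<^sup>2 - 2 * \<rho> * r * (cos (2 * pi * u) * cos (2 * pi * v) + sin (2 * pi * u) * sin (2 * pi * v))" for u v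
  proof -
    have "(\<rho> * a - r * b)\<^sup>2 + (\<rho> * c - r * d)\<^sup>2 = \<rho>\<^sup>2 * (a\<^sup>2 + c\<^sup>2) + r\<^sup>2 * (b\<^sup>2 + d\<^sup>2) - 2 * \<rho> * r * (a * b + c * d)" for a b c d
      by (simp add: power2_eq_square algebra_simps)
    then show ?thesis unfolding cmod_power2 rot_def by simp
  qed
  then show ?thesis unfolding pois_def by (simp add: norm_mult mult.commute)
qed

section \<open>Dyadic radii and maximal functions\<close>

text \<open>The cut-off gives a Borel function on the whole plane although the values of
  \<open>f\<close> outside the disc are arbitrary.\<close>

definition fp :: "real \<Rightarrow> (complex \<Rightarrow> complex) \<Rightarrow> complex \<Rightarrow> ennreal" where
  "fp p f z = ennreal (norm (f z) powr p) * indicator (ball 0 1) z"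

lemma fp_ball: "norm z < 1 \<Longrightarrow> fp p f z = ennreal (norm (f z) powr p)"
  by (simp add: fp_def)

lemma fp_measurable:
  assumes "f holomorphic_on ball 0 1"
  shows "fp p f \<in> borel_measurable borel"
proof -
  have "(\<lambda>z. indicator (ball 0 1) z *\<^sub>R f z) \<in> borel_measurable borel"
    using assms by (intro borel_measurable_continuous_on_indicator holomorphic_on_imp_continuous_on) auto
  then have [measurable]: "(\<lambda>z. indicator (ball 0 1) z *\<^sub>R f z) \<in> borel_measurable borel" .
  have [measurable]: "ball (0::complex) 1 \<in> sets borel" by simp
  have "(\<lambda>z. ennreal (norm (indicator (ball 0 1) z *\<^sub>R f z) powr p) * indicator (ball 0 1) z) \<in> borel_measurable borel"
    by measurable
  also have "(\<lambda>z. ennreal (norm (indicator (ball 0 1) z *\<^sub>R f z) powr p) * indicator (ball 0 1) z) = fp p f"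
    by (auto simp: fp_def indicator_def fun_eq_iff)
  finally show ?thesis .
qed

abbreviation pmean :: "real \<Rightarrow> (complex \<Rightarrow> complex) \<Rightarrow> real \<Rightarrow> ennreal" where
  "pmean p f \<equiv> circ_avg (fp p f)"

lemma fp_le_poisson:
  assumes f: "f holomorphic_on ball 0 1" "\<rho> < 1" "norm w < \<rho>" "0 < p"
  shows "fp p f w \<le> (\<integral>\<^sup>+u\<in>{0..<1}. ennreal (pois \<rho> w u) * fp p f (complex_of_real \<rho> * rot u) \<partial>lborel)"
proof -
  have \<rho>: "0 < \<rho>" using f(3) norm_ge_zero[of w] by linarith
  have i: "((\<lambda>u. pois \<rho> w u * norm (f (complex_of_real \<rho> * rot u)) powr p) has_integral pint p f \<rho> w) {0..1}"
    unfolding pint_def by (intro integrable_integral integrable_continuous_real continuous_pint_integrand[OF f])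
  have "fp p f w \<le> ennreal (pint p f \<rho> w)"
    using powr_le_pint[OF f] f by (subst fp_ball) (auto intro: ennreal_leI)
  also have "\<dots> = (\<integral>\<^sup>+u\<in>{0..<1}. ennreal (pois \<rho> w u * norm (f (complex_of_real \<rho> * rot u)) powr p) \<partial>lborel)"
    by (rule nn_integral_unit_interval[OF i, symmetric]) (use pois_nonneg[OF f(3)] in simp)
  also have "\<dots> = (\<integral>\<^sup>+u\<in>{0..<1}. ennreal (pois \<rho> w u) * fp p f (complex_of_real \<rho> * rot u) \<partial>lborel)"
    by (intro nn_integral_cong) (use \<rho> f(2) pois_nonneg[OF f(3)] in \<open>auto simp: fp_def norm_mult ennreal_mult indicator_def\<close>)
  finally show ?thesis .
qed

lemma circ_avg_poisson:
  assumes [measurable]: "g \<in> borel_measurable borel" and r: "0 \<le> r" "r < \<rho>"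
  shows "(\<integral>\<^sup>+v\<in>{0..<1}. (\<integral>\<^sup>+u\<in>{0..<1}. ennreal (pois \<rho> (complex_of_real r * rot v) u) * g (complex_of_real \<rho> * rot u) \<partial>lborel) \<partial>lborel) = circ_avg g \<rho>"
proof -
  have "(\<integral>\<^sup>+v\<in>{0..<1}. (\<integral>\<^sup>+u\<in>{0..<1}. ennreal (pois \<rho> (complex_of_real r * rot v) u) * g (complex_of_real \<rho> * rot u) \<partial>lborel) \<partial>lborel)
    = (\<integral>\<^sup>+v. (\<integral>\<^sup>+u. ennreal (pois \<rho> (complex_of_real r * rot v) u) * g (complex_of_real \<rho> * rot u) * indicator {0..<1} u * indicator {0..<1} v \<partial>lborel) \<partial>lborel)"
    by (intro nn_integral_cong nn_integral_multc[symmetric]) measurable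
  also have "\<dots> = (\<integral>\<^sup>+u. (\<integral>\<^sup>+v. ennreal (pois \<rho> (complex_of_real r * rot v) u) * g (complex_of_real \<rho> * rot u) * indicator {0..<1} u * indicator {0..<1} v \<partial>lborel) \<partial>lborel)"
    by (rule lborel_pair.Fubini') measurable
  also have "\<dots> = (\<integral>\<^sup>+u. (\<integral>\<^sup>+v. (g (complex_of_real \<rho> * rot u) * indicator {0..<1} u) * (ennreal (pois \<rho> (complex_of_real r * rot u) v) * indicator {0..<1} v) \<partial>lborel) \<partial>lborel)"
    by (subst pois_swap) (simp add: mult_ac)
  also have "\<dots> = (\<integral>\<^sup>+u. (g (complex_of_real \<rho> * rot u) * indicator {0..<1} u) * (\<integral>\<^sup>+v\<in>{0..<1}. ennreal (pois \<rho> (complex_of_real r * rot u) v) \<partial>lborel) \<partial>lborel)"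
    by (intro nn_integral_cong nn_integral_cmult) measurable
  also have "\<dots> = circ_avg g \<rho>"
    unfolding circ_avg_def using r by (subst nn_integral_pois) (simp_all add: norm_mult)
  finally show ?thesis .
qed

text \<open>The pointwise Poisson bound is averaged over the circle of radius \<open>r\<close>; by
  the symmetry of the kernel the average of its right-hand side is the mean over the outer
  circle.\<close>

lemma pmean_mono:
  assumes f: "f holomorphic_on ball 0 1" "0 < p" and r: "0 \<le> r" "r \<le> \<rho>" "\<rho> < 1"
  shows "pmean p f r \<le> pmean p f \<rho>"
proof (cases "r = \<rho>")
  case False
  have "pmean p f r \<le> (\<integral>\<^sup>+v\<in>{0..<1}. (\<integral>\<^sup>+u\<in>{0..<1}. ennreal (pois \<rho> (complex_of_real r * rot v) u) * fp p f (complex_of_real \<rho> * rot u) \<partial>lborel) \<partial>lborel)"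
    unfolding circ_avg_def
    by (intro nn_integral_mono mult_right_mono fp_le_poisson) (use False r f in \<open>auto simp: norm_mult\<close>)
  also have "\<dots> = pmean p f \<rho>"
    by (rule circ_avg_poisson) (use r False fp_measurable[OF f(1)] in auto)
  finally show ?thesis .
qed simp

lemma fp_le_pmean:
  assumes f: "f holomorphic_on ball 0 1" "\<rho> < 1" "norm w < \<rho>" "0 < p"
  shows "fp p f w \<le> ennreal (2 / (\<rho> - norm w)) * pmean p f \<rho>"
proof -
  note [measurable] = fp_measurable[OF f(1)]
  have "fp p f w \<le> (\<integral>\<^sup>+u\<in>{0..<1}. ennreal (pois \<rho> w u) * fp p f (complex_of_real \<rho> * rot u) \<partial>lborel)"
    by (rule fp_le_poisson[OF f])
  also have "\<dots> \<le> (\<integral>\<^sup>+u. ennreal (2 / (\<rho> - norm w)) * (fp p f (complex_of_real \<rho> * rot u) * indicator {0..<1} u) \<partial>lborel)"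
    unfolding mult.assoc by (intro nn_integral_mono mult_right_mono ennreal_leI pois_upper[OF f(3,2)]) auto
  also have "\<dots> = ennreal (2 / (\<rho> - norm w)) * pmean p f \<rho>"
    unfolding circ_avg_def by (rule nn_integral_cmult) measurable
  finally show ?thesis .
qed

section \<open>Dyadic radii, and Poisson majorants on dyadic annuli\<close>

definition dy :: "nat \<Rightarrow> real" where "dy k = 1 - 1 / 2 ^ k"

lemma dy_0 [simp]: "dy 0 = 0" and dy_less_1 [simp]: "dy k < 1" and dy_nonneg [simp]: "0 \<le> dy k"
  and dy_ge_half: "0 < k \<Longrightarrow> 1 / 2 \<le> dy k" and dy_Suc_diff: "dy (Suc k) - dy k = 1 / 2 ^ Suc k"
  and dy_Suc_mid: "dy (Suc k) = (1 + dy k) / 2"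
proof -
  show "0 < k \<Longrightarrow> 1 / 2 \<le> dy k" by (cases k) (auto simp: dy_def field_simps)
qed (auto simp: dy_def field_simps)

lemma dy_mono: "j \<le> k \<Longrightarrow> dy j \<le> dy k"
  by (auto simp: dy_def intro!: divide_left_mono power_increasing)

lemma dy_less: "dy k < dy (Suc k)" by (simp add: dy_def field_simps)

lemma dy_LIMSEQ: "dy \<longlonglongrightarrow> 1"
proof -
  have "(\<lambda>k. 1 - (1/2::real) ^ k) \<longlonglongrightarrow> 1 - 0"
    by (intro tendsto_intros LIMSEQ_power_zero) auto
  then show ?thesis by (simp add: dy_def[abs_def] power_divide)
qed

definition dI :: "nat \<Rightarrow> real set" where "dI k = {dy k..<dy (Suc k)}"

lemma dI_level: assumes "0 \<le> r" "r < 1" shows "\<exists>k. r \<in> dI k"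
proof -
  have "eventually (\<lambda>k. r < dy k) sequentially"
    using dy_LIMSEQ assms(2) by (rule order_tendstoD)
  then obtain n where n: "r < dy n" by (auto simp: eventually_sequentially)
  define k where "k = (LEAST k. r < dy k)"
  have k: "r < dy k" unfolding k_def by (rule LeastI[of _ n]) (rule n)
  then obtain j where j: "k = Suc j" using assms(1) by (cases k) auto
  have "\<not> r < dy j" using not_less_Least[of j "\<lambda>k. r < dy k"] j unfolding k_def by auto
  then show ?thesis using k j by (auto simp: dI_def intro!: exI[of _ j])
qed

lemma dI_disjoint: "disjoint_family dI"
  unfolding disjoint_family_on_def
proof (intro ballI impI)
  fix m n :: nat assume "m \<noteq> n"
  then have "Suc m \<le> n \<or> Suc n \<le> m" by linarith
  then show "dI m \<inter> dI n = {}"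
    using dy_mono[of "Suc m" n] dy_mono[of "Suc n" m] by (auto simp: dI_def)
qed

lemma UN_dI: "(\<Union>k. dI k) = {0..<1}"
proof
  show "(\<Union>k. dI k) \<subseteq> {0..<1}"
  proof
    fix r assume "r \<in> (\<Union>k. dI k)"
    then obtain k where "dy k \<le> r" "r < dy (Suc k)" by (auto simp: dI_def)
    then show "r \<in> {0..<1}" using dy_nonneg[of k] dy_less_1[of "Suc k"] by (auto simp del: dy_nonneg dy_less_1)
  qed
  show "{0..<1} \<subseteq> (\<Union>k. dI k)" using dI_level by fastforce
qed

lemma UN_dI_tail: "(\<Union>k. dI (k + n)) = {dy n..<1}"
proof (intro set_eqI iffI)
  fix r assume "r \<in> (\<Union>k. dI (k + n))"
  then obtain k where k: "dy (k + n) \<le> r" "r < dy (Suc (k + n))" by (auto simp: dI_def)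
  then show "r \<in> {dy n..<1}" using dy_mono[of n "k + n"] dy_less_1[of "Suc (k + n)"] by (auto simp del: dy_less_1)
next
  fix r assume r: "r \<in> {dy n..<1}"
  then have "0 \<le> r" "r < 1" using dy_nonneg[of n] by (auto simp del: dy_nonneg)
  then obtain k where k: "r \<in> dI k" using dI_level by blast
  have "n \<le> k"
  proof (rule ccontr)
    assume "\<not> n \<le> k"
    then have "dy (Suc k) \<le> dy n" by (intro dy_mono) auto
    then show False using k r by (auto simp: dI_def)
  qed
  then show "r \<in> (\<Union>k. dI (k + n))" using k by (auto intro!: exI[of _ "k - n"])
qed

lemma dI_sets [measurable]: "dI k \<in> sets borel" by (simp add: dI_def)

lemma nn_integral_dI_tail:
  assumes [measurable]: "f \<in> borel_measurable M" "\<And>k. dI k \<in> sets M"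
  shows "(\<integral>\<^sup>+r\<in>{dy n..<1}. f r \<partial>M) = (\<Sum>k. \<integral>\<^sup>+r\<in>dI (k + n). f r \<partial>M)"
proof -
  have "(\<integral>\<^sup>+r\<in>{dy n..<1}. f r \<partial>M) = (\<integral>\<^sup>+r. (\<Sum>k. f r * indicator (dI (k + n)) r) \<partial>M)"
  proof (rule nn_integral_cong)
    fix r
    have "disjoint_family (\<lambda>k. dI (k + n))"
      using dI_disjoint by (auto simp: disjoint_family_on_def)
    then show "f r * indicator {dy n..<1} r = (\<Sum>k. f r * indicator (dI (k + n)) r)"
      unfolding UN_dI_tail[symmetric] using suminf_indicator[of "\<lambda>k. dI (k + n)" r]
      by (simp add: ennreal_suminf_cmult)
  qed
  also have "\<dots> = (\<Sum>k. \<integral>\<^sup>+r\<in>dI (k + n). f r \<partial>M)"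
    by (rule nn_integral_suminf) measurable
  finally show ?thesis .
qed

lemma nn_integral_dI:
  assumes "f \<in> borel_measurable M" "\<And>k. dI k \<in> sets M"
  shows "(\<integral>\<^sup>+r\<in>{0..<1}. f r \<partial>M) = (\<Sum>k. \<integral>\<^sup>+r\<in>dI k. f r \<partial>M)"
  using nn_integral_dI_tail[OF assms, of 0] by simp

text \<open>A Harnack inequality. With \<open>\<rho> = dy (k + 2)\<close> one has
  \<open>r - dy k \<le> 2 * (\<rho> - r)\<close>, so passing from \<open>r\<close> to
  \<open>dy k\<close> enlarges the distance to a boundary point at most by the factor 3, whose
  square is the constant.\<close>

lemma pois_annulus:
  assumes "dy k \<le> r" "r \<le> dy (Suc k)" "norm e = 1"
  shows "pois (dy (k + 2)) (complex_of_real r * e) u \<le> 9 * pois (dy (k + 2)) (complex_of_real (dy k) * e) u"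
proof -
  define \<rho> where "\<rho> = dy (k + 2)"
  define x :: real where "x = 1 / 2 ^ (k + 2)"
  have "0 < x" "dy k = 1 - 4 * x" "dy (Suc k) = 1 - 2 * x" "\<rho> = 1 - x"
    by (simp_all add: x_def \<rho>_def dy_def)
  then have d: "r - dy k \<le> 2 * (\<rho> - r)" "r < \<rho>" using assms by auto
  have r0: "0 \<le> r" "0 \<le> dy k" using assms dy_nonneg[of k] by linarith+
  define A B where "A = norm (complex_of_real \<rho> * rot u - complex_of_real r * e)"
    and "B = norm (complex_of_real \<rho> * rot u - complex_of_real (dy k) * e)"
  have A: "\<rho> - r \<le> A" using pois_denominator[of "complex_of_real r * e" \<rho> u] d r0 assms(3) by (simp add: A_def norm_mult)
  have B0: "\<rho> - dy k \<le> B" using pois_denominator[of "complex_of_real (dy k) * e" \<rho> u] d r0 assms by (simp add: B_def norm_mult)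
  have "B \<le> A + norm (complex_of_real r * e - complex_of_real (dy k) * e)"
    unfolding A_def B_def by (rule order_trans[OF _ norm_triangle_ineq]) simp
  also have "norm (complex_of_real r * e - complex_of_real (dy k) * e) = r - dy k"
    using assms by (simp add: left_diff_distrib[symmetric] norm_mult of_real_diff[symmetric] del: of_real_diff)
  finally have "B \<le> 3 * A" using A d(1) by argo
  then have "B\<^sup>2 \<le> (3 * A)\<^sup>2" using B0 d assms by (intro power_mono) auto
  then have BA: "B\<^sup>2 \<le> 9 * A\<^sup>2" by (simp add: power_mult_distrib)
  have Bp: "0 < B\<^sup>2" and Ap: "0 < A\<^sup>2" using A B0 d assms by auto
  have rr: "(dy k)\<^sup>2 \<le> r\<^sup>2" "r\<^sup>2 \<le> \<rho>\<^sup>2"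
    using power_mono[OF assms(1) r0(2), of 2] power_mono[OF less_imp_le[OF d(2)] r0(1), of 2] by auto
  have "(\<rho>\<^sup>2 - r\<^sup>2) / A\<^sup>2 \<le> (\<rho>\<^sup>2 - (dy k)\<^sup>2) * (9 / B\<^sup>2)"
  proof -
    have "1 / A\<^sup>2 \<le> 9 / B\<^sup>2" using BA Bp Ap by (simp add: field_simps)
    then have "(\<rho>\<^sup>2 - r\<^sup>2) * (1 / A\<^sup>2) \<le> (\<rho>\<^sup>2 - (dy k)\<^sup>2) * (9 / B\<^sup>2)"
      using rr by (intro mult_mono) auto
    then show ?thesis by simp
  qed
  then show ?thesis
    unfolding pois_def \<rho>_def[symmetric] A_def[symmetric] B_def[symmetric] using r0 assms(3) by (simp add: norm_mult mult.commute)
qed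

text \<open>A majorant depending on the direction \<open>sgn z\<close> only, which dominates
  \<open>fp p f\<close> on the whole radial segment from \<open>dy k\<close> to
  \<open>dy (Suc k)\<close>. The boundary values are taken at \<open>dy (k + 2)\<close>, one level
  beyond the segment, so that the kernel stays comparable along it.\<close>

definition hmax :: "real \<Rightarrow> (complex \<Rightarrow> complex) \<Rightarrow> nat \<Rightarrow> complex \<Rightarrow> ennreal" where
  "hmax p f k z = (\<integral>\<^sup>+u\<in>{0..<1}. ennreal (9 * pois (dy (k + 2)) (complex_of_real (dy k) * sgn z) u) * fp p f (complex_of_real (dy (k + 2)) * rot u) \<partial>lborel)"

lemma hmax_measurable [measurable]:
  assumes "f holomorphic_on ball 0 1"
  shows "hmax p f k \<in> borel_measurable borel"
proof -
  note [measurable] = fp_measurable[OF assms]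
  have [measurable]: "(sgn :: complex \<Rightarrow> complex) \<in> borel_measurable borel"
    unfolding sgn_div_norm[abs_def] by measurable
  show ?thesis unfolding hmax_def[abs_def] by measurable
qed

lemma fp_le_hmax:
  assumes f: "f holomorphic_on ball 0 1" "0 < p" and s: "dy k \<le> s" "s \<le> dy (Suc k)" and z: "z \<noteq> 0 \<or> s = 0"
  shows "fp p f (complex_of_real s * sgn z) \<le> hmax p f k z"
proof -
  note [measurable] = fp_measurable[OF f(1)]
  have sk: "s < dy (k + 2)" using s dy_less[of "Suc k"] by simp
  have s0: "0 \<le> s" using s dy_nonneg[of k] by linarith
  have "pois (dy (k + 2)) (complex_of_real s * sgn z) u \<le> 9 * pois (dy (k + 2)) (complex_of_real (dy k) * sgn z) u" for u
  proof (cases "z = 0")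
    case True
    have "0 \<le> pois (dy (k + 2)) 0 u" by (rule pois_nonneg) (use sk s0 in simp)
    then show ?thesis using True by simp
  next
    case False
    then show ?thesis using pois_annulus[OF s, of "sgn z"] by (simp add: norm_sgn)
  qed
  then have "(\<integral>\<^sup>+u\<in>{0..<1}. ennreal (pois (dy (k + 2)) (complex_of_real s * sgn z) u) * fp p f (complex_of_real (dy (k + 2)) * rot u) \<partial>lborel) \<le> hmax p f k z"
    unfolding hmax_def by (intro nn_integral_mono mult_right_mono ennreal_leI) auto
  moreover have "fp p f (complex_of_real s * sgn z) \<le> (\<integral>\<^sup>+u\<in>{0..<1}. ennreal (pois (dy (k + 2)) (complex_of_real s * sgn z) u) * fp p f (complex_of_real (dy (k + 2)) * rot u) \<partial>lborel)"
    by (rule fp_le_poisson) (use f sk s0 in \<open>auto simp: norm_mult norm_sgn\<close>)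
  ultimately show ?thesis by (rule order_trans[rotated])
qed

lemma circ_avg_hmax:
  assumes f: "f holomorphic_on ball 0 1" and r: "0 < r"
  shows "circ_avg (hmax p f k) r = 9 * pmean p f (dy (k + 2))"
proof -
  note [measurable] = fp_measurable[OF f]
  have dk: "dy k < dy (k + 2)" using dy_less[of k] dy_less[of "Suc k"] by simp
  have sg: "sgn (complex_of_real r * rot v) = rot v" for v
    using r by (simp add: sgn_div_norm norm_mult scaleR_conv_of_real)
  have "circ_avg (hmax p f k) r = (\<integral>\<^sup>+v\<in>{0..<1}. 9 * (\<integral>\<^sup>+u\<in>{0..<1}. ennreal (pois (dy (k + 2)) (complex_of_real (dy k) * rot v) u) * fp p f (complex_of_real (dy (k + 2)) * rot u) \<partial>lborel) \<partial>lborel)"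
    unfolding circ_avg_def hmax_def sg
  proof (intro nn_integral_cong arg_cong2[where f = times] refl)
    fix v :: real
    have p0: "0 \<le> pois (dy (k + 2)) (complex_of_real (dy k) * rot v) u" for u
      by (rule pois_nonneg) (use dk in \<open>simp add: norm_mult\<close>)
    show "(\<integral>\<^sup>+u\<in>{0..<1}. ennreal (9 * pois (dy (k + 2)) (complex_of_real (dy k) * rot v) u) * fp p f (complex_of_real (dy (k + 2)) * rot u) \<partial>lborel)
       = 9 * (\<integral>\<^sup>+u\<in>{0..<1}. ennreal (pois (dy (k + 2)) (complex_of_real (dy k) * rot v) u) * fp p f (complex_of_real (dy (k + 2)) * rot u) \<partial>lborel)"
      by (subst nn_integral_cmult[symmetric]) (auto simp: ennreal_mult' mult.assoc)
  qed
  also have "\<dots> = 9 * (\<integral>\<^sup>+v\<in>{0..<1}. (\<integral>\<^sup>+u\<in>{0..<1}. ennreal (pois (dy (k + 2)) (complex_of_real (dy k) * rot v) u) * fp p f (complex_of_real (dy (k + 2)) * rot u) \<partial>lborel) \<partial>lborel)"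
    unfolding mult.assoc by (rule nn_integral_cmult) measurable
  also have "\<dots> = 9 * pmean p f (dy (k + 2))"
    using dk by (subst circ_avg_poisson) auto
  finally show ?thesis .
qed

section \<open>Doubling profiles and their moments\<close>

text \<open>This is one term of the binomial expansion of
  \<open>((1 - x) + x) ^ (n + M) = 1\<close>, combined with the lower bound
  \<open>((n + M) / M) ^ M\<close> for the binomial coefficient.\<close>

lemma power_mult_power_le:
  fixes x :: real
  assumes "0 \<le> x" "x \<le> 1"
  shows "x ^ n * (1 - x) ^ M \<le> (real M / real (n + 1)) ^ M"
proof (cases "M = 0")
  case True then show ?thesis using assms by (simp add: power_le_one)
next
  case False
  define c where "c = real ((n + M) choose M)"
  have "(real (n + M) / real M) ^ M \<le> c"
    unfolding c_def using binomial_ge_n_over_k_pow_k[of M "n + M", where 'a = real] by simp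
  moreover have "(real (n + 1) / real M) ^ M \<le> (real (n + M) / real M) ^ M"
    using False by (intro power_mono divide_right_mono) auto
  ultimately have c: "(real (n + 1) / real M) ^ M \<le> c" by linarith
  have "c * ((1 - x) ^ M * x ^ n) \<le> (\<Sum>k\<le>n + M. real ((n + M) choose k) * ((1 - x) ^ k * x ^ (n + M - k)))"
    using member_le_sum[of M "{..n + M}" "\<lambda>k. real ((n + M) choose k) * ((1 - x) ^ k * x ^ (n + M - k))"] assms
    by (simp add: c_def)
  also have "\<dots> = ((1 - x) + x) ^ (n + M)"
    unfolding binomial_ring by (simp add: mult.assoc)
  finally have "c * ((1 - x) ^ M * x ^ n) \<le> 1" by simp
  moreover have "(real (n + 1) / real M) ^ M * ((1 - x) ^ M * x ^ n) \<le> c * ((1 - x) ^ M * x ^ n)"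
    using assms by (intro mult_right_mono c) auto
  ultimately have "(real (n + 1) / real M) ^ M * ((1 - x) ^ M * x ^ n) \<le> 1" by linarith
  then show ?thesis using False by (simp add: power_divide field_simps)
qed

text \<open>At distance at least \<open>1 / 2 ^ Suc j\<close> from 1, an exponent of size
  \<open>2 ^ k\<close> gains an arbitrary power \<open>M\<close> of the ratio of the scales;
  \<open>M\<close> is chosen against the growth constants wherever the estimate is used.\<close>

lemma power_le_dyadic:
  assumes "0 \<le> x" "x \<le> dy (Suc j)" "2 ^ k \<le> n + 1"
  shows "x ^ n \<le> (2 * real M) ^ M * (2 ^ j / 2 ^ k) ^ M"
proof -
  have x1: "1 / 2 ^ Suc j \<le> 1 - x" using assms(2) by (simp add: dy_def)
  then have x2: "0 < 1 - x" by (smt (verit) divide_pos_pos zero_less_power)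
  have nk: "(2::real) ^ k \<le> real (n + 1)" using assms(3) by (metis of_nat_le_iff of_nat_numeral of_nat_power)
  have "x ^ n * (1 - x) ^ M \<le> (real M / real (n + 1)) ^ M"
    using power_mult_power_le[of x n M] assms(1) x2 by simp
  also have "\<dots> \<le> (real M / 2 ^ k) ^ M"
    using nk by (intro power_mono divide_left_mono) auto
  finally have 1: "x ^ n * (1 - x) ^ M \<le> (real M / 2 ^ k) ^ M" .
  have "x ^ n * (1 / 2 ^ Suc j) ^ M \<le> x ^ n * (1 - x) ^ M"
    using x1 assms(1) by (intro mult_left_mono power_mono) auto
  with 1 have "x ^ n * (1 / 2 ^ Suc j) ^ M \<le> (real M / 2 ^ k) ^ M" by linarith
  then have "x ^ n \<le> (real M / 2 ^ k) ^ M * (2 ^ Suc j) ^ M"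
    by (simp add: power_one_over field_simps)
  also have "\<dots> = (2 * real M) ^ M * (2 ^ j / 2 ^ k) ^ M"
    by (simp add: power_divide power_mult_distrib)
  finally show ?thesis .
qed

text \<open>With \<open>N = 2 ^ k\<close> this amounts to
  \<open>(1 - 1 / N) ^ (N - 1) \<ge> exp (- 1)\<close>, rounded down.\<close>

lemma dy_power_lower:
  assumes "n + 1 \<le> 2 ^ k"
  shows "1 / 3 \<le> dy k ^ n"
proof (cases "n = 0")
  case False
  define N :: real where "N = 2 ^ k"
  have N: "real n \<le> N - 1" "1 < N"
  proof -
    have "real (n + 1) \<le> N" unfolding N_def using assms by (metis of_nat_le_iff of_nat_numeral of_nat_power)
    then show "real n \<le> N - 1" "1 < N" using False by auto
  qed
  have "(1 + 1 / (N - 1)) ^ n \<le> exp (1 / (N - 1)) ^ n"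
    using N by (intro power_mono exp_ge_add_one_self) auto
  also have "\<dots> = exp (real n / (N - 1))" by (simp add: exp_of_nat_mult[symmetric])
  also have "\<dots> \<le> exp 1" using N by simp
  also have "\<dots> \<le> 3" using exp_le by simp
  finally have le3: "(1 + 1 / (N - 1)) ^ n \<le> 3" .
  have pos: "0 < (1 + 1 / (N - 1)) ^ n" using N by (intro zero_less_power) (auto simp: add_pos_pos)
  have "dy k = 1 / (1 + 1 / (N - 1))" using N by (simp add: dy_def N_def[symmetric] field_simps)
  then have "dy k ^ n = 1 / (1 + 1 / (N - 1)) ^ n" by (simp add: power_one_over)
  then show ?thesis using le3 pos by (simp add: divide_left_mono)
qed simp

text \<open>Stated for an arbitrary measure because it serves the weights as well as \<mu>. Below
  \<open>dy k\<close> the dyadic intervals are damped by \<open>power_le_dyadic\<close>; beyond it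
  only \<open>x ^ n \<le> 1\<close> is used.\<close>

lemma nn_integral_power_split:
  assumes [measurable]: "\<And>j. dI j \<in> sets N" "\<And>j. {dy j..<1} \<in> sets N" and k: "2 ^ k \<le> n + 1"
  shows "(\<integral>\<^sup>+x\<in>{0..<1}. ennreal (x ^ n) \<partial>N) \<le>
    (\<Sum>j<k. ennreal ((2 * real M) ^ M * (2 ^ j / 2 ^ k) ^ M) * emeasure N (dI j)) + emeasure N {dy k..<1}"
proof -
  have "(\<integral>\<^sup>+x\<in>{0..<1}. ennreal (x ^ n) \<partial>N) \<le>
      (\<integral>\<^sup>+x. (\<Sum>j<k. ennreal ((2 * real M) ^ M * (2 ^ j / 2 ^ k) ^ M) * indicator (dI j) x) + indicator {dy k..<1} x \<partial>N)"
  proof (rule nn_integral_mono)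
    fix x :: real
    show "ennreal (x ^ n) * indicator {0..<1} x \<le> (\<Sum>j<k. ennreal ((2 * real M) ^ M * (2 ^ j / 2 ^ k) ^ M) * indicator (dI j) x) + indicator {dy k..<1} x"
    proof (cases "x \<in> {0..<1}")
      case x: True
      show ?thesis
      proof (cases "dy k \<le> x")
        case True
        have "ennreal (x ^ n) \<le> 1" using x by (simp add: power_le_one)
        then show ?thesis using True x by (simp add: add_increasing)
      next
        case False
        obtain j where j: "x \<in> dI j" using dI_level[of x] x by auto
        then have xj: "dy j \<le> x" "x \<le> dy (Suc j)" by (auto simp: dI_def)
        have "j < k" using False xj dy_mono[of k j] by (cases "j < k") auto
        have "ennreal (x ^ n) \<le> ennreal ((2 * real M) ^ M * (2 ^ j / 2 ^ k) ^ M) * indicator (dI j) x"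
          using j power_le_dyadic[OF _ xj(2) k, of M] x by (simp add: ennreal_leI)
        also have "\<dots> \<le> (\<Sum>j<k. ennreal ((2 * real M) ^ M * (2 ^ j / 2 ^ k) ^ M) * indicator (dI j) x)"
          using \<open>j < k\<close> by (intro member_le_sum) auto
        finally show ?thesis using x by (simp add: add_increasing2)
      qed
    qed simp
  qed
  also have "\<dots> = (\<Sum>j<k. ennreal ((2 * real M) ^ M * (2 ^ j / 2 ^ k) ^ M) * emeasure N (dI j)) + emeasure N {dy k..<1}"
    by (subst nn_integral_add, measurable, subst nn_integral_sum, measurable) (auto simp: nn_integral_cmult)
  finally show ?thesis .
qed

section \<open>Comparison of moments with tails\<close>

definition tail :: "(real \<Rightarrow> real) \<Rightarrow> real \<Rightarrow> real" where
  "tail h r = enn2real (\<integral>\<^sup>+s\<in>{r..<1}. ennreal (h s) \<partial>lborel)"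

definition moment :: "(real \<Rightarrow> real) \<Rightarrow> nat \<Rightarrow> real" where
  "moment h n = enn2real (\<integral>\<^sup>+s\<in>{0..<1}. ennreal (s ^ n * h s) \<partial>lborel)"

text \<open>The one-variable content of membership in \<open>D_hat\<close>, for a Borel profile
  \<open>h\<close>. Finiteness at 0 and positivity of the tails are put among the assumptions;
  \<open>D_hat_profile\<close> derives them for actual weights.\<close>

locale doubling =
  fixes h :: "real \<Rightarrow> real" and C :: real
  assumes h_measurable [measurable]: "h \<in> borel_measurable borel"
    and h_nonneg: "0 \<le> h r"
    and h_finite: "(\<integral>\<^sup>+s\<in>{0..<1}. ennreal (h s) \<partial>lborel) < \<infinity>"
    and tail_pos: "0 \<le> r \<Longrightarrow> r < 1 \<Longrightarrow> 0 < tail h r"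
    and tail_double: "0 \<le> r \<Longrightarrow> r < 1 \<Longrightarrow> tail h r \<le> C * tail h ((1 + r) / 2)"
begin

definition W :: "nat \<Rightarrow> real" where "W k = tail h (dy k)"

lemma tail_ennreal: "0 \<le> r \<Longrightarrow> (\<integral>\<^sup>+s\<in>{r..<1}. ennreal (h s) \<partial>lborel) = ennreal (tail h r)"
proof -
  assume "0 \<le> r"
  then have "(\<integral>\<^sup>+s\<in>{r..<1}. ennreal (h s) \<partial>lborel) \<le> (\<integral>\<^sup>+s\<in>{0..<1}. ennreal (h s) \<partial>lborel)"
    by (intro nn_integral_mono) (auto simp: indicator_def)
  also have "\<dots> < \<infinity>" by (rule h_finite)
  finally show ?thesis unfolding tail_def by simp
qed

lemma tail_antimono: "0 \<le> r \<Longrightarrow> r \<le> s \<Longrightarrow> tail h s \<le> tail h r"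
proof -
  assume rs: "0 \<le> r" "r \<le> s"
  then have "ennreal (tail h s) \<le> ennreal (tail h r)"
    by (subst (1 2) tail_ennreal[symmetric]) (auto intro!: nn_integral_mono simp: indicator_def)
  then show ?thesis by (simp add: tail_def)
qed

lemma W_ennreal: "(\<integral>\<^sup>+s\<in>{dy k..<1}. ennreal (h s) \<partial>lborel) = ennreal (W k)"
  unfolding W_def by (rule tail_ennreal) simp

lemma W_pos: "0 < W k" unfolding W_def by (rule tail_pos) auto

lemma W_antimono: "j \<le> k \<Longrightarrow> W k \<le> W j"
  unfolding W_def by (rule tail_antimono) (auto intro: dy_mono)

lemma W_double: "W k \<le> C * W (Suc k)"
  using tail_double[of "dy k"] unfolding W_def dy_Suc_mid by simp

lemma C_ge_1: "1 \<le> C"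
proof -
  have "W 1 \<le> W 0" by (rule W_antimono) simp
  also have "\<dots> \<le> C * W 1" using W_double[of 0] by simp
  finally show ?thesis using W_pos[of 1] by simp
qed

lemma W_double_iterate: "W k \<le> C ^ j * W (k + j)"
proof (induction j)
  case (Suc j)
  have "C ^ j * W (k + j) \<le> C ^ j * (C * W (Suc (k + j)))"
    using C_ge_1 by (intro mult_left_mono W_double) auto
  then show ?case using Suc by (simp add: mult_ac)
qed simp

lemma tail_bounds:
  assumes "r \<in> dI k" shows "tail h r \<le> W k" "W k \<le> C * tail h r"
proof -
  have r: "dy k \<le> r" "r \<le> dy (Suc k)" "0 \<le> r" using assms dy_nonneg[of k] unfolding dI_def by (auto simp del: dy_nonneg)
  show "tail h r \<le> W k" unfolding W_def by (rule tail_antimono) (use r in auto)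
  have "W k \<le> C * W (Suc k)" by (rule W_double)
  also have "\<dots> \<le> C * tail h r" unfolding W_def using C_ge_1 r by (intro mult_left_mono tail_antimono) auto
  finally show "W k \<le> C * tail h r" .
qed

lemma moment_ennreal: "(\<integral>\<^sup>+s\<in>{0..<1}. ennreal (s ^ n * h s) \<partial>lborel) = ennreal (moment h n)"
proof -
  have "(\<integral>\<^sup>+s\<in>{0..<1}. ennreal (s ^ n * h s) \<partial>lborel) \<le> (\<integral>\<^sup>+s\<in>{0..<1}. ennreal (h s) \<partial>lborel)"
    by (intro nn_integral_mono) (auto simp: indicator_def h_nonneg power_le_one intro!: ennreal_leI mult_left_le_one_le)
  also have "\<dots> < \<infinity>" by (rule h_finite)
  finally show ?thesis unfolding moment_def by simp
qed

lemma moment_antimono: "m \<le> n \<Longrightarrow> moment h n \<le> moment h m"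
proof -
  assume "m \<le> n"
  have "ennreal (moment h n) \<le> ennreal (moment h m)"
    unfolding moment_ennreal[symmetric]
  proof (rule nn_integral_mono)
    fix s :: real
    show "ennreal (s ^ n * h s) * indicator {0..<1} s \<le> ennreal (s ^ m * h s) * indicator {0..<1} s"
      using \<open>m \<le> n\<close> h_nonneg[of s] by (cases "s \<in> {0..<1}") (auto intro!: ennreal_leI mult_right_mono power_decreasing)
  qed
  then show ?thesis by (simp add: moment_def)
qed

text \<open>On \<open>{dy (Suc k)..<1}\<close> the power \<open>s ^ n\<close> is at least
  \<open>1 / 3\<close>; one doubling step then replaces \<open>W (Suc k)\<close> by
  \<open>W k\<close>.\<close>

lemma moment_lower:
  assumes "n + 1 \<le> 2 ^ Suc k"
  shows "W k \<le> 3 * C * moment h n"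
proof -
  have "ennreal (1 / 3) * ennreal (W (Suc k)) = (\<integral>\<^sup>+s\<in>{dy (Suc k)..<1}. ennreal (1 / 3 * h s) \<partial>lborel)"
  proof -
    have "ennreal (1 / 3 * h s) * I = ennreal (1 / 3) * (ennreal (h s) * I)" for s I
      by (subst ennreal_mult') (auto simp: mult.assoc)
    then show ?thesis unfolding W_ennreal[symmetric] by (subst nn_integral_cmult[symmetric]) auto
  qed
  also have "\<dots> \<le> (\<integral>\<^sup>+s\<in>{0..<1}. ennreal (s ^ n * h s) \<partial>lborel)"
  proof (intro nn_integral_mono)
    fix s :: real
    have "1 / 3 \<le> s ^ n" if "dy (Suc k) \<le> s"
    proof -
      have "1 / 3 \<le> dy (Suc k) ^ n" by (rule dy_power_lower[OF assms])
      also have "\<dots> \<le> s ^ n" using that by (intro power_mono) auto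
      finally show ?thesis .
    qed
    moreover have "dy (Suc k) \<le> s \<Longrightarrow> 0 \<le> s" using dy_nonneg[of "Suc k"] by (auto simp del: dy_nonneg)
    ultimately show "ennreal (1 / 3 * h s) * indicator {dy (Suc k)..<1} s \<le> ennreal (s ^ n * h s) * indicator {0..<1} s"
      using h_nonneg[of s] by (auto simp: indicator_def simp del: mult_1 times_divide_eq_left intro!: ennreal_leI mult_right_mono)
  qed
  also have "\<dots> = ennreal (moment h n)" by (rule moment_ennreal)
  finally have "1 / 3 * W (Suc k) \<le> moment h n"
    using W_pos[of "Suc k"] by (simp add: ennreal_mult'[symmetric] moment_def)
  then have "W (Suc k) \<le> 3 * moment h n" by simp
  then have "C * W (Suc k) \<le> C * (3 * moment h n)" using C_ge_1 by (intro mult_left_mono) auto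
  then show ?thesis using W_double[of k] by (simp add: mult_ac)
qed

lemma moment_pos: "0 < moment h n"
proof -
  have "n + 1 \<le> 2 ^ Suc n" by (induction n) auto
  then have "W n \<le> 3 * C * moment h n" by (rule moment_lower)
  then have "0 < 3 * C * moment h n" using W_pos[of n] by linarith
  then show ?thesis using C_ge_1 by (simp add: zero_less_mult_iff)
qed

text \<open>The 2 in the condition is a reserve: after the loss of a factor \<open>C\<close> and the
  gain of \<open>2 ^ Mo\<close> per level, a geometric factor \<open>1 / 2\<close> is left.\<close>

definition Mo :: nat where "Mo = (SOME M. 2 * C \<le> 2 ^ M)"

lemma Mo: "2 * C \<le> 2 ^ Mo"
proof -
  obtain M where "2 * C < 2 ^ M" using real_arch_pow[of 2 "2 * C"] by auto
  then have "\<exists>M. 2 * C \<le> 2 ^ M" by (auto intro: less_imp_le)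
  then show ?thesis unfolding Mo_def by (rule someI_ex)
qed

text \<open>Moving \<open>k - j\<close> dyadic levels away from the boundary gains \<open>2\<^sup>-\<^sup>M\<^sup>(\<^sup>k\<^sup>-\<^sup>j\<^sup>)\<close> for every \<open>M\<close>, which beats the
  doubling constant.\<close>

lemma W_decay: assumes "j \<le> k" shows "(2 ^ j / 2 ^ k) ^ Mo * W j \<le> (1 / 2) ^ (k - j) * W k"
proof -
  define i where "i = k - j"
  have k: "k = j + i" using assms by (simp add: i_def)
  have "(2 ^ j / 2 ^ k :: real) ^ Mo = (1 / 2 ^ Mo) ^ i"
    unfolding k by (simp add: power_add power_one_over power_mult[symmetric] mult.commute)
  then have "(2 ^ j / 2 ^ k) ^ Mo * W j \<le> (1 / 2 ^ Mo) ^ i * (C ^ i * W (j + i))"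
    using W_double_iterate[of j i] by (simp add: mult_left_mono)
  also have "\<dots> = (C / 2 ^ Mo) ^ i * W k" unfolding k by (simp add: power_divide)
  also have "\<dots> \<le> (1 / 2) ^ i * W k"
    using Mo C_ge_1 W_pos[of k] by (intro mult_right_mono power_mono) (auto simp: field_simps)
  finally show ?thesis unfolding i_def .
qed

definition Bm :: real where "Bm = (2 * real Mo) ^ Mo + 1"

lemma Bm_pos: "0 < Bm" unfolding Bm_def by (simp add: add_nonneg_pos)

text \<open>The mass of each interval \<open>dI j\<close> is overestimated by \<open>W j\<close>,
  and \<open>W_decay\<close> turns the sum over \<open>j < k\<close> into a geometric series. With
  \<open>moment_lower\<close>, a moment of order about \<open>2 ^ k\<close> has the size of the tail
  at \<open>dy k\<close>.\<close>

lemma moment_upper: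
  assumes "2 ^ k \<le> n + 1"
  shows "moment h n \<le> Bm * W k"
proof -
  define N where "N = density lborel (\<lambda>s. ennreal (h s))"
  have [simp]: "sets N = sets borel" by (simp add: N_def)
  have eN: "emeasure N {dy j..<1} = ennreal (W j)" for j
    unfolding N_def by (subst emeasure_density) (auto simp: W_ennreal)
  have edI: "emeasure N (dI j) \<le> ennreal (W j)" for j
    unfolding eN[symmetric] dI_def using dy_less_1[of "Suc j"] by (intro emeasure_mono) (auto simp del: dy_less_1)
  have "ennreal (moment h n) = (\<integral>\<^sup>+s\<in>{0..<1}. ennreal (s ^ n) \<partial>N)"
    unfolding moment_ennreal[symmetric] N_def
    by (subst nn_integral_density) (auto intro!: nn_integral_cong simp: indicator_def ennreal_mult h_nonneg mult_ac)
  also have "\<dots> \<le> (\<Sum>j<k. ennreal ((2 * real Mo) ^ Mo * (2 ^ j / 2 ^ k) ^ Mo) * emeasure N (dI j)) + emeasure N {dy k..<1}"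
    by (rule nn_integral_power_split[OF _ _ assms]) auto
  also have "\<dots> \<le> (\<Sum>j<k. ennreal ((2 * real Mo) ^ Mo * (2 ^ j / 2 ^ k) ^ Mo) * ennreal (W j)) + ennreal (W k)"
    unfolding eN by (intro add_mono sum_mono mult_left_mono edI) auto
  also have "\<dots> = ennreal ((\<Sum>j<k. (2 * real Mo) ^ Mo * (2 ^ j / 2 ^ k) ^ Mo * W j) + W k)"
  proof -
    have "(\<Sum>j<k. ennreal ((2 * real Mo) ^ Mo * (2 ^ j / 2 ^ k) ^ Mo) * ennreal (W j)) = ennreal (\<Sum>j<k. (2 * real Mo) ^ Mo * (2 ^ j / 2 ^ k) ^ Mo * W j)"
      using W_pos by (subst sum_ennreal[symmetric]) (auto simp: ennreal_mult less_imp_le intro!: sum.cong)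
    then show ?thesis using W_pos
      by (subst ennreal_plus) (auto intro!: sum_nonneg simp: less_imp_le)
  qed
  finally have "moment h n \<le> (\<Sum>j<k. (2 * real Mo) ^ Mo * (2 ^ j / 2 ^ k) ^ Mo * W j) + W k"
    using W_pos by (subst (asm) ennreal_le_iff) (auto intro!: add_nonneg_nonneg sum_nonneg simp: less_imp_le)
  also have "(\<Sum>j<k. (2 * real Mo) ^ Mo * (2 ^ j / 2 ^ k) ^ Mo * W j) \<le> (\<Sum>j<k. (2 * real Mo) ^ Mo * ((1 / 2) ^ (k - j) * W k))"
    unfolding mult.assoc by (intro sum_mono mult_left_mono W_decay) auto
  also have "\<dots> = (2 * real Mo) ^ Mo * W k * (\<Sum>j<k. (1 / 2) ^ (k - j))"
    by (simp add: sum_distrib_left mult_ac)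
  also have "(\<Sum>j<k. (1 / 2 :: real) ^ (k - j)) = 1 - (1 / 2) ^ k"
  proof (induction k)
    case (Suc k)
    have "(\<Sum>j<Suc k. (1 / 2 :: real) ^ (Suc k - j)) = (\<Sum>j<k. 1 / 2 * (1 / 2) ^ (k - j)) + 1 / 2"
      by (simp add: Suc_diff_le)
    also have "\<dots> = 1 - (1 / 2) ^ Suc k"
      unfolding sum_distrib_left[symmetric] Suc by (simp add: field_simps)
    finally show ?case .
  qed simp
  finally have "moment h n \<le> (2 * real Mo) ^ Mo * W k * (1 - (1 / 2) ^ k) + W k" by simp
  also have "\<dots> \<le> (2 * real Mo) ^ Mo * W k * 1 + W k"
    using W_pos[of k] by (intro add_right_mono mult_left_mono) auto
  finally show ?thesis unfolding Bm_def by (simp add: algebra_simps)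
qed

end

section \<open>Bergman norms with regular weights\<close>

lemma term_le_suminf: "f k \<le> (\<Sum>k. f k)" for f :: "nat \<Rightarrow> ennreal"
  using sum_le_suminf[of f "{k}"] by simp

text \<open>The dyadic level of the distance to 1, where the kernel is singular. Once the level of
  \<open>1 - t\<close> exceeds it, moving \<open>t\<close> further towards 1 no longer enlarges the
  bound for the kernel at \<open>t * z\<close>.\<close>

definition lev :: "complex \<Rightarrow> nat" where "lev z = (LEAST K. 1 / 2 ^ K \<le> norm (1 - z))"

lemma lev_bounds:
  assumes "norm z < 1"
  shows "1 / 2 ^ lev z \<le> norm (1 - z)" "norm (1 - z) < 2 / 2 ^ lev z"
proof -
  have "1 - z \<noteq> 0" using assms by auto
  then have "0 < norm (1 - z)" by simp
  then obtain n where "(1 / 2) ^ n < norm (1 - z)" using real_arch_pow_inv[of "norm (1 - z)" "1 / 2"] by auto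
  then have "1 / 2 ^ n \<le> norm (1 - z)" by (simp add: power_one_over)
  then show 1: "1 / 2 ^ lev z \<le> norm (1 - z)" unfolding lev_def by (rule LeastI)
  show "norm (1 - z) < 2 / 2 ^ lev z"
  proof (cases "lev z")
    case 0
    have "norm (1 - z) \<le> norm (1::complex) + norm z" by (rule norm_triangle_ineq4)
    also have "\<dots> < 2" using assms by simp
    finally show ?thesis using 0 by simp
  next
    case (Suc j)
    then have "\<not> 1 / 2 ^ j \<le> norm (1 - z)"
      using not_less_Least[of j "\<lambda>K. 1 / 2 ^ K \<le> norm (1 - z)"] unfolding lev_def by auto
    then show ?thesis using Suc by simp
  qed
qed

definition near1 :: "nat \<Rightarrow> complex set" where "near1 K = {z. norm (1 - z) < 2 / 2 ^ K}"

lemma near1_sets [measurable]: "near1 K \<in> sets borel"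
proof -
  have "near1 K = ball 1 (2 / 2 ^ K)" by (auto simp: near1_def dist_norm)
  then show ?thesis by simp
qed

lemma circ_avg_le_1: "circ_avg (indicator A) r \<le> 1"
proof -
  have "circ_avg (indicator A) r \<le> (\<integral>\<^sup>+u\<in>{0..<1::real}. 1 \<partial>lborel)"
    unfolding circ_avg_def by (intro nn_integral_mono) (auto simp: indicator_def)
  then show ?thesis by simp
qed

text \<open>A Borel majorant of \<open>y (lev z)\<close>. Only the term with
  \<open>K = lev z\<close> is needed for that; the sum over all \<open>K\<close> is manifestly
  measurable and integrates term by term.\<close>

definition levmaj :: "(nat \<Rightarrow> ennreal) \<Rightarrow> complex \<Rightarrow> ennreal" where
  "levmaj y z = (\<Sum>K. y K * indicator (near1 K) z)"

lemma levmaj_measurable [measurable]: "levmaj y \<in> borel_measurable borel"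
  unfolding levmaj_def[abs_def] by measurable

lemma levmaj_ge: assumes "norm z < 1" shows "y (lev z) \<le> levmaj y z"
proof -
  have "y (lev z) = y (lev z) * indicator (near1 (lev z)) z"
    using lev_bounds[OF assms] by (simp add: near1_def)
  also have "\<dots> \<le> levmaj y z" unfolding levmaj_def by (rule term_le_suminf)
  finally show ?thesis .
qed

text \<open>The indicator of \<open>near1 K\<close> is dominated by a multiple of a Poisson kernel, whose circular means are
  \<open>1\<close>.\<close>

lemma circ_avg_near1:
  assumes "0 \<le> r" "r < 1"
  shows "circ_avg (indicator (near1 (Suc K))) r \<le> ennreal (9 / 2 ^ K) * indicator {dy K..<1} r"
proof (cases "dy K \<le> r")
  case False
  have "complex_of_real r * rot u \<notin> near1 (Suc K)" for u
  proof
    assume "complex_of_real r * rot u \<in> near1 (Suc K)"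
    then have "norm (1 - complex_of_real r * rot u) < 1 / 2 ^ K" by (simp add: near1_def)
    moreover have "1 - r \<le> norm (1 - complex_of_real r * rot u)"
      using norm_triangle_ineq2[of 1 "complex_of_real r * rot u"] assms by (simp add: norm_mult)
    ultimately show False using False by (simp add: dy_def)
  qed
  then show ?thesis unfolding circ_avg_def by simp
next
  case True
  define e :: real where "e = 1 / 2 ^ K"
  have e: "0 < e" "e \<le> 1" by (auto simp: e_def)
  have dK: "dy K = 1 - e" by (simp add: dy_def e_def)
  have le: "indicator (near1 (Suc K)) (complex_of_real r * rot u) \<le> ennreal (9 * e * pois 1 (complex_of_real (dy K)) u)" for u
  proof (cases "complex_of_real r * rot u \<in> near1 (Suc K)")
    case t: True
    have lt: "norm (1 - complex_of_real r * rot u) < e" using t by (simp add: near1_def e_def)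
    \<comment> \<open>The path runs through \<open>r * rot u\<close> and through 1. Each of its
      three legs has length at most \<open>e\<close>, which explains the constant 9 after
      squaring.\<close>
    have "norm (rot u - complex_of_real (dy K)) \<le> norm (rot u - complex_of_real r * rot u) + norm (complex_of_real r * rot u - 1) + norm (1 - complex_of_real (dy K))"
      using norm_triangle_ineq[of "rot u - complex_of_real r * rot u" "complex_of_real r * rot u - 1"]
        norm_triangle_ineq[of "rot u - 1" "1 - complex_of_real (dy K)"] by simp
    moreover have "norm (rot u - complex_of_real r * rot u) = 1 - r"
    proof -
      have "rot u - complex_of_real r * rot u = complex_of_real (1 - r) * rot u" by (simp add: algebra_simps)
      then show ?thesis using assms by (simp add: norm_mult del: of_real_diff)
    qed
    moreover have "norm (1 - complex_of_real (dy K)) = e" unfolding dK using e by (simp add: norm_of_real)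
    ultimately have u3: "norm (rot u - complex_of_real (dy K)) \<le> 3 * e"
      using lt True dK by (simp add: norm_minus_commute)
    define N where "N = norm (rot u - complex_of_real (dy K))"
    have "1 - dy K \<le> N" using pois_denominator[of "complex_of_real (dy K)" 1 u] unfolding N_def by simp
    then have N0: "0 < N" using dy_less_1[of K] by linarith
    have "N\<^sup>2 \<le> (3 * e)\<^sup>2" using u3 N0 unfolding N_def by (intro power_mono) auto
    then have N9: "N\<^sup>2 \<le> 9 * e\<^sup>2" by (simp add: power_mult_distrib)
    have dsq: "e \<le> 1 - (dy K)\<^sup>2" unfolding dK using e by (simp add: power2_eq_square algebra_simps)
    have "1 \<le> 9 * e * (e / N\<^sup>2)" using N9 N0 by (simp add: power2_eq_square)
    also have "\<dots> \<le> 9 * e * ((1 - (dy K)\<^sup>2) / N\<^sup>2)" using dsq e by (intro mult_left_mono divide_right_mono) auto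
    also have "\<dots> = 9 * e * pois 1 (complex_of_real (dy K)) u" unfolding pois_def N_def by simp
    finally show ?thesis by (simp add: indicator_def)
  qed simp
  have "circ_avg (indicator (near1 (Suc K))) r \<le> (\<integral>\<^sup>+u. ennreal (9 * e) * (ennreal (pois 1 (complex_of_real (dy K)) u) * indicator {0..<1} u) \<partial>lborel)"
    unfolding circ_avg_def mult.assoc[symmetric] using le e
    by (intro nn_integral_mono mult_right_mono) (auto simp: ennreal_mult')
  also have "\<dots> = ennreal (9 * e) * (\<integral>\<^sup>+u\<in>{0..<1}. ennreal (pois 1 (complex_of_real (dy K)) u) \<partial>lborel)"
    by (rule nn_integral_cmult) measurable
  also have "\<dots> = ennreal (9 / 2 ^ K)"
    by (subst nn_integral_pois) (auto simp: e_def)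
  finally show ?thesis using True assms by simp
qed

text \<open>The condition of \<open>D_check\<close> enters in dyadic form, as a drop of the tails by
  the factor \<open>c\<close> within \<open>L\<close> levels. In this locale the weight on the disc
  is accessible only through its polar formula.\<close>

locale reg_weight = doubling +
  fixes \<nu> :: "complex \<Rightarrow> real" and L :: nat and c :: real
  assumes polar: "\<And>g. g \<in> borel_measurable borel \<Longrightarrow>
      (\<integral>\<^sup>+z\<in>ball 0 1. g z * ennreal (\<nu> z) \<partial>lebesgue) = (\<integral>\<^sup>+r\<in>{0..<1}. ennreal (2 * pi * r * h r) * circ_avg g r \<partial>lborel)"
    and c_gt_1: "1 < c" and W_check: "c * W (k + L) \<le> W k"
begin

text \<open>Up to a constant this bounds the \<nu>-mass of a disc about 1 whose radius is comparable
  to \<open>1 / 2 ^ k\<close>. It is the weight of all sequence norms below.\<close>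

definition m :: "nat \<Rightarrow> real" where "m k = W k / 2 ^ k"

text \<open>The \<open>p\<close>-th power of the Bergman norm before the division by
  \<open>pi\<close>, so that the estimates are free of roots.\<close>

definition bint :: "real \<Rightarrow> (complex \<Rightarrow> complex) \<Rightarrow> ennreal" where
  "bint p f = (\<integral>\<^sup>+z\<in>ball 0 1. fp p f z * ennreal (\<nu> z) \<partial>lebesgue)"

lemma m_pos: "0 < m k" unfolding m_def using W_pos by simp

lemma m_Suc: "m (Suc k) \<le> m k / 2"
  using W_antimono[of k "Suc k"] by (simp add: m_def field_simps)

lemma m_double: "m k \<le> 2 * C * m (Suc k)"
  using W_double[of k] by (simp add: m_def field_simps)

lemma bint_polar: "f holomorphic_on ball 0 1 \<Longrightarrow> bint p f = (\<integral>\<^sup>+r\<in>{0..<1}. ennreal (2 * pi * r * h r) * pmean p f r \<partial>lborel)"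
  unfolding bint_def by (rule polar) (rule fp_measurable)

lemma W_annulus: "(1 - 1 / c) * W k \<le> W k - W (k + L)"
  using W_check[of k] c_gt_1 by (simp add: field_simps)

text \<open>This is where the drop of the tails is spent: an increasing function can be recovered at
  \<open>dy k\<close> from its integral over the next \<open>L\<close> levels, even if the profile
  vanishes on some of them.\<close>

lemma nn_integral_annulus: "ennreal ((1 - 1 / c) * W k) \<le> (\<integral>\<^sup>+s\<in>{dy k..<dy (k + L)}. ennreal (h s) \<partial>lborel)"
proof -
  have kl: "dy k \<le> dy (k + L)" by (rule dy_mono) simp
  have "ennreal (W k) = (\<integral>\<^sup>+s. ennreal (h s) * indicator {dy k..<dy (k + L)} s + ennreal (h s) * indicator {dy (k + L)..<1} s \<partial>lborel)"
    unfolding W_ennreal[symmetric] by (intro nn_integral_cong) (use kl dy_less_1[of "k + L"] in \<open>auto simp: indicator_def simp del: dy_less_1\<close>)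
  also have "\<dots> = (\<integral>\<^sup>+s\<in>{dy k..<dy (k + L)}. ennreal (h s) \<partial>lborel) + ennreal (W (k + L))"
    unfolding W_ennreal[symmetric] by (rule nn_integral_add) measurable
  finally have eq: "ennreal (W k) = (\<integral>\<^sup>+s\<in>{dy k..<dy (k + L)}. ennreal (h s) \<partial>lborel) + ennreal (W (k + L))" .
  have "ennreal ((1 - 1 / c) * W k) \<le> ennreal (W k - W (k + L))" by (intro ennreal_leI W_annulus)
  also have "\<dots> = ennreal (W k) - ennreal (W (k + L))" using W_pos[of "k + L"] by (simp add: ennreal_minus)
  also have "\<dots> = (\<integral>\<^sup>+s\<in>{dy k..<dy (k + L)}. ennreal (h s) \<partial>lborel)" unfolding eq by simp
  finally show ?thesis .
qed

text \<open>Each dyadic interval belongs to at most \<open>L\<close> of the overlapping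
  annuli.\<close>

lemma sum_annuli:
  assumes [measurable]: "G \<in> borel_measurable borel"
  shows "(\<Sum>k. \<integral>\<^sup>+s\<in>{dy (k + n)..<dy (k + n + L)}. G s \<partial>lborel) \<le> of_nat L * (\<integral>\<^sup>+s\<in>{0..<1}. G s \<partial>lborel)"
proof -
  have split: "(\<integral>\<^sup>+s\<in>{dy k..<dy (k + l)}. G s \<partial>lborel) = (\<Sum>j<l. \<integral>\<^sup>+s\<in>dI (k + j). G s \<partial>lborel)" for k l
  proof (induction l)
    case (Suc l)
    have "(\<integral>\<^sup>+s\<in>{dy k..<dy (k + Suc l)}. G s \<partial>lborel) = (\<integral>\<^sup>+s. G s * indicator {dy k..<dy (k + l)} s + G s * indicator (dI (k + l)) s \<partial>lborel)"
      using dy_mono[of k "k + l"] dy_less[of "k + l"] by (intro nn_integral_cong) (auto simp: indicator_def dI_def)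
    also have "\<dots> = (\<integral>\<^sup>+s\<in>{dy k..<dy (k + l)}. G s \<partial>lborel) + (\<integral>\<^sup>+s\<in>dI (k + l). G s \<partial>lborel)"
      by (rule nn_integral_add) measurable
    finally show ?case by (simp add: Suc)
  qed simp
  have "(\<Sum>k. \<integral>\<^sup>+s\<in>{dy (k + n)..<dy (k + n + L)}. G s \<partial>lborel) = (\<Sum>j<L. \<Sum>k. \<integral>\<^sup>+s\<in>dI (k + n + j). G s \<partial>lborel)"
    unfolding split by (rule suminf_sum) simp
  also have "\<dots> = (\<Sum>j<L. \<integral>\<^sup>+s\<in>{dy (n + j)..<1}. G s \<partial>lborel)"
    by (subst nn_integral_dI_tail) (auto simp: add.assoc)
  also have "\<dots> \<le> (\<Sum>j<L. \<integral>\<^sup>+s\<in>{0..<1}. G s \<partial>lborel)"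
  proof (intro sum_mono nn_integral_mono)
    fix j s
    show "G s * indicator {dy (n + j)..<1} s \<le> G s * indicator {0..<1} s"
      using dy_nonneg[of "n + j"] by (auto simp: indicator_def simp del: dy_nonneg)
  qed
  finally show ?thesis by simp
qed

definition Bs :: real where "Bs = C ^ 2 * (real L / (pi * (1 - 1 / c)))"

lemma Bs_nonneg: "0 \<le> Bs" unfolding Bs_def using C_ge_1 c_gt_1 by simp

text \<open>The means increase with the radius, so the mean at a dyadic radius is at most the means
  over the following \<open>L\<close> levels, which carry a fixed part of the tail. Radii from level
  2 on are at least \<open>1 / 2\<close>, which absorbs the factor \<open>r\<close> of the area
  element; the factor \<open>C ^ 2\<close> in \<open>Bs\<close> pays for passing from
  \<open>W (k + 2)\<close> to \<open>W k\<close>.\<close>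

lemma sum_pmean:
  assumes f: "f holomorphic_on ball 0 1" "0 < p"
  shows "(\<Sum>k. ennreal (W k) * pmean p f (dy (k + 2))) \<le> ennreal Bs * bint p f"
proof -
  note [measurable] = fp_measurable[OF f(1)]
  define d where "d = 1 - 1 / c"
  have d: "0 < d" using c_gt_1 by (simp add: d_def)
  have one: "ennreal (pi * d * W k) * pmean p f (dy k) \<le> (\<integral>\<^sup>+r\<in>{dy k..<dy (k + L)}. ennreal (2 * pi * r * h r) * pmean p f r \<partial>lborel)" if "0 < k" for k
  proof -
    have "ennreal (pi * d * W k) * pmean p f (dy k) = ennreal pi * pmean p f (dy k) * ennreal (d * W k)"
    proof -
      have "ennreal (pi * d * W k) = ennreal pi * ennreal (d * W k)" unfolding mult.assoc by (rule ennreal_mult') simp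
      then show ?thesis by (metis mult.assoc mult.commute)
    qed
    also have "\<dots> \<le> ennreal pi * pmean p f (dy k) * (\<integral>\<^sup>+s\<in>{dy k..<dy (k + L)}. ennreal (h s) \<partial>lborel)"
      unfolding d_def by (intro mult_left_mono nn_integral_annulus) auto
    also have "\<dots> = (\<integral>\<^sup>+s. ennreal pi * pmean p f (dy k) * (ennreal (h s) * indicator {dy k..<dy (k + L)} s) \<partial>lborel)"
      by (rule nn_integral_cmult[symmetric]) measurable
    also have "\<dots> \<le> (\<integral>\<^sup>+r\<in>{dy k..<dy (k + L)}. ennreal (2 * pi * r * h r) * pmean p f r \<partial>lborel)"
    proof (rule nn_integral_mono)
      fix s
      show "ennreal pi * pmean p f (dy k) * (ennreal (h s) * indicator {dy k..<dy (k + L)} s) \<le> ennreal (2 * pi * s * h s) * pmean p f s * indicator {dy k..<dy (k + L)} s"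
      proof (cases "s \<in> {dy k..<dy (k + L)}")
        case True
        then have s: "dy k \<le> s" "s < 1" using dy_less_1[of "k + L"] by (auto simp del: dy_less_1)
        have s2: "1 / 2 \<le> s" using dy_ge_half[OF that] s by linarith
        have "pmean p f (dy k) \<le> pmean p f s" by (rule pmean_mono[OF f]) (use s in auto)
        moreover have "ennreal pi * ennreal (h s) \<le> ennreal (2 * pi * s * h s)"
          using s2 h_nonneg[of s] by (simp add: ennreal_mult'[symmetric] mult_right_mono)
        ultimately have "(ennreal pi * ennreal (h s)) * pmean p f (dy k) \<le> ennreal (2 * pi * s * h s) * pmean p f s"
          by (intro mult_mono) auto
        then show ?thesis using True by (simp add: mult_ac)
      qed simp
    qed
    finally show ?thesis .
  qed
  have "ennreal (pi * d / C ^ 2) * (\<Sum>k. ennreal (W k) * pmean p f (dy (k + 2))) = (\<Sum>k. ennreal (pi * d / C ^ 2 * W k) * pmean p f (dy (k + 2)))"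
  proof -
    have "ennreal (pi * d / C ^ 2 * x) * P = ennreal (pi * d / C ^ 2) * (ennreal x * P)" for x P
      by (subst ennreal_mult') (use d in \<open>auto simp: mult.assoc\<close>)
    then show ?thesis by simp
  qed
  also have "\<dots> \<le> (\<Sum>k. ennreal (pi * d * W (k + 2)) * pmean p f (dy (k + 2)))"
  proof (intro suminf_le mult_right_mono ennreal_leI)
    fix k
    have "W k / C ^ 2 \<le> W (k + 2)" using W_double_iterate[of k 2] C_ge_1 by (simp add: field_simps)
    then have "pi * d * (W k / C ^ 2) \<le> pi * d * W (k + 2)" using d by (intro mult_left_mono) auto
    then show "pi * d / C ^ 2 * W k \<le> pi * d * W (k + 2)" by simp
  qed auto
  also have "\<dots> \<le> (\<Sum>k. \<integral>\<^sup>+r\<in>{dy (k + 2)..<dy (k + 2 + L)}. ennreal (2 * pi * r * h r) * pmean p f r \<partial>lborel)"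
    by (intro suminf_le one) auto
  also have "\<dots> \<le> of_nat L * bint p f"
    unfolding bint_polar[OF f(1)] by (rule sum_annuli) measurable
  finally have *: "ennreal (pi * d / C ^ 2) * (\<Sum>k. ennreal (W k) * pmean p f (dy (k + 2))) \<le> of_nat L * bint p f" .
  have e1: "ennreal (C ^ 2 / (pi * d)) * ennreal (pi * d / C ^ 2) = 1"
    using d C_ge_1 by (subst ennreal_mult'[symmetric]) auto
  have e2: "ennreal (C ^ 2 / (pi * d)) * of_nat L = ennreal Bs"
    unfolding ennreal_of_nat_eq_real_of_nat
    using d C_ge_1 by (subst ennreal_mult'[symmetric]) (auto simp: Bs_def d_def)
  have "(\<Sum>k. ennreal (W k) * pmean p f (dy (k + 2))) = ennreal (C ^ 2 / (pi * d)) * (ennreal (pi * d / C ^ 2) * (\<Sum>k. ennreal (W k) * pmean p f (dy (k + 2))))"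
    unfolding mult.assoc[symmetric] e1 by simp
  also have "\<dots> \<le> ennreal (C ^ 2 / (pi * d)) * (of_nat L * bint p f)"
    by (intro mult_left_mono *) auto
  also have "\<dots> = ennreal Bs * bint p f" unfolding mult.assoc[symmetric] e2 ..
  finally show ?thesis .
qed

text \<open>The factor is \<open>2 / (1 / 2 ^ (k + 2))\<close>: the bound \<open>pois_upper\<close>
  with the gap between the radii \<open>dy (Suc k)\<close> and \<open>dy (k + 2)\<close>.\<close>

definition Amax :: "real \<Rightarrow> (complex \<Rightarrow> complex) \<Rightarrow> nat \<Rightarrow> ennreal" where
  "Amax p f k = ennreal (8 * 2 ^ k) * pmean p f (dy (k + 2))"

lemma fp_le_Amax:
  assumes f: "f holomorphic_on ball 0 1" "0 < p" and w: "norm w \<le> dy (Suc k)"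
  shows "fp p f w \<le> Amax p f k"
proof -
  have d: "1 / 2 ^ (k + 2) \<le> dy (k + 2) - norm w" using w dy_Suc_diff[of "Suc k"] by simp
  then have d0: "norm w < dy (k + 2)" by (smt (verit) divide_pos_pos zero_less_power)
  have "fp p f w \<le> ennreal (2 / (dy (k + 2) - norm w)) * pmean p f (dy (k + 2))"
    by (rule fp_le_pmean[OF f(1) _ d0 f(2)]) simp
  also have "\<dots> \<le> Amax p f k"
    unfolding Amax_def
  proof (intro mult_right_mono ennreal_leI)
    have "2 / (dy (k + 2) - norm w) \<le> 2 / (1 / 2 ^ (k + 2))" using d d0 by (intro divide_left_mono) auto
    then show "2 / (dy (k + 2) - norm w) \<le> 8 * 2 ^ k" by simp
  qed auto
  finally show ?thesis .
qed

text \<open>The factor \<open>2 ^ k\<close> of the pointwise majorant cancels against the one in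
  \<open>m k\<close>, so nothing is lost in comparison with the means.\<close>

lemma sum_Amax:
  assumes f: "f holomorphic_on ball 0 1" "0 < p"
  shows "(\<Sum>k. Amax p f k * ennreal (m k)) \<le> ennreal (8 * Bs) * bint p f"
proof -
  have "Amax p f k * ennreal (m k) = ennreal 8 * (ennreal (W k) * pmean p f (dy (k + 2)))" for k
  proof -
    have "Amax p f k * ennreal (m k) = (ennreal (8 * 2 ^ k) * ennreal (m k)) * pmean p f (dy (k + 2))"
      by (simp add: Amax_def mult_ac)
    also have "ennreal (8 * 2 ^ k) * ennreal (m k) = ennreal (8 * W k)"
      by (subst ennreal_mult'[symmetric]) (auto simp: m_def)
    also have "\<dots> = ennreal 8 * ennreal (W k)" by (rule ennreal_mult') simp
    finally show ?thesis by (simp add: mult.assoc)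
  qed
  then have "(\<Sum>k. Amax p f k * ennreal (m k)) = ennreal 8 * (\<Sum>k. ennreal (W k) * pmean p f (dy (k + 2)))"
    by (simp add: ennreal_suminf_cmult)
  also have "\<dots> \<le> ennreal 8 * (ennreal Bs * bint p f)" by (intro mult_left_mono sum_pmean[OF f]) auto
  finally show ?thesis using Bs_nonneg by (simp add: ennreal_mult mult.assoc)
qed

text \<open>A majorant of the maximal function of \<open>fp p f\<close> over the segment from 0 to
  \<open>z\<close>. The sum over the levels below \<open>norm z\<close> replaces a supremum: it
  integrates term by term, and the loss is harmless since \<open>sum_pmean\<close> bounds the sum of
  all the terms anyway.\<close>

definition Smax :: "real \<Rightarrow> (complex \<Rightarrow> complex) \<Rightarrow> complex \<Rightarrow> ennreal" where
  "Smax p f z = (\<Sum>k. hmax p f k z * indicator {dy k..<1} (norm z))"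

lemma Smax_measurable: "f holomorphic_on ball 0 1 \<Longrightarrow> Smax p f \<in> borel_measurable borel"
proof -
  assume [measurable]: "f holomorphic_on ball 0 1"
  note [measurable] = hmax_measurable[OF this]
  show ?thesis unfolding Smax_def[abs_def] by measurable
qed

lemma fp_le_Smax:
  assumes f: "f holomorphic_on ball 0 1" "0 < p" and z: "norm z < 1" and t: "0 \<le> t" "t \<le> 1"
  shows "fp p f (complex_of_real t * z) \<le> Smax p f z"
proof -
  define s where "s = t * norm z"
  have s: "0 \<le> s" "s \<le> norm z" "s < 1" using t z by (auto simp: s_def mult_left_le_one_le intro: le_less_trans[OF mult_left_le_one_le])
  obtain k where k: "s \<in> dI k" using dI_level s by blast
  have zs: "complex_of_real t * z = complex_of_real s * sgn z"
    by (cases "z = 0") (auto simp: s_def sgn_div_norm scaleR_conv_of_real)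
  have kz: "norm z \<in> {dy k..<1}" using k s z by (auto simp: dI_def)
  have "z \<noteq> 0 \<or> s = 0" by (auto simp: s_def)
  then have "fp p f (complex_of_real t * z) \<le> hmax p f k z"
    unfolding zs using k by (intro fp_le_hmax f) (auto simp: dI_def)
  also have "\<dots> = hmax p f k z * indicator {dy k..<1} (norm z)" using kz by simp
  also have "\<dots> \<le> Smax p f z"
    unfolding Smax_def by (rule term_le_suminf)
  finally show ?thesis .
qed

text \<open>Layer \<open>k\<close> lives on \<open>norm z \<ge> dy k\<close>, so its integral is at
  most \<open>18 * pi * W k\<close> times the mean at \<open>dy (k + 2)\<close>: the factor 9 comes
  from \<open>hmax\<close>, and \<open>2 * pi\<close> from the polar formula.\<close>

lemma nn_integral_Smax:
  assumes f: "f holomorphic_on ball 0 1" "0 < p"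
  shows "(\<integral>\<^sup>+z\<in>ball 0 1. Smax p f z * ennreal (\<nu> z) \<partial>lebesgue) \<le> ennreal (18 * pi * Bs) * bint p f"
proof -
  note [measurable] = fp_measurable[OF f(1)] hmax_measurable[OF f(1)]
  have cS: "ennreal (2 * pi * r * h r) * circ_avg (Smax p f) r * indicator {0..<1} r
      \<le> (\<Sum>k. ennreal (18 * pi) * pmean p f (dy (k + 2)) * (ennreal (h r) * indicator {dy k..<1} r))" for r
  proof (cases "r \<in> {0<..<1}")
    case True
    have "circ_avg (Smax p f) r = (\<integral>\<^sup>+u. (\<Sum>k. indicator {dy k..<1} r * (hmax p f k (complex_of_real r * rot u) * indicator {0..<1} u)) \<partial>lborel)"
      unfolding circ_avg_def Smax_def using True
      by (intro nn_integral_cong) (simp add: norm_mult ennreal_suminf_multc[symmetric] mult_ac)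
    also have "\<dots> = (\<Sum>k. \<integral>\<^sup>+u. indicator {dy k..<1} r * (hmax p f k (complex_of_real r * rot u) * indicator {0..<1} u) \<partial>lborel)"
      by (rule nn_integral_suminf) measurable
    also have "\<dots> = (\<Sum>k. indicator {dy k..<1} r * circ_avg (hmax p f k) r)"
      unfolding circ_avg_def by (intro suminf_cong nn_integral_cmult) measurable
    also have "\<dots> = (\<Sum>k. indicator {dy k..<1} r * (9 * pmean p f (dy (k + 2))))"
      using True f(1) by (simp add: circ_avg_hmax)
    finally have "ennreal (2 * pi * r * h r) * circ_avg (Smax p f) r = (\<Sum>k. ennreal (2 * pi * r * h r) * (indicator {dy k..<1} r * (9 * pmean p f (dy (k + 2)))))"
      by (simp add: ennreal_suminf_cmult)
    also have "\<dots> \<le> (\<Sum>k. ennreal (18 * pi) * pmean p f (dy (k + 2)) * (ennreal (h r) * indicator {dy k..<1} r))"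
    proof (intro suminf_le)
      fix k
      have "ennreal (2 * pi * r * h r) * ennreal 9 \<le> ennreal (18 * pi) * ennreal (h r)"
        using True h_nonneg[of r] by (simp add: ennreal_mult'[symmetric] ennreal_mult''[symmetric] mult_left_le_one_le del: ennreal_numeral)
      then have "(ennreal (2 * pi * r * h r) * ennreal 9) * (indicator {dy k..<1} r * pmean p f (dy (k + 2))) \<le> (ennreal (18 * pi) * ennreal (h r)) * (indicator {dy k..<1} r * pmean p f (dy (k + 2)))"
        by (rule mult_right_mono) simp
      then show "ennreal (2 * pi * r * h r) * (indicator {dy k..<1} r * (9 * pmean p f (dy (k + 2)))) \<le> ennreal (18 * pi) * pmean p f (dy (k + 2)) * (ennreal (h r) * indicator {dy k..<1} r)"
        by (simp add: mult_ac)
    qed auto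
    finally show ?thesis using True by simp
  next
    case False
    then have "r = 0 \<or> r \<notin> {0..<1}" by auto
    then show ?thesis by auto
  qed
  have "(\<integral>\<^sup>+z\<in>ball 0 1. Smax p f z * ennreal (\<nu> z) \<partial>lebesgue) = (\<integral>\<^sup>+r\<in>{0..<1}. ennreal (2 * pi * r * h r) * circ_avg (Smax p f) r \<partial>lborel)"
    by (rule polar[OF Smax_measurable[OF f(1)]])
  also have "\<dots> \<le> (\<integral>\<^sup>+r. (\<Sum>k. ennreal (18 * pi) * pmean p f (dy (k + 2)) * (ennreal (h r) * indicator {dy k..<1} r)) \<partial>lborel)"
    by (intro nn_integral_mono cS)
  also have "\<dots> = (\<Sum>k. \<integral>\<^sup>+r. ennreal (18 * pi) * pmean p f (dy (k + 2)) * (ennreal (h r) * indicator {dy k..<1} r) \<partial>lborel)"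
    by (rule nn_integral_suminf) measurable
  also have "\<dots> = (\<Sum>k. ennreal (18 * pi) * (ennreal (W k) * pmean p f (dy (k + 2))))"
    unfolding W_ennreal[symmetric] by (subst nn_integral_cmult) (auto simp: mult_ac)
  also have "\<dots> = ennreal (18 * pi) * (\<Sum>k. ennreal (W k) * pmean p f (dy (k + 2)))" by (simp add: ennreal_suminf_cmult)
  also have "\<dots> \<le> ennreal (18 * pi) * (ennreal Bs * bint p f)" by (intro mult_left_mono sum_pmean[OF f]) auto
  finally show ?thesis using Bs_nonneg by (simp add: ennreal_mult mult.assoc)
qed

text \<open>For \<open>K = Suc j\<close> the disc meets only circles beyond \<open>dy j\<close>,
  each in a proportion of at most \<open>9 / 2 ^ j\<close>; returning from level \<open>j\<close> to
  level \<open>K\<close> costs \<open>2 * C\<close>. For \<open>K = 0\<close> the trivial bound 1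
  for the proportion is enough.\<close>

lemma near1_mass:
  "(\<integral>\<^sup>+z\<in>ball 0 1. indicator (near1 K) z * ennreal (\<nu> z) \<partial>lebesgue) \<le> ennreal (36 * pi * C * m K)"
proof -
  have *: "(\<integral>\<^sup>+z\<in>ball 0 1. indicator (near1 K) z * ennreal (\<nu> z) \<partial>lebesgue) = (\<integral>\<^sup>+r\<in>{0..<1}. ennreal (2 * pi * r * h r) * circ_avg (indicator (near1 K)) r \<partial>lborel)"
    by (rule polar) measurable
  have **: "(\<integral>\<^sup>+r\<in>{0..<1}. ennreal (2 * pi * r * h r) * circ_avg (indicator (near1 K)) r \<partial>lborel) \<le> ennreal (2 * pi * b) * ennreal (W j)"
    if b: "0 \<le> b" "\<And>r. 0 \<le> r \<Longrightarrow> r < 1 \<Longrightarrow> circ_avg (indicator (near1 K)) r \<le> ennreal b * indicator {dy j..<1} r" for b j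
  proof -
    have "(\<integral>\<^sup>+r\<in>{0..<1}. ennreal (2 * pi * r * h r) * circ_avg (indicator (near1 K)) r \<partial>lborel) \<le> (\<integral>\<^sup>+r. ennreal (2 * pi * b) * (ennreal (h r) * indicator {dy j..<1} r) \<partial>lborel)"
    proof (rule nn_integral_mono)
      fix r
      show "ennreal (2 * pi * r * h r) * circ_avg (indicator (near1 K)) r * indicator {0..<1} r \<le> ennreal (2 * pi * b) * (ennreal (h r) * indicator {dy j..<1} r)"
      proof (cases "r \<in> {0..<1}")
        case True
        have "r * (2 * pi * h r) \<le> 1 * (2 * pi * h r)" using True h_nonneg[of r] by (intro mult_right_mono) auto
        then have "ennreal (2 * pi * r * h r) \<le> ennreal (2 * pi * h r)" by (intro ennreal_leI) (simp add: mult_ac)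
        then have "ennreal (2 * pi * r * h r) * circ_avg (indicator (near1 K)) r \<le> ennreal (2 * pi * h r) * (ennreal b * indicator {dy j..<1} r)"
          using True by (intro mult_mono b(2)) auto
        also have "\<dots> = ennreal (2 * pi * b) * (ennreal (h r) * indicator {dy j..<1} r)"
          using b(1) h_nonneg[of r] by (simp add: ennreal_mult mult_ac)
        finally show ?thesis using True by simp
      qed simp
    qed
    also have "\<dots> = ennreal (2 * pi * b) * ennreal (W j)"
      unfolding W_ennreal[symmetric] by (rule nn_integral_cmult) measurable
    finally show ?thesis .
  qed
  show ?thesis
  proof (cases K)
    case 0
    have "circ_avg (indicator (near1 K)) r \<le> ennreal 1 * indicator {dy 0..<1} r" if "0 \<le> r" "r < 1" for r
      using circ_avg_le_1[of "near1 K" r] that by simp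
    then have "(\<integral>\<^sup>+z\<in>ball 0 1. indicator (near1 K) z * ennreal (\<nu> z) \<partial>lebesgue) \<le> ennreal (2 * pi * 1) * ennreal (W 0)"
      unfolding * by (intro **) auto
    also have "\<dots> \<le> ennreal (36 * pi * C * m K)"
    proof -
      have "2 * pi * 1 * W 0 \<le> 36 * pi * C * W 0" using C_ge_1 W_pos[of 0] by (intro mult_right_mono) auto
      then have "ennreal (2 * pi * 1 * W 0) \<le> ennreal (36 * pi * C * m K)" using 0 by (intro ennreal_leI) (simp add: m_def)
      then show ?thesis by (subst ennreal_mult'[symmetric]) auto
    qed
    finally show ?thesis .
  next
    case (Suc j)
    have "(\<integral>\<^sup>+z\<in>ball 0 1. indicator (near1 K) z * ennreal (\<nu> z) \<partial>lebesgue) \<le> ennreal (2 * pi * (9 / 2 ^ j)) * ennreal (W j)"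
      unfolding * using circ_avg_near1 Suc by (intro **) auto
    also have "\<dots> \<le> ennreal (36 * pi * C * m K)"
    proof -
      have "2 * pi * (9 / 2 ^ j) * W j = 18 * pi * m j" by (simp add: m_def)
      also have "\<dots> \<le> 18 * pi * (2 * C * m (Suc j))" by (intro mult_left_mono m_double) auto
      finally have "ennreal (2 * pi * (9 / 2 ^ j) * W j) \<le> ennreal (36 * pi * C * m K)" using Suc by (intro ennreal_leI) (simp add: mult_ac)
      then show ?thesis by (subst ennreal_mult'[symmetric]) auto
    qed
    finally show ?thesis .
  qed
qed

text \<open>Term by term only the masses of the discs about 1 enter. This reduces the planar
  estimate of a function of \<open>lev z\<close> to a sequence inequality with weight
  \<open>m\<close>.\<close>

lemma nn_integral_levmaj:
  "(\<integral>\<^sup>+z\<in>ball 0 1. levmaj y z * ennreal (\<nu> z) \<partial>lebesgue) \<le> ennreal (36 * pi * C) * (\<Sum>K. y K * ennreal (m K))"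
proof -
  define g where "g = levmaj y"
  have [measurable]: "g \<in> borel_measurable borel" unfolding g_def by measurable
  have "(\<integral>\<^sup>+z\<in>ball 0 1. g z * ennreal (\<nu> z) \<partial>lebesgue) = (\<integral>\<^sup>+r\<in>{0..<1}. ennreal (2 * pi * r * h r) * circ_avg g r \<partial>lborel)"
    by (rule polar) measurable
  also have "\<dots> = (\<integral>\<^sup>+r. (\<Sum>K. y K * (ennreal (2 * pi * r * h r) * circ_avg (indicator (near1 K)) r * indicator {0..<1} r)) \<partial>lborel)"
  proof (rule nn_integral_cong)
    fix r
    have "circ_avg g r = (\<integral>\<^sup>+u. (\<Sum>K. y K * (indicator (near1 K) (complex_of_real r * rot u) * indicator {0..<1} u)) \<partial>lborel)"
      unfolding circ_avg_def g_def levmaj_def by (intro nn_integral_cong) (simp add: ennreal_suminf_multc[symmetric] mult.assoc)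
    also have "\<dots> = (\<Sum>K. \<integral>\<^sup>+u. y K * (indicator (near1 K) (complex_of_real r * rot u) * indicator {0..<1} u) \<partial>lborel)"
      by (rule nn_integral_suminf) measurable
    also have "\<dots> = (\<Sum>K. y K * circ_avg (indicator (near1 K)) r)"
      unfolding circ_avg_def by (intro suminf_cong nn_integral_cmult) measurable
    finally have "ennreal (2 * pi * r * h r) * circ_avg g r * indicator {0..<1} r = ennreal (2 * pi * r * h r) * indicator {0..<1} r * (\<Sum>K. y K * circ_avg (indicator (near1 K)) r)"
      by (simp add: mult_ac)
    also have "\<dots> = (\<Sum>K. ennreal (2 * pi * r * h r) * indicator {0..<1} r * (y K * circ_avg (indicator (near1 K)) r))"
      by (rule ennreal_suminf_cmult[symmetric])
    finally show "ennreal (2 * pi * r * h r) * circ_avg g r * indicator {0..<1} r = (\<Sum>K. y K * (ennreal (2 * pi * r * h r) * circ_avg (indicator (near1 K)) r * indicator {0..<1} r))"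
      by (simp add: mult_ac)
  qed
  also have "\<dots> = (\<Sum>K. \<integral>\<^sup>+r. y K * (ennreal (2 * pi * r * h r) * circ_avg (indicator (near1 K)) r * indicator {0..<1} r) \<partial>lborel)"
    by (rule nn_integral_suminf) measurable
  also have "\<dots> = (\<Sum>K. y K * (\<integral>\<^sup>+r\<in>{0..<1}. ennreal (2 * pi * r * h r) * circ_avg (indicator (near1 K)) r \<partial>lborel))"
    by (intro suminf_cong nn_integral_cmult) measurable
  also have "\<dots> = (\<Sum>K. y K * (\<integral>\<^sup>+z\<in>ball 0 1. indicator (near1 K) z * ennreal (\<nu> z) \<partial>lebesgue))"
    by (subst polar) (auto intro: borel_measurable_indicator near1_sets)
  also have "\<dots> \<le> (\<Sum>K. y K * ennreal (36 * pi * C * m K))"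
    by (intro suminf_le mult_left_mono near1_mass) auto
  also have "\<dots> = (\<Sum>K. ennreal (36 * pi * C) * (y K * ennreal (m K)))"
    using C_ge_1 m_pos by (intro suminf_cong) (simp add: ennreal_mult less_imp_le mult_ac)
  also have "\<dots> = ennreal (36 * pi * C) * (\<Sum>K. y K * ennreal (m K))" by (simp add: ennreal_suminf_cmult)
  finally show ?thesis unfolding g_def .
qed

end

section \<open>Kernel estimates\<close>

definition fd :: "(nat \<Rightarrow> real) \<Rightarrow> nat \<Rightarrow> real" where "fd f n = f (Suc n) - f n"

lemma fd_funpow_Suc: "(fd ^^ Suc N) f n = (fd ^^ N) f (Suc n) - (fd ^^ N) f n"
  by (simp only: funpow.simps comp_def fd_def)

lemma fd_funpow_add: "(fd ^^ N) (\<lambda>n. f n + g n) n = (fd ^^ N) f n + (fd ^^ N) g n"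
proof (induction N arbitrary: n)
  case (Suc N)
  show ?case unfolding fd_funpow_Suc Suc by simp
qed simp

lemma fd_funpow_Suc_right: "(fd ^^ Suc N) f n = (fd ^^ N) (fd f) n"
  by (simp only: funpow_Suc_right comp_def)

lemma fd_funpow_shift: "(fd ^^ N) (\<lambda>n. f (Suc n)) n = (fd ^^ N) f (Suc n)"
proof (induction N arbitrary: n)
  case (Suc N)
  show ?case unfolding fd_funpow_Suc Suc ..
qed simp

lemma fd_leibniz:
  "(fd ^^ N) (\<lambda>n. f n * g n) n = (\<Sum>j\<le>N. real (N choose j) * ((fd ^^ j) f n * (fd ^^ (N - j)) g (n + j)))"
proof (induction N arbitrary: f g)
  case (Suc N)
  define x where "x j = (fd ^^ j) f n * (fd ^^ (Suc N - j)) g (n + j)" for j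
  have "fd (\<lambda>n. f n * g n) = (\<lambda>n. f n * fd g n + fd f n * g (Suc n))"
    by (simp add: fd_def fun_eq_iff algebra_simps)
  then have "(fd ^^ Suc N) (\<lambda>n. f n * g n) n = (fd ^^ N) (\<lambda>n. f n * fd g n) n + (fd ^^ N) (\<lambda>n. fd f n * g (Suc n)) n"
    by (simp only: fd_funpow_Suc_right fd_funpow_add)
  also have "(fd ^^ N) (\<lambda>n. f n * fd g n) n = (\<Sum>j\<le>N. real (N choose j) * x j)"
    unfolding Suc x_def fd_funpow_Suc_right[symmetric] by (intro sum.cong) (simp_all add: Suc_diff_le)
  also have "(fd ^^ N) (\<lambda>n. fd f n * g (Suc n)) n = (\<Sum>j\<le>N. real (N choose j) * x (Suc j))"
    unfolding Suc x_def fd_funpow_Suc_right[symmetric] fd_funpow_shift by simp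
  also have "(\<Sum>j\<le>N. real (N choose j) * x j) = x 0 + (\<Sum>j\<le>N. real (N choose Suc j) * x (Suc j))"
  proof -
    have "(\<Sum>j\<le>N. real (N choose j) * x j) = (\<Sum>j\<le>Suc N. real (N choose j) * x j)" by simp
    also have "\<dots> = x 0 + (\<Sum>j\<le>N. real (N choose Suc j) * x (Suc j))" by (subst sum.atMost_Suc_shift) simp
    finally show ?thesis .
  qed
  also have "x 0 + (\<Sum>j\<le>N. real (N choose Suc j) * x (Suc j)) + (\<Sum>j\<le>N. real (N choose j) * x (Suc j))
      = x 0 + (\<Sum>j\<le>N. real (Suc N choose Suc j) * x (Suc j))"
    by (simp add: sum.distrib[symmetric] distrib_right add.commute)
  also have "\<dots> = (\<Sum>j\<le>Suc N. real (Suc N choose j) * x j)"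
    by (subst sum.atMost_Suc_shift) simp
  finally show ?case unfolding x_def .
qed simp

text \<open>Half of the decay, with \<open>s = sqrt r\<close>, absorbs the polynomial by
  \<open>power_mult_power_le\<close>; the other half is summed.\<close>

lemma summable_poly_geometric:
  fixes r :: real
  assumes "0 \<le> r" "r < 1"
  shows "summable (\<lambda>n. real (n + 1) ^ M * r ^ n)"
proof (rule summable_comparison_test_ev)
  define s where "s = sqrt r"
  have s: "0 \<le> s" "s < 1" "r = s * s" using assms by (auto simp: s_def)
  show "\<forall>\<^sub>F n in sequentially. norm (real (n + 1) ^ M * r ^ n) \<le> (real M / (1 - s)) ^ M * s ^ n"
  proof (intro always_eventually allI)
    fix n
    have "s ^ n * (1 - s) ^ M \<le> (real M / real (n + 1)) ^ M" using power_mult_power_le[of s n M] s by simp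
    then have "real (n + 1) ^ M * s ^ n \<le> (real M / (1 - s)) ^ M"
      using s by (simp add: power_divide field_simps)
    then have "real (n + 1) ^ M * s ^ n * s ^ n \<le> (real M / (1 - s)) ^ M * s ^ n"
      using s by (intro mult_right_mono) auto
    then show "norm (real (n + 1) ^ M * r ^ n) \<le> (real M / (1 - s)) ^ M * s ^ n"
      using s by (simp add: power_mult_distrib mult.assoc abs_mult)
  qed
  show "summable (\<lambda>n. (real M / (1 - s)) ^ M * s ^ n)"
    using s by (intro summable_mult summable_geometric) auto
qed

text \<open>Multiplying the tail \<open>T\<close> by \<open>1 - z\<close> leaves a boundary term and
  the differenced tail \<open>U\<close>: \<open>(1 - z) * T = f n0 * z ^ n0 + z * U\<close>.\<close>

lemma tail_by_parts:
  fixes z :: complex and f :: "nat \<Rightarrow> real"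
  assumes sf: "summable (\<lambda>n. \<bar>f n\<bar> * norm z ^ n)" and sg: "summable (\<lambda>n. \<bar>fd f n\<bar> * norm z ^ n)" and z: "norm z < 1"
  shows "norm (\<Sum>n. of_real (f (n + n0)) * z ^ (n + n0))
      \<le> (\<bar>f n0\<bar> + norm (\<Sum>n. of_real (fd f (n + n0)) * z ^ (n + n0))) / norm (1 - z)"
proof -
  have sum: "summable (\<lambda>n. complex_of_real (g (n + k)) * z ^ (n + k))" if "summable (\<lambda>n. \<bar>g n\<bar> * norm z ^ n)" for g k
  proof -
    have "summable (\<lambda>n. complex_of_real (g n) * z ^ n)"
      by (rule summable_norm_cancel) (use that in \<open>simp add: norm_mult norm_power\<close>)
    then show ?thesis by (rule summable_ignore_initial_segment)
  qed
  define T where "T = (\<Sum>n. of_real (f (n + n0)) * z ^ (n + n0))"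
  define U where "U = (\<Sum>n. of_real (fd f (n + n0)) * z ^ (n + n0))"
  have T1: "T = of_real (f n0) * z ^ n0 + (\<Sum>n. of_real (f (Suc n + n0)) * z ^ (Suc n + n0))"
    unfolding T_def using suminf_split_head[OF sum[OF sf, of n0]] by simp
  have zT: "z * T = (\<Sum>n. of_real (f (n + n0)) * z ^ (Suc n + n0))"
    unfolding T_def using suminf_mult[OF sum[OF sf, of n0], of z] by (simp add: mult_ac)
  have zU: "z * U = (\<Sum>n. of_real (fd f (n + n0)) * z ^ (Suc n + n0))"
    unfolding U_def using suminf_mult[OF sum[OF sg, of n0], of z] by (simp add: mult_ac)
  have "(\<Sum>n. of_real (f (Suc n + n0)) * z ^ (Suc n + n0)) - z * T
      = (\<Sum>n. of_real (f (Suc n + n0)) * z ^ (Suc n + n0) - of_real (f (n + n0)) * z ^ (Suc n + n0))"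
    unfolding zT
  proof (rule suminf_diff)
    show "summable (\<lambda>n. complex_of_real (f (Suc n + n0)) * z ^ (Suc n + n0))"
      using sum[OF sf, of "Suc n0"] by simp
    show "summable (\<lambda>n. complex_of_real (f (n + n0)) * z ^ (Suc n + n0))"
      using summable_mult[OF sum[OF sf, of n0], of z] by (simp add: mult_ac)
  qed
  also have "\<dots> = z * U" unfolding zU fd_def by (simp add: left_diff_distrib)
  finally have "(1 - z) * T = of_real (f n0) * z ^ n0 + z * U"
    using T1 by (simp add: algebra_simps)
  then have "norm (1 - z) * norm T = norm (of_real (f n0) * z ^ n0 + z * U)" by (metis norm_mult)
  also have "\<dots> \<le> \<bar>f n0\<bar> * norm z ^ n0 + norm z * norm U"
    by (rule order_trans[OF norm_triangle_ineq]) (simp add: norm_mult norm_power)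
  also have "\<dots> \<le> \<bar>f n0\<bar> + norm U"
    using z by (intro add_mono) (auto simp: power_le_one mult_left_le mult_left_le_one_le)
  finally have "norm T * norm (1 - z) \<le> \<bar>f n0\<bar> + norm U" by (simp add: mult.commute)
  moreover have "1 - z \<noteq> 0" using z by auto
  ultimately show ?thesis unfolding T_def U_def by (simp add: pos_le_divide_eq)
qed

section \<open>Regularity of the kernel coefficients and size of the kernel\<close>

context doubling
begin

abbreviation am :: "nat \<Rightarrow> real" where "am n \<equiv> moment h (2 * n + 1)"

text \<open>The \<open>kc n\<close> are the Taylor coefficients of the kernel \<open>G\<close>, and \<open>kd k\<close> is its size at distance
  \<open>1 / 2 ^ k\<close> from the point \<open>1\<close>.\<close>

definition kc :: "nat \<Rightarrow> real" where "kc n = 1 / (2 * am n)"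

definition kd :: "nat \<Rightarrow> real" where "kd k = 2 ^ k / W k"

definition G :: "complex \<Rightarrow> complex" where "G z = (\<Sum>n. of_real (kc n) * z ^ n)"

lemma kc_pos: "0 < kc n" unfolding kc_def using moment_pos by simp

lemma kc_mono: "i \<le> j \<Longrightarrow> kc i \<le> kc j"
  unfolding kc_def using moment_pos moment_antimono[of "2 * i + 1" "2 * j + 1"] by (intro divide_left_mono) auto

lemma kd_pos: "0 < kd k" unfolding kd_def using W_pos by simp

lemma kc_upper: assumes "n + 1 \<le> 2 ^ Suc i" shows "kc n \<le> 2 * C ^ 2 / W i"
proof -
  have "2 * n + 1 + 1 \<le> 2 ^ Suc (Suc i)" using assms by simp
  then have "W (Suc i) \<le> 3 * C * am n" by (rule moment_lower)
  then have "C * W (Suc i) \<le> C * (3 * C * am n)" using C_ge_1 by (intro mult_left_mono) auto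
  then have "W i \<le> 3 * C ^ 2 * am n" using W_double[of i] by (simp add: power2_eq_square mult_ac)
  then have "W i \<le> 4 * C ^ 2 * am n" using moment_pos[of "2 * n + 1"] by (smt (verit) mult_right_mono zero_le_power2)
  then show ?thesis unfolding kc_def using W_pos[of i] moment_pos[of "2 * n + 1"] by (simp add: field_simps)
qed

lemma kc_lower: assumes "2 ^ i \<le> n + 1" shows "1 / (2 * Bm * W i) \<le> kc n"
proof -
  have "2 ^ Suc i \<le> 2 * n + 1 + 1" using assms by simp
  then have "am n \<le> Bm * W (Suc i)" by (rule moment_upper)
  also have "\<dots> \<le> Bm * W i" using Bm_pos W_antimono[of i "Suc i"] by simp
  finally show ?thesis unfolding kc_def using moment_pos[of "2 * n + 1"] by (intro divide_left_mono) (auto simp: mult_pos_pos Bm_pos W_pos)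
qed

text \<open>Doubling the index multiplies the bound of \<open>kc_upper\<close> by at most
  \<open>C \<le> 2 ^ Mo\<close>, which amounts to polynomial growth of degree \<open>Mo\<close>
  relative to the index \<open>2 ^ k\<close>.\<close>

lemma kc_growth: assumes "2 ^ k \<le> n + 1" shows "kc n \<le> 2 * C ^ 2 / W k * (real (n + 1) / 2 ^ k) ^ Mo"
proof -
  obtain i where i: "2 ^ i \<le> n + 1" "n + 1 < 2 ^ (i + 1)" using ex_power_ivl1[of 2 "n + 1"] by auto
  have "(2::nat) ^ k < 2 ^ (i + 1)" using i assms by linarith
  then have "k < i + 1" by (rule power_less_imp_less_exp[rotated]) simp
  then have ki: "k \<le> i" by simp
  have "W k \<le> C ^ (i - k) * W i" using W_double_iterate[of k "i - k"] ki by simp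
  then have "1 / W i \<le> C ^ (i - k) / W k" using W_pos by (simp add: field_simps)
  also have "\<dots> \<le> (real (n + 1) / 2 ^ k) ^ Mo / W k"
  proof (intro divide_right_mono)
    have "C ^ (i - k) \<le> (2 ^ Mo) ^ (i - k)" using Mo C_ge_1 by (intro power_mono) auto
    also have "\<dots> = (2 ^ i / 2 ^ k) ^ Mo" using ki by (simp add: power_diff[symmetric] power_mult[symmetric] mult.commute)
    also have "\<dots> \<le> (real (n + 1) / 2 ^ k) ^ Mo"
    proof (intro power_mono divide_right_mono)
      show "(2::real) ^ i \<le> real (n + 1)" using i(1) by (metis of_nat_le_iff of_nat_numeral of_nat_power)
    qed auto
    finally show "C ^ (i - k) \<le> (real (n + 1) / 2 ^ k) ^ Mo" .
  qed (use W_pos[of k] in auto)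
  finally have "2 * C ^ 2 * (1 / W i) \<le> 2 * C ^ 2 * ((real (n + 1) / 2 ^ k) ^ Mo / W k)"
    using C_ge_1 by (intro mult_left_mono) auto
  moreover have "kc n \<le> 2 * C ^ 2 / W i" using i by (intro kc_upper) auto
  ultimately show ?thesis by simp
qed

lemma summable_kc: assumes "0 \<le> r" "r < 1" shows "summable (\<lambda>n. kc n * r ^ n)"
proof (rule summable_comparison_test_ev)
  show "\<forall>\<^sub>F n in sequentially. norm (kc n * r ^ n) \<le> 2 * C ^ 2 / W 0 * (real (n + 1) ^ Mo * r ^ n)"
  proof (intro always_eventually allI)
    fix n
    have "kc n * r ^ n \<le> (2 * C ^ 2 / W 0 * (real (n + 1) / 2 ^ 0) ^ Mo) * r ^ n"
      using assms by (intro mult_right_mono kc_growth) auto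
    then show "norm (kc n * r ^ n) \<le> 2 * C ^ 2 / W 0 * (real (n + 1) ^ Mo * r ^ n)"
      using kc_pos[of n] assms by (simp add: abs_mult mult.assoc)
  qed
  show "summable (\<lambda>n. 2 * C ^ 2 / W 0 * (real (n + 1) ^ Mo * r ^ n))"
    by (intro summable_mult summable_poly_geometric assms)
qed

definition Ba :: real where "Ba = 3 * C ^ 2 * Bm"

text \<open>Both moments have the size of the tail at the dyadic level of \<open>n\<close>. The
  constant \<open>Ba\<close> collects \<open>moment_upper\<close>, one doubling step and
  \<open>moment_lower\<close>.\<close>

lemma am_half: "am (n div 2) \<le> Ba * am n"
proof -
  obtain i where i: "2 ^ i \<le> n + 1" "n + 1 < 2 ^ (i + 1)" using ex_power_ivl1[of 2 "n + 1"] by auto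
  have "2 ^ i \<le> 2 * (n div 2) + 1 + 1" using i(1) by linarith
  then have "am (n div 2) \<le> Bm * W i" by (rule moment_upper)
  also have "\<dots> \<le> Bm * (C * W (Suc i))" using Bm_pos by (intro mult_left_mono W_double) auto
  also have "\<dots> \<le> Bm * (C * (3 * C * am n))"
    using Bm_pos C_ge_1 i(2) by (intro mult_left_mono moment_lower) auto
  finally show ?thesis by (simp add: Ba_def power2_eq_square mult_ac)
qed

lemma Ba_ge_1: "1 \<le> Ba"
  using am_half[of 0] moment_pos[of 1] by simp

lemma am_shift: "am n \<le> Ba ^ k * am (n + k)"
proof (induction k)
  case (Suc k)
  have "am (n + k) \<le> Ba * am (2 * (n + k) + 1)" using am_half[of "2 * (n + k) + 1"] by simp
  also have "\<dots> \<le> Ba * am (Suc (n + k))" using Ba_ge_1 by (intro mult_left_mono moment_antimono) auto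
  finally have "Ba ^ k * am (n + k) \<le> Ba ^ k * (Ba * am (Suc (n + k)))" using Ba_ge_1 by (intro mult_left_mono) auto
  then show ?case using Suc by (simp add: mult_ac)
qed simp

text \<open>The \<open>k\<close>-th difference is the integral of
  \<open>s ^ (2 * n + 1) * (s^2 - 1) ^ k\<close>. About half of the power of \<open>s\<close> is
  spent against \<open>(1 - s^2) ^ k\<close> and yields the factor of order
  \<open>1 / (n + 1) ^ k\<close>; the other half remains as the moment \<open>am (n div 2)\<close>,
  which is comparable to \<open>am n\<close>.\<close>

lemma fd_am_bound: "\<bar>(fd ^^ k) am n\<bar> \<le> (2 * real k) ^ k * Ba * am n / real (n + 1) ^ k"
proof -
  define N where "N = density lborel (\<lambda>s. ennreal (h s) * indicator {0..<1} s)"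
  have sN [measurable_cong]: "sets N = sets borel" by (simp add: N_def)
  have "emeasure N (space N) = (\<integral>\<^sup>+s\<in>{0..<1}. ennreal (h s) \<partial>lborel)"
    unfolding N_def by (subst emeasure_density) auto
  then interpret N: finite_measure N using h_finite by (intro finite_measureI) auto
  have AEN: "AE s in N. s \<in> {0..<1}"
    unfolding N_def by (subst AE_density) (auto simp: indicator_def split: if_splits)
  have int: "integrable N (\<lambda>s. s ^ i * (s\<^sup>2 - 1) ^ j)" for i j
  proof (rule N.integrable_const_bound[where B = 1])
    show "AE s in N. norm (s ^ i * (s\<^sup>2 - 1) ^ j) \<le> 1"
      using AEN
    proof eventually_elim
      case (elim s)
      then have "\<bar>s ^ i\<bar> \<le> 1" "\<bar>(s\<^sup>2 - 1) ^ j\<bar> \<le> 1"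
        by (auto simp: power_abs abs_le_iff power_le_one intro!: power_le_one)
      then show ?case by (simp add: abs_mult mult_le_one)
    qed
  qed measurable
  have mom: "moment h i = (\<integral>s. s ^ i \<partial>N)" for i
  proof -
    have "ennreal (\<integral>s. s ^ i \<partial>N) = (\<integral>\<^sup>+s. ennreal (s ^ i) \<partial>N)"
      using int[of i 0] AEN by (intro nn_integral_eq_integral[symmetric]) auto
    also have "\<dots> = ennreal (moment h i)"
      unfolding moment_ennreal[symmetric] N_def
      by (subst nn_integral_density) (auto intro!: nn_integral_cong simp: indicator_def ennreal_mult h_nonneg mult_ac)
    finally have eq: "ennreal (\<integral>s. s ^ i \<partial>N) = ennreal (moment h i)" .
    have "0 \<le> (\<integral>s. s ^ i \<partial>N)"
      by (rule integral_nonneg_AE) (use AEN in \<open>auto elim!: eventually_mono\<close>)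
    then show ?thesis using eq moment_pos[of i] by simp
  qed
  have fdk: "(fd ^^ k) am n = (\<integral>s. s ^ (2 * n + 1) * (s\<^sup>2 - 1) ^ k \<partial>N)" for n
  proof (induction k arbitrary: n)
    case 0 show ?case by (simp add: mom)
  next
    case (Suc k)
    have "(fd ^^ Suc k) am n = (\<integral>s. s ^ (2 * Suc n + 1) * (s\<^sup>2 - 1) ^ k \<partial>N) - (\<integral>s. s ^ (2 * n + 1) * (s\<^sup>2 - 1) ^ k \<partial>N)"
      by (simp only: funpow.simps comp_def fd_def Suc)
    also have "\<dots> = (\<integral>s. s ^ (2 * Suc n + 1) * (s\<^sup>2 - 1) ^ k - s ^ (2 * n + 1) * (s\<^sup>2 - 1) ^ k \<partial>N)"
      by (rule Bochner_Integration.integral_diff[symmetric]) (rule int)+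
    also have "\<dots> = (\<integral>s. s ^ (2 * n + 1) * (s\<^sup>2 - 1) ^ Suc k \<partial>N)"
      by (intro Bochner_Integration.integral_cong) (simp_all add: power2_eq_square algebra_simps)
    finally show ?case .
  qed
  have "\<bar>(fd ^^ k) am n\<bar> \<le> (\<integral>s. (2 * real k / real (n + 1)) ^ k * s ^ (2 * (n div 2) + 1) \<partial>N)"
    unfolding fdk real_norm_def[symmetric]
  proof (rule order_trans[OF integral_norm_bound integral_mono_AE[OF integrable_norm[OF int]]])
    show "integrable N (\<lambda>s. (2 * real k / real (n + 1)) ^ k * s ^ (2 * (n div 2) + 1))"
      using int[of "2 * (n div 2) + 1" 0] by (intro integrable_mult_right) simp
    show "AE s in N. norm (s ^ (2 * n + 1) * (s\<^sup>2 - 1) ^ k) \<le> (2 * real k / real (n + 1)) ^ k * s ^ (2 * (n div 2) + 1)"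
      using AEN
    proof eventually_elim
      case (elim s)
      define e where "e = n div 2"
      define f where "f = n - e"
      have nef: "n = e + f" by (simp add: f_def e_def)
      have "n + 1 \<le> 2 * (f + 1)" unfolding f_def e_def by presburger
      then have "real (n + 1) \<le> real (2 * (f + 1))" by (rule of_nat_mono)
      then have f2: "real (n + 1) / 2 \<le> real (f + 1)" by simp
      have s: "0 \<le> s" "s\<^sup>2 \<le> 1" using elim by (auto simp: power_le_one)
      have "norm (s ^ (2 * n + 1) * (s\<^sup>2 - 1) ^ k) = s ^ (2 * e + 1) * ((s\<^sup>2) ^ f * (1 - s\<^sup>2) ^ k)"
        using s by (simp add: abs_mult power_abs nef power_add power_mult[symmetric] mult_ac distrib_left)
      also have "\<dots> \<le> s ^ (2 * e + 1) * (real k / real (f + 1)) ^ k"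
        using s by (intro mult_left_mono power_mult_power_le) auto
      also have "\<dots> \<le> s ^ (2 * e + 1) * (2 * real k / real (n + 1)) ^ k"
      proof (intro mult_left_mono power_mono)
        have "real k / real (f + 1) \<le> real k / (real (n + 1) / 2)"
          using f2 by (intro divide_left_mono) auto
        then show "real k / real (f + 1) \<le> 2 * real k / real (n + 1)" by (simp add: mult.commute)
      qed (use s in auto)
      finally show ?case unfolding e_def by (simp only: mult.commute)
    qed
  qed
  also have "\<dots> = (2 * real k / real (n + 1)) ^ k * am (n div 2)" by (simp add: mom)
  also have "\<dots> \<le> (2 * real k / real (n + 1)) ^ k * (Ba * am n)" by (intro mult_left_mono am_half) auto
  finally show ?thesis by (simp add: power_divide mult_ac)
qed

text \<open>Expanding the \<open>N\<close>-th difference of the constant \<open>kc n * am n = 1 / 2\<close> by Leibniz' rule bounds the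
  differences of the reciprocals recursively.\<close>

lemma fd_kc_bound: "\<exists>B\<ge>0. \<forall>n. \<bar>(fd ^^ N) kc n\<bar> \<le> B * kc n / real (n + 1) ^ N"
proof (induction N rule: less_induct)
  case (less N)
  show ?case
  proof (cases "N = 0")
    case True
    then show ?thesis using kc_pos by (intro exI[of _ 1]) (simp add: less_imp_le)
  next
    case False
    have "\<forall>j\<in>{..<N}. \<exists>B\<ge>0. \<forall>n. \<bar>(fd ^^ j) kc n\<bar> \<le> B * kc n / real (n + 1) ^ j" using less by auto
    then obtain B where B: "\<And>j. j < N \<Longrightarrow> 0 \<le> B j" "\<And>j n. j < N \<Longrightarrow> \<bar>(fd ^^ j) kc n\<bar> \<le> B j * kc n / real (n + 1) ^ j"
      by (metis lessThan_iff)
    define A where "A j = (2 * real j) ^ j * Ba" for j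
    have A0: "0 \<le> A j" for j unfolding A_def using Ba_ge_1 by simp
    define S where "S = (\<Sum>j<N. real (N choose j) * (B j * A (N - j)))"
    have S0: "0 \<le> S" unfolding S_def using B(1) A0 by (intro sum_nonneg) auto
    have "\<bar>(fd ^^ N) kc n\<bar> \<le> S * Ba ^ N * kc n / real (n + 1) ^ N" for n
    proof -
      have one: "(\<lambda>n. kc n * am n) = (\<lambda>n. 1 / 2)" using moment_pos unfolding kc_def by (auto simp: fun_eq_iff less_imp_neq[symmetric])
      have "(fd ^^ N) (\<lambda>n. 1 / 2) n = 0" if "N \<noteq> 0" for N n
        using that
      proof (induction N)
        case (Suc N)
        have "fd (\<lambda>n. 1 / 2) = (\<lambda>n. 0)" by (simp add: fd_def fun_eq_iff)
        moreover have "(fd ^^ N) (\<lambda>n. 0) n = 0" for n by (induction N arbitrary: n) (auto simp: fd_def)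
        ultimately show ?case by (simp only: fd_funpow_Suc_right)
      qed simp
      then have "0 = (\<Sum>j\<le>N. real (N choose j) * ((fd ^^ j) kc n * (fd ^^ (N - j)) am (n + j)))"
        unfolding fd_leibniz[symmetric] one using False by simp
      also have "\<dots> = (\<Sum>j<N. real (N choose j) * ((fd ^^ j) kc n * (fd ^^ (N - j)) am (n + j))) + (fd ^^ N) kc n * am (n + N)"
        unfolding lessThan_Suc_atMost[symmetric] by simp
      finally have eq: "(fd ^^ N) kc n * am (n + N) = - (\<Sum>j<N. real (N choose j) * ((fd ^^ j) kc n * (fd ^^ (N - j)) am (n + j)))"
        by linarith
      have "\<bar>(fd ^^ N) kc n\<bar> * am (n + N) = \<bar>(fd ^^ N) kc n * am (n + N)\<bar>" using moment_pos[of "2 * (n + N) + 1"] by (simp add: abs_mult)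
      also have "\<dots> \<le> (\<Sum>j<N. \<bar>real (N choose j) * ((fd ^^ j) kc n * (fd ^^ (N - j)) am (n + j))\<bar>)"
        unfolding eq abs_minus_cancel by (rule sum_abs)
      also have "\<dots> \<le> (\<Sum>j<N. real (N choose j) * (B j * A (N - j)) * (kc n * am n / real (n + 1) ^ N))"
      proof (rule sum_mono)
        fix j assume "j \<in> {..<N}"
        then have j: "j < N" by simp
        have "\<bar>(fd ^^ (N - j)) am (n + j)\<bar> \<le> A (N - j) * am (n + j) / real (n + j + 1) ^ (N - j)"
          unfolding A_def by (rule fd_am_bound)
        also have "\<dots> \<le> A (N - j) * am n / real (n + 1) ^ (N - j)"
          using A0 moment_pos by (intro frac_le mult_left_mono moment_antimono power_mono) (auto simp: less_imp_le)
        finally have 1: "\<bar>(fd ^^ (N - j)) am (n + j)\<bar> \<le> A (N - j) * am n / real (n + 1) ^ (N - j)" .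
        have "\<bar>(fd ^^ j) kc n\<bar> * \<bar>(fd ^^ (N - j)) am (n + j)\<bar> \<le> (B j * kc n / real (n + 1) ^ j) * (A (N - j) * am n / real (n + 1) ^ (N - j))"
          using B j kc_pos[of n] by (intro mult_mono 1) (auto intro!: divide_nonneg_nonneg mult_nonneg_nonneg simp: less_imp_le)
        also have "\<dots> = (B j * A (N - j)) * (kc n * am n / real (n + 1) ^ N)"
          using power_add[of "real (n + 1)" j "N - j"] j by (simp add: mult_ac)
        finally have "real (N choose j) * (\<bar>(fd ^^ j) kc n\<bar> * \<bar>(fd ^^ (N - j)) am (n + j)\<bar>) \<le> real (N choose j) * ((B j * A (N - j)) * (kc n * am n / real (n + 1) ^ N))"
          by (intro mult_left_mono) auto
        then show "\<bar>real (N choose j) * ((fd ^^ j) kc n * (fd ^^ (N - j)) am (n + j))\<bar> \<le> real (N choose j) * (B j * A (N - j)) * (kc n * am n / real (n + 1) ^ N)"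
          by (simp add: abs_mult mult.assoc)
      qed
      also have "\<dots> = S * (kc n * am n / real (n + 1) ^ N)" unfolding S_def sum_distrib_right ..
      \<comment> \<open>The moment is moved to the shifted index so that it cancels against the
        factor \<open>am (n + N)\<close> next to the top difference.\<close>
      also have "\<dots> \<le> S * (kc n * (Ba ^ N * am (n + N)) / real (n + 1) ^ N)"
        using S0 kc_pos[of n] by (intro mult_left_mono divide_right_mono am_shift) (auto simp: less_imp_le)
      also have "\<dots> = (S * Ba ^ N * kc n / real (n + 1) ^ N) * am (n + N)" by simp
      finally show ?thesis using moment_pos[of "2 * (n + N) + 1"] by (simp only: mult_le_cancel_right_pos)
    qed
    moreover have "0 \<le> S * Ba ^ N" using S0 Ba_ge_1 by simp
    ultimately show ?thesis by blast
  qed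
qed

lemma summable_fd_kc: assumes "0 \<le> r" "r < 1" shows "summable (\<lambda>n. \<bar>(fd ^^ N) kc n\<bar> * r ^ n)"
proof -
  obtain B where B: "0 \<le> B" "\<And>n. \<bar>(fd ^^ N) kc n\<bar> \<le> B * kc n / real (n + 1) ^ N" using fd_kc_bound by blast
  show ?thesis
  proof (rule summable_comparison_test_ev)
    show "summable (\<lambda>n. B * (kc n * r ^ n))" by (intro summable_mult summable_kc assms)
    show "\<forall>\<^sub>F n in sequentially. norm (\<bar>(fd ^^ N) kc n\<bar> * r ^ n) \<le> B * (kc n * r ^ n)"
    proof (intro always_eventually allI)
      fix n
      have "B * kc n / real (n + 1) ^ N \<le> B * kc n / 1" using B(1) kc_pos[of n] by (intro divide_left_mono) auto
      then have "\<bar>(fd ^^ N) kc n\<bar> * r ^ n \<le> B * kc n * r ^ n" using B(2)[of n] assms by (intro mult_right_mono) auto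
      then show "norm (\<bar>(fd ^^ N) kc n\<bar> * r ^ n) \<le> B * (kc n * r ^ n)" using assms by (simp add: mult.assoc abs_mult)
    qed
  qed
qed

lemma tail_by_parts_iterate:
  assumes z: "norm z < 1"
  shows "norm (\<Sum>n. complex_of_real (kc (n + n0)) * z ^ (n + n0))
    \<le> (\<Sum>j<N. \<bar>(fd ^^ j) kc n0\<bar> / norm (1 - z) ^ Suc j) + norm (\<Sum>n. complex_of_real ((fd ^^ N) kc (n + n0)) * z ^ (n + n0)) / norm (1 - z) ^ N"
proof (induction N)
  case (Suc N)
  have "norm (\<Sum>n. complex_of_real ((fd ^^ N) kc (n + n0)) * z ^ (n + n0)) \<le> (\<bar>(fd ^^ N) kc n0\<bar> + norm (\<Sum>n. complex_of_real ((fd ^^ Suc N) kc (n + n0)) * z ^ (n + n0))) / norm (1 - z)"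
    using tail_by_parts[of "(fd ^^ N) kc" z n0] summable_fd_kc[of "norm z" N] summable_fd_kc[of "norm z" "Suc N"] z by simp
  then have "norm (\<Sum>n. complex_of_real ((fd ^^ N) kc (n + n0)) * z ^ (n + n0)) / norm (1 - z) ^ N
    \<le> (\<bar>(fd ^^ N) kc n0\<bar> + norm (\<Sum>n. complex_of_real ((fd ^^ Suc N) kc (n + n0)) * z ^ (n + n0))) / norm (1 - z) / norm (1 - z) ^ N"
    by (intro divide_right_mono) auto
  then show ?case using Suc by (simp add: add_divide_distrib)
qed simp

text \<open>Comparison with the telescoping series of \<open>1 / n - 1 / (n + 1)\<close>.\<close>

lemma sum_inverse_squares_tail:
  assumes "0 < n0"
  shows "summable (\<lambda>n. 1 / real (n + n0 + 1) ^ 2)" "(\<Sum>n. 1 / real (n + n0 + 1) ^ 2) \<le> 1 / real n0"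
proof -
  have "(\<lambda>n. 1 / real (n + n0)) \<longlonglongrightarrow> 0"
    using LIMSEQ_ignore_initial_segment[OF lim_inverse_n', of n0] by simp
  then have tele: "(\<lambda>n. 1 / real (n + n0) - 1 / real (Suc n + n0)) sums (1 / real (0 + n0) - 0)"
    by (rule telescope_sums')
  have le: "1 / real (n + n0 + 1) ^ 2 \<le> 1 / real (n + n0) - 1 / real (Suc n + n0)" for n
  proof -
    have "1 / real (n + n0) - 1 / real (Suc n + n0) = 1 / (real (n + n0) * real (n + n0 + 1))"
      using assms by (simp add: field_simps)
    also have "\<dots> \<ge> 1 / real (n + n0 + 1) ^ 2"
      using assms by (intro divide_left_mono) (auto simp: power2_eq_square intro!: mult_right_mono)
    finally show ?thesis .
  qed
  show s: "summable (\<lambda>n. 1 / real (n + n0 + 1) ^ 2)"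
    by (rule summable_comparison_test_ev[OF _ sums_summable[OF tele]]) (use le in auto)
  show "(\<Sum>n. 1 / real (n + n0 + 1) ^ 2) \<le> 1 / real n0"
    using suminf_le[OF le s sums_summable[OF tele]] sums_unique[OF tele] by simp
qed

text \<open>The series is split at \<open>n0 = 2 ^ k\<close>, and the head is at most
  \<open>n0\<close> times its largest coefficient. In the tail every summation by parts costs
  \<open>1 / norm (1 - z) \<le> 2 ^ k\<close> and gains a factor of order \<open>1 / n0\<close> in
  the boundary term, so all boundary terms have the size of \<open>kd k\<close>. After enough steps
  the remaining series converges absolutely and has this size too.\<close>

lemma kernel_upper: "\<exists>B>0. \<forall>k z. norm z < 1 \<longrightarrow> 1 / 2 ^ k \<le> norm (1 - z) \<longrightarrow> norm (G z) \<le> B * kd k"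
proof -
  \<comment> \<open>The coefficients grow at most like \<open>n ^ Mo\<close>; two further
    differences leave the summable \<open>1 / n ^ 2\<close>.\<close>
  define N where "N = Mo + 2"
  have "\<forall>j. \<exists>B\<ge>0. \<forall>n. \<bar>(fd ^^ j) kc n\<bar> \<le> B * kc n / real (n + 1) ^ j" using fd_kc_bound by blast
  then obtain B where B: "\<And>j. 0 \<le> B j" "\<And>j n. \<bar>(fd ^^ j) kc n\<bar> \<le> B j * kc n / real (n + 1) ^ j" by metis
  define D where "D = 2 * C ^ 2"
  have D: "0 < D" using C_ge_1 by (simp add: D_def)
  define K where "K = D * (1 + (\<Sum>j<N. B j) + B N)"
  have K: "0 < K" unfolding K_def using D B(1) by (intro mult_pos_pos) (auto intro!: add_pos_nonneg sum_nonneg)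
  have "norm (G z) \<le> K * kd k" if z: "norm z < 1" and zk: "1 / 2 ^ k \<le> norm (1 - z)" for k z
  proof -
    define n0 :: nat where "n0 = 2 ^ k"
    have n0: "0 < n0" "real n0 = 2 ^ k" by (auto simp: n0_def)
    define q where "q = D / W k"
    have q: "0 < q" using D W_pos by (simp add: q_def)
    have n0le: "n0 + 1 \<le> 2 ^ Suc k" by (simp add: n0_def)
    have kcn0: "kc n0 \<le> q" using kc_upper[OF n0le] by (simp add: q_def D_def)
    have dinv: "1 / norm (1 - z) \<le> 2 ^ k" using zk by (simp add: field_simps divide_le_eq)
    have dpos: "0 < norm (1 - z)" using zk by (smt (verit) divide_pos_pos zero_less_power)
    have dj: "1 / norm (1 - z) ^ j \<le> (2 ^ k) ^ j" for j
      using power_mono[OF dinv, of j] dpos by (simp add: power_one_over)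
    have sm: "summable (\<lambda>n. complex_of_real (kc n) * z ^ n)"
      by (rule summable_norm_cancel) (use summable_kc[of "norm z"] z kc_pos in \<open>simp add: norm_mult norm_power less_imp_le\<close>)
    have "G z = (\<Sum>n. complex_of_real (kc (n + n0)) * z ^ (n + n0)) + (\<Sum>n<n0. complex_of_real (kc n) * z ^ n)"
      unfolding G_def by (rule suminf_split_initial_segment[OF sm])
    then have "norm (G z) \<le> norm (\<Sum>n. complex_of_real (kc (n + n0)) * z ^ (n + n0)) + norm (\<Sum>n<n0. complex_of_real (kc n) * z ^ n)"
      by (simp add: norm_triangle_ineq)
    moreover have "norm (\<Sum>n<n0. complex_of_real (kc n) * z ^ n) \<le> 2 ^ k * q"
    proof -
      have "norm (\<Sum>n<n0. complex_of_real (kc n) * z ^ n) \<le> (\<Sum>n<n0. q)"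
      proof (rule sum_norm_le)
        fix n assume "n \<in> {..<n0}"
        then have "kc n \<le> q" using kc_mono[of n n0] kcn0 by simp
        moreover have "norm z ^ n \<le> 1" using z by (simp add: power_le_one)
        ultimately show "norm (complex_of_real (kc n) * z ^ n) \<le> q"
          using kc_pos[of n] q mult_mono[of "kc n" q "norm z ^ n" 1] by (simp add: norm_mult norm_power less_imp_le)
      qed
      then show ?thesis using n0 by simp
    qed
    moreover have "norm (\<Sum>n. complex_of_real (kc (n + n0)) * z ^ (n + n0)) \<le> 2 ^ k * q * ((\<Sum>j<N. B j) + B N)"
    proof -
      have 1: "(\<Sum>j<N. \<bar>(fd ^^ j) kc n0\<bar> / norm (1 - z) ^ Suc j) \<le> (\<Sum>j<N. 2 ^ k * q * B j)"
      proof (rule sum_mono)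
        fix j
        have "\<bar>(fd ^^ j) kc n0\<bar> \<le> B j * q / (2 ^ k) ^ j"
        proof -
          have "B j * kc n0 / real (n0 + 1) ^ j \<le> B j * q / (2 ^ k) ^ j"
            using B(1)[of j] kcn0 kc_pos[of n0] n0(2) q by (intro frac_le mult_left_mono power_mono) (auto simp: less_imp_le)
          then show ?thesis using B(2)[of j n0] by linarith
        qed
        then have "\<bar>(fd ^^ j) kc n0\<bar> * (1 / norm (1 - z) ^ Suc j) \<le> (B j * q / (2 ^ k) ^ j) * (2 ^ k) ^ Suc j"
          using B(1)[of j] q by (intro mult_mono dj) auto
        then show "\<bar>(fd ^^ j) kc n0\<bar> / norm (1 - z) ^ Suc j \<le> 2 ^ k * q * B j" by (simp add: mult_ac)
      qed
      have bd: "norm (complex_of_real ((fd ^^ N) kc (n + n0)) * z ^ (n + n0)) \<le> B N * q / (2 ^ k) ^ Mo * (1 / real (n + n0 + 1) ^ 2)" for n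
      proof -
        have "norm (complex_of_real ((fd ^^ N) kc (n + n0)) * z ^ (n + n0)) \<le> \<bar>(fd ^^ N) kc (n + n0)\<bar> * 1"
          using z by (simp add: norm_mult norm_power mult_left_le power_le_one)
        also have "\<dots> \<le> B N * kc (n + n0) / real (n + n0 + 1) ^ N" using B(2)[of N "n + n0"] by simp
        also have "\<dots> \<le> B N * (q * (real (n + n0 + 1) / 2 ^ k) ^ Mo) / real (n + n0 + 1) ^ N"
          using B(1)[of N] kc_growth[of k "n + n0"] unfolding n0_def q_def D_def
          by (intro divide_right_mono mult_left_mono) auto
        also have "\<dots> = B N * q / (2 ^ k) ^ Mo * (real (n + n0 + 1) ^ Mo / real (n + n0 + 1) ^ N)"
          by (simp add: power_divide)
        also have "real (n + n0 + 1) ^ Mo / real (n + n0 + 1) ^ N = 1 / real (n + n0 + 1) ^ 2"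
          unfolding N_def power_add by simp
        finally show ?thesis .
      qed
      have "norm (\<Sum>n. complex_of_real ((fd ^^ N) kc (n + n0)) * z ^ (n + n0)) \<le> (\<Sum>n. B N * q / (2 ^ k) ^ Mo * (1 / real (n + n0 + 1) ^ 2))"
        by (rule norm_suminf_le[OF bd]) (intro summable_mult sum_inverse_squares_tail n0)
      also have "\<dots> = B N * q / (2 ^ k) ^ Mo * (\<Sum>n. 1 / real (n + n0 + 1) ^ 2)"
        by (rule suminf_mult) (intro sum_inverse_squares_tail n0)
      also have "\<dots> \<le> B N * q / (2 ^ k) ^ Mo * (1 / 2 ^ k)"
        using sum_inverse_squares_tail(2)[OF n0(1)] n0(2) B(1)[of N] q by (intro mult_left_mono) auto
      finally have "norm (\<Sum>n. complex_of_real ((fd ^^ N) kc (n + n0)) * z ^ (n + n0)) * (1 / norm (1 - z) ^ N) \<le> (B N * q / (2 ^ k) ^ Mo * (1 / 2 ^ k)) * (2 ^ k) ^ N"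
        using B(1)[of N] q by (intro mult_mono dj) auto
      also have "\<dots> = 2 ^ k * q * B N" unfolding N_def by (simp add: power_add power2_eq_square)
      finally have 2: "norm (\<Sum>n. complex_of_real ((fd ^^ N) kc (n + n0)) * z ^ (n + n0)) / norm (1 - z) ^ N \<le> 2 ^ k * q * B N" by simp
      show ?thesis
        using tail_by_parts_iterate[OF z, of n0 N] 1 2 by (simp add: sum_distrib_left[symmetric] distrib_left)
    qed
    ultimately have "norm (G z) \<le> 2 ^ k * q * (1 + (\<Sum>j<N. B j) + B N)" by (simp add: algebra_simps)
    then show ?thesis by (simp add: q_def K_def kd_def mult_ac)
  qed
  then show ?thesis using K by blast
qed

lemma G_real:
  assumes "0 \<le> x" "x < 1"
  shows "G (complex_of_real x) = complex_of_real (\<Sum>n. kc n * x ^ n)"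
  unfolding G_def using suminf_of_real[OF summable_kc[OF assms], where 'a = complex] by simp

text \<open>All terms are nonnegative, so for \<open>k > 0\<close> the indices from
  \<open>2 ^ (k - 1)\<close> up to \<open>2 ^ k\<close> suffice, on which
  \<open>x ^ n \<ge> 1 / 9\<close>. The threshold is a square because the operator is evaluated at
  \<open>z = dy k\<close> and \<open>t \<ge> dy k\<close>.\<close>

lemma kernel_lower:
  assumes "(dy k)\<^sup>2 \<le> x" "x < 1"
  shows "kd k / (36 * Bm * C) \<le> (\<Sum>n. kc n * x ^ n)"
proof -
  have x0: "0 \<le> x" using assms(1) by (meson order_trans zero_le_power2)
  have sumle: "(\<Sum>n\<in>I. kc n * x ^ n) \<le> (\<Sum>n. kc n * x ^ n)" if "finite I" for I
    using that kc_pos x0 by (intro sum_le_suminf summable_kc assms) (auto simp: less_imp_le)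
  show ?thesis
  proof (cases k)
    case 0
    have "kd 0 / (36 * Bm * C) \<le> 1 / (2 * Bm * W 0)"
      using Bm_pos C_ge_1 W_pos[of 0] by (simp add: kd_def field_simps)
    also have "\<dots> \<le> kc 0" by (rule kc_lower) simp
    also have "\<dots> \<le> (\<Sum>n. kc n * x ^ n)" using sumle[of "{0}"] by simp
    finally show ?thesis using 0 by simp
  next
    case (Suc i)
    have trm: "1 / (18 * Bm * C * W k) \<le> kc n * x ^ n" if n: "n \<in> {2 ^ i..<2 ^ k::nat}" for n
    proof -
      have "1 / 3 \<le> dy k ^ n" by (rule dy_power_lower) (use n in auto)
      then have "(1 / 3) ^ 2 \<le> (dy k ^ n) ^ 2" by (intro power_mono) auto
      also have "\<dots> = ((dy k)\<^sup>2) ^ n" by (simp add: power_mult[symmetric] mult.commute)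
      also have "\<dots> \<le> x ^ n" using assms by (intro power_mono) auto
      finally have xn: "1 / 9 \<le> x ^ n" by (simp add: power2_eq_square)
      have "1 / (2 * Bm * (C * W k)) \<le> 1 / (2 * Bm * W i)"
        using Bm_pos W_double[of i] Suc W_pos C_ge_1 by (intro divide_left_mono) (auto simp: mult_pos_pos)
      also have "\<dots> \<le> kc n" by (rule kc_lower) (use n in auto)
      finally have "1 / (2 * Bm * (C * W k)) * (1 / 9) \<le> kc n * x ^ n"
        using xn kc_pos[of n] by (intro mult_mono) (auto simp: less_imp_le)
      then show ?thesis by simp
    qed
    have "kd k / (36 * Bm * C) = (\<Sum>n\<in>{2 ^ i..<2 ^ k::nat}. 1 / (18 * Bm * C * W k))"
      using Suc by (simp add: kd_def of_nat_diff)
    also have "\<dots> \<le> (\<Sum>n\<in>{2 ^ i..<2 ^ k::nat}. kc n * x ^ n)" by (rule sum_mono) (rule trm)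
    also have "\<dots> \<le> (\<Sum>n. kc n * x ^ n)" by (rule sumle) simp
    finally show ?thesis .
  qed
qed

end

section \<open>Discrete Schur and Hardy inequalities\<close>

abbreviation ndist :: "nat \<Rightarrow> nat \<Rightarrow> nat" where "ndist i j \<equiv> (i - j) + (j - i)"

lemma sum_power_ndist:
  fixes x :: real
  assumes "0 < x" "x < 1" "finite F"
  shows "(\<Sum>k\<in>F. x ^ ndist K k) \<le> 2 / (1 - x)"
proof -
  have geo: "(\<Sum>i\<in>I. x ^ i) \<le> 1 / (1 - x)" if "finite I" for I
    using sum_le_suminf[of "\<lambda>i. x ^ i" I] suminf_geometric[of x] assms that by (simp add: summable_geometric)
  have "(\<Sum>k\<in>F. x ^ ndist K k) = (\<Sum>k\<in>F \<inter> {..K}. x ^ ndist K k) + (\<Sum>k\<in>F \<inter> {K<..}. x ^ ndist K k)"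
    using assms(3) by (subst sum.union_disjoint[symmetric]) (auto intro!: sum.cong)
  also have "(\<Sum>k\<in>F \<inter> {..K}. x ^ ndist K k) = (\<Sum>i\<in>(\<lambda>k. K - k) ` (F \<inter> {..K}). x ^ i)"
    by (subst sum.reindex) (auto simp: inj_on_def)
  also have "(\<Sum>k\<in>F \<inter> {K<..}. x ^ ndist K k) = (\<Sum>i\<in>(\<lambda>k. k - K) ` (F \<inter> {K<..}). x ^ i)"
    by (subst sum.reindex) (auto simp: inj_on_def)
  also have "(\<Sum>i\<in>(\<lambda>k. K - k) ` (F \<inter> {..K}). x ^ i) + (\<Sum>i\<in>(\<lambda>k. k - K) ` (F \<inter> {K<..}). x ^ i) \<le> 1 / (1 - x) + 1 / (1 - x)"
    using assms(3) by (intro add_mono geo) auto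
  finally show ?thesis by simp
qed

lemma suminf_power_ndist:
  fixes x :: real
  assumes "0 < x" "x < 1"
  shows "(\<Sum>K. ennreal (x ^ ndist K k)) \<le> ennreal (2 / (1 - x))"
proof (rule suminf_le_const)
  fix n
  have "(\<Sum>K<n. ennreal (x ^ ndist K k)) = ennreal (\<Sum>K<n. x ^ ndist k K)"
    using assms by (subst sum_ennreal) (auto simp: add.commute)
  also have "\<dots> \<le> ennreal (2 / (1 - x))" by (intro ennreal_leI sum_power_ndist assms) simp
  finally show "(\<Sum>K<n. ennreal (x ^ ndist K k)) \<le> ennreal (2 / (1 - x))" .
qed simp

lemma suminf_swap_ennreal:
  fixes f :: "nat \<Rightarrow> nat \<Rightarrow> ennreal"
  shows "(\<Sum>i. \<Sum>j. f i j) = (\<Sum>j. \<Sum>i. f i j)"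
proof -
  have "(\<Sum>i. \<Sum>j. f i j) = (\<integral>\<^sup>+i. (\<Sum>j. f i j) \<partial>count_space UNIV)" by (simp add: nn_integral_count_space_nat)
  also have "\<dots> = (\<Sum>j. \<integral>\<^sup>+i. f i j \<partial>count_space UNIV)" by (rule nn_integral_suminf) simp
  finally show ?thesis by (simp add: nn_integral_count_space_nat)
qed

text \<open>A Schur test valid for every \<open>q > 0\<close>: since the kernel decays geometrically off the diagonal, half of
  the decay bounds the sum by its largest term, and the power \<open>q\<close> of that is at most a sum of powers.\<close>

lemma schur_powr:
  fixes E :: "nat \<Rightarrow> nat \<Rightarrow> real" and w :: "nat \<Rightarrow> real"
  assumes q: "0 < q" and \<theta>: "0 < \<theta>" "\<theta> < 1" and B: "0 < B" and w: "\<And>k. 0 < w k" and E0: "\<And>K k. 0 \<le> E K k"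
    and E: "\<And>K k. E K k powr q * w K \<le> B * \<theta> ^ ndist K k * w k"
  shows "\<exists>C>0. \<forall>x F. (\<forall>k. 0 \<le> x k) \<longrightarrow> (\<forall>K. finite (F K)) \<longrightarrow>
    (\<Sum>K. ennreal ((\<Sum>k\<in>F K. E K k * x k) powr q * w K)) \<le> ennreal C * (\<Sum>k. ennreal (x k powr q * w k))"
proof -
  \<comment> \<open>Chosen so that \<open>\<tau> powr q = sqrt \<theta>\<close>. The powers of
    \<tau> pay for replacing the sum by its largest term, and the other half of the decay is kept
    for the summation over \<open>K\<close>.\<close>
  define \<tau> where "\<tau> = \<theta> powr (1 / (2 * q))"
  have \<tau>: "0 < \<tau>" "\<tau> < 1" using \<theta> q powr_less_mono2[of "1 / (2 * q)" \<theta> 1] by (auto simp: \<tau>_def)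
  define \<phi> where "\<phi> = sqrt \<theta>"
  have \<phi>: "0 < \<phi>" "\<phi> < 1" "\<phi> * \<phi> = \<theta>" using \<theta> by (auto simp: \<phi>_def)
  have \<tau>q: "(\<tau> ^ d) powr q = \<phi> ^ d" for d
  proof -
    have "\<tau> powr q = \<phi>" using \<theta> q by (simp add: \<tau>_def \<phi>_def powr_powr powr_half_sqrt)
    moreover have "(\<tau> ^ d) powr q = (\<tau> powr q) ^ d"
      using \<tau> by (simp add: powr_realpow[symmetric] powr_powr mult.commute)
    ultimately show ?thesis by simp
  qed
  define S where "S = 2 / (1 - \<tau>)"
  have S: "0 < S" using \<tau> by (simp add: S_def)
  have main: "ennreal ((\<Sum>k\<in>I. E K k * x k) powr q * w K) \<le> (\<Sum>k. ennreal (S powr q * B * \<phi> ^ ndist K k * (x k powr q * w k)))"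
    if x: "\<And>k. 0 \<le> x k" and I: "finite I" for I K x
  proof (cases "I = {}")
    case False
    define v where "v k = E K k * x k / \<tau> ^ ndist K k" for k
    have v0: "0 \<le> v k" for k unfolding v_def using E0 x \<tau> by simp
    obtain k0 where k0: "k0 \<in> I" "\<And>k. k \<in> I \<Longrightarrow> v k \<le> v k0"
    proof -
      have "Max (v ` I) \<in> v ` I" using I False by (intro Max_in) auto
      then obtain k0 where "k0 \<in> I" "v k0 = Max (v ` I)" by auto
      then show thesis using that[of k0] I by auto
    qed
    have "(\<Sum>k\<in>I. E K k * x k) = (\<Sum>k\<in>I. \<tau> ^ ndist K k * v k)" using \<tau> by (simp add: v_def)
    also have "\<dots> \<le> (\<Sum>k\<in>I. \<tau> ^ ndist K k * v k0)" using \<tau> k0 by (intro sum_mono mult_left_mono) auto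
    also have "\<dots> = (\<Sum>k\<in>I. \<tau> ^ ndist K k) * v k0" by (simp add: sum_distrib_right)
    also have "\<dots> \<le> S * v k0" unfolding S_def by (intro mult_right_mono sum_power_ndist \<tau> I v0)
    finally have "(\<Sum>k\<in>I. E K k * x k) powr q \<le> (S * v k0) powr q"
      using q E0 x by (intro powr_mono2) (auto intro!: sum_nonneg)
    also have "\<dots> = S powr q * v k0 powr q" using S v0 by (simp add: powr_mult)
    also have "v k0 powr q = E K k0 powr q * x k0 powr q / \<phi> ^ ndist K k0"
      unfolding v_def using E0 x \<tau> by (simp add: powr_divide powr_mult \<tau>q)
    finally have "(\<Sum>k\<in>I. E K k * x k) powr q * w K \<le> S powr q * (E K k0 powr q * x k0 powr q / \<phi> ^ ndist K k0) * w K"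
      using w[of K] by (intro mult_right_mono) auto
    also have "\<dots> = S powr q * x k0 powr q / \<phi> ^ ndist K k0 * (E K k0 powr q * w K)" by simp
    also have "\<dots> \<le> S powr q * x k0 powr q / \<phi> ^ ndist K k0 * (B * \<theta> ^ ndist K k0 * w k0)"
      using \<phi> by (intro mult_left_mono E) auto
    also have "\<theta> ^ ndist K k0 = \<phi> ^ ndist K k0 * \<phi> ^ ndist K k0" by (simp only: \<phi>(3)[symmetric] power_mult_distrib)
    also have "S powr q * x k0 powr q / \<phi> ^ ndist K k0 * (B * (\<phi> ^ ndist K k0 * \<phi> ^ ndist K k0) * w k0) = S powr q * B * \<phi> ^ ndist K k0 * (x k0 powr q * w k0)"
      using \<phi> by simp
    finally have "ennreal ((\<Sum>k\<in>I. E K k * x k) powr q * w K) \<le> ennreal (S powr q * B * \<phi> ^ ndist K k0 * (x k0 powr q * w k0))"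
      by (rule ennreal_leI)
    also have "\<dots> \<le> (\<Sum>k. ennreal (S powr q * B * \<phi> ^ ndist K k * (x k powr q * w k)))"
      by (rule term_le_suminf)
    finally show ?thesis .
  qed simp
  define D where "D = S powr q * B * (2 / (1 - \<phi>))"
  have D: "0 < D" unfolding D_def using S B \<phi> by simp
  have "(\<Sum>K. ennreal ((\<Sum>k\<in>F K. E K k * x k) powr q * w K)) \<le> ennreal D * (\<Sum>k. ennreal (x k powr q * w k))"
    if x: "\<And>k. 0 \<le> x k" and F: "\<And>K. finite (F K)" for x F
  proof -
    have "(\<Sum>K. ennreal ((\<Sum>k\<in>F K. E K k * x k) powr q * w K)) \<le> (\<Sum>K. \<Sum>k. ennreal (S powr q * B * \<phi> ^ ndist K k * (x k powr q * w k)))"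
      by (intro suminf_le main x F) auto
    also have "\<dots> = (\<Sum>k. \<Sum>K. ennreal (S powr q * B * \<phi> ^ ndist K k * (x k powr q * w k)))" by (rule suminf_swap_ennreal)
    also have "\<dots> = (\<Sum>k. ennreal (S powr q * B * (x k powr q * w k)) * (\<Sum>K. ennreal (\<phi> ^ ndist K k)))"
    proof (intro suminf_cong)
      fix k
      have "ennreal (S powr q * B * \<phi> ^ ndist K k * (x k powr q * w k)) = ennreal (S powr q * B * (x k powr q * w k)) * ennreal (\<phi> ^ ndist K k)" for K
        using B w[of k] \<phi> by (subst ennreal_mult[symmetric]) (auto simp: mult_ac less_imp_le)
      then show "(\<Sum>K. ennreal (S powr q * B * \<phi> ^ ndist K k * (x k powr q * w k))) = ennreal (S powr q * B * (x k powr q * w k)) * (\<Sum>K. ennreal (\<phi> ^ ndist K k))"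
        by simp
    qed
    also have "\<dots> \<le> (\<Sum>k. ennreal (S powr q * B * (x k powr q * w k)) * ennreal (2 / (1 - \<phi>)))"
      by (intro suminf_le mult_left_mono suminf_power_ndist \<phi>) auto
    also have "\<dots> = (\<Sum>k. ennreal D * ennreal (x k powr q * w k))"
    proof (intro suminf_cong)
      fix k
      show "ennreal (S powr q * B * (x k powr q * w k)) * ennreal (2 / (1 - \<phi>)) = ennreal D * ennreal (x k powr q * w k)"
        unfolding D_def using B w[of k] \<phi> by (subst (1 2) ennreal_mult[symmetric]) (auto simp: mult_ac less_imp_le)
    qed
    also have "\<dots> = ennreal D * (\<Sum>k. ennreal (x k powr q * w k))" by (rule ennreal_suminf_cmult)
    finally show ?thesis .
  qed
  then show ?thesis using D by blast
qed

text \<open>The instance of \<open>schur_powr\<close> with the kernel 1 for \<open>k \<le> K\<close>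
  and 0 otherwise; the halving of the weight supplies the decay off the diagonal.\<close>

lemma hardy_powr:
  fixes w :: "nat \<Rightarrow> real"
  assumes q: "0 < q" and w: "\<And>k. 0 < w k" "\<And>k. w (Suc k) \<le> w k / 2"
  shows "\<exists>C>0. \<forall>x. (\<forall>k. 0 \<le> x k) \<longrightarrow>
    (\<Sum>K. ennreal ((\<Sum>k\<le>K. x k) powr q * w K)) \<le> ennreal C * (\<Sum>k. ennreal (x k powr q * w k))"
proof -
  have decay: "w (k + i) \<le> (1 / 2) ^ i * w k" for k i
  proof (induction i)
    case (Suc i)
    show ?case using w(2)[of "k + i"] Suc by simp
  qed simp
  define E :: "nat \<Rightarrow> nat \<Rightarrow> real" where "E K k = (if k \<le> K then 1 else 0)" for K k
  have "\<exists>C>0. \<forall>x F. (\<forall>k. 0 \<le> x k) \<longrightarrow> (\<forall>K. finite (F K)) \<longrightarrow>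
    (\<Sum>K. ennreal ((\<Sum>k\<in>F K. E K k * x k) powr q * w K)) \<le> ennreal C * (\<Sum>k. ennreal (x k powr q * w k))"
  proof (rule schur_powr[of q "1 / 2" 1 w E])
    fix K k
    show "E K k powr q * w K \<le> 1 * (1 / 2) ^ ndist K k * w k"
      using decay[of k "K - k"] w(1)[of k] by (auto simp: E_def)
  qed (use q w in \<open>auto simp: E_def\<close>)
  then obtain C where C: "C > 0" and *: "\<And>x F. (\<forall>k. 0 \<le> x k) \<Longrightarrow> (\<forall>K. finite (F K)) \<Longrightarrow>
    (\<Sum>K. ennreal ((\<Sum>k\<in>F K. E K k * x k) powr q * w K)) \<le> ennreal C * (\<Sum>k. ennreal (x k powr q * w k))" by blast
  have "(\<Sum>k\<in>{..K}. E K k * x k) = (\<Sum>k\<le>K. x k)" for K x by (intro sum.cong) (auto simp: E_def)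
  then show ?thesis using *[where F = "\<lambda>K. {..K}"] C by auto
qed

section \<open>Power series and measures on the radius\<close>

lemma taylor_coeff_sums:
  assumes "\<And>z. norm z < 1 \<Longrightarrow> (\<lambda>n. a n * z ^ n) sums f z"
  shows "taylor_coeff f n = a n"
proof -
  have "eventually (\<lambda>u. u \<in> ball 0 1) (nhds (0::complex))" by (intro eventually_nhds_in_open) auto
  then have "f has_fps_expansion Abs_fps a"
    by (intro has_fps_expansionI) (auto elim!: eventually_mono intro: assms)
  then show ?thesis unfolding taylor_coeff_def by (metis fps_nth_fps_expansion fps_nth_Abs_fps)
qed

lemma holomorphic_sums:
  assumes "\<And>z. norm z < 1 \<Longrightarrow> (\<lambda>n. a n * z ^ n) sums f z"
  shows "f holomorphic_on ball 0 1"
  by (rule power_series_holomorphic[of 0 1 a]) (use assms in simp)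

lemma sums_holomorphic:
  assumes "f holomorphic_on ball 0 1" "norm z < 1"
  shows "(\<lambda>n. (deriv ^^ n) f 0 / fact n * z ^ n) sums f z"
  using holomorphic_power_series[OF assms(1), of z] assms(2) by simp

lemma summable_norm_sums:
  fixes a :: "nat \<Rightarrow> complex"
  assumes "\<And>z. norm z < 1 \<Longrightarrow> (\<lambda>n. a n * z ^ n) sums f z" "norm z < 1"
  shows "summable (\<lambda>n. norm (a n * z ^ n))"
proof -
  obtain r where r: "norm z < r" "r < 1" using dense[OF assms(2)] by blast
  have r0: "0 < r" using r(1) norm_ge_zero[of z] by linarith
  have "summable (\<lambda>n. a n * complex_of_real r ^ n)"
    using assms(1)[of "complex_of_real r"] r r0 by (auto simp: sums_iff)
  then show ?thesis by (rule powser_insidea) (use r r0 in simp)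
qed

locale disc_measure =
  fixes \<mu> :: "real measure"
  assumes \<mu>: "\<mu> \<in> M_plus"
begin

sublocale finite_measure \<mu> using \<mu> by (simp add: M_plus_def)

lemma sets_\<mu>: "sets \<mu> = sets (restrict_space borel {0..<1::real})" using \<mu> by (simp add: M_plus_def)

lemma space_\<mu>: "space \<mu> = {0..<1}" using sets_eq_imp_space_eq[OF sets_\<mu>] by (simp add: space_restrict_space)

lemma sets_\<mu>_I: "A \<in> sets borel \<Longrightarrow> A \<subseteq> {0..<1} \<Longrightarrow> A \<in> sets \<mu>"
  unfolding sets_\<mu> by (auto simp: sets_restrict_space image_iff)

lemma dI_\<mu> [measurable]: "dI k \<in> sets \<mu>"
  using UN_dI by (intro sets_\<mu>_I) auto

lemma dy_\<mu> [measurable]: "{dy k..<1} \<in> sets \<mu>"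
  by (rule sets_\<mu>_I) (use dy_nonneg[of k] in \<open>auto simp del: dy_nonneg\<close>)

lemma measurable_\<mu>_continuous:
  fixes f :: "real \<Rightarrow> 'b::topological_space"
  assumes "continuous_on {0..<1} f" shows "f \<in> borel_measurable \<mu>"
  using borel_measurable_continuous_on_restrict[OF assms] measurable_cong_sets[OF sets_\<mu> refl] by blast

definition U :: "nat \<Rightarrow> real" where "U k = measure \<mu> {dy k..<1}"

lemma U_hat: "U k = measure_hat \<mu> (dy k)" by (simp add: U_def measure_hat_def)

lemma U_nonneg: "0 \<le> U k" by (simp add: U_def)

lemma hat_antimono: "0 \<le> r \<Longrightarrow> r \<le> s \<Longrightarrow> measure_hat \<mu> s \<le> measure_hat \<mu> r"
  unfolding measure_hat_def by (intro finite_measure_mono sets_\<mu>_I) auto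

lemma dI_le_U: "measure \<mu> (dI k) \<le> U k"
  unfolding U_def by (rule finite_measure_mono) (auto simp: dI_def less_imp_le)

text \<open>The estimate \<open>norm (a n * (t * z) ^ n) \<le> norm (a n * z ^ n)\<close> is uniform
  in \<open>t\<close> and permits integration term by term. For the kernel this gives the
  coefficients of the fundamental function; for the product of \<open>f\<close> with the kernel it
  gives the holomorphy of the image.\<close>

lemma sums_integral_disc:
  assumes F: "\<And>z. norm z < 1 \<Longrightarrow> (\<lambda>n. a n * z ^ n) sums F z" and z: "norm z < 1"
  shows "(\<lambda>n. a n * complex_of_real (measure_moment \<mu> n) * z ^ n) sums (LINT t|\<mu>. F (complex_of_real t * z))"
proof -
  have sn: "summable (\<lambda>n. norm (a n * z ^ n))" by (rule summable_norm_sums[OF F z])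
  have meas: "(\<lambda>t. a n * (complex_of_real t * z) ^ n) \<in> borel_measurable \<mu>" for n
    by (intro measurable_\<mu>_continuous continuous_intros)
  have le: "norm (a n * (complex_of_real t * z) ^ n) \<le> norm (a n * z ^ n)" if "t \<in> space \<mu>" for t n
  proof -
    have "t ^ n \<le> 1" "0 \<le> t" using that by (auto simp: space_\<mu> power_le_one)
    then show ?thesis by (simp add: norm_mult norm_power power_mult_distrib mult_left_le_one_le mult_left_mono)
  qed
  have int: "integrable \<mu> (\<lambda>t. a n * (complex_of_real t * z) ^ n)" for n
    by (rule integrable_const_bound[OF _ meas]) (use le in \<open>auto intro!: AE_I2\<close>)
  have "(\<lambda>n. LINT t|\<mu>. a n * (complex_of_real t * z) ^ n) sums (LINT t|\<mu>. (\<Sum>n. a n * (complex_of_real t * z) ^ n))"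
  proof (rule sums_integral[OF int])
    show "AE t in \<mu>. summable (\<lambda>n. norm (a n * (complex_of_real t * z) ^ n))"
      by (intro AE_I2 summable_comparison_test_ev[OF _ sn] always_eventually allI) (use le in simp)
    have nle: "(LINT t|\<mu>. norm (a n * (complex_of_real t * z) ^ n)) \<le> (LINT t|\<mu>. norm (a n * z ^ n))" for n
      by (intro integral_mono integrable_norm int le) simp
    then show "summable (\<lambda>n. LINT t|\<mu>. norm (a n * (complex_of_real t * z) ^ n))"
      by (intro summable_comparison_test_ev[OF _ summable_mult[OF sn, of "measure \<mu> (space \<mu>)"]] always_eventually allI)
        (simp add: integral_nonneg_AE)
  qed
  moreover have "(LINT t|\<mu>. a n * (complex_of_real t * z) ^ n) = a n * complex_of_real (measure_moment \<mu> n) * z ^ n" for n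
  proof -
    have "(LINT t|\<mu>. a n * (complex_of_real t * z) ^ n) = (LINT t|\<mu>. (a n * z ^ n) * complex_of_real (t ^ n))"
      by (intro Bochner_Integration.integral_cong) (auto simp: power_mult_distrib)
    also have "\<dots> = (a n * z ^ n) * complex_of_real (measure_moment \<mu> n)"
      unfolding measure_moment_def by (simp add: integral_complex_of_real del: of_real_power)
    finally show ?thesis by (simp only: mult_ac)
  qed
  moreover have "(LINT t|\<mu>. (\<Sum>n. a n * (complex_of_real t * z) ^ n)) = (LINT t|\<mu>. F (complex_of_real t * z))"
  proof (intro Bochner_Integration.integral_cong refl)
    fix t assume "t \<in> space \<mu>"
    then have "norm (complex_of_real t * z) < 1" using z by (auto simp: space_\<mu> norm_mult intro: le_less_trans[OF mult_left_le_one_le])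
    then show "(\<Sum>n. a n * (complex_of_real t * z) ^ n) = F (complex_of_real t * z)" using F sums_unique by metis
  qed
  ultimately show ?thesis by (simp only:)
qed

lemma measure_moment_nonneg: "0 \<le> measure_moment \<mu> n"
  unfolding measure_moment_def by (intro integral_nonneg_AE AE_I2) (auto simp: space_\<mu>)

lemma measure_moment_ennreal: "ennreal (measure_moment \<mu> n) = (\<integral>\<^sup>+x\<in>{0..<1}. ennreal (x ^ n) \<partial>\<mu>)"
proof -
  have m: "(\<lambda>t. t ^ n) \<in> borel_measurable \<mu>" by (intro measurable_\<mu>_continuous continuous_intros)
  have "integrable \<mu> (\<lambda>t. t ^ n)"
    by (rule integrable_const_bound[OF _ m, of 1]) (auto intro!: AE_I2 simp: space_\<mu> power_abs power_le_one)
  then have "(\<integral>\<^sup>+x. ennreal (x ^ n) \<partial>\<mu>) = ennreal (measure_moment \<mu> n)"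
    unfolding measure_moment_def by (intro nn_integral_eq_integral) (auto intro!: AE_I2 simp: space_\<mu>)
  moreover have "(\<integral>\<^sup>+x\<in>{0..<1}. ennreal (x ^ n) \<partial>\<mu>) = (\<integral>\<^sup>+x. ennreal (x ^ n) \<partial>\<mu>)"
    by (intro nn_integral_cong) (auto simp: space_\<mu>)
  ultimately show ?thesis by simp
qed

lemma measure_moment_antimono: "m \<le> n \<Longrightarrow> measure_moment \<mu> n \<le> measure_moment \<mu> m"
proof -
  assume mn: "m \<le> n"
  have "ennreal (measure_moment \<mu> n) \<le> ennreal (measure_moment \<mu> m)"
    unfolding measure_moment_ennreal
    by (intro nn_integral_mono) (auto simp: space_\<mu> intro!: ennreal_leI power_decreasing mn)
  then show ?thesis by (simp add: measure_moment_nonneg)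
qed

lemma measure_moment_lower: assumes "n + 1 \<le> 2 ^ k" shows "U k \<le> 3 * measure_moment \<mu> n"
proof -
  have "ennreal (1 / 3) * ennreal (U k) = (\<integral>\<^sup>+x. ennreal (1 / 3) * indicator {dy k..<1} x \<partial>\<mu>)"
    by (subst nn_integral_cmult_indicator) (auto simp: U_def emeasure_eq_measure)
  also have "\<dots> \<le> ennreal (measure_moment \<mu> n)"
    unfolding measure_moment_ennreal
  proof (rule nn_integral_mono)
    fix x assume "x \<in> space \<mu>"
    moreover have "1 / 3 \<le> x ^ n" if "dy k \<le> x"
      using dy_power_lower[OF assms] power_mono[OF that, of n] by simp
    ultimately show "ennreal (1 / 3) * indicator {dy k..<1} x \<le> ennreal (x ^ n) * indicator {0..<1} x"
      by (auto simp: indicator_def space_\<mu> intro!: ennreal_leI)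
  qed
  finally have "1 / 3 * U k \<le> measure_moment \<mu> n"
    by (subst (asm) ennreal_mult[symmetric]) (auto simp: U_nonneg measure_moment_nonneg)
  then show ?thesis by simp
qed

text \<open>In contrast to \<open>moment_upper\<close> the sum cannot be collapsed, since the tails
  of \<mu> need not be doubling. For the same reason \<open>M\<close> stays free: it has to be
  fitted to whatever bound on the tails is available later.\<close>

lemma measure_moment_upper:
  assumes "2 ^ k \<le> n + 1"
  shows "measure_moment \<mu> n \<le> (\<Sum>j<k. (2 * real M) ^ M * (2 ^ j / 2 ^ k) ^ M * U j) + U k"
proof -
  have "ennreal (measure_moment \<mu> n) \<le> (\<Sum>j<k. ennreal ((2 * real M) ^ M * (2 ^ j / 2 ^ k) ^ M) * emeasure \<mu> (dI j)) + emeasure \<mu> {dy k..<1}"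
    unfolding measure_moment_ennreal by (rule nn_integral_power_split[OF _ _ assms]) auto
  also have "\<dots> \<le> (\<Sum>j<k. ennreal ((2 * real M) ^ M * (2 ^ j / 2 ^ k) ^ M) * ennreal (U j)) + ennreal (U k)"
    using dI_le_U by (intro add_mono sum_mono mult_left_mono) (auto simp: emeasure_eq_measure U_def ennreal_leI)
  also have "\<dots> = ennreal ((\<Sum>j<k. (2 * real M) ^ M * (2 ^ j / 2 ^ k) ^ M * U j) + U k)"
  proof -
    have "(\<Sum>j<k. ennreal ((2 * real M) ^ M * (2 ^ j / 2 ^ k) ^ M) * ennreal (U j)) = ennreal (\<Sum>j<k. (2 * real M) ^ M * (2 ^ j / 2 ^ k) ^ M * U j)"
      using U_nonneg by (subst sum_ennreal[symmetric]) (auto simp: ennreal_mult intro!: sum.cong)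
    then show ?thesis using U_nonneg
      by (subst ennreal_plus) (auto intro!: sum_nonneg)
  qed
  finally show ?thesis
    using U_nonneg by (subst (asm) ennreal_le_iff) (auto intro!: add_nonneg_nonneg sum_nonneg)
qed

end

section \<open>The Cesaro-type operator\<close>

text \<open>The operator sees \<omega> only through its moments, so \<omega> is represented by its
  profile \<open>ho\<close>. The weight \<nu> is also kept as a function on the disc, for the
  integrals in the norms.\<close>

locale cesaro_setting = reg_weight h C \<nu> L c + om: doubling ho Co
  for h C \<nu> L c ho Co +
  fixes \<omega> :: "complex \<Rightarrow> real"
  assumes om_moment: "weight_moment \<omega> n = moment ho n"
    and nu_nonneg: "z \<in> ball 0 1 \<Longrightarrow> 0 \<le> \<nu> z"
    and nu_measurable [measurable]: "(\<lambda>z. ennreal (\<nu> z) * indicator (ball 0 1) z) \<in> borel_measurable lebesgue"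
begin

lemma kernel_G: "kernel \<omega> t z = om.G (complex_of_real t * z)"
proof -
  have "x / complex_of_real (2 * w) = complex_of_real (1 / (2 * w)) * x" for x w by simp
  then show ?thesis unfolding kernel_def om.G_def om.kc_def om_moment by (simp only:)
qed

lemma G_sums: "norm z < 1 \<Longrightarrow> (\<lambda>n. complex_of_real (om.kc n) * z ^ n) sums om.G z"
proof -
  assume z: "norm z < 1"
  have "summable (\<lambda>n. complex_of_real (om.kc n) * z ^ n)"
    by (rule summable_norm_cancel) (use om.summable_kc[of "norm z"] z om.kc_pos in \<open>simp add: norm_mult norm_power less_imp_le\<close>)
  then show ?thesis unfolding om.G_def by (rule summable_sums)
qed

lemma G_holomorphic: "om.G holomorphic_on ball 0 1"
  by (rule holomorphic_sums[OF G_sums])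

lemma cesaro_eq: "cesaro_op \<mu> \<omega> f z = (LINT t|\<mu>. f (complex_of_real t * z) * om.G (complex_of_real t * z))"
  unfolding cesaro_op_def kernel_G ..

lemma cesaro_holomorphic:
  assumes \<mu>: "\<mu> \<in> M_plus" and f: "f holomorphic_on ball 0 1"
  shows "cesaro_op \<mu> \<omega> f holomorphic_on ball 0 1"
proof -
  interpret disc_measure \<mu> by unfold_locales (rule \<mu>)
  define F where "F z = f z * om.G z" for z
  have F: "F holomorphic_on ball 0 1" unfolding F_def by (intro holomorphic_intros f G_holomorphic)
  show ?thesis
    unfolding cesaro_eq F_def[symmetric]
    by (rule holomorphic_sums[OF sums_integral_disc[OF sums_holomorphic[OF F]]])
qed

lemma fundamental_sums:
  assumes \<mu>: "\<mu> \<in> M_plus" and z: "norm z < 1"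
  shows "(\<lambda>n. complex_of_real (om.kc n * measure_moment \<mu> n) * z ^ n) sums fundamental_fun \<mu> \<omega> z"
proof -
  interpret disc_measure \<mu> by unfold_locales (rule \<mu>)
  show ?thesis
    unfolding fundamental_fun_def cesaro_eq using sums_integral_disc[OF G_sums z] by simp
qed

lemma fp_bint: "bint p f = (\<integral>\<^sup>+z\<in>ball 0 1. ennreal (norm (f z) powr p * \<nu> z) \<partial>lebesgue)"
  unfolding bint_def by (intro nn_integral_cong) (auto simp: fp_def indicator_def ennreal_mult nu_nonneg)

lemma kd_mono2: "K \<le> k \<Longrightarrow> 2 ^ (k - K) * om.kd K \<le> om.kd k"
proof -
  assume Kk: "K \<le> k"
  have "2 ^ (k - K) * om.kd K = 2 ^ k / om.W K" using Kk by (simp add: om.kd_def power_diff)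
  also have "\<dots> \<le> 2 ^ k / om.W k" using om.W_antimono[OF Kk] om.W_pos by (intro divide_left_mono) auto
  finally show ?thesis by (simp add: om.kd_def)
qed

lemma kd_Suc: "om.kd (Suc k) \<le> 2 * Co * om.kd k"
proof -
  have "om.W k \<le> Co * om.W (Suc k)" by (rule om.W_double)
  then have "1 / om.W (Suc k) \<le> Co / om.W k" using om.W_pos by (simp add: field_simps)
  then have "2 * 2 ^ k * (1 / om.W (Suc k)) \<le> 2 * 2 ^ k * (Co / om.W k)" by (intro mult_left_mono) auto
  then show ?thesis by (simp add: om.kd_def mult_ac)
qed

definition KB :: real where
  "KB = (SOME B. B > 0 \<and> (\<forall>k z. norm z < 1 \<longrightarrow> 1 / 2 ^ k \<le> norm (1 - z) \<longrightarrow> norm (om.G z) \<le> B * om.kd k))"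

lemma KB: "KB > 0" "norm z < 1 \<Longrightarrow> 1 / 2 ^ k \<le> norm (1 - z) \<Longrightarrow> norm (om.G z) \<le> KB * om.kd k"
  using someI_ex[of "\<lambda>B. B > 0 \<and> (\<forall>k z. norm z < 1 \<longrightarrow> 1 / 2 ^ k \<le> norm (1 - z) \<longrightarrow> norm (om.G z) \<le> B * om.kd k)"]
    om.kernel_upper unfolding KB_def by blast+

text \<open>The second bound follows from the first by
  \<open>1 - z = (1 - t * z) - (1 - t) * z\<close>. Together they keep \<open>t * z\<close> away
  from 1 by a multiple of the larger of \<open>1 - t\<close> and
  \<open>norm (1 - z)\<close>.\<close>

lemma norm_one_minus_tz:
  fixes z :: complex
  assumes z: "norm z < 1" and t: "0 \<le> t" "t < 1"
  shows "1 - t \<le> norm (1 - complex_of_real t * z)" "norm (1 - z) \<le> 2 * norm (1 - complex_of_real t * z)" "norm (complex_of_real t * z) < 1"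
proof -
  have tz: "t * norm z \<le> t" using z t by (intro mult_left_le) auto
  then show 1: "1 - t \<le> norm (1 - complex_of_real t * z)"
    using norm_triangle_ineq2[of 1 "complex_of_real t * z"] t by (simp add: norm_mult)
  have "1 - z = (1 - complex_of_real t * z) - complex_of_real (1 - t) * z" by (simp add: algebra_simps)
  then have "norm (1 - z) \<le> norm (1 - complex_of_real t * z) + norm (complex_of_real (1 - t) * z)" by (metis norm_triangle_ineq4)
  also have "norm (complex_of_real (1 - t) * z) \<le> 1 - t" using z t by (simp add: norm_mult mult_left_le del: of_real_diff)
  finally show "norm (1 - z) \<le> 2 * norm (1 - complex_of_real t * z)" using 1 by simp
  show "norm (complex_of_real t * z) < 1" using tz t by (simp add: norm_mult)
qed

definition CB :: real where "CB = KB * (2 * Co)"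

lemma CB_pos: "0 < CB" unfolding CB_def using KB(1) om.C_ge_1 by simp

text \<open>The kernel is bounded one level deeper than stated: the extra level comes from the right
  end of \<open>dI k\<close> or from the factor 2 in \<open>norm_one_minus_tz\<close>, and
  \<open>kd_Suc\<close> removes it at the cost of a constant.\<close>

lemma G_dI:
  assumes z: "norm z < 1" and t: "t \<in> dI k"
  shows "norm (om.G (complex_of_real t * z)) \<le> CB * om.kd (min k (lev z))"
proof -
  have t01: "0 \<le> t" "t < 1" using t UN_dI by auto
  have k: "1 / 2 ^ Suc k \<le> 1 - t" using t by (simp add: dI_def dy_def)
  note nz = norm_one_minus_tz[OF z t01]
  define j where "j = min k (lev z)"
  have "1 / 2 ^ Suc j \<le> norm (1 - complex_of_real t * z)"
  proof (cases "k \<le> lev z")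
    case True then show ?thesis using k nz(1) by (simp add: j_def min_def)
  next
    case False then show ?thesis using lev_bounds(1)[OF z] nz(2) by (simp add: j_def min_def)
  qed
  then have "norm (om.G (complex_of_real t * z)) \<le> KB * om.kd (Suc j)" using nz(3) by (intro KB(2))
  also have "\<dots> \<le> KB * (2 * Co * om.kd j)" using KB(1) by (intro mult_left_mono kd_Suc) auto
  finally show ?thesis by (simp add: CB_def j_def mult_ac)
qed

lemma cesaro_bound:
  assumes \<mu>: "\<mu> \<in> M_plus" and f: "f holomorphic_on ball 0 1" and z: "norm z < 1"
    and a: "\<And>k. 0 \<le> a k" "\<And>k t. t \<in> dI k \<Longrightarrow> norm (f (complex_of_real t * z)) \<le> a k"
  shows "ennreal (norm (cesaro_op \<mu> \<omega> f z)) \<le> (\<Sum>k. ennreal (CB * om.kd (min k (lev z)) * measure \<mu> (dI k) * a k))"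
proof -
  interpret disc_measure \<mu> by unfold_locales (rule \<mu>)
  define g where "g t = f (complex_of_real t * z) * om.G (complex_of_real t * z)" for t
  have "continuous_on {0..<1} g"
  proof -
    have im: "(\<lambda>t. complex_of_real t * z) ` {0..<1} \<subseteq> ball 0 1"
      using norm_one_minus_tz(3)[OF z] by auto
    show ?thesis unfolding g_def
      by (intro continuous_intros continuous_on_compose2[OF holomorphic_on_imp_continuous_on[OF f] _ im]
        continuous_on_compose2[OF holomorphic_on_imp_continuous_on[OF G_holomorphic] _ im])
  qed
  then have [measurable]: "g \<in> borel_measurable \<mu>" by (rule measurable_\<mu>_continuous)
  have "ennreal (norm (cesaro_op \<mu> \<omega> f z)) \<le> (\<integral>\<^sup>+t. ennreal (norm (g t)) \<partial>\<mu>)"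
  proof (cases "integrable \<mu> g")
    case True
    then show ?thesis unfolding cesaro_eq g_def[symmetric] by (rule integral_norm_bound_ennreal)
  next
    \<comment> \<open>For a nonintegrable integrand the Bochner integral is 0 by convention, so the
      bound holds trivially and integrability need not be shown.\<close>
    case False
    then show ?thesis unfolding cesaro_eq g_def[symmetric] by (simp add: not_integrable_integral_eq)
  qed
  also have "\<dots> = (\<integral>\<^sup>+t\<in>{0..<1}. ennreal (norm (g t)) \<partial>\<mu>)"
    by (intro nn_integral_cong) (simp add: space_\<mu>)
  also have "\<dots> = (\<Sum>k. \<integral>\<^sup>+t\<in>dI k. ennreal (norm (g t)) \<partial>\<mu>)"
    by (rule nn_integral_dI) auto
  also have "\<dots> \<le> (\<Sum>k. ennreal (CB * om.kd (min k (lev z)) * measure \<mu> (dI k) * a k))"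
  proof (intro suminf_le)
    fix k
    have ck: "0 \<le> CB * om.kd (min k (lev z))" using CB_pos om.kd_pos[of "min k (lev z)"] by simp
    have "(\<integral>\<^sup>+t\<in>dI k. ennreal (norm (g t)) \<partial>\<mu>) \<le> (\<integral>\<^sup>+t. ennreal (a k * (CB * om.kd (min k (lev z)))) * indicator (dI k) t \<partial>\<mu>)"
    proof (rule nn_integral_mono)
      fix t
      show "ennreal (norm (g t)) * indicator (dI k) t \<le> ennreal (a k * (CB * om.kd (min k (lev z)))) * indicator (dI k) t"
      proof (cases "t \<in> dI k")
        case True
        have "norm (g t) \<le> a k * (CB * om.kd (min k (lev z)))"
          unfolding g_def norm_mult using a True by (intro mult_mono G_dI z) auto
        then show ?thesis using True by (simp add: ennreal_leI)
      qed simp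
    qed
    also have "\<dots> = ennreal (a k * (CB * om.kd (min k (lev z)))) * ennreal (measure \<mu> (dI k))"
      by (subst nn_integral_cmult_indicator) (auto simp: emeasure_eq_measure)
    also have "\<dots> = ennreal (CB * om.kd (min k (lev z)) * measure \<mu> (dI k) * a k)"
      using a(1)[of k] ck by (subst ennreal_mult[symmetric]) (auto simp: mult_ac)
    finally show "(\<integral>\<^sup>+t\<in>dI k. ennreal (norm (g t)) \<partial>\<mu>) \<le> ennreal (CB * om.kd (min k (lev z)) * measure \<mu> (dI k) * a k)" .
  qed auto
  finally show ?thesis .
qed

text \<open>The dyadic value of \<open>measure_hat \<mu> r / (weight_hat \<omega> r * (1 - r))\<close>: all conditions of the theorem
  are compared with norms of this sequence.\<close>

definition lam :: "real measure \<Rightarrow> nat \<Rightarrow> real" where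
  "lam \<mu> k = measure_hat \<mu> (dy k) * om.kd k"

lemma lam_nonneg: "0 \<le> lam \<mu> k"
  unfolding lam_def measure_hat_def using om.kd_pos[of k] by simp

text \<open>At a point of the radius the integrand is real and nonnegative, so the part
  \<open>t < dy k\<close> may be dropped. For \<open>t \<ge> dy k\<close> the argument
  \<open>t * dy k\<close> is at least \<open>(dy k)^2\<close>, where both \<open>r\<close> and the
  kernel are bounded below.\<close>

lemma cesaro_ge:
  assumes \<mu>: "\<mu> \<in> M_plus" and f: "f holomorphic_on ball 0 1"
    and r: "\<And>x. 0 \<le> x \<Longrightarrow> x < 1 \<Longrightarrow> f (complex_of_real x) = complex_of_real (r x)" "\<And>x. 0 \<le> x \<Longrightarrow> x < 1 \<Longrightarrow> 0 \<le> r x"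
    and b: "0 \<le> b" "\<And>x. (dy k)\<^sup>2 \<le> x \<Longrightarrow> x < 1 \<Longrightarrow> b \<le> r x"
  shows "b * lam \<mu> k / (36 * om.Bm * Co) \<le> norm (cesaro_op \<mu> \<omega> f (complex_of_real (dy k)))"
proof -
  interpret disc_measure \<mu> by unfold_locales (rule \<mu>)
  define y where "y = dy k"
  have y: "0 \<le> y" "y < 1" by (auto simp: y_def)
  define gr where "gr x = (\<Sum>n. om.kc n * x ^ n)" for x
  define g where "g t = r (t * y) * gr (t * y)" for t
  have ty: "0 \<le> t * y" "t * y < 1" if "t \<in> {0..<1}" for t
    using that y by (auto intro: le_less_trans[OF mult_left_le_one_le])
  have gc: "f (complex_of_real t * complex_of_real y) * om.G (complex_of_real t * complex_of_real y) = complex_of_real (g t)" if "t \<in> {0..<1}" for t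
    using r(1)[OF ty[OF that]] om.G_real[OF ty[OF that]] by (simp add: g_def gr_def)
  have gr0: "0 \<le> gr x" if "0 \<le> x" "x < 1" for x
    unfolding gr_def using that om.kc_pos by (intro suminf_nonneg om.summable_kc) (auto simp: less_imp_le)
  have g0: "0 \<le> g t" if "t \<in> {0..<1}" for t
    unfolding g_def using r(2)[OF ty[OF that]] gr0[OF ty[OF that]] by simp
  have im: "(\<lambda>t. complex_of_real t * complex_of_real y) ` {0..<1} \<subseteq> ball 0 1"
    using norm_one_minus_tz(3)[of "complex_of_real y"] y by auto
  have cont: "continuous_on {0..<1} (\<lambda>t. f (complex_of_real t * complex_of_real y) * om.G (complex_of_real t * complex_of_real y))"
    by (intro continuous_intros continuous_on_compose2[OF holomorphic_on_imp_continuous_on[OF f] _ im]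
        continuous_on_compose2[OF holomorphic_on_imp_continuous_on[OF G_holomorphic] _ im])
  have "continuous_on {0..<1} (\<lambda>t. Re (f (complex_of_real t * complex_of_real y) * om.G (complex_of_real t * complex_of_real y)))"
    by (intro continuous_on_Re cont)
  then have "continuous_on {0..<1} g" by (rule continuous_on_eq) (simp only: gc Re_complex_of_real)
  then have gm: "g \<in> borel_measurable \<mu>" by (rule measurable_\<mu>_continuous)
  have eq: "cesaro_op \<mu> \<omega> f (complex_of_real y) = complex_of_real (LINT t|\<mu>. g t)"
    unfolding cesaro_eq integral_complex_of_real[symmetric]
    by (intro Bochner_Integration.integral_cong) (auto simp: space_\<mu> gc)
  have cf: "continuous_on {0..1} (\<lambda>t. f (complex_of_real t * complex_of_real y) * om.G (complex_of_real t * complex_of_real y))"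
  proof -
    have im: "(\<lambda>t. complex_of_real t * complex_of_real y) ` {0..1} \<subseteq> ball 0 1"
      using y by (auto simp: norm_mult intro: le_less_trans[OF mult_left_le_one_le])
    show ?thesis
      by (intro continuous_intros continuous_on_compose2[OF holomorphic_on_imp_continuous_on[OF f] _ im]
        continuous_on_compose2[OF holomorphic_on_imp_continuous_on[OF G_holomorphic] _ im])
  qed
  have "compact ((\<lambda>t. f (complex_of_real t * complex_of_real y) * om.G (complex_of_real t * complex_of_real y)) ` {0..1})"
    by (rule compact_continuous_image[OF cf]) simp
  then have "bounded ((\<lambda>t. f (complex_of_real t * complex_of_real y) * om.G (complex_of_real t * complex_of_real y)) ` {0..1})"
    by (rule compact_imp_bounded)
  then obtain M where M': "\<forall>x\<in>(\<lambda>t. f (complex_of_real t * complex_of_real y) * om.G (complex_of_real t * complex_of_real y)) ` {0..1}. norm x \<le> M"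
    unfolding bounded_iff by blast
  have M: "norm (f (complex_of_real t * complex_of_real y) * om.G (complex_of_real t * complex_of_real y)) \<le> M" if "t \<in> {0..1}" for t
    using M' that by blast
  have gi: "integrable \<mu> g"
  proof (rule integrable_const_bound[OF _ gm, of M], intro AE_I2)
    fix t assume "t \<in> space \<mu>"
    then have t: "t \<in> {0..<1}" by (simp add: space_\<mu>)
    have "norm (complex_of_real (g t)) \<le> M" using M[of t] t unfolding gc[OF t] by auto
    then show "norm (g t) \<le> M" by simp
  qed
  have "b * lam \<mu> k / (36 * om.Bm * Co) = (b * (om.kd k / (36 * om.Bm * Co))) * measure \<mu> {dy k..<1}"
    by (simp add: lam_def measure_hat_def)
  also have "\<dots> = (LINT t|\<mu>. (b * (om.kd k / (36 * om.Bm * Co))) * indicator {dy k..<1} t)"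
    by (simp add: mult.commute)
  also have "\<dots> \<le> (LINT t|\<mu>. g t)"
  proof (rule integral_mono[OF _ gi])
    show "integrable \<mu> (\<lambda>t. (b * (om.kd k / (36 * om.Bm * Co))) * indicator {dy k..<1} t)"
      by (intro integrable_mult_right integrable_real_indicator) (auto simp: emeasure_eq_measure)
    fix t assume "t \<in> space \<mu>"
    then have t: "t \<in> {0..<1}" by (simp add: space_\<mu>)
    show "(b * (om.kd k / (36 * om.Bm * Co))) * indicator {dy k..<1} t \<le> g t"
    proof (cases "dy k \<le> t")
      case True
      have sq: "(dy k)\<^sup>2 \<le> t * y" using mult_right_mono[OF True y(1)] by (simp add: y_def power2_eq_square)
      have "om.kd k / (36 * om.Bm * Co) \<le> gr (t * y)"
        unfolding gr_def using sq ty[OF t] by (intro om.kernel_lower) auto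
      then have "b * (om.kd k / (36 * om.Bm * Co)) \<le> r (t * y) * gr (t * y)"
        using b sq ty[OF t] r(2) om.kd_pos[of k] om.Bm_pos om.C_ge_1 by (intro mult_mono) auto
      then show ?thesis using True t by (simp add: g_def)
    next
      case False then show ?thesis using g0[OF t] by simp
    qed
  qed
  also have "\<dots> \<le> norm (cesaro_op \<mu> \<omega> f (complex_of_real (dy k)))" unfolding y_def[symmetric] eq by simp
  finally show ?thesis .
qed

end

text \<open>The crude step \<open>u + v \<le> 2 * max u v\<close> keeps the inequality valid for
  exponents on both sides of 1.\<close>

lemma add_powr_le:
  fixes u v :: real
  assumes "0 \<le> u" "0 \<le> v" "0 < q"
  shows "(u + v) powr q \<le> 2 powr q * (u powr q + v powr q)"
proof -
  have "(u + v) powr q \<le> (2 * max u v) powr q" using assms by (intro powr_mono2) auto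
  also have "\<dots> = 2 powr q * max u v powr q" using assms by (simp add: powr_mult)
  also have "max u v powr q \<le> u powr q + v powr q" by (auto simp: max_def)
  finally show ?thesis by simp
qed

text \<open>Young's inequality without its sharp weights: both factors are simply replaced by the
  maximum.\<close>

lemma young_powr:
  fixes x y \<theta> :: real
  assumes "0 \<le> x" "0 \<le> y" "0 < \<theta>" "\<theta> < 1"
  shows "x powr \<theta> * y powr (1 - \<theta>) \<le> x + y"
proof -
  have "x powr \<theta> * y powr (1 - \<theta>) \<le> max x y powr \<theta> * max x y powr (1 - \<theta>)"
    using assms by (intro mult_mono powr_mono2) auto
  also have "\<dots> = max x y"
    using assms by (cases "max x y = 0") (simp_all add: powr_add[symmetric] max_def split: if_splits)
  also have "\<dots> \<le> x + y" using assms by simp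
  finally show ?thesis .
qed

lemma sums_split_geometric:
  fixes v :: real
  shows "(\<lambda>k. if k < K then u k else v * (1 / 2) ^ (k - K)) sums ((\<Sum>k<K. u k) + 2 * v)"
proof -
  define f where "f k = (if k < K then u k else v * (1 / 2) ^ (k - K))" for k
  have "(\<lambda>i. v * (1 / 2) ^ i) sums (v * (1 / (1 - 1 / 2)))" by (intro sums_mult geometric_sums) simp
  then have "(\<lambda>i. f (i + K)) sums (2 * v)" by (simp add: f_def mult.commute)
  then have "f sums (2 * v + (\<Sum>i<K. f i))" by (simp add: sums_iff_shift)
  moreover have "(\<Sum>i<K. f i) = (\<Sum>k<K. u k)" by (simp add: f_def)
  ultimately show ?thesis unfolding f_def by (simp add: add.commute)
qed

section \<open>Upper estimates for the operator\<close>

context cesaro_setting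
begin

text \<open>Real-valued versions of \<open>Amax\<close> and of the radial maximum.
  \<open>Amax\<close> is finite because it occurs in a finite sum with positive weight
  \<open>m k\<close>; \<open>T z\<close> is an attained maximum over a compact segment, hence real
  even where \<open>Smax\<close> might be infinite.\<close>

lemma majorants:
  assumes f: "f holomorphic_on ball 0 1" and p: "0 < p" and X: "0 < X" "bint p f \<le> ennreal X"
  obtains A T where "\<And>k. 0 \<le> A k" "\<And>k w. norm w \<le> dy (Suc k) \<Longrightarrow> norm (f w) powr p \<le> A k"
    "(\<Sum>k. ennreal (A k * m k)) \<le> ennreal (8 * Bs * X)" "\<And>k. A k \<le> 8 * Bs * X / m k"
    "\<And>z. 0 \<le> T z" "\<And>z t. norm z < 1 \<Longrightarrow> 0 \<le> t \<Longrightarrow> t \<le> 1 \<Longrightarrow> norm (f (complex_of_real t * z)) powr p \<le> T z"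
    "\<And>z. norm z < 1 \<Longrightarrow> ennreal (T z) \<le> Smax p f z"
proof -
  define A where "A k = enn2real (Amax p f k)" for k
  have sumA: "(\<Sum>k. Amax p f k * ennreal (m k)) \<le> ennreal (8 * Bs * X)"
  proof -
    have "(\<Sum>k. Amax p f k * ennreal (m k)) \<le> ennreal (8 * Bs) * bint p f" by (rule sum_Amax[OF f p])
    also have "\<dots> \<le> ennreal (8 * Bs) * ennreal X" by (intro mult_left_mono X) simp
    finally show ?thesis using Bs_nonneg X by (subst ennreal_mult) auto
  qed
  have Amk: "Amax p f k * ennreal (m k) \<le> ennreal (8 * Bs * X)" for k
    by (rule order_trans[OF term_le_suminf sumA])
  have Afin: "Amax p f k = ennreal (A k)" for k
  proof -
    have "Amax p f k \<noteq> \<infinity>"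
    proof
      assume "Amax p f k = \<infinity>"
      then have "Amax p f k * ennreal (m k) = \<infinity>" using m_pos[of k] by (simp add: ennreal_top_mult)
      then show False using Amk[of k] by (simp add: top_unique)
    qed
    then show ?thesis by (simp add: A_def less_top)
  qed
  have A0: "0 \<le> A k" for k by (simp add: A_def)
  have fw: "norm (f w) powr p \<le> A k" if "norm w \<le> dy (Suc k)" for k w
  proof -
    have "norm w < 1" using that dy_less_1[of "Suc k"] by linarith
    then have "ennreal (norm (f w) powr p) \<le> ennreal (A k)"
      using fp_le_Amax[OF f p that] by (simp add: fp_ball Afin)
    then show ?thesis using A0 by simp
  qed
  have Ale: "A k \<le> 8 * Bs * X / m k" for k
  proof -
    have "ennreal (A k * m k) \<le> ennreal (8 * Bs * X)"
      using Amk[of k] A0[of k] m_pos[of k] by (simp add: Afin ennreal_mult less_imp_le)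
    then have "A k * m k \<le> 8 * Bs * X" using Bs_nonneg X by simp
    then show ?thesis using m_pos[of k] by (simp add: field_simps)
  qed
  have "\<exists>T. 0 \<le> T \<and> (\<forall>t. 0 \<le> t \<and> t \<le> 1 \<longrightarrow> norm (f (complex_of_real t * z)) powr p \<le> T) \<and> ennreal T \<le> Smax p f z"
    if z: "norm z < 1" for z
  proof -
    have im: "(\<lambda>t. complex_of_real t * z) ` {0..1} \<subseteq> ball 0 1"
      by (auto simp: norm_mult intro!: le_less_trans[OF mult_left_le_one_le z])
    have "continuous_on {0..1} (\<lambda>t. norm (f (complex_of_real t * z)) powr p)"
      by (intro continuous_on_norm_powr continuous_on_compose2[OF holomorphic_on_imp_continuous_on[OF f] _ im] continuous_intros p)
    then obtain t0 where t0: "t0 \<in> {0..1}" "\<And>t. t \<in> {0..1} \<Longrightarrow> norm (f (complex_of_real t * z)) powr p \<le> norm (f (complex_of_real t0 * z)) powr p"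
      using continuous_attains_sup[of "{0..1}" "\<lambda>t. norm (f (complex_of_real t * z)) powr p"] by auto
    have "complex_of_real t0 * z \<in> ball 0 1" using im t0(1) by blast
    then have "ennreal (norm (f (complex_of_real t0 * z)) powr p) \<le> Smax p f z"
      using fp_le_Smax[OF f p z, of t0] t0(1) by (simp add: fp_ball)
    then show ?thesis using t0(2) by (intro exI[of _ "norm (f (complex_of_real t0 * z)) powr p"]) auto
  qed
  then obtain T0 where T0: "\<And>z. norm z < 1 \<Longrightarrow> 0 \<le> T0 z \<and> (\<forall>t. 0 \<le> t \<and> t \<le> 1 \<longrightarrow> norm (f (complex_of_real t * z)) powr p \<le> T0 z) \<and> ennreal (T0 z) \<le> Smax p f z"
    by metis
  define T where "T z = (if norm z < 1 then T0 z else 0)" for z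
  have "(\<Sum>k. ennreal (A k * m k)) \<le> ennreal (8 * Bs * X)"
    using sumA A0 m_pos by (simp add: Afin ennreal_mult less_imp_le)
  moreover have "0 \<le> T z" for z using T0[of z] by (simp add: T_def)
  moreover have "norm (f (complex_of_real t * z)) powr p \<le> T z" if "norm z < 1" "0 \<le> t" "t \<le> 1" for z t
    using T0[of z] that by (simp add: T_def)
  moreover have "ennreal (T z) \<le> Smax p f z" if "norm z < 1" for z using T0[of z] that by (simp add: T_def)
  ultimately show thesis using that[of A T] A0 fw Ale by blast
qed

text \<open>The part depending on the level is enlarged to the Borel function
  \<open>levmaj y\<close>; then the two parts can be integrated separately.\<close>

lemma bint_le_majorant:
  assumes le: "\<And>z. norm z < 1 \<Longrightarrow> fp q g z \<le> y (lev z) + D * S z" and [measurable]: "S \<in> borel_measurable borel"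
  shows "bint q g \<le> ennreal (36 * pi * C) * (\<Sum>K. y K * ennreal (m K)) + D * (\<integral>\<^sup>+z\<in>ball 0 1. S z * ennreal (\<nu> z) \<partial>lebesgue)"
proof -
  have [measurable]: "S \<in> borel_measurable lebesgue" "levmaj y \<in> borel_measurable lebesgue"
    by (simp_all add: measurable_completion)
  have "bint q g \<le> (\<integral>\<^sup>+z. levmaj y z * (ennreal (\<nu> z) * indicator (ball 0 1) z) + D * (S z * (ennreal (\<nu> z) * indicator (ball 0 1) z)) \<partial>lebesgue)"
    unfolding bint_def
  proof (rule nn_integral_mono)
    fix z :: complex
    show "fp q g z * ennreal (\<nu> z) * indicator (ball 0 1) z \<le> levmaj y z * (ennreal (\<nu> z) * indicator (ball 0 1) z) + D * (S z * (ennreal (\<nu> z) * indicator (ball 0 1) z))"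
    proof (cases "norm z < 1")
      case True
      have "fp q g z \<le> levmaj y z + D * S z" using le[OF True] levmaj_ge[OF True, of y] by (meson add_right_mono order_trans)
      then have "fp q g z * ennreal (\<nu> z) \<le> (levmaj y z + D * S z) * ennreal (\<nu> z)" by (rule mult_right_mono) simp
      then show ?thesis using True by (simp add: distrib_right mult.assoc)
    qed simp
  qed
  also have "\<dots> = (\<integral>\<^sup>+z. levmaj y z * (ennreal (\<nu> z) * indicator (ball 0 1) z) \<partial>lebesgue) + (\<integral>\<^sup>+z. D * (S z * (ennreal (\<nu> z) * indicator (ball 0 1) z)) \<partial>lebesgue)"
    by (rule nn_integral_add) measurable
  also have "(\<integral>\<^sup>+z. D * (S z * (ennreal (\<nu> z) * indicator (ball 0 1) z)) \<partial>lebesgue) = D * (\<integral>\<^sup>+z. S z * (ennreal (\<nu> z) * indicator (ball 0 1) z) \<partial>lebesgue)"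
    by (rule nn_integral_cmult) measurable
  also have "(\<integral>\<^sup>+z. levmaj y z * (ennreal (\<nu> z) * indicator (ball 0 1) z) \<partial>lebesgue) \<le> ennreal (36 * pi * C) * (\<Sum>K. y K * ennreal (m K))"
    using nn_integral_levmaj[of y] by (simp add: mult.assoc)
  finally show ?thesis by (simp add: mult.assoc add_right_mono)
qed

text \<open>Boundedness in homogeneous form, with powers instead of norms. Requiring only an upper
  bound \<open>X > 0\<close> for the integral permits division by \<open>X\<close> even if
  \<open>f\<close> vanishes.\<close>

definition OpB :: "real measure \<Rightarrow> real \<Rightarrow> real \<Rightarrow> real \<Rightarrow> bool" where
  "OpB \<mu> p q Q \<longleftrightarrow> (\<forall>f X. f holomorphic_on ball 0 1 \<longrightarrow> 0 < X \<longrightarrow> bint p f \<le> ennreal X \<longrightarrow>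
     bint q (cesaro_op \<mu> \<omega> f) \<le> ennreal (Q * X powr (q / p)))"

lemma kd_min_tail: assumes "\<not> k < K" shows "om.kd (min k K) * measure_hat \<mu> (dy k) \<le> lam \<mu> k * (1 / 2) ^ (k - K)"
proof -
  have "om.kd K \<le> om.kd k * (1 / 2) ^ (k - K)" using kd_mono2[of K k] assms by (simp add: field_simps power_one_over)
  then have "om.kd K * measure_hat \<mu> (dy k) \<le> (om.kd k * (1 / 2) ^ (k - K)) * measure_hat \<mu> (dy k)"
    by (rule mult_right_mono) (simp add: measure_hat_def)
  then show ?thesis using assms by (simp add: lam_def min_def mult_ac)
qed

text \<open>With \<open>\<sigma> = 1 / p - 1 / q\<close>, the modulus of \<open>f\<close> is the
  product of the powers \<open>1 / q\<close> and \<sigma> of \<open>norm (f w) powr p\<close>. The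
  second factor is at most \<open>(Xs / m k) powr \<sigma>\<close>, whose denominator cancels
  against the bound for \<open>lam\<close>. Only the power \<open>1 / q\<close> remains: below the
  level of \<open>z\<close> the majorants \<open>A\<close> form a Hardy sum, and above it the
  geometric gain of \<open>kd_min_tail\<close> leaves a multiple of the radial maximum.\<close>

lemma upper_le:
  assumes p: "0 < p" and pq: "p \<le> q"
  shows "\<exists>B>0. \<forall>\<mu>\<in>M_plus. \<forall>\<Lambda>\<ge>0. (\<forall>k. lam \<mu> k \<le> \<Lambda> * m k powr (1 / p - 1 / q)) \<longrightarrow> OpB \<mu> p q (B * \<Lambda> powr q)"
proof -
  have q: "0 < q" using p pq by linarith
  define \<sigma> where "\<sigma> = 1 / p - 1 / q"
  have \<sigma>: "0 \<le> \<sigma>" using p pq by (simp add: \<sigma>_def field_simps)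
  obtain H where H: "H > 0" and hardy: "\<And>x. (\<And>k. 0 \<le> x k) \<Longrightarrow> (\<Sum>K. ennreal ((\<Sum>k\<le>K. x k) powr q * m K)) \<le> ennreal H * (\<Sum>k. ennreal (x k powr q * m k))"
    using hardy_powr[of q m, OF q m_pos m_Suc] by blast
  define c0 where "c0 = 36 * pi * C * (2 powr q * H * (8 * Bs)) + 4 powr q * (18 * pi * Bs)"
  have c0: "0 \<le> c0" unfolding c0_def using C_ge_1 H Bs_nonneg by simp
  define B where "B = CB powr q * (8 * Bs) powr (\<sigma> * q) * c0 + 1"
  have B: "0 < B" unfolding B_def using c0 by (simp add: add_nonneg_pos)
  have "OpB \<mu> p q (B * \<Lambda> powr q)"
    if \<mu>: "\<mu> \<in> M_plus" and \<Lambda>: "0 \<le> \<Lambda>" "\<And>k. lam \<mu> k \<le> \<Lambda> * m k powr \<sigma>" for \<mu> \<Lambda>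
    unfolding OpB_def
  proof (intro allI impI)
    interpret disc_measure \<mu> by unfold_locales (rule \<mu>)
    fix f X assume f: "f holomorphic_on ball 0 1" and X: "0 < X" "bint p f \<le> ennreal X"
    obtain A T where A: "\<And>k. 0 \<le> A k" "\<And>k w. norm w \<le> dy (Suc k) \<Longrightarrow> norm (f w) powr p \<le> A k"
      "(\<Sum>k. ennreal (A k * m k)) \<le> ennreal (8 * Bs * X)" "\<And>k. A k \<le> 8 * Bs * X / m k"
      and T: "\<And>z. 0 \<le> T z" "\<And>z t. norm z < 1 \<Longrightarrow> 0 \<le> t \<Longrightarrow> t \<le> 1 \<Longrightarrow> norm (f (complex_of_real t * z)) powr p \<le> T z"
      "\<And>z. norm z < 1 \<Longrightarrow> ennreal (T z) \<le> Smax p f z"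
      using majorants[OF f p X] by blast
    define Xs where "Xs = 8 * Bs * X"
    have Xs: "0 \<le> Xs" using Bs_nonneg X by (simp add: Xs_def)
    define P where "P = CB * \<Lambda> * Xs powr \<sigma>"
    have P: "0 \<le> P" unfolding P_def using CB_pos \<Lambda> by simp
    define s where "s K = (\<Sum>k<K. A k powr (1 / q))" for K
    have s0: "0 \<le> s K" for K unfolding s_def by (intro sum_nonneg) simp
    define y where "y K = ennreal (P powr q * 2 powr q * s K powr q)" for K
    define D where "D = P powr q * 4 powr q"
    have split: "v powr (1 / p) = v powr (1 / q) * v powr \<sigma>" if "0 \<le> v" for v :: real
      by (simp add: powr_add[symmetric] \<sigma>_def)
    have root: "norm (f w) \<le> v powr (1 / q) * (Xs / m k) powr \<sigma>"
      if "norm (f w) powr p \<le> v" "norm (f w) powr p \<le> A k" for w v k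
    proof -
      have "norm (f w) = (norm (f w) powr p) powr (1 / p)" using p by (simp add: powr_powr)
      also have "\<dots> = (norm (f w) powr p) powr (1 / q) * (norm (f w) powr p) powr \<sigma>" by (rule split) simp
      also have "\<dots> \<le> v powr (1 / q) * (Xs / m k) powr \<sigma>"
        using that A(4)[of k] q \<sigma> by (intro mult_mono powr_mono2) (auto simp: Xs_def)
      finally show ?thesis .
    qed
    have Xm: "(Xs / m k) powr \<sigma> * m k powr \<sigma> = Xs powr \<sigma>" for k
      using Xs m_pos[of k] by (simp add: powr_divide)
    have main: "norm (cesaro_op \<mu> \<omega> f z) \<le> P * (s (lev z) + 2 * T z powr (1 / q))" if z: "norm z < 1" for z
    proof -
      define K where "K = lev z"
      define a where "a k = (if k < K then A k powr (1 / q) * (Xs / m k) powr \<sigma> else T z powr (1 / q) * (Xs / m k) powr \<sigma>)" for k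
      define b where "b k = (if k < K then A k powr (1 / q) else T z powr (1 / q) * (1 / 2) ^ (k - K))" for k
      have "ennreal (norm (cesaro_op \<mu> \<omega> f z)) \<le> (\<Sum>k. ennreal (CB * om.kd (min k K) * measure \<mu> (dI k) * a k))"
        unfolding K_def
      proof (rule cesaro_bound[OF \<mu> f z])
        show "0 \<le> a k" for k unfolding a_def by simp
        fix k t assume t: "t \<in> dI k"
        have "t \<in> {0..<1}" using t UN_dI by auto
        then have t01: "0 \<le> t" "t \<le> 1" "t \<le> dy (Suc k)" using t by (auto simp: dI_def)
        have "norm (complex_of_real t * z) \<le> t" using z t01 by (simp add: norm_mult mult_left_le)
        then have fA: "norm (f (complex_of_real t * z)) powr p \<le> A k" using t01 by (intro A(2)) linarith
        show "norm (f (complex_of_real t * z)) \<le> a k"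
          unfolding a_def using root[OF fA fA] root[OF T(2)[OF z t01(1,2)] fA] by simp
      qed
      also have "\<dots> \<le> (\<Sum>k. ennreal (P * b k))"
      proof (intro suminf_le ennreal_leI)
        fix k
        have kU: "om.kd (min k K) * measure \<mu> (dI k) \<le> om.kd (min k K) * measure_hat \<mu> (dy k)"
          using om.kd_pos[of "min k K"] dI_le_U[of k] by (intro mult_left_mono) (auto simp: U_hat)
        show "CB * om.kd (min k K) * measure \<mu> (dI k) * a k \<le> P * b k"
        proof (cases "k < K")
          case True
          have "om.kd (min k K) * measure \<mu> (dI k) \<le> lam \<mu> k" using kU True by (simp add: lam_def mult.commute)
          also have "\<dots> \<le> \<Lambda> * m k powr \<sigma>" by (rule \<Lambda>)
          finally have "CB * (om.kd (min k K) * measure \<mu> (dI k)) * a k \<le> CB * (\<Lambda> * m k powr \<sigma>) * a k"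
            using CB_pos by (intro mult_right_mono mult_left_mono) (auto simp: a_def)
          also have "\<dots> = CB * \<Lambda> * ((Xs / m k) powr \<sigma> * m k powr \<sigma>) * A k powr (1 / q)"
            using True by (simp add: a_def mult_ac)
          finally show ?thesis unfolding Xm using True by (simp add: P_def b_def mult.assoc)
        next
          case False
          have "om.kd (min k K) * measure \<mu> (dI k) \<le> lam \<mu> k * (1 / 2) ^ (k - K)" using kU kd_min_tail[OF False, of \<mu>] by linarith
          also have "\<dots> \<le> \<Lambda> * m k powr \<sigma> * (1 / 2) ^ (k - K)" by (intro mult_right_mono \<Lambda>) simp
          finally have "CB * (om.kd (min k K) * measure \<mu> (dI k)) * a k \<le> CB * (\<Lambda> * m k powr \<sigma> * (1 / 2) ^ (k - K)) * a k"
            using CB_pos by (intro mult_right_mono mult_left_mono) (auto simp: a_def)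
          also have "\<dots> = CB * \<Lambda> * ((Xs / m k) powr \<sigma> * m k powr \<sigma>) * (T z powr (1 / q) * (1 / 2) ^ (k - K))"
            using False by (simp add: a_def mult_ac)
          finally show ?thesis unfolding Xm using False by (simp add: P_def b_def mult.assoc)
        qed
      qed auto
      also have "\<dots> = ennreal (P * (s K + 2 * T z powr (1 / q)))"
      proof (rule suminf_ennreal_eq)
        show "0 \<le> P * b k" for k unfolding b_def using P by simp
        show "(\<lambda>k. P * b k) sums (P * (s K + 2 * T z powr (1 / q)))"
          unfolding b_def s_def by (intro sums_mult sums_split_geometric)
      qed
      finally show ?thesis using P s0[of K] by (simp add: K_def)
    qed
    have le: "fp q (cesaro_op \<mu> \<omega> f) z \<le> y (lev z) + ennreal D * Smax p f z" if z: "norm z < 1" for z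
    proof -
      have "norm (cesaro_op \<mu> \<omega> f z) powr q \<le> (P * (s (lev z) + 2 * T z powr (1 / q))) powr q"
        using main[OF z] q by (intro powr_mono2) auto
      also have "\<dots> = P powr q * (s (lev z) + 2 * T z powr (1 / q)) powr q" using P s0 by (simp add: powr_mult)
      also have "\<dots> \<le> P powr q * (2 powr q * (s (lev z) powr q + (2 * T z powr (1 / q)) powr q))"
        using s0 q by (intro mult_left_mono add_powr_le) auto
      also have "(2 * T z powr (1 / q)) powr q = 2 powr q * T z" using T(1) q by (simp add: powr_mult powr_powr)
      also have "P powr q * (2 powr q * (s (lev z) powr q + 2 powr q * T z)) = P powr q * 2 powr q * s (lev z) powr q + D * T z"
      proof -
        have "(4::real) powr q = 2 powr q * 2 powr q" using powr_mult[of 2 2 q] by simp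
        then show ?thesis by (simp add: D_def algebra_simps)
      qed
      finally have "ennreal (norm (cesaro_op \<mu> \<omega> f z) powr q) \<le> ennreal (P powr q * 2 powr q * s (lev z) powr q + D * T z)" by (rule ennreal_leI)
      also have "\<dots> = y (lev z) + ennreal D * ennreal (T z)" using T(1) by (simp add: y_def D_def ennreal_mult)
      also have "\<dots> \<le> y (lev z) + ennreal D * Smax p f z" by (intro add_left_mono mult_left_mono T z) simp
      finally show ?thesis using z by (simp add: fp_ball)
    qed
    have "(\<Sum>K. y K * ennreal (m K)) = ennreal (P powr q * 2 powr q) * (\<Sum>K. ennreal (s K powr q * m K))"
    proof -
      have "y K * ennreal (m K) = ennreal (P powr q * 2 powr q) * ennreal (s K powr q * m K)" for K
        unfolding y_def using m_pos[of K] by (subst (1 2) ennreal_mult[symmetric]) (auto simp: mult_ac less_imp_le)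
      then show ?thesis by simp
    qed
    also have "(\<Sum>K. ennreal (s K powr q * m K)) \<le> (\<Sum>K. ennreal ((\<Sum>k\<le>K. A k powr (1 / q)) powr q * m K))"
    proof (intro suminf_le ennreal_leI mult_right_mono powr_mono2)
      show "s K \<le> (\<Sum>k\<le>K. A k powr (1 / q))" for K unfolding s_def by (intro sum_mono2) auto
    qed (use s0 q m_pos in \<open>auto simp: less_imp_le\<close>)
    also have "\<dots> \<le> ennreal H * (\<Sum>k. ennreal ((A k powr (1 / q)) powr q * m k))" by (rule hardy) simp
    also have "(\<Sum>k. ennreal ((A k powr (1 / q)) powr q * m k)) = (\<Sum>k. ennreal (A k * m k))"
      using A(1) q by (simp add: powr_powr)
    also have "\<dots> \<le> ennreal Xs" unfolding Xs_def by (rule A(3))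
    finally have ysum: "(\<Sum>K. y K * ennreal (m K)) \<le> ennreal (P powr q * 2 powr q) * (ennreal H * ennreal Xs)"
      by (simp add: mult_left_mono)
    have "bint q (cesaro_op \<mu> \<omega> f) \<le> ennreal (36 * pi * C) * (\<Sum>K. y K * ennreal (m K)) + ennreal D * (\<integral>\<^sup>+z\<in>ball 0 1. Smax p f z * ennreal (\<nu> z) \<partial>lebesgue)"
      by (rule bint_le_majorant[OF le Smax_measurable[OF f]])
    also have "\<dots> \<le> ennreal (36 * pi * C) * (ennreal (P powr q * 2 powr q) * (ennreal H * ennreal Xs)) + ennreal D * (ennreal (18 * pi * Bs) * ennreal X)"
      by (intro add_mono mult_left_mono ysum order_trans[OF nn_integral_Smax[OF f p]] X) auto
    also have "\<dots> = ennreal (36 * pi * C * (P powr q * 2 powr q * (H * Xs)) + D * (18 * pi * Bs * X))"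
      using C_ge_1 H Xs X Bs_nonneg by (simp add: ennreal_mult D_def)
    also have "36 * pi * C * (P powr q * 2 powr q * (H * Xs)) + D * (18 * pi * Bs * X) = P powr q * c0 * X"
      by (simp add: c0_def D_def Xs_def algebra_simps)
    also have "P powr q * c0 * X = (CB powr q * (8 * Bs) powr (\<sigma> * q) * c0) * \<Lambda> powr q * (X powr (\<sigma> * q) * X)"
    proof -
      have "P powr q = CB powr q * \<Lambda> powr q * ((8 * Bs) powr (\<sigma> * q) * X powr (\<sigma> * q))"
        unfolding P_def Xs_def using CB_pos \<Lambda> X Bs_nonneg by (simp add: powr_mult powr_powr)
      then show ?thesis by simp
    qed
    also have "X powr (\<sigma> * q) * X = X powr (q / p)"
    proof -
      have "q / p = \<sigma> * q + 1" using q p by (simp add: \<sigma>_def field_simps)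
      then show ?thesis using X by (simp add: powr_add)
    qed
    also have "ennreal ((CB powr q * (8 * Bs) powr (\<sigma> * q) * c0) * \<Lambda> powr q * X powr (q / p)) \<le> ennreal (B * \<Lambda> powr q * X powr (q / p))"
      unfolding B_def by (intro ennreal_leI mult_right_mono) auto
    finally show "bint q (cesaro_op \<mu> \<omega> f) \<le> ennreal (B * \<Lambda> powr q * X powr (q / p))" .
  qed
  then show ?thesis using B unfolding \<sigma>_def by blast
qed

text \<open>Since \<open>1 / q = 1 / s + 1 / p\<close>, the products
  \<open>lam \<mu> k * v powr (1 / p)\<close> are split pointwise by Young's inequality with
  exponents \<open>q / s\<close> and \<open>q / p\<close>; this replaces Hoelder's inequality. From
  level \<open>lev z\<close> on, the kernel bound is constant, and the pieces of \<mu> add up to the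
  single term \<open>lam \<mu> (lev z)\<close>.\<close>

lemma upper_gt:
  assumes q: "0 < q" and qp: "q < p"
  defines "s \<equiv> q * p / (p - q)"
  shows "\<exists>B>0. \<forall>\<mu>\<in>M_plus. \<forall>Y>0. (\<Sum>k. ennreal (lam \<mu> k powr s * m k)) \<le> ennreal Y \<longrightarrow> OpB \<mu> p q (B * Y powr (q / s))"
proof -
  have p: "0 < p" using q qp by linarith
  have s: "0 < s" unfolding s_def using q qp p by simp
  define \<theta> where "\<theta> = q / s"
  have \<theta>: "0 < \<theta>" "\<theta> < 1" "1 - \<theta> = q / p" using q qp p by (auto simp: \<theta>_def s_def field_simps)
  obtain H where H: "H > 0" and hardy: "\<And>x. (\<And>k. 0 \<le> x k) \<Longrightarrow> (\<Sum>K. ennreal ((\<Sum>k\<le>K. x k) powr q * m K)) \<le> ennreal H * (\<Sum>k. ennreal (x k powr q * m k))"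
    using hardy_powr[of q m, OF q m_pos m_Suc] by blast
  define B where "B = CB powr q * 2 powr q * (36 * pi * C * (H * (1 + 8 * Bs) + 1) + 18 * pi * Bs)"
  have B: "0 < B"
    unfolding B_def using CB_pos C_ge_1 H Bs_nonneg by (intro mult_pos_pos add_pos_nonneg) auto
  have "OpB \<mu> p q (B * Y powr (q / s))"
    if \<mu>: "\<mu> \<in> M_plus" and Y: "0 < Y" "(\<Sum>k. ennreal (lam \<mu> k powr s * m k)) \<le> ennreal Y" for \<mu> Y
    unfolding OpB_def
  proof (intro allI impI)
    interpret disc_measure \<mu> by unfold_locales (rule \<mu>)
    fix f X assume f: "f holomorphic_on ball 0 1" and X: "0 < X" "bint p f \<le> ennreal X"
    obtain A T where A: "\<And>k. 0 \<le> A k" "\<And>k w. norm w \<le> dy (Suc k) \<Longrightarrow> norm (f w) powr p \<le> A k"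
      "(\<Sum>k. ennreal (A k * m k)) \<le> ennreal (8 * Bs * X)" "\<And>k. A k \<le> 8 * Bs * X / m k"
      and T: "\<And>z. 0 \<le> T z" "\<And>z t. norm z < 1 \<Longrightarrow> 0 \<le> t \<Longrightarrow> t \<le> 1 \<Longrightarrow> norm (f (complex_of_real t * z)) powr p \<le> T z"
      "\<And>z. norm z < 1 \<Longrightarrow> ennreal (T z) \<le> Smax p f z"
      using majorants[OF f p X] by blast
    \<comment> \<open>The factor that restores homogeneity in Young's inequality after normalising
      by \<open>Y\<close> and \<open>X\<close>. Up to the constant \<open>B\<close> it is already
      the bound to be proved.\<close>
    define Q where "Q = Y powr (q / s) * X powr (q / p)"
    have Q: "0 \<le> Q" by (simp add: Q_def)
    have young: "(l * v powr (1 / p)) powr q \<le> Q * (l powr s / Y + v / X)" if "0 \<le> l" "0 \<le> v" for l v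
    proof -
      have "(l powr s / Y) powr \<theta> * (v / X) powr (1 - \<theta>) \<le> l powr s / Y + v / X"
        using that X Y \<theta> by (intro young_powr) auto
      then have "Q * ((l powr s / Y) powr \<theta> * (v / X) powr (1 - \<theta>)) \<le> Q * (l powr s / Y + v / X)"
        using Q by (rule mult_left_mono)
      moreover have "Q * ((l powr s / Y) powr \<theta> * (v / X) powr (1 - \<theta>)) = (l * v powr (1 / p)) powr q"
        using that X Y s p unfolding \<theta>(3) unfolding \<theta>_def Q_def by (simp add: powr_divide powr_powr powr_mult)
      ultimately show ?thesis by simp
    qed
    define u where "u k = lam \<mu> k * A k powr (1 / p)" for k
    have u0: "0 \<le> u k" for k unfolding u_def using lam_nonneg by simp
    define S where "S K = (\<Sum>k<K. u k)" for K
    have S0: "0 \<le> S K" for K unfolding S_def by (intro sum_nonneg u0)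
    define R where "R = CB powr q * 2 powr q"
    have R: "0 \<le> R" by (simp add: R_def)
    define y where "y K = ennreal (R * (S K powr q + Q * (lam \<mu> K powr s / Y)))" for K
    define D where "D = R * (Q / X)"
    have D0: "0 \<le> D" unfolding D_def using R Q X by simp
    have main: "norm (cesaro_op \<mu> \<omega> f z) \<le> CB * (S (lev z) + lam \<mu> (lev z) * T z powr (1 / p))" if z: "norm z < 1" for z
    proof -
      define K where "K = lev z"
      define a where "a k = (if k < K then A k powr (1 / p) else T z powr (1 / p))" for k
      define b where "b k = (if k < K then u k else om.kd K * T z powr (1 / p) * measure \<mu> (dI k))" for k
      have root: "norm (f w) \<le> v powr (1 / p)" if "norm (f w) powr p \<le> v" for w v
      proof -
        have "norm (f w) = (norm (f w) powr p) powr (1 / p)" using p by (simp add: powr_powr)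
        also have "\<dots> \<le> v powr (1 / p)" using that p by (intro powr_mono2) auto
        finally show ?thesis .
      qed
      have "ennreal (norm (cesaro_op \<mu> \<omega> f z)) \<le> (\<Sum>k. ennreal (CB * om.kd (min k K) * measure \<mu> (dI k) * a k))"
        unfolding K_def
      proof (rule cesaro_bound[OF \<mu> f z])
        show "0 \<le> a k" for k unfolding a_def by simp
        fix k t assume t: "t \<in> dI k"
        have "t \<in> {0..<1}" using t UN_dI by auto
        then have t01: "0 \<le> t" "t \<le> 1" "t \<le> dy (Suc k)" using t by (auto simp: dI_def)
        have "norm (complex_of_real t * z) \<le> t" using z t01 by (simp add: norm_mult mult_left_le)
        then have fA: "norm (f (complex_of_real t * z)) powr p \<le> A k" using t01 by (intro A(2)) linarith
        show "norm (f (complex_of_real t * z)) \<le> a k"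
          unfolding a_def using root[OF fA] root[OF T(2)[OF z t01(1,2)]] by simp
      qed
      also have "\<dots> \<le> (\<Sum>k. ennreal (CB * b k))"
      proof (intro suminf_le ennreal_leI)
        fix k
        show "CB * om.kd (min k K) * measure \<mu> (dI k) * a k \<le> CB * b k"
        proof (cases "k < K")
          case True
          have "om.kd (min k K) * measure \<mu> (dI k) \<le> lam \<mu> k"
            using True om.kd_pos[of k] dI_le_U[of k] by (simp add: lam_def U_hat mult.commute)
          then have "CB * (om.kd (min k K) * measure \<mu> (dI k)) * a k \<le> CB * lam \<mu> k * a k"
            using CB_pos by (intro mult_right_mono mult_left_mono) (auto simp: a_def)
          then show ?thesis using True by (simp add: a_def b_def u_def mult.assoc)
        next
          case False then show ?thesis by (simp add: a_def b_def mult_ac)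
        qed
      qed auto
      also have "\<dots> = ennreal (CB * (S K + lam \<mu> K * T z powr (1 / p)))"
      proof (rule suminf_ennreal_eq)
        show "0 \<le> CB * b k" for k unfolding b_def using CB_pos u0 om.kd_pos[of K] by simp
        have "(\<lambda>i. measure \<mu> (dI (i + K))) sums measure \<mu> (\<Union>i. dI (i + K))"
          using dI_disjoint by (intro finite_measure_UNION) (auto simp: disjoint_family_on_def)
        then have "(\<lambda>i. measure \<mu> (dI (i + K))) sums measure_hat \<mu> (dy K)" unfolding UN_dI_tail by (simp add: measure_hat_def)
        then have "(\<lambda>i. b (i + K)) sums (om.kd K * T z powr (1 / p) * measure_hat \<mu> (dy K))"
          unfolding b_def by (simp add: sums_mult)
        then have "b sums (om.kd K * T z powr (1 / p) * measure_hat \<mu> (dy K) + (\<Sum>i<K. b i))" by (simp add: sums_iff_shift)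
        moreover have "(\<Sum>i<K. b i) = S K" by (simp add: b_def S_def)
        ultimately have "b sums (S K + lam \<mu> K * T z powr (1 / p))" by (simp add: lam_def mult_ac add.commute)
        then show "(\<lambda>k. CB * b k) sums (CB * (S K + lam \<mu> K * T z powr (1 / p)))" by (rule sums_mult)
      qed
      finally show ?thesis using CB_pos S0[of K] lam_nonneg[of \<mu> K] by (simp add: K_def)
    qed
    have le: "fp q (cesaro_op \<mu> \<omega> f) z \<le> y (lev z) + ennreal D * Smax p f z" if z: "norm z < 1" for z
    proof -
      define K where "K = lev z"
      have "norm (cesaro_op \<mu> \<omega> f z) powr q \<le> (CB * (S K + lam \<mu> K * T z powr (1 / p))) powr q"
        using main[OF z] q by (intro powr_mono2) (auto simp: K_def)
      also have "\<dots> = CB powr q * (S K + lam \<mu> K * T z powr (1 / p)) powr q" using CB_pos S0 lam_nonneg by (simp add: powr_mult)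
      also have "\<dots> \<le> CB powr q * (2 powr q * (S K powr q + (lam \<mu> K * T z powr (1 / p)) powr q))"
        using S0 q lam_nonneg by (intro mult_left_mono add_powr_le) auto
      also have "\<dots> \<le> CB powr q * (2 powr q * (S K powr q + Q * (lam \<mu> K powr s / Y + T z / X)))"
        by (intro mult_left_mono add_left_mono young lam_nonneg T(1)) auto
      also have "\<dots> = R * (S K powr q + Q * (lam \<mu> K powr s / Y)) + D * T z"
        by (simp add: R_def D_def algebra_simps)
      finally have "ennreal (norm (cesaro_op \<mu> \<omega> f z) powr q) \<le> ennreal (R * (S K powr q + Q * (lam \<mu> K powr s / Y)) + D * T z)" by (rule ennreal_leI)
      also have "\<dots> = y K + ennreal D * ennreal (T z)"
        unfolding y_def using T(1)[of z] D0 R Q Y by (subst ennreal_plus) (auto simp: ennreal_mult)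
      also have "\<dots> \<le> y K + ennreal D * Smax p f z" by (intro add_left_mono mult_left_mono T z) simp
      finally show ?thesis using z by (simp add: fp_ball K_def)
    qed
    have sumY: "(\<Sum>k. ennreal (lam \<mu> k powr s / Y * m k)) \<le> 1"
    proof -
      have "ennreal (lam \<mu> k powr s / Y * m k) = ennreal (1 / Y) * ennreal (lam \<mu> k powr s * m k)" for k
        using Y m_pos[of k] by (subst ennreal_mult[symmetric]) (auto simp: less_imp_le)
      then have "(\<Sum>k. ennreal (lam \<mu> k powr s / Y * m k)) = ennreal (1 / Y) * (\<Sum>k. ennreal (lam \<mu> k powr s * m k))" by simp
      also have "\<dots> \<le> ennreal (1 / Y) * ennreal Y" by (intro mult_left_mono Y) simp
      also have "\<dots> = 1" using Y by (subst ennreal_mult[symmetric]) auto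
      finally show ?thesis .
    qed
    have sumX: "(\<Sum>k. ennreal (A k / X * m k)) \<le> ennreal (8 * Bs)"
    proof -
      have "ennreal (A k / X * m k) = ennreal (1 / X) * ennreal (A k * m k)" for k
        using X m_pos[of k] A(1)[of k] by (subst ennreal_mult[symmetric]) (auto simp: less_imp_le)
      then have "(\<Sum>k. ennreal (A k / X * m k)) = ennreal (1 / X) * (\<Sum>k. ennreal (A k * m k))" by simp
      also have "\<dots> \<le> ennreal (1 / X) * ennreal (8 * Bs * X)" by (intro mult_left_mono A) simp
      also have "\<dots> = ennreal (8 * Bs)" using X Bs_nonneg by (subst ennreal_mult[symmetric]) auto
      finally show ?thesis .
    qed
    have sumS: "(\<Sum>K. ennreal (S K powr q * m K)) \<le> ennreal (H * Q * (1 + 8 * Bs))"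
    proof -
      have "(\<Sum>K. ennreal (S K powr q * m K)) \<le> (\<Sum>K. ennreal ((\<Sum>k\<le>K. u k) powr q * m K))"
      proof (intro suminf_le ennreal_leI mult_right_mono powr_mono2)
        show "S K \<le> (\<Sum>k\<le>K. u k)" for K unfolding S_def using u0 by (intro sum_mono2) auto
      qed (use S0 q m_pos in \<open>auto simp: less_imp_le\<close>)
      also have "\<dots> \<le> ennreal H * (\<Sum>k. ennreal (u k powr q * m k))" by (rule hardy[OF u0])
      also have "(\<Sum>k. ennreal (u k powr q * m k)) \<le> (\<Sum>k. ennreal Q * (ennreal (lam \<mu> k powr s / Y * m k) + ennreal (A k / X * m k)))"
      proof (intro suminf_le)
        fix k
        have "u k powr q * m k \<le> Q * (lam \<mu> k powr s / Y + A k / X) * m k"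
          unfolding u_def using m_pos[of k] by (intro mult_right_mono young lam_nonneg A) auto
        then have "ennreal (u k powr q * m k) \<le> ennreal (Q * (lam \<mu> k powr s / Y * m k + A k / X * m k))"
          by (intro ennreal_leI) (simp add: algebra_simps)
        also have "\<dots> = ennreal Q * (ennreal (lam \<mu> k powr s / Y * m k) + ennreal (A k / X * m k))"
          using Q Y X A(1)[of k] m_pos[of k] by (subst ennreal_mult, simp, simp, subst ennreal_plus) auto
        finally show "ennreal (u k powr q * m k) \<le> ennreal Q * (ennreal (lam \<mu> k powr s / Y * m k) + ennreal (A k / X * m k))" .
      qed auto
      also have "\<dots> = ennreal Q * ((\<Sum>k. ennreal (lam \<mu> k powr s / Y * m k)) + (\<Sum>k. ennreal (A k / X * m k)))"
        by (simp add: suminf_add)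
      also have "\<dots> \<le> ennreal Q * (1 + ennreal (8 * Bs))" by (intro mult_left_mono add_mono sumY sumX) simp
      finally have "(\<Sum>K. ennreal (S K powr q * m K)) \<le> ennreal H * (ennreal Q * (1 + ennreal (8 * Bs)))" by (simp add: mult_left_mono)
      also have "\<dots> = ennreal (H * Q * (1 + 8 * Bs))"
      proof -
        have "1 + ennreal (8 * Bs) = ennreal (1 + 8 * Bs)" using Bs_nonneg by (subst ennreal_plus) auto
        moreover have "ennreal (H * Q * (1 + 8 * Bs)) = ennreal H * (ennreal Q * ennreal (1 + 8 * Bs))"
          unfolding mult.assoc using H Q Bs_nonneg by (subst ennreal_mult, simp, simp, subst ennreal_mult) auto
        ultimately show ?thesis by simp
      qed
      finally show ?thesis .
    qed
    have "(\<Sum>K. y K * ennreal (m K)) = (\<Sum>K. ennreal R * (ennreal (S K powr q * m K) + ennreal Q * ennreal (lam \<mu> K powr s / Y * m K)))"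
    proof (intro suminf_cong)
      fix K
      have "y K * ennreal (m K) = ennreal (R * (S K powr q * m K + Q * (lam \<mu> K powr s / Y * m K)))"
        unfolding y_def using m_pos[of K] R Q Y by (subst ennreal_mult[symmetric]) (auto simp: algebra_simps)
      also have "\<dots> = ennreal R * (ennreal (S K powr q * m K) + ennreal Q * ennreal (lam \<mu> K powr s / Y * m K))"
      proof -
        define x v where "x = lam \<mu> K powr s / Y * m K" and "v = S K powr q * m K"
        have "0 \<le> x" "0 \<le> v" using Y m_pos[of K] by (auto simp: x_def v_def)
        then have "ennreal (R * (v + Q * x)) = ennreal R * (ennreal v + ennreal Q * ennreal x)"
          using R Q by (simp add: ennreal_mult)
        then show ?thesis unfolding x_def v_def .
      qed
      finally show "y K * ennreal (m K) = ennreal R * (ennreal (S K powr q * m K) + ennreal Q * ennreal (lam \<mu> K powr s / Y * m K))" .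
    qed
    also have "\<dots> = ennreal R * ((\<Sum>K. ennreal (S K powr q * m K)) + ennreal Q * (\<Sum>K. ennreal (lam \<mu> K powr s / Y * m K)))"
      by (simp add: suminf_add[symmetric])
    also have "\<dots> \<le> ennreal R * (ennreal (H * Q * (1 + 8 * Bs)) + ennreal Q * 1)"
      by (intro mult_left_mono add_mono sumS sumY) auto
    finally have ysum: "(\<Sum>K. y K * ennreal (m K)) \<le> ennreal R * (ennreal (H * Q * (1 + 8 * Bs)) + ennreal Q * 1)" .
    have "bint q (cesaro_op \<mu> \<omega> f) \<le> ennreal (36 * pi * C) * (\<Sum>K. y K * ennreal (m K)) + ennreal D * (\<integral>\<^sup>+z\<in>ball 0 1. Smax p f z * ennreal (\<nu> z) \<partial>lebesgue)"
      by (rule bint_le_majorant[OF le Smax_measurable[OF f]])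
    also have "\<dots> \<le> ennreal (36 * pi * C) * (ennreal R * (ennreal (H * Q * (1 + 8 * Bs)) + ennreal Q * 1)) + ennreal D * (ennreal (18 * pi * Bs) * ennreal X)"
      by (intro add_mono mult_left_mono ysum order_trans[OF nn_integral_Smax[OF f p]] X) auto
    also have "\<dots> = ennreal (36 * pi * C * (R * (H * Q * (1 + 8 * Bs) + Q)) + D * (18 * pi * Bs * X))"
      using C_ge_1 H R Q D0 X Bs_nonneg by (simp add: ennreal_mult)
    also have "36 * pi * C * (R * (H * Q * (1 + 8 * Bs) + Q)) + D * (18 * pi * Bs * X) = B * Q"
      using X by (simp add: B_def D_def R_def algebra_simps)
    finally show "bint q (cesaro_op \<mu> \<omega> f) \<le> ennreal (B * Y powr (q / s) * X powr (q / p))"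
      by (simp add: Q_def mult.assoc)
  qed
  then show ?thesis using B by blast
qed

end

section \<open>Comparable quantities and operator norms\<close>

lemma comparableI:
  assumes "0 < a" "0 < b" "\<And>\<mu>. \<mu> \<in> M_plus \<Longrightarrow> A \<mu> \<le> ennreal a * B \<mu>" "\<And>\<mu>. \<mu> \<in> M_plus \<Longrightarrow> B \<mu> \<le> ennreal b * A \<mu>"
  shows "comparable A B"
  unfolding comparable_def
proof (intro exI[of _ "max a b"] conjI ballI)
  fix \<mu> assume \<mu>: "\<mu> \<in> M_plus"
  show "A \<mu> \<le> ennreal (max a b) * B \<mu>"
    by (rule order_trans[OF assms(3)[OF \<mu>]]) (intro mult_right_mono ennreal_leI, auto)
  have "B \<mu> \<le> ennreal (max a b) * A \<mu>"
    by (rule order_trans[OF assms(4)[OF \<mu>]]) (intro mult_right_mono ennreal_leI, auto)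
  then have "ennreal (1 / max a b) * B \<mu> \<le> ennreal (1 / max a b) * (ennreal (max a b) * A \<mu>)" by (rule mult_left_mono) simp
  also have "\<dots> = A \<mu>"
    unfolding mult.assoc[symmetric] using assms(1) by (subst ennreal_mult[symmetric]) (auto simp: max_def)
  finally show "ennreal (1 / max a b) * B \<mu> \<le> A \<mu>" .
qed (use assms in auto)

lemma comparableD:
  assumes "comparable A B"
  obtains c where "0 < c" "\<And>\<mu>. \<mu> \<in> M_plus \<Longrightarrow> A \<mu> \<le> ennreal c * B \<mu>" "\<And>\<mu>. \<mu> \<in> M_plus \<Longrightarrow> B \<mu> \<le> ennreal c * A \<mu>"
proof -
  obtain c where c: "c > 0" "\<And>\<mu>. \<mu> \<in> M_plus \<Longrightarrow> ennreal (1 / c) * B \<mu> \<le> A \<mu> \<and> A \<mu> \<le> ennreal c * B \<mu>"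
    using assms unfolding comparable_def by blast
  have "B \<mu> \<le> ennreal c * A \<mu>" if "\<mu> \<in> M_plus" for \<mu>
  proof -
    have "ennreal c * (ennreal (1 / c) * B \<mu>) \<le> ennreal c * A \<mu>" using c(2)[OF that] by (intro mult_left_mono) auto
    moreover have "ennreal c * (ennreal (1 / c) * B \<mu>) = B \<mu>"
      unfolding mult.assoc[symmetric] using c(1) by (subst ennreal_mult[symmetric]) auto
    ultimately show ?thesis by simp
  qed
  then show thesis using that[of c] c by blast
qed

lemma comparable_sym: "comparable A B \<Longrightarrow> comparable B A"
  by (elim comparableD) (rule comparableI)

lemma comparable_trans:
  assumes "comparable A B" "comparable B D" shows "comparable A D"
proof -
  obtain a where a: "0 < a" "\<And>\<mu>. \<mu> \<in> M_plus \<Longrightarrow> A \<mu> \<le> ennreal a * B \<mu>" "\<And>\<mu>. \<mu> \<in> M_plus \<Longrightarrow> B \<mu> \<le> ennreal a * A \<mu>"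
    using comparableD[OF assms(1)] by blast
  obtain b where b: "0 < b" "\<And>\<mu>. \<mu> \<in> M_plus \<Longrightarrow> B \<mu> \<le> ennreal b * D \<mu>" "\<And>\<mu>. \<mu> \<in> M_plus \<Longrightarrow> D \<mu> \<le> ennreal b * B \<mu>"
    using comparableD[OF assms(2)] by blast
  have ab: "ennreal (a * b) = ennreal a * ennreal b" "ennreal (a * b) = ennreal b * ennreal a"
    using a(1) b(1) by (simp_all add: ennreal_mult mult.commute)
  show ?thesis
  proof (rule comparableI[of "a * b" "a * b"])
    fix \<mu> assume \<mu>: "\<mu> \<in> M_plus"
    show "A \<mu> \<le> ennreal (a * b) * D \<mu>"
      unfolding ab(1) mult.assoc by (rule order_trans[OF a(2)[OF \<mu>] mult_left_mono[OF b(2)[OF \<mu>]]]) simp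
    show "D \<mu> \<le> ennreal (a * b) * A \<mu>"
      unfolding ab(2) mult.assoc by (rule order_trans[OF b(3)[OF \<mu>] mult_left_mono[OF a(3)[OF \<mu>]]]) simp
  qed (use a b in auto)
qed

lemma comparable_finite_iff:
  assumes "comparable A B" "\<mu> \<in> M_plus" shows "A \<mu> < \<infinity> \<longleftrightarrow> B \<mu> < \<infinity>"
proof -
  obtain c where c: "0 < c" "\<And>\<mu>. \<mu> \<in> M_plus \<Longrightarrow> A \<mu> \<le> ennreal c * B \<mu>" "\<And>\<mu>. \<mu> \<in> M_plus \<Longrightarrow> B \<mu> \<le> ennreal c * A \<mu>"
    using comparableD[OF assms(1)] by blast
  then show ?thesis using assms(2) c(2)[OF assms(2)] c(3)[OF assms(2)]
    by (metis ennreal_less_top ennreal_mult_less_top infinity_ennreal_def order_le_less_trans)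
qed

lemma power_powr_commute: "0 < x \<Longrightarrow> (x ^ n) powr p = (x powr p) ^ n" for x :: real
  by (induction n) (auto simp: powr_mult)

section \<open>Powers with extended real values\<close>

lemma epowr_ennreal: "0 \<le> x \<Longrightarrow> epowr (ennreal x) a = ennreal (x powr a)"
  by (simp add: epowr_def)

lemma epowr_top [simp]: "epowr top a = top"
  by (simp add: epowr_def)

lemma epowr_mono: assumes "x \<le> y" "0 < a" shows "epowr x a \<le> epowr y a"
proof (cases "y = top")
  case False
  then have "x \<noteq> top" using assms(1) by (auto simp: top_unique)
  then show ?thesis using False assms
    by (cases x; cases y) (auto simp: epowr_ennreal intro!: ennreal_leI powr_mono2)
qed simp

lemma epowr_less_top: "epowr x a < top \<longleftrightarrow> x < top"
  by (cases x) (auto simp: epowr_ennreal)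

lemma epowr_le_iff:
  assumes a: "0 < a" and y: "0 \<le> y" shows "epowr x a \<le> ennreal y \<longleftrightarrow> x \<le> ennreal (y powr (1 / a))"
proof (cases x)
  case (real r)
  have "r powr a \<le> y \<longleftrightarrow> r \<le> y powr (1 / a)"
  proof
    assume "r powr a \<le> y"
    then have "(r powr a) powr (1 / a) \<le> y powr (1 / a)" using a by (intro powr_mono2) auto
    then show "r \<le> y powr (1 / a)" using a real by (simp add: powr_powr)
  next
    assume "r \<le> y powr (1 / a)"
    then have "r powr a \<le> (y powr (1 / a)) powr a" using a real by (intro powr_mono2) auto
    then show "r powr a \<le> y" using a y by (simp add: powr_powr)
  qed
  then show ?thesis using real y by (simp add: epowr_ennreal)
qed (simp add: top_unique)

lemma epowr_cmult:
  assumes "0 \<le> r" "0 < a" shows "epowr (ennreal r * x) a \<le> ennreal (r powr a) * epowr x a"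
proof (cases x)
  case (real t)
  then show ?thesis using assms by (simp add: ennreal_mult[symmetric] epowr_ennreal powr_mult)
next
  case top
  show ?thesis
  proof (cases "r = 0")
    case True then show ?thesis using epowr_ennreal[of 0 a] by simp
  next
    case False then show ?thesis using top assms by (simp add: ennreal_mult_top)
  qed
qed

section \<open>Bergman norms and operator bounds in terms of integrals\<close>

context cesaro_setting
begin

lemma bergman_norm_bint: "bergman_norm \<nu> p f = epowr (bint p f / ennreal pi) (1 / p)"
  unfolding bergman_norm_def fp_bint ..

lemma bergman_norm_le_iff:
  assumes p: "0 < p" and y: "0 \<le> y"
  shows "bergman_norm \<nu> p f \<le> ennreal y \<longleftrightarrow> bint p f \<le> ennreal (pi * y powr p)"
proof -
  have "bergman_norm \<nu> p f \<le> ennreal y \<longleftrightarrow> bint p f / ennreal pi \<le> ennreal (y powr p)"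
    unfolding bergman_norm_bint using epowr_le_iff[of "1 / p" y] p y by simp
  also have "\<dots> \<longleftrightarrow> bint p f \<le> ennreal (pi * y powr p)"
  proof (cases "bint p f")
    case (real r)
    then show ?thesis by (simp add: divide_ennreal field_simps)
  next
    case top then show ?thesis by (simp add: ennreal_top_divide top_unique)
  qed
  finally show ?thesis .
qed

lemma bergman_norm_less_top: "0 < p \<Longrightarrow> bergman_norm \<nu> p f < \<infinity> \<longleftrightarrow> bint p f < \<infinity>"
proof (cases "bint p f")
  case (real r)
  then show ?thesis by (simp add: bergman_norm_bint epowr_less_top divide_ennreal)
next
  case top
  then show ?thesis by (simp add: bergman_norm_bint ennreal_top_divide)
qed

text \<open>The powers of \<open>pi\<close> arise from the normalised area measure: either norm
  divides its integral by \<open>pi\<close> before the root is taken.\<close>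

lemma bergman_bound_iff:
  assumes p: "0 < p" and q: "0 < q" and \<mu>: "\<mu> \<in> M_plus" and K: "0 \<le> K"
  shows "bergman_bound \<nu> p q (cesaro_op \<mu> \<omega>) K \<longleftrightarrow> OpB \<mu> p q (pi * K powr q * pi powr (- (q / p)))"
proof -
  have pw: "pi * K powr q * pi powr (- (q / p)) * X powr (q / p) = pi * (K * (X / pi) powr (1 / p)) powr q" if "0 \<le> X" for X
    using K that by (simp add: powr_mult powr_powr powr_divide powr_minus_divide)
  show ?thesis
  proof
    assume bd: "bergman_bound \<nu> p q (cesaro_op \<mu> \<omega>) K"
    show "OpB \<mu> p q (pi * K powr q * pi powr (- (q / p)))"
      unfolding OpB_def
    proof (intro allI impI)
      fix f X assume f: "f holomorphic_on ball 0 1" and X: "0 < X" "bint p f \<le> ennreal X"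
      have "bergman_norm \<nu> p f \<le> ennreal ((X / pi) powr (1 / p))"
        using X p by (subst bergman_norm_le_iff) (auto simp: powr_powr)
      moreover from this have "f \<in> bergman_space \<nu> p"
        using f by (auto simp: bergman_space_def intro: le_less_trans)
      ultimately have "bergman_norm \<nu> q (cesaro_op \<mu> \<omega> f) \<le> ennreal K * ennreal ((X / pi) powr (1 / p))"
        using bd unfolding bergman_bound_def by (meson mult_left_mono order_trans zero_le)
      then have "bergman_norm \<nu> q (cesaro_op \<mu> \<omega> f) \<le> ennreal (K * (X / pi) powr (1 / p))" using K by (simp add: ennreal_mult)
      then show "bint q (cesaro_op \<mu> \<omega> f) \<le> ennreal (pi * K powr q * pi powr (- (q / p)) * X powr (q / p))"
        using K X q by (subst pw) (auto simp: bergman_norm_le_iff)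
    qed
  next
    assume op: "OpB \<mu> p q (pi * K powr q * pi powr (- (q / p)))"
    have "cesaro_op \<mu> \<omega> f \<in> bergman_space \<nu> q \<and> bergman_norm \<nu> q (cesaro_op \<mu> \<omega> f) \<le> ennreal K * bergman_norm \<nu> p f"
      if f: "f \<in> bergman_space \<nu> p" for f
    proof -
      have hol: "f holomorphic_on ball 0 1" and fin: "bint p f < \<infinity>"
        using f bergman_norm_less_top[OF p, of f] by (auto simp: bergman_space_def)
      then obtain x where x: "bint p f = ennreal x" "0 \<le> x" by (cases "bint p f") auto
      have X: "bergman_norm \<nu> q (cesaro_op \<mu> \<omega> f) \<le> ennreal (K * (X / pi) powr (1 / p))" if "0 < X" "x \<le> X" for X
      proof -
        have "bint q (cesaro_op \<mu> \<omega> f) \<le> ennreal (pi * K powr q * pi powr (- (q / p)) * X powr (q / p))"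
          using op hol that x unfolding OpB_def by (simp add: ennreal_leI)
        then show ?thesis using that K q by (subst bergman_norm_le_iff) (auto simp: pw)
      qed
      have "bergman_norm \<nu> q (cesaro_op \<mu> \<omega> f) \<le> ennreal (K * (x / pi) powr (1 / p))"
      proof (cases "x = 0")
        case False then show ?thesis using X[of x] x by simp
      next
        \<comment> \<open>\<open>OpB\<close> speaks about \<open>X > 0\<close> only. For a function
          of norm 0 it is applied along \<open>X = 1 / (n + 1)\<close>, and the limit is
          taken.\<close>
        case True
        have "(\<lambda>n. ennreal (K * (inverse (real (Suc n)) / pi) powr (1 / p))) \<longlonglongrightarrow> ennreal (K * (0 / pi) powr (1 / p))"
          using p by (intro tendsto_ennrealI tendsto_intros tendsto_powr' LIMSEQ_inverse_real_of_nat) auto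
        then show ?thesis using True X
          by (intro LIMSEQ_le_const[of _ "ennreal (K * (x / pi) powr (1 / p))"]) (auto intro!: exI[of _ 0])
      qed
      also have "\<dots> = ennreal K * bergman_norm \<nu> p f"
        using K x by (simp add: bergman_norm_bint divide_ennreal epowr_ennreal ennreal_mult)
      finally have le: "bergman_norm \<nu> q (cesaro_op \<mu> \<omega> f) \<le> ennreal K * bergman_norm \<nu> p f" .
      have "ennreal K * bergman_norm \<nu> p f < \<infinity>" using f by (simp add: bergman_space_def ennreal_mult_less_top)
      then show ?thesis using le cesaro_holomorphic[OF \<mu> hol] by (auto simp: bergman_space_def intro: le_less_trans)
    qed
    then show "bergman_bound \<nu> p q (cesaro_op \<mu> \<omega>) K" unfolding bergman_bound_def using K by blast
  qed
qed

lemma bergman_opnorm_le: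
  assumes "0 < p" "0 < q" "\<mu> \<in> M_plus" "0 \<le> Q" "OpB \<mu> p q Q"
  shows "bergman_opnorm \<nu> p q (cesaro_op \<mu> \<omega>) \<le> ennreal ((Q * pi powr (q / p) / pi) powr (1 / q))"
proof -
  define K where "K = (Q * pi powr (q / p) / pi) powr (1 / q)"
  have K0: "0 \<le> K" by (simp add: K_def)
  have "pi * K powr q * pi powr (- (q / p)) = Q"
    using assms by (simp add: K_def powr_powr powr_minus_divide)
  then have "bergman_bound \<nu> p q (cesaro_op \<mu> \<omega>) K"
    using bergman_bound_iff[of p q \<mu> K] assms K0 by simp
  then show ?thesis unfolding bergman_opnorm_def K_def by (intro INF_lower) simp
qed

lemma bergman_bounded_iff: "bergman_bounded \<nu> p q T \<longleftrightarrow> bergman_opnorm \<nu> p q T < \<infinity>"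
proof
  assume "bergman_bounded \<nu> p q T"
  then obtain K where "bergman_bound \<nu> p q T K" unfolding bergman_bounded_def by blast
  then have "bergman_opnorm \<nu> p q T \<le> ennreal K" unfolding bergman_opnorm_def by (intro INF_lower) simp
  then show "bergman_opnorm \<nu> p q T < \<infinity>" by (rule le_less_trans) simp
next
  assume "bergman_opnorm \<nu> p q T < \<infinity>"
  then have "{K. bergman_bound \<nu> p q T K} \<noteq> {}" unfolding bergman_opnorm_def by (metis image_empty Inf_empty infinity_ennreal_def less_irrefl)
  then show "bergman_bounded \<nu> p q T" unfolding bergman_bounded_def by blast
qed

section \<open>Lower estimates by test functions\<close>

lemma m_double_iterate: "m K \<le> (2 * C) ^ i * m (K + i)"
proof (induction i)
  case (Suc i)
  have "(2 * C) ^ i * m (K + i) \<le> (2 * C) ^ i * (2 * C * m (Suc (K + i)))"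
    using C_ge_1 by (intro mult_left_mono m_double) auto
  then show ?case using Suc by (simp add: mult_ac)
qed simp

text \<open>The functions \<open>1 / (1 - dy k * z) ^ \<eta>\<close> have nonnegative Taylor coefficients, as has
  \<open>om.G\<close>, so that superpositions of them can be tested on the radius without any cancellation.\<close>

lemma lower_test:
  assumes p: "0 < p" and q: "0 < q"
  shows "\<exists>B>0. \<forall>\<mu>\<in>M_plus. \<forall>Q\<ge>0. OpB \<mu> p q Q \<longrightarrow> (\<forall>n b. (\<forall>k. 0 \<le> b k) \<longrightarrow>
    (\<Sum>k<n. (b k * lam \<mu> k) powr q * m k) \<le> B * Q * (\<Sum>k<n. b k powr p * m k) powr (q / p))"
proof -
  have "1 < 2 powr p" using p by simp
  \<comment> \<open>The decay \<open>(2 powr p) ^ \<eta>\<close> per level has to beat the growth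
    \<open>2 * C\<close> of \<open>m\<close> towards lower levels, with a factor 2 to spare for the
    Schur test.\<close>
  then obtain \<eta> where \<eta>: "4 * C < (2 powr p) ^ \<eta>" using real_arch_pow by blast
  define R where "R = (2 powr p) ^ \<eta>"
  have R: "4 * C < R" using \<eta> by (simp add: R_def)
  have R0: "0 < R" by (simp add: R_def)
  \<comment> \<open>\<open>E K k\<close> bounds the \<open>k\<close>-th test function on the set
    \<open>lev z = K\<close>: by 1 up to the level of \<open>z\<close>, and by a power of the ratio
    of the scales beyond it.\<close>
  define E :: "nat \<Rightarrow> nat \<Rightarrow> real" where "E K k = (if k \<le> K then 1 else (2 * (1 / 2) ^ (k - K)) ^ \<eta>)" for K k
  have E0: "0 \<le> E K k" for K k by (simp add: E_def)
  have Epow: "E K k powr p = R * (1 / R) ^ (k - K)" if "\<not> k \<le> K" for K k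
  proof -
    have "(0::real) < 2 * (1 / 2) ^ (k - K)" by simp
    from power_powr_commute[OF this] have "E K k powr p = ((2 * (1 / 2) ^ (k - K)) powr p) ^ \<eta>"
      by (simp only: E_def that if_False)
    also have "(2 * (1 / 2) ^ (k - K)) powr p = 2 powr p * (1 / 2 powr p) ^ (k - K)"
    proof -
      have "(2 * (1 / 2) ^ (k - K) :: real) powr p = 2 powr p * ((1 / 2) ^ (k - K)) powr p" by (rule powr_mult)
      also have "((1 / 2 :: real) ^ (k - K)) powr p = (1 / 2 powr p) ^ (k - K)"
        by (subst power_powr_commute) (auto simp: powr_divide)
      finally show ?thesis .
    qed
    also have "\<dots> ^ \<eta> = R * (1 / R) ^ (k - K)"
      unfolding R_def by (simp add: power_divide power_one_over power_mult[symmetric] mult.commute)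
    finally show ?thesis .
  qed
  have mdec: "m (k + i) \<le> (1 / 2) ^ i * m k" for k i
  proof (induction i)
    case (Suc i)
    show ?case using m_Suc[of "k + i"] Suc by simp
  qed simp
  have Ecrit: "E K k powr p * m K \<le> R * (1 / 2) ^ ndist K k * m k" for K k
  proof (cases "k \<le> K")
    case True
    have "E K k powr p * m K \<le> 1 * ((1 / 2) ^ (K - k) * m k)" using mdec[of k "K - k"] True by (simp add: E_def)
    also have "\<dots> \<le> R * ((1 / 2) ^ (K - k) * m k)" using R C_ge_1 m_pos[of k] by (intro mult_right_mono) auto
    finally show ?thesis using True by (simp add: mult.assoc)
  next
    case False
    have "E K k powr p * m K \<le> R * (1 / R) ^ (k - K) * ((2 * C) ^ (k - K) * m k)"
      unfolding Epow[OF False] using m_double_iterate[of K "k - K"] False R0 by (intro mult_left_mono) auto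
    also have "\<dots> = R * (2 * C / R) ^ (k - K) * m k" by (simp add: power_divide power_one_over)
    also have "\<dots> \<le> R * (1 / 2) ^ (k - K) * m k"
      using R R0 C_ge_1 m_pos[of k] by (intro mult_right_mono mult_left_mono power_mono) (auto simp: field_simps)
    finally show ?thesis using False by simp
  qed
  obtain S where S: "S > 0" and schur: "\<And>x F. (\<forall>k. 0 \<le> x k) \<Longrightarrow> (\<forall>K. finite (F K)) \<Longrightarrow>
    (\<Sum>K. ennreal ((\<Sum>k\<in>F K. E K k * x k) powr p * m K)) \<le> ennreal S * (\<Sum>k. ennreal (x k powr p * m k))"
    using schur_powr[of p "1 / 2" R m E, OF p _ _ R0 m_pos E0 Ecrit] by auto
  define \<kappa> where "\<kappa> = 1 / 3 ^ \<eta> / (36 * om.Bm * Co)"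
  have \<kappa>: "0 < \<kappa>" unfolding \<kappa>_def using om.Bm_pos om.C_ge_1 by simp
  define c1 where "c1 = 36 * pi * C * S"
  have c1: "0 < c1" unfolding c1_def using C_ge_1 S by simp
  define B where "B = 8 * Bs * c1 powr (q / p) / \<kappa> powr q + 1"
  have B: "0 < B" unfolding B_def using Bs_nonneg by (intro add_nonneg_pos) auto
  have "(\<Sum>k<n. (b k * lam \<mu> k) powr q * m k) \<le> B * Q * (\<Sum>k<n. b k powr p * m k) powr (q / p)"
    if \<mu>: "\<mu> \<in> M_plus" and Q: "0 \<le> Q" and op: "OpB \<mu> p q Q" and b: "\<And>k. 0 \<le> b k" for \<mu> Q n b
  proof -
    define \<Sigma> where "\<Sigma> = (\<Sum>k<n. b k powr p * m k)"
    have \<Sigma>0: "0 \<le> \<Sigma>" unfolding \<Sigma>_def using m_pos by (intro sum_nonneg) (auto simp: less_imp_le)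
    show ?thesis
    proof (cases "\<Sigma> = 0")
      case True
      then have z: "b k powr p * m k = 0" if "k < n" for k
        using that m_pos unfolding \<Sigma>_def by (subst (asm) sum_nonneg_eq_0_iff) (auto simp: less_imp_le)
      then have "b k = 0" if "k < n" for k using z[OF that] m_pos[of k] by auto
      then show ?thesis using True unfolding \<Sigma>_def by simp
    next
      case False
      then have \<Sigma>: "0 < \<Sigma>" using \<Sigma>0 by simp
      \<comment> \<open>The factor \<open>1 / 2 ^ k\<close> equals \<open>1 - dy k\<close>, so every
        summand without its coefficient takes the value 1 at \<open>z = 1\<close>.\<close>
      define f where "f z = (\<Sum>k<n. complex_of_real (b k) * (complex_of_real (1 / 2 ^ k) / (1 - complex_of_real (dy k) * z)) ^ \<eta>)" for z
      have nz: "1 - complex_of_real (dy k) * z \<noteq> 0" if "norm z < 1" for k z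
        using norm_one_minus_tz(1)[OF that, of "dy k"] dy_less_1[of k] by (auto simp del: dy_less_1)
      have f: "f holomorphic_on ball 0 1" unfolding f_def using nz by (intro holomorphic_intros) auto
      have fE: "norm (f z) \<le> (\<Sum>k<n. E (lev z) k * b k)" if z: "norm z < 1" for z
        unfolding f_def
      proof (rule sum_norm_le)
        fix k
        define N where "N = norm (1 - complex_of_real (dy k) * z)"
        have N1: "1 / 2 ^ k \<le> N" using norm_one_minus_tz(1)[OF z, of "dy k"] by (simp add: N_def dy_def)
        then have N0: "0 < N" by (smt (verit) divide_pos_pos zero_less_power)
        have N2: "1 / 2 ^ lev z \<le> 2 * N" using norm_one_minus_tz(2)[OF z, of "dy k"] lev_bounds(1)[OF z] by (simp add: N_def)
        have "(1 / 2 ^ k / N) ^ \<eta> \<le> E (lev z) k"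
        proof (cases "k \<le> lev z")
          case True
          have "1 / 2 ^ k / N \<le> 1" using N1 N0 by (subst divide_le_eq_1_pos) auto
          then have "(1 / 2 ^ k / N) ^ \<eta> \<le> 1" using N0 by (intro power_le_one) auto
          then show ?thesis using True by (simp only: E_def if_True)
        next
          case False
          have "1 / 2 ^ k / N = 2 * (1 / 2 ^ k) * (1 / (2 * N))" by simp
          also have "\<dots> \<le> 2 * (1 / 2 ^ k) * 2 ^ lev z"
            using N2 N0 by (intro mult_left_mono) (auto simp: field_simps)
          also have "\<dots> = 2 * (1 / 2) ^ (k - lev z)" using False by (simp add: power_diff power_one_over)
          finally have "(1 / 2 ^ k / N) ^ \<eta> \<le> (2 * (1 / 2) ^ (k - lev z)) ^ \<eta>" using N0 by (intro power_mono) auto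
          then show ?thesis using False by (simp only: E_def if_False)
        qed
        then have "b k * (1 / 2 ^ k / N) ^ \<eta> \<le> b k * E (lev z) k" using b[of k] by (rule mult_left_mono)
        then show "norm (complex_of_real (b k) * (complex_of_real (1 / 2 ^ k) / (1 - complex_of_real (dy k) * z)) ^ \<eta>) \<le> E (lev z) k * b k"
          using b[of k] by (simp add: norm_mult norm_power norm_divide N_def mult.commute)
      qed
      have bp: "bint p f \<le> ennreal (c1 * \<Sigma>)"
      proof -
        define y where "y K = ennreal ((\<Sum>k<n. E K k * b k) powr p)" for K
        define b' where "b' k = (if k < n then b k else 0)" for k
        have "fp p f z \<le> y (lev z)" if z: "norm z < 1" for z
          using fE[OF z] p z by (simp add: fp_ball y_def ennreal_leI powr_mono2)
        then have "bint p f \<le> ennreal (36 * pi * C) * (\<Sum>K. y K * ennreal (m K))"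
          using bint_le_majorant[of p f y 0 "\<lambda>_. 0"] by simp
        also have "\<dots> = ennreal (36 * pi * C) * (\<Sum>K. ennreal ((\<Sum>k\<in>{..<n}. E K k * b' k) powr p * m K))"
          using m_pos by (simp add: y_def b'_def ennreal_mult less_imp_le)
        also have "\<dots> \<le> ennreal (36 * pi * C) * (ennreal S * (\<Sum>k. ennreal (b' k powr p * m k)))"
          using b by (intro mult_left_mono schur) (auto simp: b'_def)
        also have "(\<Sum>k. ennreal (b' k powr p * m k)) = (\<Sum>k<n. ennreal (b' k powr p * m k))"
          by (rule suminf_finite) (auto simp: b'_def)
        also have "\<dots> = (\<Sum>k<n. ennreal (b k powr p * m k))" by (rule sum.cong) (auto simp: b'_def)
        also have "\<dots> = ennreal \<Sigma>" unfolding \<Sigma>_def using m_pos by (subst sum_ennreal) (auto simp: less_imp_le)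
        also have "ennreal (36 * pi * C) * (ennreal S * ennreal \<Sigma>) = ennreal (c1 * \<Sigma>)"
          unfolding c1_def using C_ge_1 S \<Sigma> by (simp add: ennreal_mult mult.assoc)
        finally show ?thesis .
      qed
      define g where "g = cesaro_op \<mu> \<omega> f"
      have g: "g holomorphic_on ball 0 1" unfolding g_def by (rule cesaro_holomorphic[OF \<mu> f])
      have bq: "bint q g \<le> ennreal (Q * (c1 * \<Sigma>) powr (q / p))"
        using op f bp c1 \<Sigma> unfolding OpB_def g_def by simp
      have pt: "\<kappa> * (b j * lam \<mu> j) \<le> norm (g (complex_of_real (dy j)))" if j: "j < n" for j
      proof -
        define r where "r x = (\<Sum>k<n. b k * (1 / 2 ^ k / (1 - dy k * x)) ^ \<eta>)" for x
        have d0: "0 \<le> 1 - dy k * x" if "0 \<le> x" "x < 1" for k x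
          using mult_le_one[of "dy k" x] that by (simp add: less_imp_le)
        \<comment> \<open>Only the \<open>j\<close>-th summand is kept. For
          \<open>x \<ge> (dy j)^2\<close> one has \<open>1 - dy j * x \<le> 3 / 2 ^ j\<close>, which
          is the origin of \<open>3 ^ \<eta>\<close>.\<close>
        have "b j / 3 ^ \<eta> * lam \<mu> j / (36 * om.Bm * Co) \<le> norm (cesaro_op \<mu> \<omega> f (complex_of_real (dy j)))"
        proof (rule cesaro_ge[OF \<mu> f, where r = r])
          show "f (complex_of_real x) = complex_of_real (r x)" for x unfolding f_def r_def by simp
          show "0 \<le> r x" if "0 \<le> x" "x < 1" for x
            unfolding r_def using b d0[OF that] by (intro sum_nonneg mult_nonneg_nonneg zero_le_power divide_nonneg_nonneg) auto
          show "0 \<le> b j / 3 ^ \<eta>" using b by simp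
          fix x assume x: "(dy j)\<^sup>2 \<le> x" "x < 1"
          have x0: "0 \<le> x" using x(1) by (meson order_trans zero_le_power2)
          define e :: real where "e = 1 / 2 ^ j"
          have e: "0 < e" "e \<le> 1" "dy j = 1 - e" by (auto simp: e_def dy_def)
          have "dy j * (dy j)\<^sup>2 \<le> dy j * x" by (intro mult_left_mono x) simp
          moreover have "1 - dy j * (dy j)\<^sup>2 \<le> 3 * e"
          proof -
            have "1 - dy j * (dy j)\<^sup>2 = 3 * e - e\<^sup>2 * (3 - e)" unfolding e(3) by (simp add: power2_eq_square algebra_simps)
            moreover have "0 \<le> e\<^sup>2 * (3 - e)" using e by simp
            ultimately show ?thesis by linarith
          qed
          ultimately have le3: "1 - dy j * x \<le> 3 * e" by argo
          have "dy j * x < 1" using dy_less_1[of j] x x0 by (meson dy_nonneg less_imp_le mult_le_one mult_left_le order_le_less_trans x(2))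
          then have pos: "0 < 1 - dy j * x" by simp
          have "1 / 3 \<le> 1 / 2 ^ j / (1 - dy j * x)" using le3 pos by (simp add: e_def[symmetric] field_simps)
          then have "(1 / 3) ^ \<eta> \<le> (1 / 2 ^ j / (1 - dy j * x)) ^ \<eta>" by (intro power_mono) auto
          then have "b j * (1 / 3) ^ \<eta> \<le> b j * (1 / 2 ^ j / (1 - dy j * x)) ^ \<eta>" using b by (intro mult_left_mono) auto
          also have "\<dots> \<le> r x"
            unfolding r_def using j b d0[OF x0 x(2)]
            by (intro member_le_sum[of j "{..<n}" "\<lambda>k. b k * (1 / 2 ^ k / (1 - dy k * x)) ^ \<eta>"]) (auto intro!: mult_nonneg_nonneg zero_le_power divide_nonneg_nonneg)
          finally show "b j / 3 ^ \<eta> \<le> r x" by (simp add: power_one_over)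
        qed
        then show ?thesis by (simp add: \<kappa>_def g_def)
      qed
      \<comment> \<open>The same \<open>Amax\<close> that served the upper bound is applied to the
        image: it dominates the values at \<open>dy j\<close>, and its weighted sum is controlled by
        the integral of the image.\<close>
      have "(\<Sum>j<n. ennreal (\<kappa> powr q * ((b j * lam \<mu> j) powr q * m j))) \<le> (\<Sum>j<n. Amax q g j * ennreal (m j))"
      proof (rule sum_mono)
        fix j assume "j \<in> {..<n}"
        then have "\<kappa> * (b j * lam \<mu> j) \<le> norm (g (complex_of_real (dy j)))" using pt by simp
        then have "(\<kappa> * (b j * lam \<mu> j)) powr q \<le> norm (g (complex_of_real (dy j))) powr q"
          using \<kappa> b lam_nonneg q by (intro powr_mono2) auto
        then have "ennreal ((\<kappa> * (b j * lam \<mu> j)) powr q) \<le> fp q g (complex_of_real (dy j))"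
          by (subst fp_ball) (auto intro: ennreal_leI)
        also have "\<dots> \<le> Amax q g j" by (rule fp_le_Amax[OF g q]) (use dy_less[of j] in simp)
        finally have "ennreal ((\<kappa> * (b j * lam \<mu> j)) powr q) * ennreal (m j) \<le> Amax q g j * ennreal (m j)" by (rule mult_right_mono) simp
        moreover have "ennreal ((\<kappa> * (b j * lam \<mu> j)) powr q) * ennreal (m j) = ennreal (\<kappa> powr q * ((b j * lam \<mu> j) powr q * m j))"
          using \<kappa> b lam_nonneg m_pos[of j] by (subst ennreal_mult[symmetric]) (auto simp: powr_mult mult_ac less_imp_le)
        ultimately show "ennreal (\<kappa> powr q * ((b j * lam \<mu> j) powr q * m j)) \<le> Amax q g j * ennreal (m j)" by simp
      qed
      also have "\<dots> \<le> (\<Sum>j. Amax q g j * ennreal (m j))" by (rule sum_le_suminf) auto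
      also have "\<dots> \<le> ennreal (8 * Bs) * bint q g" by (rule sum_Amax[OF g q])
      also have "\<dots> \<le> ennreal (8 * Bs) * ennreal (Q * (c1 * \<Sigma>) powr (q / p))" by (intro mult_left_mono bq) simp
      also have "\<dots> = ennreal (8 * Bs * (Q * (c1 * \<Sigma>) powr (q / p)))" using Bs_nonneg Q by (simp add: ennreal_mult)
      also have "(\<Sum>j<n. ennreal (\<kappa> powr q * ((b j * lam \<mu> j) powr q * m j))) = ennreal (\<Sum>j<n. \<kappa> powr q * ((b j * lam \<mu> j) powr q * m j))"
        using m_pos by (subst sum_ennreal) (auto simp: less_imp_le)
      finally have "(\<Sum>j<n. \<kappa> powr q * ((b j * lam \<mu> j) powr q * m j)) \<le> 8 * Bs * (Q * (c1 * \<Sigma>) powr (q / p))"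
        using Bs_nonneg Q by (subst (asm) ennreal_le_iff) auto
      then have "\<kappa> powr q * (\<Sum>j<n. (b j * lam \<mu> j) powr q * m j) \<le> \<kappa> powr q * ((8 * Bs * c1 powr (q / p) / \<kappa> powr q) * Q * \<Sigma> powr (q / p))"
        using \<kappa> c1 \<Sigma> by (simp add: sum_distrib_left powr_mult mult_ac)
      then have "(\<Sum>j<n. (b j * lam \<mu> j) powr q * m j) \<le> (8 * Bs * c1 powr (q / p) / \<kappa> powr q) * Q * \<Sigma> powr (q / p)"
        using \<kappa> by (subst (asm) mult_le_cancel_left_pos) auto
      also have "\<dots> \<le> B * Q * \<Sigma> powr (q / p)"
        unfolding B_def using Q by (intro mult_right_mono) auto
      finally show ?thesis unfolding \<Sigma>_def .
    qed
  qed
  then show ?thesis using B by blast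
qed

section \<open>Operator norms and the fundamental function as sequence norms\<close>

definition Dinf :: "real \<Rightarrow> real measure \<Rightarrow> ennreal" where
  "Dinf \<sigma> \<mu> = (SUP k. ennreal (lam \<mu> k / m k powr \<sigma>))"

definition Dsum :: "real \<Rightarrow> real measure \<Rightarrow> ennreal" where
  "Dsum s \<mu> = (\<Sum>k. ennreal (lam \<mu> k powr s * m k))"

lemma opnorm_comparable_le:
  assumes p: "0 < p" and pq: "p \<le> q"
  shows "comparable (\<lambda>\<mu>. bergman_opnorm \<nu> p q (cesaro_op \<mu> \<omega>)) (Dinf (1 / p - 1 / q))"
proof -
  have q: "0 < q" using p pq by linarith
  define \<sigma> where "\<sigma> = 1 / p - 1 / q"
  obtain B where B: "B > 0" and up: "\<And>\<mu> \<Lambda>. \<mu> \<in> M_plus \<Longrightarrow> 0 \<le> \<Lambda> \<Longrightarrow> (\<And>k. lam \<mu> k \<le> \<Lambda> * m k powr \<sigma>) \<Longrightarrow> OpB \<mu> p q (B * \<Lambda> powr q)"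
    using upper_le[OF p pq] unfolding \<sigma>_def by blast
  obtain B' where B': "B' > 0" and low: "\<And>\<mu> Q n b. \<mu> \<in> M_plus \<Longrightarrow> 0 \<le> Q \<Longrightarrow> OpB \<mu> p q Q \<Longrightarrow> (\<And>k. 0 \<le> b k) \<Longrightarrow>
    (\<Sum>k<n. (b k * lam \<mu> k) powr q * m k) \<le> B' * Q * (\<Sum>k<n. b k powr p * m k) powr (q / p)"
    using lower_test[OF p q] by blast
  define c1 where "c1 = (B * pi powr (q / p) / pi) powr (1 / q)"
  define c2 where "c2 = (B' * (pi * pi powr (- (q / p)))) powr (1 / q)"
  have c: "0 < c1" "0 < c2" using B B' by (auto simp: c1_def c2_def)
  have "comparable (\<lambda>\<mu>. bergman_opnorm \<nu> p q (cesaro_op \<mu> \<omega>)) (Dinf \<sigma>)"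
  proof (rule comparableI[OF c])
    fix \<mu> assume \<mu>: "\<mu> \<in> M_plus"
    show "bergman_opnorm \<nu> p q (cesaro_op \<mu> \<omega>) \<le> ennreal c1 * Dinf \<sigma> \<mu>"
    proof (cases "Dinf \<sigma> \<mu>")
      case (real \<Lambda>)
      have "lam \<mu> k \<le> \<Lambda> * m k powr \<sigma>" for k
      proof -
        have "ennreal (lam \<mu> k / m k powr \<sigma>) \<le> ennreal \<Lambda>" unfolding real(2)[symmetric] Dinf_def by (intro SUP_upper) simp
        then have "lam \<mu> k / m k powr \<sigma> \<le> \<Lambda>" using real by simp
        then show ?thesis using m_pos[of k] by (simp add: divide_le_eq)
      qed
      then have "OpB \<mu> p q (B * \<Lambda> powr q)" using up[OF \<mu>] real by blast
      then have "bergman_opnorm \<nu> p q (cesaro_op \<mu> \<omega>) \<le> ennreal ((B * \<Lambda> powr q * pi powr (q / p) / pi) powr (1 / q))"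
        using B p q \<mu> by (intro bergman_opnorm_le) auto
      also have "(B * \<Lambda> powr q * pi powr (q / p) / pi) powr (1 / q) = c1 * \<Lambda>"
        using B q real by (simp add: c1_def powr_mult powr_divide powr_powr)
      finally show ?thesis using real c by (simp add: ennreal_mult)
    next
      case top then show ?thesis using c by (simp add: ennreal_mult_top)
    qed
    show "Dinf \<sigma> \<mu> \<le> ennreal c2 * bergman_opnorm \<nu> p q (cesaro_op \<mu> \<omega>)"
    proof -
      have "ennreal (1 / c2) * Dinf \<sigma> \<mu> \<le> bergman_opnorm \<nu> p q (cesaro_op \<mu> \<omega>)"
        unfolding bergman_opnorm_def
      proof (rule INF_greatest)
        fix K assume "K \<in> {K. bergman_bound \<nu> p q (cesaro_op \<mu> \<omega>) K}"
        then have bd: "bergman_bound \<nu> p q (cesaro_op \<mu> \<omega>) K" by simp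
        then have K: "0 \<le> K" by (simp add: bergman_bound_def)
        define Q where "Q = pi * K powr q * pi powr (- (q / p))"
        have Q: "0 \<le> Q" by (simp add: Q_def)
        have op: "OpB \<mu> p q Q" unfolding Q_def using bergman_bound_iff[OF p q \<mu> K] bd by simp
        have "lam \<mu> k / m k powr \<sigma> \<le> c2 * K" for k
        proof -
          \<comment> \<open>In this range of exponents a single test function, that of level
            \<open>k\<close>, is enough.\<close>
          have "(\<Sum>j<Suc k. ((if j = k then 1 else 0) * lam \<mu> j) powr q * m j) \<le> B' * Q * (\<Sum>j<Suc k. (if j = k then 1 else 0) powr p * m j) powr (q / p)"
            by (rule low[OF \<mu> Q op]) simp
          then have "lam \<mu> k powr q * m k \<le> B' * Q * m k powr (q / p)"
            by (simp add: if_distrib[of "\<lambda>x. x * _"] if_distrib[of "\<lambda>x. x powr _"] cong: if_cong)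
          then have "(lam \<mu> k powr q * m k) powr (1 / q) \<le> (B' * Q * m k powr (q / p)) powr (1 / q)"
            using q m_pos[of k] by (intro powr_mono2) (auto simp: less_imp_le)
          then have "lam \<mu> k * m k powr (1 / q) \<le> (B' * Q) powr (1 / q) * m k powr (1 / p)"
            using q B' Q m_pos[of k] lam_nonneg[of \<mu> k] by (simp add: powr_mult powr_powr less_imp_le)
          then have "lam \<mu> k \<le> (B' * Q) powr (1 / q) * (m k powr (1 / p) / m k powr (1 / q))"
            using m_pos[of k] by (simp add: field_simps)
          also have "m k powr (1 / p) / m k powr (1 / q) = m k powr \<sigma>" by (simp add: \<sigma>_def powr_diff)
          also have "(B' * Q) powr (1 / q) = c2 * K" using B' K q by (simp add: c2_def Q_def powr_mult powr_powr)
          finally show ?thesis using m_pos[of k] by (simp add: divide_le_eq)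
        qed
        then have "Dinf \<sigma> \<mu> \<le> ennreal (c2 * K)" unfolding Dinf_def by (intro SUP_least ennreal_leI)
        then have "ennreal (1 / c2) * Dinf \<sigma> \<mu> \<le> ennreal (1 / c2) * ennreal (c2 * K)" by (rule mult_left_mono) simp
        also have "\<dots> = ennreal K" using c K by (subst ennreal_mult[symmetric]) auto
        finally show "ennreal (1 / c2) * Dinf \<sigma> \<mu> \<le> ennreal K" .
      qed
      then have "ennreal c2 * (ennreal (1 / c2) * Dinf \<sigma> \<mu>) \<le> ennreal c2 * bergman_opnorm \<nu> p q (cesaro_op \<mu> \<omega>)" by (rule mult_left_mono) simp
      moreover have "ennreal c2 * (ennreal (1 / c2) * Dinf \<sigma> \<mu>) = Dinf \<sigma> \<mu>"
        unfolding mult.assoc[symmetric] using c by (subst ennreal_mult[symmetric]) auto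
      ultimately show ?thesis by simp
    qed
  qed
  then show ?thesis unfolding \<sigma>_def .
qed

lemma opnorm_comparable_gt:
  assumes q: "0 < q" and qp: "q < p"
  defines "s \<equiv> q * p / (p - q)"
  shows "comparable (\<lambda>\<mu>. bergman_opnorm \<nu> p q (cesaro_op \<mu> \<omega>)) (\<lambda>\<mu>. epowr (Dsum s \<mu>) (1 / s))"
proof -
  have p: "0 < p" using q qp by linarith
  have s: "0 < s" unfolding s_def using q qp p by simp
  have sq: "1 - q / p = q / s" using q qp p by (simp add: s_def field_simps)
  obtain B where B: "B > 0" and up: "\<And>\<mu> Y. \<mu> \<in> M_plus \<Longrightarrow> 0 < Y \<Longrightarrow> Dsum s \<mu> \<le> ennreal Y \<Longrightarrow> OpB \<mu> p q (B * Y powr (q / s))"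
    using upper_gt[OF q qp] unfolding s_def Dsum_def by blast
  obtain B' where B': "B' > 0" and low: "\<And>\<mu> Q n b. \<mu> \<in> M_plus \<Longrightarrow> 0 \<le> Q \<Longrightarrow> OpB \<mu> p q Q \<Longrightarrow> (\<And>k. 0 \<le> b k) \<Longrightarrow>
    (\<Sum>k<n. (b k * lam \<mu> k) powr q * m k) \<le> B' * Q * (\<Sum>k<n. b k powr p * m k) powr (q / p)"
    using lower_test[OF p q] by blast
  define c1 where "c1 = (B * pi powr (q / p) / pi) powr (1 / q)"
  define c2 where "c2 = (B' * (pi * pi powr (- (q / p)))) powr (1 / q)"
  have c: "0 < c1" "0 < c2" using B B' by (auto simp: c1_def c2_def)
  show ?thesis
  proof (rule comparableI[OF c])
    fix \<mu> assume \<mu>: "\<mu> \<in> M_plus"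
    have upY: "bergman_opnorm \<nu> p q (cesaro_op \<mu> \<omega>) \<le> ennreal (c1 * Y powr (1 / s))" if Y: "0 < Y" "Dsum s \<mu> \<le> ennreal Y" for Y
    proof -
      have "bergman_opnorm \<nu> p q (cesaro_op \<mu> \<omega>) \<le> ennreal ((B * Y powr (q / s) * pi powr (q / p) / pi) powr (1 / q))"
        using B p q \<mu> up[OF \<mu> Y] by (intro bergman_opnorm_le) auto
      also have "(B * Y powr (q / s) * pi powr (q / p) / pi) powr (1 / q) = c1 * Y powr (1 / s)"
        using B q s by (simp add: c1_def powr_mult powr_divide powr_powr)
      finally show ?thesis .
    qed
    show "bergman_opnorm \<nu> p q (cesaro_op \<mu> \<omega>) \<le> ennreal c1 * epowr (Dsum s \<mu>) (1 / s)"
    proof (cases "Dsum s \<mu>")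
      case (real Y)
      have "bergman_opnorm \<nu> p q (cesaro_op \<mu> \<omega>) \<le> ennreal (c1 * Y powr (1 / s))"
      proof (cases "Y = 0")
        case False then show ?thesis using upY[of Y] real by simp
      next
        \<comment> \<open>The upper estimate requires \<open>Y > 0\<close>; here it is applied along
          \<open>Y = 1 / (n + 1)\<close>, followed by a limit.\<close>
        case True
        have "(\<lambda>n. ennreal (c1 * inverse (real (Suc n)) powr (1 / s))) \<longlonglongrightarrow> ennreal (c1 * 0 powr (1 / s))"
          using s by (intro tendsto_ennrealI tendsto_intros tendsto_powr' LIMSEQ_inverse_real_of_nat) auto
        then show ?thesis using True upY real
          by (intro LIMSEQ_le_const[of _ "ennreal (c1 * Y powr (1 / s))"]) (auto intro!: exI[of _ 0])
      qed
      then show ?thesis using real c by (simp add: epowr_ennreal ennreal_mult)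
    next
      case top then show ?thesis using c by (simp add: ennreal_mult_top)
    qed
    show "epowr (Dsum s \<mu>) (1 / s) \<le> ennreal c2 * bergman_opnorm \<nu> p q (cesaro_op \<mu> \<omega>)"
    proof -
      have "ennreal (1 / c2) * epowr (Dsum s \<mu>) (1 / s) \<le> bergman_opnorm \<nu> p q (cesaro_op \<mu> \<omega>)"
        unfolding bergman_opnorm_def
      proof (rule INF_greatest)
        fix K assume "K \<in> {K. bergman_bound \<nu> p q (cesaro_op \<mu> \<omega>) K}"
        then have bd: "bergman_bound \<nu> p q (cesaro_op \<mu> \<omega>) K" by simp
        then have K: "0 \<le> K" by (simp add: bergman_bound_def)
        define Q where "Q = pi * K powr q * pi powr (- (q / p))"
        have Q: "0 \<le> Q" by (simp add: Q_def)
        have op: "OpB \<mu> p q Q" unfolding Q_def using bergman_bound_iff[OF p q \<mu> K] bd by simp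
        \<comment> \<open>The extremal choice \<open>b k = lam \<mu> k powr (s / p)\<close> makes
          both sums of the test inequality equal to \<Sigma>, because
          \<open>(s / p + 1) * q = s\<close>. The truncation at \<open>n\<close> keeps \<Sigma>
          finite, so that a power of it may be divided out.\<close>
        have part: "(\<Sum>k<n. lam \<mu> k powr s * m k) \<le> (B' * Q) powr (s / q)" for n
        proof -
          define \<Sigma> where "\<Sigma> = (\<Sum>k<n. lam \<mu> k powr s * m k)"
          have \<Sigma>0: "0 \<le> \<Sigma>" unfolding \<Sigma>_def using m_pos by (intro sum_nonneg) (auto simp: less_imp_le)
          have e1: "(lam \<mu> k powr (s / p) * lam \<mu> k) powr q = lam \<mu> k powr s" for k
          proof -
            have "lam \<mu> k powr (s / p) * lam \<mu> k = lam \<mu> k powr (s / p + 1)"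
              using lam_nonneg[of \<mu> k] by (cases "lam \<mu> k = 0") (simp_all add: powr_add)
            moreover have "(s / p + 1) * q = s" using q qp p by (simp add: s_def field_simps)
            ultimately show ?thesis by (simp add: powr_powr)
          qed
          have e2: "(lam \<mu> k powr (s / p)) powr p = lam \<mu> k powr s" for k using p by (simp add: powr_powr)
          have main: "\<Sigma> \<le> B' * Q * \<Sigma> powr (q / p)"
            using low[OF \<mu> Q op, of "\<lambda>k. lam \<mu> k powr (s / p)" n] by (simp add: e1 e2 \<Sigma>_def)
          show ?thesis
          proof (cases "\<Sigma> = 0")
            case True then show ?thesis unfolding \<Sigma>_def by simp
          next
            case False
            then have "0 < \<Sigma>" using \<Sigma>0 by simp
            have "\<Sigma> powr (q / s) = \<Sigma> / \<Sigma> powr (q / p)"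
              unfolding sq[symmetric] using \<open>0 < \<Sigma>\<close> by (simp add: powr_diff)
            also have "\<dots> \<le> B' * Q" using main \<open>0 < \<Sigma>\<close> by (simp add: divide_le_eq)
            finally have "(\<Sigma> powr (q / s)) powr (s / q) \<le> (B' * Q) powr (s / q)" using s q by (intro powr_mono2) auto
            then show ?thesis using s q \<open>0 < \<Sigma>\<close> by (simp add: powr_powr \<Sigma>_def)
          qed
        qed
        have "Dsum s \<mu> \<le> ennreal ((B' * Q) powr (s / q))"
          unfolding Dsum_def
        proof (rule suminf_le_const)
          fix n
          have "(\<Sum>k<n. ennreal (lam \<mu> k powr s * m k)) = ennreal (\<Sum>k<n. lam \<mu> k powr s * m k)"
            using m_pos by (subst sum_ennreal) (auto simp: less_imp_le)
          then show "(\<Sum>k<n. ennreal (lam \<mu> k powr s * m k)) \<le> ennreal ((B' * Q) powr (s / q))" using part[of n] by (simp add: ennreal_leI)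
        qed simp
        then have "epowr (Dsum s \<mu>) (1 / s) \<le> epowr (ennreal ((B' * Q) powr (s / q))) (1 / s)" using s by (intro epowr_mono) auto
        also have "\<dots> = ennreal ((B' * Q) powr (1 / q))" using s by (simp add: epowr_ennreal powr_powr)
        also have "(B' * Q) powr (1 / q) = c2 * K" using B' K q by (simp add: c2_def Q_def powr_mult powr_powr)
        finally have "ennreal (1 / c2) * epowr (Dsum s \<mu>) (1 / s) \<le> ennreal (1 / c2) * ennreal (c2 * K)" by (rule mult_left_mono) simp
        also have "\<dots> = ennreal K" using c K by (subst ennreal_mult[symmetric]) auto
        finally show "ennreal (1 / c2) * epowr (Dsum s \<mu>) (1 / s) \<le> ennreal K" .
      qed
      then have "ennreal c2 * (ennreal (1 / c2) * epowr (Dsum s \<mu>) (1 / s)) \<le> ennreal c2 * bergman_opnorm \<nu> p q (cesaro_op \<mu> \<omega>)" by (rule mult_left_mono) simp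
      moreover have "ennreal c2 * (ennreal (1 / c2) * epowr (Dsum s \<mu>) (1 / s)) = epowr (Dsum s \<mu>) (1 / s)"
        unfolding mult.assoc[symmetric] using c by (subst ennreal_mult[symmetric]) auto
      ultimately show ?thesis by simp
    qed
  qed
qed

text \<open>The fundamental function is the image of the constant 1, so both kernel estimates apply
  directly. Above, the pieces add up to the sum of \<open>lam\<close> up to the level of
  \<open>z\<close>, which Hardy's inequality controls; below, the value at \<open>dy j\<close> is at
  least a multiple of \<open>lam \<mu> j\<close>.\<close>

lemma fundamental_comparable:
  assumes s: "0 < s"
  shows "comparable (\<lambda>\<mu>. epowr (Dsum s \<mu>) (1 / s)) (\<lambda>\<mu>. bergman_norm \<nu> s (fundamental_fun \<mu> \<omega>))"
proof -
  obtain H where H: "H > 0" and hardy: "\<And>x. (\<And>k. 0 \<le> x k) \<Longrightarrow> (\<Sum>K. ennreal ((\<Sum>k\<le>K. x k) powr s * m K)) \<le> ennreal H * (\<Sum>k. ennreal (x k powr s * m k))"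
    using hardy_powr[of s m, OF s m_pos m_Suc] by blast
  define c1 where "c1 = 36 * pi * C * (CB powr s * H)"
  have c1: "0 < c1" unfolding c1_def using C_ge_1 CB_pos H by simp
  define \<kappa> where "\<kappa> = 1 / (36 * om.Bm * Co)"
  have \<kappa>: "0 < \<kappa>" unfolding \<kappa>_def using om.Bm_pos om.C_ge_1 by simp
  define c2 where "c2 = 8 * Bs / \<kappa> powr s + 1"
  have c2: "0 < c2" unfolding c2_def using Bs_nonneg by (simp add: add_nonneg_pos)
  have hol1: "(\<lambda>_. 1) holomorphic_on ball (0::complex) 1" by simp
  have upper: "bint s (fundamental_fun \<mu> \<omega>) \<le> ennreal c1 * Dsum s \<mu>" if \<mu>: "\<mu> \<in> M_plus" for \<mu>
  proof -
    interpret disc_measure \<mu> by unfold_locales (rule \<mu>)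
    define y where "y K = ennreal ((CB * (\<Sum>k\<le>K. lam \<mu> k)) powr s)" for K
    have main: "norm (fundamental_fun \<mu> \<omega> z) \<le> CB * (\<Sum>k\<le>lev z. lam \<mu> k)" if z: "norm z < 1" for z
    proof -
      define K where "K = lev z"
      define b where "b k = (if k < K then lam \<mu> k else om.kd K * measure \<mu> (dI k))" for k
      have "ennreal (norm (fundamental_fun \<mu> \<omega> z)) \<le> (\<Sum>k. ennreal (CB * om.kd (min k K) * measure \<mu> (dI k) * 1))"
        unfolding K_def fundamental_fun_def by (rule cesaro_bound[OF \<mu> hol1 z]) auto
      also have "\<dots> \<le> (\<Sum>k. ennreal (CB * b k))"
      proof (intro suminf_le ennreal_leI)
        fix k
        have "om.kd (min k K) * measure \<mu> (dI k) \<le> b k"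
          using om.kd_pos[of k] dI_le_U[of k] by (auto simp: b_def lam_def U_hat mult.commute)
        then show "CB * om.kd (min k K) * measure \<mu> (dI k) * 1 \<le> CB * b k" using CB_pos by (simp add: mult.assoc)
      qed auto
      also have "\<dots> = ennreal (CB * (\<Sum>k\<le>K. lam \<mu> k))"
      proof (rule suminf_ennreal_eq)
        show "0 \<le> CB * b k" for k unfolding b_def using CB_pos lam_nonneg om.kd_pos[of K] by simp
        have "(\<lambda>i. measure \<mu> (dI (i + K))) sums measure \<mu> (\<Union>i. dI (i + K))"
          using dI_disjoint by (intro finite_measure_UNION) (auto simp: disjoint_family_on_def)
        then have "(\<lambda>i. measure \<mu> (dI (i + K))) sums measure_hat \<mu> (dy K)" unfolding UN_dI_tail by (simp add: measure_hat_def)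
        then have "(\<lambda>i. b (i + K)) sums (om.kd K * measure_hat \<mu> (dy K))" unfolding b_def by (simp add: sums_mult)
        then have "b sums (om.kd K * measure_hat \<mu> (dy K) + (\<Sum>i<K. b i))" by (simp add: sums_iff_shift)
        moreover have "(\<Sum>i<K. b i) = (\<Sum>i<K. lam \<mu> i)" by (simp add: b_def)
        ultimately have "b sums (\<Sum>k\<le>K. lam \<mu> k)" by (simp add: lam_def mult.commute add.commute lessThan_Suc_atMost[symmetric])
        then show "(\<lambda>k. CB * b k) sums (CB * (\<Sum>k\<le>K. lam \<mu> k))" by (rule sums_mult)
      qed
      finally show ?thesis using CB_pos by (simp add: K_def sum_nonneg lam_nonneg)
    qed
    have "fp s (fundamental_fun \<mu> \<omega>) z \<le> y (lev z)" if z: "norm z < 1" for z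
      using main[OF z] s z by (simp add: fp_ball y_def ennreal_leI powr_mono2)
    then have "bint s (fundamental_fun \<mu> \<omega>) \<le> ennreal (36 * pi * C) * (\<Sum>K. y K * ennreal (m K))"
      using bint_le_majorant[of s "fundamental_fun \<mu> \<omega>" y 0 "\<lambda>_. 0"] by simp
    also have "\<dots> = ennreal (36 * pi * C) * (\<Sum>K. ennreal (CB powr s) * ennreal ((\<Sum>k\<le>K. lam \<mu> k) powr s * m K))"
      using m_pos CB_pos lam_nonneg by (simp add: y_def ennreal_mult less_imp_le powr_mult sum_nonneg mult.assoc)
    also have "\<dots> = ennreal (36 * pi * C) * (ennreal (CB powr s) * (\<Sum>K. ennreal ((\<Sum>k\<le>K. lam \<mu> k) powr s * m K)))" by simp
    also have "\<dots> \<le> ennreal (36 * pi * C) * (ennreal (CB powr s) * (ennreal H * Dsum s \<mu>))"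
      unfolding Dsum_def by (intro mult_left_mono hardy lam_nonneg) auto
    also have "\<dots> = ennreal c1 * Dsum s \<mu>"
      unfolding c1_def using C_ge_1 H by (simp add: ennreal_mult mult.assoc)
    finally show ?thesis .
  qed
  have lower: "Dsum s \<mu> \<le> ennreal c2 * bint s (fundamental_fun \<mu> \<omega>)" if \<mu>: "\<mu> \<in> M_plus" for \<mu>
  proof -
    define g where "g = fundamental_fun \<mu> \<omega>"
    have g: "g holomorphic_on ball 0 1" unfolding g_def fundamental_fun_def by (rule cesaro_holomorphic[OF \<mu> hol1])
    have pt: "ennreal (\<kappa> powr s) * ennreal (lam \<mu> j powr s * m j) \<le> Amax s g j * ennreal (m j)" for j
    proof -
      have "1 * lam \<mu> j / (36 * om.Bm * Co) \<le> norm (cesaro_op \<mu> \<omega> (\<lambda>_. 1) (complex_of_real (dy j)))"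
        by (rule cesaro_ge[OF \<mu> hol1, where r = "\<lambda>_. 1"]) auto
      then have "\<kappa> * lam \<mu> j \<le> norm (g (complex_of_real (dy j)))" by (simp add: \<kappa>_def g_def fundamental_fun_def)
      then have "(\<kappa> * lam \<mu> j) powr s \<le> norm (g (complex_of_real (dy j))) powr s"
        using \<kappa> lam_nonneg s by (intro powr_mono2) auto
      then have "ennreal ((\<kappa> * lam \<mu> j) powr s) \<le> fp s g (complex_of_real (dy j))"
        by (subst fp_ball) (auto intro: ennreal_leI)
      also have "\<dots> \<le> Amax s g j" by (rule fp_le_Amax[OF g s]) (use dy_less[of j] in simp)
      finally have "ennreal ((\<kappa> * lam \<mu> j) powr s) * ennreal (m j) \<le> Amax s g j * ennreal (m j)" by (rule mult_right_mono) simp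
      moreover have "ennreal ((\<kappa> * lam \<mu> j) powr s) * ennreal (m j) = ennreal (\<kappa> powr s) * ennreal (lam \<mu> j powr s * m j)"
        using \<kappa> lam_nonneg m_pos[of j] by (subst (1 2) ennreal_mult[symmetric]) (auto simp: powr_mult mult_ac less_imp_le)
      ultimately show ?thesis by simp
    qed
    have "ennreal (\<kappa> powr s) * Dsum s \<mu> = (\<Sum>j. ennreal (\<kappa> powr s) * ennreal (lam \<mu> j powr s * m j))" unfolding Dsum_def by simp
    also have "\<dots> \<le> (\<Sum>j. Amax s g j * ennreal (m j))" by (intro suminf_le pt) auto
    also have "\<dots> \<le> ennreal (8 * Bs) * bint s g" by (rule sum_Amax[OF g s])
    finally have "ennreal (1 / \<kappa> powr s) * (ennreal (\<kappa> powr s) * Dsum s \<mu>) \<le> ennreal (1 / \<kappa> powr s) * (ennreal (8 * Bs) * bint s g)" by (rule mult_left_mono) simp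
    moreover have "ennreal (1 / \<kappa> powr s) * (ennreal (\<kappa> powr s) * Dsum s \<mu>) = Dsum s \<mu>"
      unfolding mult.assoc[symmetric] using \<kappa> by (subst ennreal_mult[symmetric]) auto
    moreover have "ennreal (1 / \<kappa> powr s) * (ennreal (8 * Bs) * bint s g) = ennreal (8 * Bs / \<kappa> powr s) * bint s g"
      unfolding mult.assoc[symmetric] using \<kappa> Bs_nonneg by (subst ennreal_mult[symmetric]) auto
    moreover have "ennreal (8 * Bs / \<kappa> powr s) * bint s g \<le> ennreal c2 * bint s g"
      unfolding c2_def by (intro mult_right_mono ennreal_leI) auto
    ultimately show ?thesis by (simp add: g_def)
  qed
  show ?thesis
  proof (rule comparableI[of "(c2 * pi) powr (1 / s)" "(c1 / pi) powr (1 / s)"])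
    fix \<mu> assume \<mu>: "\<mu> \<in> M_plus"
    define I where "I = bint s (fundamental_fun \<mu> \<omega>)"
    have pi_div: "I = ennreal pi * (I / ennreal pi)"
      by (cases I) (auto simp: divide_ennreal ennreal_mult[symmetric] ennreal_top_divide ennreal_mult_top)
    have "Dsum s \<mu> \<le> ennreal (c2 * pi) * (I / ennreal pi)"
      using lower[OF \<mu>] pi_div c2 unfolding I_def[symmetric] by (subst ennreal_mult) (auto simp: mult.assoc)
    then have "epowr (Dsum s \<mu>) (1 / s) \<le> epowr (ennreal (c2 * pi) * (I / ennreal pi)) (1 / s)" using s by (intro epowr_mono) auto
    also have "\<dots> \<le> ennreal ((c2 * pi) powr (1 / s)) * epowr (I / ennreal pi) (1 / s)" using c2 s by (intro epowr_cmult) auto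
    finally show "epowr (Dsum s \<mu>) (1 / s) \<le> ennreal ((c2 * pi) powr (1 / s)) * bergman_norm \<nu> s (fundamental_fun \<mu> \<omega>)"
      by (simp add: bergman_norm_bint I_def)
    have "I / ennreal pi \<le> ennreal (c1 / pi) * Dsum s \<mu>"
    proof -
      have "I / ennreal pi \<le> (ennreal c1 * Dsum s \<mu>) / ennreal pi" using upper[OF \<mu>] unfolding I_def by (rule divide_right_mono_ennreal)
      also have "\<dots> = ennreal (c1 / pi) * Dsum s \<mu>"
        using c1 by (simp add: divide_ennreal[symmetric] divide_ennreal_def mult_ac)
      finally show ?thesis .
    qed
    then have "epowr (I / ennreal pi) (1 / s) \<le> epowr (ennreal (c1 / pi) * Dsum s \<mu>) (1 / s)" using s by (intro epowr_mono) auto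
    also have "\<dots> \<le> ennreal ((c1 / pi) powr (1 / s)) * epowr (Dsum s \<mu>) (1 / s)" using c1 s by (intro epowr_cmult) auto
    finally show "bergman_norm \<nu> s (fundamental_fun \<mu> \<omega>) \<le> ennreal ((c1 / pi) powr (1 / s)) * epowr (Dsum s \<mu>) (1 / s)"
      by (simp add: bergman_norm_bint I_def)
  qed (use c1 c2 in auto)
qed

end

section \<open>Profiles of the weights\<close>

text \<open>Integrability over the disc controls the tail only from a positive radius on; the
  doubling condition at 0, which refers to the radius \<open>1 / 2\<close>, extends finiteness to 0.
  Doubling also carries a zero of the tail inwards along the radii \<open>dy k\<close> as far as 0,
  and then the weight would vanish almost everywhere.\<close>

lemma D_hat_profile:
  assumes "\<omega> \<in> D_hat"
  obtains h C where "doubling h C" "\<And>n. weight_moment \<omega> n = moment h n"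
    "\<And>r. 0 \<le> r \<Longrightarrow> weight_hat \<omega> r = ennreal (tail h r)"
    "\<And>g. g \<in> borel_measurable borel \<Longrightarrow>
      (\<integral>\<^sup>+z\<in>ball 0 1. g z * ennreal (\<omega> z) \<partial>lebesgue) = (\<integral>\<^sup>+r\<in>{0..<1}. ennreal (2 * pi * r * h r) * circ_avg g r \<partial>lborel)"
    "\<And>z. z \<in> ball 0 1 \<Longrightarrow> 0 \<le> \<omega> z"
    "(\<lambda>z. ennreal (\<omega> z) * indicator (ball 0 1) z) \<in> borel_measurable lebesgue"
proof -
  have rw: "radial_weight \<omega>" and nz: "\<not> (AE z in lebesgue. z \<in> ball 0 1 \<longrightarrow> \<omega> z = 0)"
    using assms unfolding D_hat_def by blast+
  obtain C where C: "C > 1" and dbl: "\<And>r. 0 \<le> r \<Longrightarrow> r < 1 \<Longrightarrow> weight_hat \<omega> r \<le> ennreal C * weight_hat \<omega> ((1 + r) / 2)"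
    using assms unfolding D_hat_def by blast
  have int: "set_integrable lebesgue (ball 0 1) \<omega>" and nn: "\<And>z. z \<in> ball 0 1 \<Longrightarrow> 0 \<le> \<omega> z"
    using rw unfolding radial_weight_def weight_def by blast+
  obtain h where [measurable]: "h \<in> borel_measurable borel" and h0: "\<And>r. 0 \<le> h r"
    and AEh: "AE r in lborel. r \<in> {0..<1} \<longrightarrow> \<omega> (complex_of_real r) = h r"
    and polar: "\<And>g. g \<in> borel_measurable borel \<Longrightarrow>
      (\<integral>\<^sup>+z\<in>ball 0 1. g z * ennreal (\<omega> z) \<partial>lebesgue) = (\<integral>\<^sup>+r\<in>{0..<1}. ennreal (2 * pi * r * h r) * circ_avg g r \<partial>lborel)"
    by (rule radial_weight_profile[OF rw]) blast
  have meas: "(\<lambda>z. ennreal (\<omega> z) * indicator (ball 0 1) z) \<in> borel_measurable lebesgue"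
  proof -
    have [measurable]: "(\<lambda>z. indicator (ball 0 1) z *\<^sub>R \<omega> z) \<in> borel_measurable lebesgue"
      using int unfolding set_integrable_def by (rule borel_measurable_integrable)
    have "(\<lambda>z. ennreal (indicator (ball 0 1) z *\<^sub>R \<omega> z)) \<in> borel_measurable lebesgue" by measurable
    also have "(\<lambda>z. ennreal (indicator (ball 0 1) z *\<^sub>R \<omega> z)) = (\<lambda>z. ennreal (\<omega> z) * indicator (ball 0 1) z)"
      by (auto simp: indicator_def)
    finally show ?thesis .
  qed
  have hat: "weight_hat \<omega> r = (\<integral>\<^sup>+s\<in>{r..<1}. ennreal (h s) \<partial>lborel)" if "0 \<le> r" for r
  proof -
    have "weight_hat \<omega> r = (\<integral>\<^sup>+s. ennreal (h s) * indicator {r..<1} s \<partial>lebesgue)"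
      unfolding weight_hat_def
      by (rule nn_integral_cong_AE) (use AE_completion[OF AEh] that in \<open>auto elim!: eventually_mono simp: indicator_def\<close>)
    then show ?thesis by (simp add: nn_integral_completion)
  qed
  have avg1: "circ_avg (\<lambda>_. 1) r = 1" for r
    unfolding circ_avg_def by simp
  have disc: "(\<integral>\<^sup>+z\<in>ball 0 1. ennreal (\<omega> z) \<partial>lebesgue) = (\<integral>\<^sup>+r\<in>{0..<1}. ennreal (2 * pi * r * h r) \<partial>lborel)"
    using polar[of "\<lambda>_. 1"] by (simp add: avg1)
  have fin_half: "weight_hat \<omega> (1 / 2) < \<infinity>"
  proof -
    have "weight_hat \<omega> (1 / 2) \<le> (\<integral>\<^sup>+r\<in>{0..<1}. ennreal (2 * pi * r * h r) \<partial>lborel)"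
      unfolding hat[of "1 / 2", simplified]
    proof (intro nn_integral_mono)
      fix s :: real
      show "ennreal (h s) * indicator {1 / 2..<1} s \<le> ennreal (2 * pi * s * h s) * indicator {0..<1} s"
      proof (cases "s \<in> {1 / 2..<1}")
        case True
        have "1 * 1 \<le> pi * (2 * s)" using True pi_ge_two by (intro mult_mono) auto
        then have "1 * h s \<le> 2 * pi * s * h s" using h0[of s] by (intro mult_right_mono) (auto simp: mult_ac)
        then show ?thesis using True by (simp add: ennreal_leI)
      qed simp
    qed
    also have "\<dots> = (\<integral>\<^sup>+z. ennreal (norm (indicator (ball 0 1) z *\<^sub>R \<omega> z)) \<partial>lebesgue)"
      unfolding disc[symmetric] by (intro nn_integral_cong) (auto simp: indicator_def nn)
    also have "\<dots> < \<infinity>" using int unfolding set_integrable_def integrable_iff_bounded by blast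
    finally show ?thesis .
  qed
  have fin: "(\<integral>\<^sup>+s\<in>{0..<1}. ennreal (h s) \<partial>lborel) < \<infinity>"
  proof -
    have "weight_hat \<omega> 0 \<le> ennreal C * weight_hat \<omega> (1 / 2)" using dbl[of 0] by simp
    also have "\<dots> < \<infinity>" using fin_half by (simp add: ennreal_mult_less_top)
    finally show ?thesis using hat[of 0] by simp
  qed
  have tail: "weight_hat \<omega> r = ennreal (tail h r)" if "0 \<le> r" for r
  proof -
    have "(\<integral>\<^sup>+s\<in>{r..<1}. ennreal (h s) \<partial>lborel) \<le> (\<integral>\<^sup>+s\<in>{0..<1}. ennreal (h s) \<partial>lborel)"
      using that by (intro nn_integral_mono) (auto simp: indicator_def)
    also have "\<dots> < \<infinity>" by (rule fin)
    finally show ?thesis using hat[OF that] by (simp add: tail_def)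
  qed
  have tail0: "0 \<le> tail h r" for r by (simp add: tail_def)
  have tdbl: "tail h r \<le> C * tail h ((1 + r) / 2)" if "0 \<le> r" "r < 1" for r
  proof -
    have "ennreal (tail h r) \<le> ennreal (C * tail h ((1 + r) / 2))"
      using dbl[OF that] that C by (simp add: tail ennreal_mult tail0)
    then show ?thesis using C tail0 by (simp add: ennreal_le_iff)
  qed
  have tpos: "0 < tail h r" if r: "0 \<le> r" "r < 1" for r
  proof (rule ccontr)
    assume "\<not> 0 < tail h r"
    then have t0: "tail h r = 0" using tail0[of r] by simp
    obtain n where n: "r \<in> dI n" using dI_level[OF r] by blast
    have "weight_hat \<omega> (dy (Suc n)) \<le> weight_hat \<omega> r"
      using n r by (subst (1 2) hat) (auto intro!: nn_integral_mono simp: indicator_def dI_def)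
    then have "ennreal (tail h (dy (Suc n))) = 0" using t0 r by (simp add: tail)
    then have dz: "tail h (dy (Suc n)) = 0" using tail0[of "dy (Suc n)"] by simp
    have "tail h (dy k) = 0 \<Longrightarrow> tail h 0 = 0" for k
    proof (induction k)
      case (Suc k)
      have "tail h (dy k) \<le> C * tail h ((1 + dy k) / 2)" by (rule tdbl) auto
      then have "tail h (dy k) = 0" using Suc(2) tail0[of "dy k"] by (simp add: dy_Suc_mid)
      then show ?case by (rule Suc.IH)
    qed simp
    from this[OF dz] have "(\<integral>\<^sup>+s\<in>{0..<1}. ennreal (h s) \<partial>lborel) = 0" using tail[of 0] hat[of 0] by simp
    then have "AE s in lborel. ennreal (h s) * indicator {0..<1} s = 0" by (subst (asm) nn_integral_0_iff_AE) auto
    then have "(\<integral>\<^sup>+r\<in>{0..<1}. ennreal (2 * pi * r * h r) \<partial>lborel) = 0"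
      using h0 by (subst nn_integral_0_iff_AE) (auto elim!: eventually_mono simp: indicator_def order_antisym split: if_splits)
    then have "(\<integral>\<^sup>+z. ennreal (\<omega> z) * indicator (ball 0 1) z \<partial>lebesgue) = 0" using disc by simp
    then have "AE z in lebesgue. ennreal (\<omega> z) * indicator (ball 0 1) z = 0" by (subst (asm) nn_integral_0_iff_AE[OF meas])
    then have "AE z in lebesgue. z \<in> ball 0 1 \<longrightarrow> \<omega> z = 0"
      by eventually_elim (use nn in \<open>auto simp: indicator_def order_antisym split: if_splits\<close>)
    then show False using nz by simp
  qed
  have mom: "weight_moment \<omega> n = moment h n" for n
  proof -
    define g where "g s = indicator {0..<1} s *\<^sub>R (s ^ n * h s)" for s :: real
    have [measurable]: "g \<in> borel_measurable lborel" unfolding g_def by measurable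
    have ae: "AE s in lebesgue. g s = indicator {0..<1} s *\<^sub>R (s ^ n * \<omega> (complex_of_real s))"
      using AE_completion[OF AEh] by eventually_elim (auto simp: g_def indicator_def)
    have gl: "g \<in> borel_measurable lebesgue" by (rule measurable_completion) simp
    have "weight_moment \<omega> n = (\<integral>s. g s \<partial>lebesgue)"
      unfolding weight_moment_def set_lebesgue_integral_def
      by (rule integral_cong_AE[OF borel_measurable_AE[OF gl ae] gl]) (use ae in \<open>auto elim!: eventually_mono\<close>)
    also have "\<dots> = (\<integral>s. g s \<partial>lborel)" by (rule integral_completion) simp
    also have "\<dots> = enn2real (\<integral>\<^sup>+s. ennreal (g s) \<partial>lborel)"
      by (rule integral_eq_nn_integral) (auto simp: g_def indicator_def h0)
    also have "(\<integral>\<^sup>+s. ennreal (g s) \<partial>lborel) = (\<integral>\<^sup>+s\<in>{0..<1}. ennreal (s ^ n * h s) \<partial>lborel)"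
      by (intro nn_integral_cong) (auto simp: g_def indicator_def)
    finally show ?thesis by (simp add: moment_def)
  qed
  have "doubling h C"
    by unfold_locales (use h0 fin tpos tdbl in auto)
  then show thesis using that[of h C] mom tail polar nn meas by blast
qed

lemma cesaro_setting_exists:
  assumes "\<omega> \<in> D_hat" "\<nu> \<in> D_reg"
  obtains h C L c ho Co where "cesaro_setting h C \<nu> L c ho Co \<omega>"
    "\<And>n. weight_moment \<nu> n = moment h n"
    "\<And>r. 0 \<le> r \<Longrightarrow> weight_hat \<nu> r = ennreal (tail h r)" "\<And>r. 0 \<le> r \<Longrightarrow> weight_hat \<omega> r = ennreal (tail ho r)"
proof -
  obtain ho Co where o: "doubling ho Co" "\<And>n. weight_moment \<omega> n = moment ho n" "\<And>r. 0 \<le> r \<Longrightarrow> weight_hat \<omega> r = ennreal (tail ho r)"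
    by (rule D_hat_profile[OF assms(1)]) blast
  have "\<nu> \<in> D_hat" using assms(2) by (simp add: D_reg_def)
  then obtain h C where n: "doubling h C" "\<And>n. weight_moment \<nu> n = moment h n" "\<And>r. 0 \<le> r \<Longrightarrow> weight_hat \<nu> r = ennreal (tail h r)"
    and polar: "\<And>g. g \<in> borel_measurable borel \<Longrightarrow>
      (\<integral>\<^sup>+z\<in>ball 0 1. g z * ennreal (\<nu> z) \<partial>lebesgue) = (\<integral>\<^sup>+r\<in>{0..<1}. ennreal (2 * pi * r * h r) * circ_avg g r \<partial>lborel)"
    and nn: "\<And>z. z \<in> ball 0 1 \<Longrightarrow> 0 \<le> \<nu> z" and me: "(\<lambda>z. ennreal (\<nu> z) * indicator (ball 0 1) z) \<in> borel_measurable lebesgue"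
    by (rule D_hat_profile) blast
  interpret n: doubling h C by (rule n(1))
  obtain c K where cK: "c > 1" "K > 1" and chk: "\<And>r. 0 \<le> r \<Longrightarrow> r < 1 \<Longrightarrow> weight_hat \<nu> r \<ge> ennreal c * weight_hat \<nu> (1 - (1 - r) / K)"
    using assms(2) unfolding D_reg_def D_check_def by blast
  \<comment> \<open>Shrinking \<open>1 - r\<close> by \<open>K\<close> is replaced by the stronger
    dyadic shrinking by \<open>2 ^ L\<close>, at which the tail is no larger.\<close>
  obtain L where L: "K < 2 ^ L" using real_arch_pow[of 2 K] by auto
  have check: "c * n.W (k + L) \<le> n.W k" for k
  proof -
    define r where "r = 1 - (1 - dy k) / K"
    have k2: "1 - dy k = 1 / 2 ^ k" by (simp add: dy_def)
    have "(1 - dy k) / K \<ge> 1 / 2 ^ (k + L)"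
    proof -
      have "(1::real) / 2 ^ (k + L) = 1 / 2 ^ k * (1 / 2 ^ L)" by (simp add: power_add)
      also have "\<dots> \<le> 1 / 2 ^ k * (1 / K)" using L cK by (intro mult_left_mono divide_left_mono) auto
      finally show ?thesis unfolding k2 by simp
    qed
    then have r1: "r \<le> dy (k + L)" by (simp add: r_def dy_def)
    have "(1 - dy k) / K \<le> 1 - dy k" using cK dy_less_1[of k] by (simp add: divide_le_eq del: dy_less_1)
    then have r0: "dy k \<le> r" by (simp add: r_def)
    have r0': "0 \<le> r" using r0 dy_nonneg[of k] by linarith
    have "ennreal (c * tail h r) \<le> ennreal (tail h (dy k))"
      using chk[of "dy k"] cK r0' by (simp add: n(3) r_def[symmetric] ennreal_mult')
    then have "c * tail h r \<le> tail h (dy k)" using n.W_pos[of k] by (simp add: n.W_def less_imp_le)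
    moreover have "c * n.W (k + L) \<le> c * tail h r" unfolding n.W_def using cK r1 r0' by (intro mult_left_mono n.tail_antimono) auto
    ultimately show ?thesis by (simp add: n.W_def)
  qed
  interpret reg_weight h C \<nu> L c
    by unfold_locales (use polar cK check in auto)
  interpret o: doubling ho Co by (rule o(1))
  have "cesaro_setting h C \<nu> L c ho Co \<omega>"
    by unfold_locales (use o(2) nn me in auto)
  then show thesis using that n(2,3) o(3) by blast
qed

section \<open>The standard weights\<close>

definition std_profile :: "real \<Rightarrow> real \<Rightarrow> real" where
  "std_profile \<alpha> s = \<alpha> * (1 - s\<^sup>2) powr (\<alpha> - 1)"

lemma std_profile_measurable [measurable]: "std_profile \<alpha> \<in> borel_measurable borel"
  unfolding std_profile_def[abs_def] by measurable

lemma std_profile_nonneg: "0 < \<alpha> \<Longrightarrow> 0 \<le> std_profile \<alpha> s"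
  by (simp add: std_profile_def)

lemma standard_weight_moment:
  assumes "0 < \<alpha>" shows "weight_moment (standard_weight \<alpha>) n = moment (std_profile \<alpha>) n"
proof -
  define g where "g s = indicator {0..<1} s *\<^sub>R (s ^ n * std_profile \<alpha> s)" for s :: real
  have [measurable]: "g \<in> borel_measurable lborel" unfolding g_def by measurable
  have "weight_moment (standard_weight \<alpha>) n = (\<integral>s. g s \<partial>lebesgue)"
    unfolding weight_moment_def set_lebesgue_integral_def g_def std_profile_def standard_weight_def by simp
  also have "\<dots> = (\<integral>s. g s \<partial>lborel)" by (rule integral_completion) simp
  also have "\<dots> = enn2real (\<integral>\<^sup>+s. ennreal (g s) \<partial>lborel)"
    by (rule integral_eq_nn_integral) (auto simp: g_def indicator_def std_profile_nonneg assms)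
  also have "(\<integral>\<^sup>+s. ennreal (g s) \<partial>lborel) = (\<integral>\<^sup>+s\<in>{0..<1}. ennreal (s ^ n * std_profile \<alpha> s) \<partial>lborel)"
    by (intro nn_integral_cong) (auto simp: g_def indicator_def)
  finally show ?thesis by (simp add: moment_def)
qed

lemma nn_integral_powr_tail:
  assumes \<alpha>: "0 < \<alpha>" and r: "r < 1"
  shows "(\<integral>\<^sup>+s\<in>{r..<1}. ennreal (\<alpha> * (1 - s) powr (\<alpha> - 1)) \<partial>lborel) = ennreal ((1 - r) powr \<alpha>)"
proof -
  have i: "((\<lambda>x. \<alpha> * x powr (\<alpha> - 1)) has_integral (\<alpha> * ((1 - r) powr (\<alpha> - 1 + 1) / (\<alpha> - 1 + 1)))) {0..1 - r}"
    using \<alpha> r by (intro has_integral_mult_right has_integral_powr_from_0) auto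
  have "(\<integral>\<^sup>+s\<in>{r..<1}. ennreal (\<alpha> * (1 - s) powr (\<alpha> - 1)) \<partial>lborel) = (\<integral>\<^sup>+x. ennreal (\<alpha> * x powr (\<alpha> - 1)) * indicator {r..<1} (1 - x) \<partial>lborel)"
    using nn_integral_real_affine[of "\<lambda>s. ennreal (\<alpha> * (1 - s) powr (\<alpha> - 1)) * indicator {r..<1} s" "-1" 1] by simp
  also have "\<dots> = (\<integral>\<^sup>+x. ennreal (indicator {0..1 - r} x * (\<alpha> * x powr (\<alpha> - 1))) \<partial>lborel)"
    by (rule nn_integral_cong_AE, use AE_lborel_singleton[of 0] in eventually_elim) (auto simp: indicator_def)
  also have "\<dots> = ennreal (\<alpha> * ((1 - r) powr (\<alpha> - 1 + 1) / (\<alpha> - 1 + 1)))"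
    using nn_integral_has_integral_lebesgue[OF _ i] \<alpha> by simp
  also have "\<alpha> * ((1 - r) powr (\<alpha> - 1 + 1) / (\<alpha> - 1 + 1)) = (1 - r) powr \<alpha>" using \<alpha> by simp
  finally show ?thesis .
qed

text \<open>The factorisation \<open>1 - s^2 = (1 - s) * (1 + s)\<close> separates a power with
  explicit tail from one that stays between \<open>2 powr (- \<bar>\<alpha> - 1\<bar>)\<close> and
  \<open>2 powr \<bar>\<alpha> - 1\<bar>\<close>.\<close>

lemma std_tail:
  assumes \<alpha>: "0 < \<alpha>" and r: "0 \<le> r" "r < 1"
  shows "tail (std_profile \<alpha>) r \<le> 2 powr \<bar>\<alpha> - 1\<bar> * (1 - r) powr \<alpha>" "(1 - r) powr \<alpha> \<le> 2 powr \<bar>\<alpha> - 1\<bar> * tail (std_profile \<alpha>) r"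
    "(\<integral>\<^sup>+s\<in>{r..<1}. ennreal (std_profile \<alpha> s) \<partial>lborel) < \<infinity>"
proof -
  define D where "D = (2::real) powr \<bar>\<alpha> - 1\<bar>"
  have D: "0 < D" by (simp add: D_def)
  have pt: "std_profile \<alpha> s \<le> D * (\<alpha> * (1 - s) powr (\<alpha> - 1))" "\<alpha> * (1 - s) powr (\<alpha> - 1) \<le> D * std_profile \<alpha> s"
    if s: "0 \<le> s" "s < 1" for s
  proof -
    have f: "std_profile \<alpha> s = \<alpha> * (1 - s) powr (\<alpha> - 1) * (1 + s) powr (\<alpha> - 1)"
      using s by (simp add: std_profile_def powr_mult[symmetric] power2_eq_square algebra_simps)
    have u: "(1 + s) powr (\<alpha> - 1) \<le> D"
    proof -
      have "(1 + s) powr (\<alpha> - 1) \<le> (1 + s) powr \<bar>\<alpha> - 1\<bar>" using s by (intro powr_mono) auto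
      also have "\<dots> \<le> D" unfolding D_def using s by (intro powr_mono2) auto
      finally show ?thesis .
    qed
    have l: "1 \<le> D * (1 + s) powr (\<alpha> - 1)"
    proof -
      have "(1 + s) powr (1 - \<alpha>) \<le> (1 + s) powr \<bar>\<alpha> - 1\<bar>" using s by (intro powr_mono) auto
      also have "\<dots> \<le> D" unfolding D_def using s by (intro powr_mono2) auto
      finally have "(1 + s) powr (1 - \<alpha>) * (1 + s) powr (\<alpha> - 1) \<le> D * (1 + s) powr (\<alpha> - 1)" by (rule mult_right_mono) simp
      then show ?thesis using s by (simp add: powr_add[symmetric])
    qed
    have p0: "0 \<le> \<alpha> * (1 - s) powr (\<alpha> - 1)" using \<alpha> by simp
    show "std_profile \<alpha> s \<le> D * (\<alpha> * (1 - s) powr (\<alpha> - 1))" unfolding f using mult_left_mono[OF u p0] by (simp add: mult_ac)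
    show "\<alpha> * (1 - s) powr (\<alpha> - 1) \<le> D * std_profile \<alpha> s" unfolding f using mult_left_mono[OF l p0] by (simp add: mult_ac)
  qed
  have up: "(\<integral>\<^sup>+s\<in>{r..<1}. ennreal (std_profile \<alpha> s) \<partial>lborel) \<le> ennreal (D * (1 - r) powr \<alpha>)"
  proof -
    have "(\<integral>\<^sup>+s\<in>{r..<1}. ennreal (std_profile \<alpha> s) \<partial>lborel) \<le> (\<integral>\<^sup>+s. ennreal D * (ennreal (\<alpha> * (1 - s) powr (\<alpha> - 1)) * indicator {r..<1} s) \<partial>lborel)"
    proof (rule nn_integral_mono)
      fix s
      show "ennreal (std_profile \<alpha> s) * indicator {r..<1} s \<le> ennreal D * (ennreal (\<alpha> * (1 - s) powr (\<alpha> - 1)) * indicator {r..<1} s)"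
        using pt(1)[of s] r D \<alpha> by (auto simp: indicator_def ennreal_mult[symmetric] intro!: ennreal_leI)
    qed
    also have "\<dots> = ennreal D * ennreal ((1 - r) powr \<alpha>)"
      by (subst nn_integral_cmult) (auto simp: nn_integral_powr_tail[OF \<alpha> r(2)])
    finally show ?thesis using D by (simp add: ennreal_mult)
  qed
  then show fin: "(\<integral>\<^sup>+s\<in>{r..<1}. ennreal (std_profile \<alpha> s) \<partial>lborel) < \<infinity>" by (rule le_less_trans) simp
  then have t: "(\<integral>\<^sup>+s\<in>{r..<1}. ennreal (std_profile \<alpha> s) \<partial>lborel) = ennreal (tail (std_profile \<alpha>) r)"
    by (simp add: tail_def)
  show "tail (std_profile \<alpha>) r \<le> 2 powr \<bar>\<alpha> - 1\<bar> * (1 - r) powr \<alpha>"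
    using up D unfolding t D_def by simp
  have "ennreal ((1 - r) powr \<alpha>) = (\<integral>\<^sup>+s\<in>{r..<1}. ennreal (\<alpha> * (1 - s) powr (\<alpha> - 1)) \<partial>lborel)" by (rule nn_integral_powr_tail[OF \<alpha> r(2), symmetric])
  also have "\<dots> \<le> (\<integral>\<^sup>+s. ennreal D * (ennreal (std_profile \<alpha> s) * indicator {r..<1} s) \<partial>lborel)"
  proof (rule nn_integral_mono)
    fix s
    show "ennreal (\<alpha> * (1 - s) powr (\<alpha> - 1)) * indicator {r..<1} s \<le> ennreal D * (ennreal (std_profile \<alpha> s) * indicator {r..<1} s)"
      using pt(2)[of s] r D \<alpha> by (auto simp: indicator_def ennreal_mult[symmetric] std_profile_nonneg intro!: ennreal_leI)
  qed
  also have "\<dots> = ennreal D * ennreal (tail (std_profile \<alpha>) r)"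
    unfolding t[symmetric] by (rule nn_integral_cmult) measurable
  also have "\<dots> = ennreal (D * tail (std_profile \<alpha>) r)" using D by (simp add: ennreal_mult tail_def)
  finally show "(1 - r) powr \<alpha> \<le> 2 powr \<bar>\<alpha> - 1\<bar> * tail (std_profile \<alpha>) r"
    using D by (simp add: D_def tail_def)
qed

text \<open>For the model tail \<open>(1 - r) powr \<alpha>\<close>, halving \<open>1 - r\<close>
  costs \<open>2 powr \<alpha>\<close>; the outer factors pay for passing to the model and
  back.\<close>

lemma doubling_std:
  assumes \<alpha>: "0 < \<alpha>"
  shows "doubling (std_profile \<alpha>) (2 powr \<bar>\<alpha> - 1\<bar> * 2 powr \<alpha> * 2 powr \<bar>\<alpha> - 1\<bar>)"
proof
  define D where "D = (2::real) powr \<bar>\<alpha> - 1\<bar>"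
  have D: "0 < D" by (simp add: D_def)
  fix r :: real
  show "std_profile \<alpha> \<in> borel_measurable borel" by measurable
  show "0 \<le> std_profile \<alpha> r" by (rule std_profile_nonneg[OF \<alpha>])
  show "(\<integral>\<^sup>+s\<in>{0..<1}. ennreal (std_profile \<alpha> s) \<partial>lborel) < \<infinity>" by (rule std_tail(3)[OF \<alpha>]) auto
  assume r: "0 \<le> r" "r < 1"
  have "0 < (1 - r) powr \<alpha>" using r by simp
  also have "\<dots> \<le> D * tail (std_profile \<alpha>) r" unfolding D_def by (rule std_tail(2)[OF \<alpha> r])
  finally show "0 < tail (std_profile \<alpha>) r" using D by (simp add: zero_less_mult_iff)
  have "tail (std_profile \<alpha>) r \<le> D * (1 - r) powr \<alpha>" unfolding D_def by (rule std_tail(1)[OF \<alpha> r])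
  also have "(1 - r) powr \<alpha> = 2 powr \<alpha> * (1 - (1 + r) / 2) powr \<alpha>"
  proof -
    have "1 - r = 2 * (1 - (1 + r) / 2)" by (simp add: field_simps)
    then show ?thesis using powr_mult[of 2 "1 - (1 + r) / 2" \<alpha>] by (simp only:)
  qed
  also have "D * (2 powr \<alpha> * (1 - (1 + r) / 2) powr \<alpha>) \<le> D * (2 powr \<alpha> * (D * tail (std_profile \<alpha>) ((1 + r) / 2)))"
    unfolding D_def using r by (intro mult_left_mono std_tail(2)[OF \<alpha>]) auto
  finally show "tail (std_profile \<alpha>) r \<le> 2 powr \<bar>\<alpha> - 1\<bar> * 2 powr \<alpha> * 2 powr \<bar>\<alpha> - 1\<bar> * tail (std_profile \<alpha>) ((1 + r) / 2)"
    by (simp add: D_def mult_ac)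
qed

section \<open>Integral and sequence conditions\<close>

lemma comparable_epowr:
  assumes "comparable A B" "0 < a"
  shows "comparable (\<lambda>\<mu>. epowr (A \<mu>) a) (\<lambda>\<mu>. epowr (B \<mu>) a)"
proof -
  obtain c where c: "0 < c" "\<And>\<mu>. \<mu> \<in> M_plus \<Longrightarrow> A \<mu> \<le> ennreal c * B \<mu>" "\<And>\<mu>. \<mu> \<in> M_plus \<Longrightarrow> B \<mu> \<le> ennreal c * A \<mu>"
    using comparableD[OF assms(1)] by blast
  show ?thesis
  proof (rule comparableI[of "c powr a" "c powr a"])
    fix \<mu> assume \<mu>: "\<mu> \<in> M_plus"
    show "epowr (A \<mu>) a \<le> ennreal (c powr a) * epowr (B \<mu>) a"
      by (rule order_trans[OF epowr_mono[OF c(2)[OF \<mu>] assms(2)] epowr_cmult]) (use c assms in auto)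
    show "epowr (B \<mu>) a \<le> ennreal (c powr a) * epowr (A \<mu>) a"
      by (rule order_trans[OF epowr_mono[OF c(3)[OF \<mu>] assms(2)] epowr_cmult]) (use c assms in auto)
  qed (use c in auto)
qed

text \<open>The indices for which \<open>n + 1\<close> has binary logarithm \<open>k\<close>,
  rounded down. The shift by one puts the index 0 into block 0.\<close>

definition blk :: "nat \<Rightarrow> nat set" where "blk k = {2 ^ k - 1..<2 ^ Suc k - 1}"

lemma blk_iff: "n \<in> blk k \<longleftrightarrow> 2 ^ k \<le> n + 1 \<and> n + 1 < 2 ^ Suc k"
proof -
  have "(0::nat) < 2 ^ k" "(0::nat) < 2 ^ Suc k" by simp_all
  then show ?thesis unfolding blk_def by (auto simp del: power_Suc)
qed

lemma finite_blk [simp]: "finite (blk k)" by (simp add: blk_def)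

lemma card_blk [simp]: "card (blk k) = 2 ^ k"
proof -
  have "(1::nat) \<le> 2 ^ k" by simp
  then show ?thesis by (simp add: blk_def)
qed

lemma ex_blk: "\<exists>k. n \<in> blk k"
  using ex_power_ivl1[of 2 "n + 1"] by (auto simp: blk_iff)

lemma suminf_blk:
  fixes f :: "nat \<Rightarrow> ennreal"
  shows "(\<Sum>n. f n) = (\<Sum>k. \<Sum>n\<in>blk k. f n)"
proof -
  have dis: "disjoint_family blk"
    unfolding disjoint_family_on_def
  proof (intro ballI impI)
    fix i j :: nat assume "i \<noteq> j"
    then have "Suc i \<le> j \<or> Suc j \<le> i" by linarith
    then have "(2::nat) ^ Suc i \<le> 2 ^ j \<or> (2::nat) ^ Suc j \<le> 2 ^ i" by (metis one_le_numeral power_increasing)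
    then have "\<not> (n \<in> blk i \<and> n \<in> blk j)" for n unfolding blk_iff by linarith
    then show "blk i \<inter> blk j = {}" by blast
  qed
  have "f n = (\<Sum>k. f n * indicator (blk k) n)" for n
  proof -
    have "(\<Sum>k. indicator (blk k) n :: ennreal) = indicator (\<Union>k. blk k) n" by (rule suminf_indicator[OF dis])
    also have "\<dots> = 1" using ex_blk[of n] by (auto simp: indicator_def)
    finally show ?thesis by simp
  qed
  then have "(\<Sum>n. f n) = (\<Sum>n. \<Sum>k. f n * indicator (blk k) n)" by simp
  also have "\<dots> = (\<Sum>k. \<Sum>n. f n * indicator (blk k) n)" by (rule suminf_swap_ennreal)
  also have "\<dots> = (\<Sum>k. \<Sum>n\<in>blk k. f n)"
  proof (intro suminf_cong)
    fix k
    have "(\<Sum>n. f n * indicator (blk k) n) = (\<Sum>n\<in>blk k. f n * indicator (blk k) n)" by (rule suminf_finite) auto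
    then show "(\<Sum>n. f n * indicator (blk k) n) = (\<Sum>n\<in>blk k. f n)" by simp
  qed
  finally show ?thesis .
qed

lemma real_blk:
  assumes "n \<in> blk k" shows "2 ^ k \<le> real (n + 1)" "real (n + 1) \<le> 2 * 2 ^ k"
proof -
  have "real (2 ^ k) \<le> real (n + 1)" "real (n + 1) \<le> real (2 ^ Suc k)"
    using assms by (auto simp only: blk_iff of_nat_le_iff)
  then show "2 ^ k \<le> real (n + 1)" "real (n + 1) \<le> 2 * 2 ^ k" by simp_all
qed

lemma sum_half_powers: "(\<Sum>j\<le>k. (1 / 2 :: real) ^ (k - j)) \<le> 4"
proof -
  have "(\<Sum>j\<le>k. (1 / 2 :: real) ^ (k - j)) = (\<Sum>j\<in>{..k}. (1 / 2) ^ ndist k j)" by (intro sum.cong) auto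
  also have "\<dots> \<le> 2 / (1 - 1 / 2)" by (rule sum_power_ndist) auto
  finally show ?thesis by simp
qed

lemma suminf_le_head_tail: "(\<Sum>k. f k) \<le> f 0 + (\<Sum>k. f (Suc k))" for f :: "nat \<Rightarrow> ennreal"
proof (rule suminf_le_const)
  fix n
  have "(\<Sum>k<n. f k) \<le> (\<Sum>k<Suc n. f k)" by simp
  also have "\<dots> = f 0 + (\<Sum>k<n. f (Suc k))" by (rule sum.lessThan_Suc_shift)
  also have "\<dots> \<le> f 0 + (\<Sum>k. f (Suc k))" by (intro add_left_mono sum_le_suminf) auto
  finally show "(\<Sum>k<n. f k) \<le> f 0 + (\<Sum>k. f (Suc k))" .
qed simp

section \<open>Comparison of the remaining conditions with the sequence norms\<close>

locale cesaro_full = cesaro_setting +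
  assumes nu_moment: "weight_moment \<nu> n = moment h n"
    and nu_hat: "0 \<le> r \<Longrightarrow> weight_hat \<nu> r = ennreal (tail h r)"
    and om_hat: "0 \<le> r \<Longrightarrow> weight_hat \<omega> r = ennreal (tail ho r)"
begin

lemma hats: "0 \<le> r \<Longrightarrow> r < 1 \<Longrightarrow> enn2real (weight_hat \<nu> r) = tail h r"
  "0 \<le> r \<Longrightarrow> r < 1 \<Longrightarrow> enn2real (weight_hat \<omega> r) = tail ho r"
  using tail_pos[of r] om.tail_pos[of r] by (simp_all add: nu_hat om_hat less_imp_le)

lemma m_powr: "m k powr \<sigma> = W k powr \<sigma> / (2 ^ k) powr \<sigma>"
  using W_pos[of k] by (simp add: m_def powr_divide less_imp_le)

lemma ratio_eq: "x / (om.W k * W k powr \<sigma> * (1 / 2 ^ k) powr (1 + \<sigma>)) = x * om.kd k / m k powr \<sigma>"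
proof -
  have "(1 / 2 ^ k :: real) powr (1 + \<sigma>) = 1 / (2 ^ k * (2 ^ k) powr \<sigma>)"
    by (simp add: powr_divide powr_add)
  then show ?thesis unfolding m_powr om.kd_def by simp
qed

text \<open>Between consecutive dyadic radii the numerator is monotone, each tail in the denominator
  changes at most by its doubling constant, and \<open>1 - r\<close> at most by the factor
  2.\<close>

lemma mu_Linf_comparable:
  assumes \<sigma>: "0 \<le> 1 / p - 1 / q"
  shows "comparable (mu_Linf p q \<omega> \<nu>) (Dinf (1 / p - 1 / q))"
proof -
  define \<sigma> where "\<sigma> = 1 / p - 1 / q"
  have e: "1 + 1 / p - 1 / q = 1 + \<sigma>" by (simp add: \<sigma>_def)
  define c where "c = Co * C powr \<sigma> * 2 powr (1 + \<sigma>)"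
  have c: "0 < c" using om.C_ge_1 C_ge_1 by (simp add: c_def)
  have "comparable (mu_Linf p q \<omega> \<nu>) (Dinf \<sigma>)"
  proof (rule comparableI[of c 1])
    fix \<mu> assume \<mu>: "\<mu> \<in> M_plus"
    interpret disc_measure \<mu> by unfold_locales (rule \<mu>)
    show "mu_Linf p q \<omega> \<nu> \<mu> \<le> ennreal c * Dinf \<sigma> \<mu>"
      unfolding mu_Linf_def \<sigma>_def[symmetric] e
    proof (rule SUP_least)
      fix r :: real assume r: "r \<in> {0..<1}"
      then obtain k where k: "r \<in> dI k" using dI_level[of r] by auto
      have r2: "1 / 2 ^ Suc k \<le> 1 - r" "dy k \<le> r" using k by (auto simp: dI_def dy_def)
      have "measure_hat \<mu> r / (tail ho r * tail h r powr \<sigma> * (1 - r) powr (1 + \<sigma>)) \<le>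
          measure_hat \<mu> (dy k) / ((om.W k / Co) * (W k / C) powr \<sigma> * (1 / 2 ^ Suc k) powr (1 + \<sigma>))"
      proof (intro frac_le mult_mono powr_mono2 hat_antimono)
        show "om.W k / Co \<le> tail ho r" using om.tail_bounds(2)[OF k] om.C_ge_1 by (simp add: divide_le_eq mult.commute)
        show "W k / C \<le> tail h r" using tail_bounds(2)[OF k] C_ge_1 by (simp add: divide_le_eq mult.commute)
        show "0 < om.W k / Co * (W k / C) powr \<sigma> * (1 / 2 ^ Suc k) powr (1 + \<sigma>)"
          using om.W_pos[of k] W_pos[of k] om.C_ge_1 C_ge_1 by (intro mult_pos_pos divide_pos_pos) auto
      qed (use r2 \<sigma> om.W_pos[of k] W_pos[of k] om.C_ge_1 C_ge_1 r om.tail_pos[of r] in \<open>auto simp: \<sigma>_def measure_hat_def less_imp_le\<close>)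
      also have "\<dots> = c * (measure_hat \<mu> (dy k) / (om.W k * W k powr \<sigma> * (1 / 2 ^ k) powr (1 + \<sigma>)))"
      proof -
        have "(1 / 2 ^ Suc k :: real) powr (1 + \<sigma>) = (1 / 2 ^ k) powr (1 + \<sigma>) / 2 powr (1 + \<sigma>)"
          by (simp add: powr_divide powr_mult)
        moreover have "(W k / C) powr \<sigma> = W k powr \<sigma> / C powr \<sigma>" using W_pos[of k] C_ge_1 by (simp add: powr_divide)
        ultimately show ?thesis using om.C_ge_1 by (simp only: c_def) simp
      qed
      also have "\<dots> = c * (lam \<mu> k / m k powr \<sigma>)" by (simp add: ratio_eq lam_def)
      finally have "ennreal (measure_hat \<mu> r / (enn2real (weight_hat \<omega> r) * enn2real (weight_hat \<nu> r) powr \<sigma> * (1 - r) powr (1 + \<sigma>))) \<le> ennreal (c * (lam \<mu> k / m k powr \<sigma>))"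
        using r by (intro ennreal_leI) (simp add: hats)
      also have "\<dots> = ennreal c * ennreal (lam \<mu> k / m k powr \<sigma>)" using c by (intro ennreal_mult') simp
      also have "\<dots> \<le> ennreal c * Dinf \<sigma> \<mu>" unfolding Dinf_def by (intro mult_left_mono SUP_upper) auto
      finally show "ennreal (measure_hat \<mu> r / (enn2real (weight_hat \<omega> r) * enn2real (weight_hat \<nu> r) powr \<sigma> * (1 - r) powr (1 + \<sigma>))) \<le> ennreal c * Dinf \<sigma> \<mu>" .
    qed
    have "Dinf \<sigma> \<mu> \<le> mu_Linf p q \<omega> \<nu> \<mu>"
      unfolding Dinf_def
    proof (rule SUP_least)
      fix k
      have "lam \<mu> k / m k powr \<sigma> = measure_hat \<mu> (dy k) / (tail ho (dy k) * tail h (dy k) powr \<sigma> * (1 - dy k) powr (1 + \<sigma>))"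
        unfolding om.W_def[symmetric] W_def[symmetric] using ratio_eq[of "measure_hat \<mu> (dy k)" k \<sigma>] by (simp add: lam_def dy_def[of k])
      also have "ennreal \<dots> \<le> mu_Linf p q \<omega> \<nu> \<mu>"
        unfolding mu_Linf_def \<sigma>_def[symmetric] e
        by (rule SUP_upper2[of "dy k"]) (auto simp: hats)
      finally show "ennreal (lam \<mu> k / m k powr \<sigma>) \<le> mu_Linf p q \<omega> \<nu> \<mu>" .
    qed
    then show "Dinf \<sigma> \<mu> \<le> ennreal 1 * mu_Linf p q \<omega> \<nu> \<mu>" by simp
  qed (use c in auto)
  then show ?thesis unfolding \<sigma>_def .
qed

lemma kd_iterate: "om.kd (j + i) \<le> (2 * Co) ^ i * om.kd j"
proof (induction i)
  case (Suc i)
  have "om.kd (Suc (j + i)) \<le> 2 * Co * om.kd (j + i)" by (rule kd_Suc)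
  also have "\<dots> \<le> 2 * Co * ((2 * Co) ^ i * om.kd j)" using om.C_ge_1 Suc by (intro mult_left_mono) auto
  finally show ?case by (simp add: mult_ac)
qed simp

text \<open>From level \<open>j\<close> to level \<open>k\<close> the kernel size \<open>kd\<close>
  grows at most by \<open>(2 * Co) ^ (k - j)\<close>; the free exponent of
  \<open>measure_moment_upper\<close> provides the competing factor \<open>1 / 2 ^ M\<close> per
  level.\<close>

lemma moment_le_lam:
  assumes \<mu>: "\<mu> \<in> M_plus" and k: "2 ^ k \<le> n + 1"
  shows "measure_moment \<mu> n * om.kd k \<le> (\<Sum>j\<le>k. ((2 * real M) ^ M + 1) * (2 * Co / 2 ^ M) ^ (k - j) * lam \<mu> j)"
proof -
  interpret disc_measure \<mu> by unfold_locales (rule \<mu>)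
  have kdj: "om.kd k * U j \<le> (2 * Co) ^ (k - j) * lam \<mu> j" if "j \<le> k" for j
    using mult_right_mono[OF kd_iterate[of j "k - j"] U_nonneg[of j]] that by (simp add: lam_def U_hat mult_ac)
  have "measure_moment \<mu> n * om.kd k \<le> ((\<Sum>j<k. (2 * real M) ^ M * (2 ^ j / 2 ^ k) ^ M * U j) + U k) * om.kd k"
    using om.kd_pos[of k] by (intro mult_right_mono measure_moment_upper k) auto
  also have "\<dots> = (\<Sum>j<k. (2 * real M) ^ M * (2 ^ j / 2 ^ k) ^ M * (om.kd k * U j)) + om.kd k * U k"
    unfolding distrib_right sum_distrib_right by (intro arg_cong2[of _ _ _ _ "(+)"] sum.cong) (simp_all add: mult_ac)
  also have "\<dots> \<le> (\<Sum>j<k. ((2 * real M) ^ M + 1) * (2 * Co / 2 ^ M) ^ (k - j) * lam \<mu> j) + ((2 * real M) ^ M + 1) * (2 * Co / 2 ^ M) ^ (k - k) * lam \<mu> k"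
  proof (intro add_mono sum_mono)
    fix j assume "j \<in> {..<k}"
    then have j: "j \<le> k" by simp
    define i where "i = k - j"
    have ki: "k = j + i" using j by (simp add: i_def)
    have "(2 ^ j / 2 ^ k :: real) ^ M = 1 / (2 ^ M) ^ i" unfolding ki by (simp add: power_add power_one_over power_mult[symmetric] mult.commute)
    then have "(2 * real M) ^ M * (2 ^ j / 2 ^ k) ^ M * (om.kd k * U j) \<le> (2 * real M) ^ M * (1 / (2 ^ M) ^ i) * ((2 * Co) ^ i * lam \<mu> j)"
      using kdj[OF j] unfolding i_def by (simp only:) (intro mult_left_mono, auto)
    also have "\<dots> = (2 * real M) ^ M * ((2 * Co / 2 ^ M) ^ i * lam \<mu> j)" by (simp add: power_divide)
    also have "\<dots> \<le> ((2 * real M) ^ M + 1) * ((2 * Co / 2 ^ M) ^ i * lam \<mu> j)"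
      using om.C_ge_1 lam_nonneg[of \<mu> j] by (intro mult_right_mono) auto
    finally show "(2 * real M) ^ M * (2 ^ j / 2 ^ k) ^ M * (om.kd k * U j) \<le> ((2 * real M) ^ M + 1) * (2 * Co / 2 ^ M) ^ (k - j) * lam \<mu> j"
      by (simp add: i_def mult.assoc)
  next
    have "om.kd k * U k \<le> 1 * lam \<mu> k" by (simp add: lam_def U_hat mult.commute)
    also have "\<dots> \<le> ((2 * real M) ^ M + 1) * lam \<mu> k" using lam_nonneg[of \<mu> k] by (intro mult_right_mono) auto
    finally show "om.kd k * U k \<le> ((2 * real M) ^ M + 1) * (2 * Co / 2 ^ M) ^ (k - k) * lam \<mu> k" by simp
  qed
  also have "\<dots> = (\<Sum>j\<le>k. ((2 * real M) ^ M + 1) * (2 * Co / 2 ^ M) ^ (k - j) * lam \<mu> j)"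
    by (simp add: lessThan_Suc_atMost[symmetric])
  finally show ?thesis .
qed

definition cval :: "real \<Rightarrow> real measure \<Rightarrow> nat \<Rightarrow> real" where
  "cval \<sigma> \<mu> n = measure_moment \<mu> n * real (n + 1) powr (1 + \<sigma>) / (moment ho n * moment h n powr \<sigma>)"

lemma mu_linf_cval: "mu_linf p q \<omega> \<nu> \<mu> = (SUP n. ennreal (cval (1 / p - 1 / q) \<mu> n))"
  unfolding mu_linf_def cval_def om_moment nu_moment by (simp add: add_diff_eq)

lemma mu_linf_comparable:
  assumes \<sigma>0: "0 \<le> 1 / p - 1 / q"
  shows "comparable (mu_linf p q \<omega> \<nu>) (Dinf (1 / p - 1 / q))"
proof -
  define \<sigma> where "\<sigma> = 1 / p - 1 / q"
  have \<sigma>: "0 \<le> \<sigma>" using \<sigma>0 by (simp add: \<sigma>_def)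
  \<comment> \<open>Per level the growth of \<open>kd\<close> costs \<open>2 * Co\<close>, and the
    comparison of the powers of \<open>m\<close> costs \<open>(2 * C) powr \<sigma>\<close>. The 2
    in front leaves a geometric series of ratio \<open>1 / 2\<close>.\<close>
  obtain M where M: "2 * (2 * Co * (2 * C) powr \<sigma>) < 2 ^ M" using real_arch_pow[of 2 "2 * (2 * Co * (2 * C) powr \<sigma>)"] by auto
  define D where "D = (2 * real M) ^ M + 1"
  have D: "0 < D" by (simp add: D_def add_nonneg_pos)
  define b where "b = 2 powr (1 + \<sigma>) * (3 * Co) * (3 * C) powr \<sigma>"
  have b: "0 < b" using om.C_ge_1 C_ge_1 by (simp add: b_def)
  define c where "c = b * (D * 4)"
  have c: "0 < c" using b D by (simp add: c_def)
  define c' where "c' = 3 * om.Bm * Bm powr \<sigma>"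
  have c': "0 < c'" using om.Bm_pos Bm_pos by (simp add: c'_def)
  have "comparable (mu_linf p q \<omega> \<nu>) (Dinf \<sigma>)"
  proof (rule comparableI[OF c c'])
    fix \<mu> assume \<mu>: "\<mu> \<in> M_plus"
    interpret disc_measure \<mu> by unfold_locales (rule \<mu>)
    show "mu_linf p q \<omega> \<nu> \<mu> \<le> ennreal c * Dinf \<sigma> \<mu>"
    proof (cases "Dinf \<sigma> \<mu>")
      case top then show ?thesis using c by (simp add: ennreal_mult_top)
    next
      case (real \<Lambda>)
      have lamle: "lam \<mu> k \<le> \<Lambda> * m k powr \<sigma>" for k
      proof -
        have "ennreal (lam \<mu> k / m k powr \<sigma>) \<le> ennreal \<Lambda>" unfolding real(2)[symmetric] Dinf_def by (intro SUP_upper) simp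
        then have "lam \<mu> k / m k powr \<sigma> \<le> \<Lambda>" using real by simp
        then show ?thesis using m_pos[of k] by (simp add: divide_le_eq)
      qed
      have "cval \<sigma> \<mu> n \<le> c * \<Lambda>" for n
      proof -
        obtain k where n: "n \<in> blk k" using ex_blk by blast
        have nk: "2 ^ k \<le> n + 1" "n + 1 \<le> 2 ^ Suc k" using n by (auto simp: blk_iff)
        have "cval \<sigma> \<mu> n \<le> measure_moment \<mu> n * (2 * 2 ^ k) powr (1 + \<sigma>) / ((om.W k / (3 * Co)) * (W k / (3 * C)) powr \<sigma>)"
          unfolding cval_def
        proof (intro frac_le mult_mono powr_mono2 mult_nonneg_nonneg measure_moment_nonneg)
          show "om.W k / (3 * Co) \<le> moment ho n" using om.moment_lower[OF nk(2)] om.C_ge_1 by (simp add: divide_le_eq mult.commute)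
          show "W k / (3 * C) \<le> moment h n" using moment_lower[OF nk(2)] C_ge_1 by (simp add: divide_le_eq mult.commute)
          show "real (n + 1) \<le> 2 * 2 ^ k" by (rule real_blk[OF n])
          show "0 < om.W k / (3 * Co) * (W k / (3 * C)) powr \<sigma>" using om.W_pos[of k] W_pos[of k] om.C_ge_1 C_ge_1 by (intro mult_pos_pos divide_pos_pos) auto
        qed (use \<sigma> om.W_pos[of k] W_pos[of k] om.C_ge_1 C_ge_1 om.moment_pos[of n] in \<open>auto simp: less_imp_le\<close>)
        also have "\<dots> = b * (measure_moment \<mu> n * om.kd k / m k powr \<sigma>)"
        proof -
          have "(2 * 2 ^ k :: real) powr (1 + \<sigma>) = 2 powr (1 + \<sigma>) * (2 ^ k * (2 ^ k) powr \<sigma>)" by (simp add: powr_mult powr_add)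
          moreover have "(W k / (3 * C)) powr \<sigma> = W k powr \<sigma> / (3 * C) powr \<sigma>" using W_pos[of k] C_ge_1 by (simp add: powr_divide)
          ultimately show ?thesis unfolding m_powr om.kd_def b_def by simp
        qed
        also have "\<dots> \<le> b * (D * 4 * \<Lambda>)"
        proof (intro mult_left_mono)
          have "measure_moment \<mu> n * om.kd k \<le> (\<Sum>j\<le>k. D * (2 * Co / 2 ^ M) ^ (k - j) * lam \<mu> j)"
            unfolding D_def by (rule moment_le_lam[OF \<mu> nk(1)])
          also have "\<dots> \<le> (\<Sum>j\<le>k. D * \<Lambda> * m k powr \<sigma> * (1 / 2) ^ (k - j))"
          proof (rule sum_mono)
            fix j assume "j \<in> {..k}"
            then have j: "j \<le> k" by simp
            have "m j \<le> (2 * C) ^ (k - j) * m k" using m_double_iterate[of j "k - j"] j by simp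
            then have "m j powr \<sigma> \<le> ((2 * C) ^ (k - j) * m k) powr \<sigma>" using \<sigma> m_pos[of j] by (intro powr_mono2) (auto simp: less_imp_le)
            also have "\<dots> = ((2 * C) powr \<sigma>) ^ (k - j) * m k powr \<sigma>"
              using m_pos[of k] C_ge_1 by (simp add: powr_mult power_powr_commute less_imp_le power_mult_distrib)
            finally have mj: "m j powr \<sigma> \<le> ((2 * C) powr \<sigma>) ^ (k - j) * m k powr \<sigma>" .
            have "D * (2 * Co / 2 ^ M) ^ (k - j) * lam \<mu> j \<le> D * (2 * Co / 2 ^ M) ^ (k - j) * (\<Lambda> * (((2 * C) powr \<sigma>) ^ (k - j) * m k powr \<sigma>))"
              using D om.C_ge_1 real by (intro mult_left_mono order_trans[OF lamle] mj) auto
            also have "\<dots> = D * \<Lambda> * m k powr \<sigma> * (2 * Co / 2 ^ M * (2 * C) powr \<sigma>) ^ (k - j)"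
              by (simp add: power_mult_distrib power_divide)
            also have "\<dots> \<le> D * \<Lambda> * m k powr \<sigma> * (1 / 2) ^ (k - j)"
              using D real M om.C_ge_1 by (intro mult_left_mono power_mono) (auto simp: field_simps)
            finally show "D * (2 * Co / 2 ^ M) ^ (k - j) * lam \<mu> j \<le> D * \<Lambda> * m k powr \<sigma> * (1 / 2) ^ (k - j)" .
          qed
          also have "\<dots> = D * \<Lambda> * m k powr \<sigma> * (\<Sum>j\<le>k. (1 / 2) ^ (k - j))" by (simp add: sum_distrib_left)
          also have "\<dots> \<le> D * \<Lambda> * m k powr \<sigma> * 4" using D real by (intro mult_left_mono sum_half_powers) auto
          finally show "measure_moment \<mu> n * om.kd k / m k powr \<sigma> \<le> D * 4 * \<Lambda>"
            using m_pos[of k] by (simp add: divide_le_eq mult_ac)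
        qed (use b in auto)
        finally show ?thesis by (simp add: c_def)
      qed
      then have "mu_linf p q \<omega> \<nu> \<mu> \<le> ennreal (c * \<Lambda>)"
        unfolding mu_linf_cval \<sigma>_def[symmetric] by (intro SUP_least ennreal_leI)
      then show ?thesis using real c by (simp add: ennreal_mult)
    qed
    show "Dinf \<sigma> \<mu> \<le> ennreal c' * mu_linf p q \<omega> \<nu> \<mu>"
      unfolding Dinf_def
    proof (rule SUP_least)
      fix k
      \<comment> \<open>The lower bound for the moment of \<mu> and the upper bounds for those of
        the weights need opposite inequalities between \<open>n + 1\<close> and
        \<open>2 ^ k\<close>; this index satisfies both with equality.\<close>
      define n :: nat where "n = 2 ^ k - 1"
      have n: "n + 1 = 2 ^ k" by (simp add: n_def)
      have n': "real (n + 1) = 2 ^ k" unfolding n by simp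
      have "U k \<le> 3 * measure_moment \<mu> n" by (rule measure_moment_lower) (simp only: n order_refl)
      have "lam \<mu> k / m k powr \<sigma> = U k * (2 ^ k) powr (1 + \<sigma>) / (om.W k * W k powr \<sigma>)"
        unfolding lam_def m_powr om.kd_def U_hat by (simp add: powr_add)
      also have "\<dots> \<le> (3 * measure_moment \<mu> n) * (2 ^ k) powr (1 + \<sigma>) / ((moment ho n / om.Bm) * (moment h n / Bm) powr \<sigma>)"
      proof (intro frac_le mult_mono powr_mono2 mult_nonneg_nonneg)
        show "U k \<le> 3 * measure_moment \<mu> n" by fact
        show "moment ho n / om.Bm \<le> om.W k" using om.moment_upper[of k n] n om.Bm_pos by (simp add: divide_le_eq mult.commute)
        show "moment h n / Bm \<le> W k" using moment_upper[of k n] n Bm_pos by (simp add: divide_le_eq mult.commute)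
        show "0 < moment ho n / om.Bm * (moment h n / Bm) powr \<sigma>" using om.Bm_pos Bm_pos om.moment_pos[of n] moment_pos[of n] by (intro mult_pos_pos divide_pos_pos) auto
      qed (use \<sigma> om.W_pos[of k] om.Bm_pos Bm_pos moment_pos[of n] measure_moment_nonneg[of n] in \<open>auto simp: less_imp_le\<close>)
      also have "\<dots> = c' * cval \<sigma> \<mu> n"
        unfolding cval_def n' c'_def using moment_pos[of n] Bm_pos by (simp add: powr_divide less_imp_le)
      finally have "ennreal (lam \<mu> k / m k powr \<sigma>) \<le> ennreal (c' * cval \<sigma> \<mu> n)" by (rule ennreal_leI)
      also have "\<dots> = ennreal c' * ennreal (cval \<sigma> \<mu> n)" using c' by (intro ennreal_mult') simp
      also have "\<dots> \<le> ennreal c' * mu_linf p q \<omega> \<nu> \<mu>"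
        unfolding mu_linf_cval \<sigma>_def[symmetric] by (intro mult_left_mono SUP_upper) auto
      finally show "ennreal (lam \<mu> k / m k powr \<sigma>) \<le> ennreal c' * mu_linf p q \<omega> \<nu> \<mu>" .
    qed
  qed
  then show ?thesis unfolding \<sigma>_def .
qed

lemma nn_integral_steps:
  "(\<integral>\<^sup>+r. (\<Sum>k. ennreal (u k) * indicator (dI k) r) \<partial>lebesgue) = (\<Sum>k. ennreal (u k) * ennreal (1 / 2 ^ Suc k))"
proof -
  have [measurable]: "dI k \<in> sets lebesgue" for k by (simp add: dI_def)
  have "(\<integral>\<^sup>+r. (\<Sum>k. ennreal (u k) * indicator (dI k) r) \<partial>lebesgue) = (\<Sum>k. \<integral>\<^sup>+r. ennreal (u k) * indicator (dI k) r \<partial>lebesgue)"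
    by (rule nn_integral_suminf) measurable
  also have "\<dots> = (\<Sum>k. ennreal (u k) * ennreal (1 / 2 ^ Suc k))"
  proof (intro suminf_cong)
    fix k
    have "emeasure lebesgue (dI k) = ennreal (1 / 2 ^ Suc k)"
      unfolding dI_def using dy_less[of k] dy_Suc_diff[of k] by (simp add: less_imp_le)
    then show "(\<integral>\<^sup>+r. ennreal (u k) * indicator (dI k) r \<partial>lebesgue) = ennreal (u k) * ennreal (1 / 2 ^ Suc k)"
      by (subst nn_integral_cmult_indicator) auto
  qed
  finally show ?thesis .
qed

lemma steps_at: "r \<in> dI k \<Longrightarrow> (\<Sum>j. u j * indicator (dI j) r) = u k" for u :: "nat \<Rightarrow> ennreal"
proof -
  assume r: "r \<in> dI k"
  have "indicator (dI j) r = (if j = k then 1 else 0 :: ennreal)" for j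
    using r dI_disjoint by (auto simp: disjoint_family_on_def indicator_def)
  then have "(\<Sum>j. u j * indicator (dI j) r) = (\<Sum>j. if j = k then u j else 0)" by (intro suminf_cong) simp
  also have "\<dots> = u k" using suminf_finite[of "{k}" "\<lambda>j. if j = k then u j else 0"] by simp
  finally show ?thesis .
qed

text \<open>On \<open>dI k\<close> the integrand is squeezed between step functions, with the value
  of level \<open>k\<close> above and that of level \<open>Suc k\<close> below. The integral thus
  misses level 0 from below, and this is what the separate summand
  \<open>measure_hat \<mu> 0 powr s\<close> supplies.\<close>

lemma mu_Ls_comparable:
  assumes s: "0 < s"
  shows "comparable (mu_Ls s \<omega> \<nu>) (\<lambda>\<mu>. epowr (Dsum s \<mu>) (1 / s))"
proof -
  define f where "f \<mu> r = (measure_hat \<mu> r / (enn2real (weight_hat \<omega> r) * (1 - r))) powr s * enn2real (weight_hat \<nu> r)" for \<mu> r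
  define I where "I \<mu> = (\<integral>\<^sup>+ r\<in>{0..<1}. ennreal (f \<mu> r) \<partial>lebesgue)" for \<mu>
  define c0 where "c0 = om.W 0 powr s / m 0"
  have c0: "0 < c0" using om.W_pos[of 0] m_pos[of 0] by (simp add: c0_def)
  define c1 where "c1 = (2 * Co) powr s"
  have c1: "0 < c1" using om.C_ge_1 by (simp add: c1_def)
  have head: "ennreal (measure_hat \<mu> 0 powr s) = ennreal c0 * ennreal (lam \<mu> 0 powr s * m 0)" for \<mu>
  proof -
    have "measure_hat \<mu> 0 = lam \<mu> 0 * om.W 0" using om.W_pos[of 0] by (simp add: lam_def om.kd_def)
    then have "measure_hat \<mu> 0 powr s = c0 * (lam \<mu> 0 powr s * m 0)"
      using m_pos[of 0] lam_nonneg[of \<mu> 0] om.W_pos[of 0] by (simp add: c0_def powr_mult)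
    then show ?thesis using c0 by (simp add: ennreal_mult')
  qed
  have "comparable (\<lambda>\<mu>. I \<mu> + ennreal (measure_hat \<mu> 0 powr s)) (Dsum s)"
  proof (rule comparableI[of "c1 + c0" "1 / c0 + c1"])
    fix \<mu> assume \<mu>: "\<mu> \<in> M_plus"
    interpret disc_measure \<mu> by unfold_locales (rule \<mu>)
    have up: "I \<mu> \<le> ennreal c1 * Dsum s \<mu>"
    proof -
      define u where "u k = c1 * (lam \<mu> k powr s * W k)" for k
      have fu: "f \<mu> r \<le> u k" if k: "r \<in> dI k" for r k
      proof -
        have r: "0 \<le> r" "r < 1" using k UN_dI by auto
        have r2: "1 / 2 ^ Suc k \<le> 1 - r" "dy k \<le> r" using k by (auto simp: dI_def dy_def)
        have "measure_hat \<mu> r / (tail ho r * (1 - r)) \<le> measure_hat \<mu> (dy k) / ((om.W k / Co) * (1 / 2 ^ Suc k))"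
        proof (intro frac_le mult_mono hat_antimono)
          show "om.W k / Co \<le> tail ho r" using om.tail_bounds(2)[OF k] om.C_ge_1 by (simp add: divide_le_eq mult.commute)
          show "0 < om.W k / Co * (1 / 2 ^ Suc k)" using om.W_pos om.C_ge_1 by simp
        qed (use r2 om.W_pos[of k] om.C_ge_1 r om.tail_pos[of r] in \<open>auto simp: measure_hat_def less_imp_le\<close>)
        also have "\<dots> = 2 * Co * lam \<mu> k" by (simp add: lam_def om.kd_def)
        finally have "(measure_hat \<mu> r / (tail ho r * (1 - r))) powr s \<le> (2 * Co * lam \<mu> k) powr s"
          using s r om.tail_pos[of r] by (intro powr_mono2) (auto simp: measure_hat_def)
        then have "(measure_hat \<mu> r / (tail ho r * (1 - r))) powr s * tail h r \<le> (2 * Co * lam \<mu> k) powr s * W k"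
          using tail_bounds(1)[OF k] tail_pos[of r] r by (intro mult_mono) (auto simp: less_imp_le)
        then show ?thesis using r om.C_ge_1 lam_nonneg[of \<mu> k] by (simp add: f_def hats u_def c1_def powr_mult mult_ac)
      qed
      have "I \<mu> \<le> (\<integral>\<^sup>+r. (\<Sum>k. ennreal (u k) * indicator (dI k) r) \<partial>lebesgue)"
        unfolding I_def
      proof (rule nn_integral_mono)
        fix r :: real
        show "ennreal (f \<mu> r) * indicator {0..<1} r \<le> (\<Sum>k. ennreal (u k) * indicator (dI k) r)"
        proof (cases "r \<in> {0..<1}")
          case True
          then obtain k where k: "r \<in> dI k" using dI_level[of r] by auto
          show ?thesis unfolding steps_at[OF k] using True fu[OF k] by (simp add: ennreal_leI)
        qed simp
      qed
      also have "\<dots> = (\<Sum>k. ennreal (u k) * ennreal (1 / 2 ^ Suc k))" by (rule nn_integral_steps)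
      also have "\<dots> \<le> (\<Sum>k. ennreal c1 * ennreal (lam \<mu> k powr s * m k))"
      proof (intro suminf_le)
        fix k
        have "ennreal (u k) * ennreal (1 / 2 ^ Suc k) = ennreal (c1 * (lam \<mu> k powr s * (m k / 2)))"
          using c1 W_pos[of k] by (subst ennreal_mult[symmetric]) (auto simp: u_def m_def)
        also have "\<dots> \<le> ennreal (c1 * (lam \<mu> k powr s * m k))"
          using c1 m_pos[of k] by (intro ennreal_leI mult_left_mono) auto
        also have "\<dots> = ennreal c1 * ennreal (lam \<mu> k powr s * m k)" using c1 by (intro ennreal_mult') simp
        finally show "ennreal (u k) * ennreal (1 / 2 ^ Suc k) \<le> ennreal c1 * ennreal (lam \<mu> k powr s * m k)" .
      qed auto
      finally show ?thesis by (simp add: Dsum_def)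
    qed
    have h0: "ennreal (lam \<mu> 0 powr s * m 0) \<le> Dsum s \<mu>" unfolding Dsum_def by (rule term_le_suminf)
    have "I \<mu> + ennreal (measure_hat \<mu> 0 powr s) \<le> ennreal c1 * Dsum s \<mu> + ennreal c0 * Dsum s \<mu>"
      unfolding head by (intro add_mono up mult_left_mono h0) auto
    then show "I \<mu> + ennreal (measure_hat \<mu> 0 powr s) \<le> ennreal (c1 + c0) * Dsum s \<mu>"
      using c0 c1 by (simp add: distrib_right)
    have low: "(\<Sum>k. ennreal (lam \<mu> (Suc k) powr s * m (Suc k))) \<le> ennreal c1 * I \<mu>"
    proof -
      define u where "u k = (lam \<mu> (Suc k) powr s * W (Suc k)) / c1" for k
      have fu: "u k \<le> f \<mu> r" if k: "r \<in> dI k" for r k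
      proof -
        have r: "0 \<le> r" "r < 1" using k UN_dI by auto
        have r2: "1 - r \<le> 1 / 2 ^ k" "r \<le> dy (Suc k)" using k by (auto simp: dI_def dy_def)
        have "measure_hat \<mu> (dy (Suc k)) / ((Co * om.W (Suc k)) * (1 / 2 ^ k)) \<le> measure_hat \<mu> r / (tail ho r * (1 - r))"
        proof (intro frac_le mult_mono hat_antimono)
          show "tail ho r \<le> Co * om.W (Suc k)" using om.tail_bounds(1)[OF k] om.W_double[of k] by linarith
          show "0 < tail ho r * (1 - r)" using om.tail_pos[of r] r by simp
        qed (use r2 om.W_pos[of "Suc k"] om.C_ge_1 r om.tail_pos[of r] in \<open>auto simp: measure_hat_def less_imp_le\<close>)
        moreover have "measure_hat \<mu> (dy (Suc k)) / ((Co * om.W (Suc k)) * (1 / 2 ^ k)) = lam \<mu> (Suc k) / (2 * Co)"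
          by (simp add: lam_def om.kd_def)
        ultimately have "(lam \<mu> (Suc k) / (2 * Co)) powr s \<le> (measure_hat \<mu> r / (tail ho r * (1 - r))) powr s"
          using s om.C_ge_1 lam_nonneg[of \<mu> "Suc k"] by (intro powr_mono2) auto
        moreover have "W (Suc k) \<le> tail h r" unfolding W_def using r2 r by (intro tail_antimono)
        ultimately have "(lam \<mu> (Suc k) / (2 * Co)) powr s * W (Suc k) \<le> (measure_hat \<mu> r / (tail ho r * (1 - r))) powr s * tail h r"
          using W_pos[of "Suc k"] by (intro mult_mono) (auto simp: less_imp_le)
        then show ?thesis using r om.C_ge_1 lam_nonneg[of \<mu> "Suc k"] by (simp add: f_def hats u_def c1_def powr_divide)
      qed
      have "(\<Sum>k. ennreal (u k) * ennreal (1 / 2 ^ Suc k)) = (\<integral>\<^sup>+r. (\<Sum>k. ennreal (u k) * indicator (dI k) r) \<partial>lebesgue)"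
        by (rule nn_integral_steps[symmetric])
      also have "\<dots> \<le> I \<mu>"
        unfolding I_def
      proof (rule nn_integral_mono)
        fix r :: real
        show "(\<Sum>k. ennreal (u k) * indicator (dI k) r) \<le> ennreal (f \<mu> r) * indicator {0..<1} r"
        proof (cases "r \<in> {0..<1}")
          case True
          then obtain k where k: "r \<in> dI k" using dI_level[of r] by auto
          show ?thesis unfolding steps_at[OF k] using True fu[OF k] by (simp add: ennreal_leI)
        next
          case False
          then have "\<And>k. r \<notin> dI k" using UN_dI by blast
          then show ?thesis by simp
        qed
      qed
      finally have le: "(\<Sum>k. ennreal (u k) * ennreal (1 / 2 ^ Suc k)) \<le> I \<mu>" .
      have "ennreal (lam \<mu> (Suc k) powr s * m (Suc k)) = ennreal c1 * (ennreal (u k) * ennreal (1 / 2 ^ Suc k))" for k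
      proof -
        have "0 \<le> u k" using c1 W_pos[of "Suc k"] by (simp add: u_def)
        then have "ennreal c1 * (ennreal (u k) * ennreal (1 / 2 ^ Suc k)) = ennreal (c1 * (u k * (1 / 2 ^ Suc k)))"
          using c1 by (metis ennreal_mult' less_imp_le)
        then show ?thesis using c1 by (simp add: u_def m_def)
      qed
      then have "(\<Sum>k. ennreal (lam \<mu> (Suc k) powr s * m (Suc k))) = ennreal c1 * (\<Sum>k. ennreal (u k) * ennreal (1 / 2 ^ Suc k))" by simp
      also have "\<dots> \<le> ennreal c1 * I \<mu>" by (intro mult_left_mono le) simp
      finally show ?thesis .
    qed
    have "Dsum s \<mu> \<le> ennreal (lam \<mu> 0 powr s * m 0) + (\<Sum>k. ennreal (lam \<mu> (Suc k) powr s * m (Suc k)))"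
      unfolding Dsum_def by (rule suminf_le_head_tail)
    also have "ennreal (lam \<mu> 0 powr s * m 0) = ennreal (1 / c0) * ennreal (measure_hat \<mu> 0 powr s)"
      unfolding head mult.assoc[symmetric] using c0 by (subst ennreal_mult[symmetric]) auto
    also have "ennreal (1 / c0) * ennreal (measure_hat \<mu> 0 powr s) + (\<Sum>k. ennreal (lam \<mu> (Suc k) powr s * m (Suc k)))
        \<le> ennreal (1 / c0) * (I \<mu> + ennreal (measure_hat \<mu> 0 powr s)) + ennreal c1 * (I \<mu> + ennreal (measure_hat \<mu> 0 powr s))"
      by (intro add_mono mult_left_mono order_trans[OF low]) auto
    finally show "Dsum s \<mu> \<le> ennreal (1 / c0 + c1) * (I \<mu> + ennreal (measure_hat \<mu> 0 powr s))"
      using c0 c1 by (simp add: distrib_right)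
  qed (use c0 c1 in \<open>auto simp: add_pos_pos\<close>)
  then have "comparable (\<lambda>\<mu>. epowr (I \<mu> + ennreal (measure_hat \<mu> 0 powr s)) (1 / s)) (\<lambda>\<mu>. epowr (Dsum s \<mu>) (1 / s))"
    using s by (intro comparable_epowr) auto
  then show ?thesis unfolding mu_Ls_def I_def f_def .
qed

text \<open>Block \<open>k\<close> consists of \<open>2 ^ k\<close> indices with weights of order
  \<open>W k / 4 ^ k\<close>, which together make up \<open>m k\<close>. A moment sees all lower
  levels, so it is bounded by a sum of \<open>lam\<close> that Hardy's inequality removes.
  Conversely block \<open>k\<close> recovers level \<open>Suc k\<close>, and the index 0 recovers
  level 0.\<close>

lemma mu_ls_comparable:
  assumes s: "0 < s"
  shows "comparable (mu_ls s \<omega> \<nu>) (\<lambda>\<mu>. epowr (Dsum s \<mu>) (1 / s))"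
proof -
  define v where "v \<mu> n = (measure_moment \<mu> n * real (n + 1) / moment ho n) powr s * (moment h n / (real (n + 1))\<^sup>2)" for \<mu> n
  obtain H where H: "H > 0" and hardy: "\<And>x. (\<And>k. 0 \<le> x k) \<Longrightarrow> (\<Sum>K. ennreal ((\<Sum>k\<le>K. x k) powr s * m K)) \<le> ennreal H * (\<Sum>k. ennreal (x k powr s * m k))"
    using hardy_powr[of s m, OF s m_pos m_Suc] by blast
  \<comment> \<open>The ratio per level need only be at most 1 here, because Hardy's inequality
    handles the sum of \<open>lam\<close> without damping.\<close>
  obtain M where M: "2 * Co < 2 ^ M" using real_arch_pow[of 2 "2 * Co"] by auto
  define D where "D = (2 * real M) ^ M + 1"
  have D: "0 < D" by (simp add: D_def add_nonneg_pos)
  have Co: "0 < Co" "1 \<le> Co" and C: "0 < C" "1 \<le> C" using om.C_ge_1 C_ge_1 by auto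
  define a1 where "a1 = (6 * Co * D) powr s * Bm"
  have a1: "0 < a1" using Co D Bm_pos by (simp add: a1_def)
  define a2 where "a2 = (6 * om.Bm * Co) powr s * (6 * C)"
  have a2: "0 < a2" using Co C om.Bm_pos by (simp add: a2_def)
  have "comparable (\<lambda>\<mu>. \<Sum>n. ennreal (v \<mu> n)) (Dsum s)"
  proof (rule comparableI[of "a1 * H" "a2 + a2"])
    fix \<mu> assume \<mu>: "\<mu> \<in> M_plus"
    interpret disc_measure \<mu> by unfold_locales (rule \<mu>)
    have v0: "0 \<le> v \<mu> n" for n
      using moment_pos[of n] by (simp add: v_def)
    have upper: "v \<mu> n \<le> a1 * ((\<Sum>j\<le>k. lam \<mu> j) powr s * m k) / 2 ^ k" if n: "n \<in> blk k" for n k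
    proof -
      have nk: "2 ^ k \<le> n + 1" "n + 1 \<le> 2 ^ Suc k" using n by (auto simp: blk_iff)
      have "measure_moment \<mu> n * real (n + 1) / moment ho n \<le> measure_moment \<mu> n * (2 * 2 ^ k) / (om.W k / (3 * Co))"
      proof (intro frac_le mult_mono measure_moment_nonneg)
        show "om.W k / (3 * Co) \<le> moment ho n" using om.moment_lower[OF nk(2)] Co by (simp add: divide_le_eq mult.commute)
        show "real (n + 1) \<le> 2 * 2 ^ k" by (rule real_blk[OF n])
      qed (use om.W_pos[of k] Co measure_moment_nonneg[of n] in auto)
      also have "\<dots> = 6 * Co * (measure_moment \<mu> n * om.kd k)" by (simp add: om.kd_def)
      also have "\<dots> \<le> 6 * Co * (D * (\<Sum>j\<le>k. lam \<mu> j))"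
      proof (rule mult_left_mono)
        have "measure_moment \<mu> n * om.kd k \<le> (\<Sum>j\<le>k. D * (2 * Co / 2 ^ M) ^ (k - j) * lam \<mu> j)"
          unfolding D_def by (rule moment_le_lam[OF \<mu> nk(1)])
        also have "\<dots> \<le> (\<Sum>j\<le>k. D * 1 * lam \<mu> j)"
          using D Co M lam_nonneg by (intro sum_mono mult_right_mono mult_left_mono power_le_one) auto
        finally show "measure_moment \<mu> n * om.kd k \<le> D * (\<Sum>j\<le>k. lam \<mu> j)" by (simp add: sum_distrib_left)
      qed (use Co in auto)
      finally have "(measure_moment \<mu> n * real (n + 1) / moment ho n) powr s \<le> (6 * Co * (D * (\<Sum>j\<le>k. lam \<mu> j))) powr s"
        using s om.moment_pos[of n] measure_moment_nonneg[of n] by (intro powr_mono2) auto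
      also have "\<dots> = (6 * Co * D) powr s * (\<Sum>j\<le>k. lam \<mu> j) powr s"
        using D Co lam_nonneg by (simp add: powr_mult sum_nonneg)
      finally have 1: "(measure_moment \<mu> n * real (n + 1) / moment ho n) powr s \<le> (6 * Co * D) powr s * (\<Sum>j\<le>k. lam \<mu> j) powr s" .
      have 2: "moment h n / (real (n + 1))\<^sup>2 \<le> Bm * W k / (2 ^ k)\<^sup>2"
        using moment_upper[OF nk(1)] moment_pos[of n] real_blk(1)[OF n] Bm_pos W_pos[of k]
        by (intro frac_le power_mono) auto
      have "v \<mu> n \<le> ((6 * Co * D) powr s * (\<Sum>j\<le>k. lam \<mu> j) powr s) * (Bm * W k / (2 ^ k)\<^sup>2)"
        unfolding v_def using moment_pos[of n] by (intro mult_mono 1 2) auto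
      also have "\<dots> = a1 * ((\<Sum>j\<le>k. lam \<mu> j) powr s * m k) / 2 ^ k"
        by (simp add: a1_def m_def power2_eq_square)
      finally show ?thesis .
    qed
    have "(\<Sum>n. ennreal (v \<mu> n)) = (\<Sum>k. \<Sum>n\<in>blk k. ennreal (v \<mu> n))" by (rule suminf_blk)
    also have "\<dots> \<le> (\<Sum>k. ennreal a1 * ennreal ((\<Sum>j\<le>k. lam \<mu> j) powr s * m k))"
    proof (intro suminf_le)
      fix k
      have "(\<Sum>n\<in>blk k. ennreal (v \<mu> n)) = ennreal (\<Sum>n\<in>blk k. v \<mu> n)" by (rule sum_ennreal) (rule v0)
      also have "\<dots> \<le> ennreal (\<Sum>n\<in>blk k. a1 * ((\<Sum>j\<le>k. lam \<mu> j) powr s * m k) / 2 ^ k)"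
        by (intro ennreal_leI sum_mono upper)
      also have "(\<Sum>n\<in>blk k. a1 * ((\<Sum>j\<le>k. lam \<mu> j) powr s * m k) / 2 ^ k) = a1 * ((\<Sum>j\<le>k. lam \<mu> j) powr s * m k)"
        by simp
      also have "ennreal \<dots> = ennreal a1 * ennreal ((\<Sum>j\<le>k. lam \<mu> j) powr s * m k)" using a1 by (intro ennreal_mult') simp
      finally show "(\<Sum>n\<in>blk k. ennreal (v \<mu> n)) \<le> ennreal a1 * ennreal ((\<Sum>j\<le>k. lam \<mu> j) powr s * m k)" .
    qed auto
    also have "\<dots> = ennreal a1 * (\<Sum>k. ennreal ((\<Sum>j\<le>k. lam \<mu> j) powr s * m k))" by simp
    also have "\<dots> \<le> ennreal a1 * (ennreal H * Dsum s \<mu>)"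
      unfolding Dsum_def by (intro mult_left_mono hardy lam_nonneg) auto
    finally show "(\<Sum>n. ennreal (v \<mu> n)) \<le> ennreal (a1 * H) * Dsum s \<mu>"
      using a1 H by (simp add: ennreal_mult mult.assoc)
    have lower: "lam \<mu> (Suc k) powr s * m (Suc k) / 2 ^ k \<le> a2 * v \<mu> n" if n: "n \<in> blk k" for n k
    proof -
      have nk: "2 ^ k \<le> n + 1" "n + 1 \<le> 2 ^ Suc k" using n by (auto simp: blk_iff)
      have "lam \<mu> (Suc k) = U (Suc k) * 2 ^ k * 2 / om.W (Suc k)" by (simp add: lam_def U_hat om.kd_def)
      also have "\<dots> \<le> (3 * measure_moment \<mu> n) * real (n + 1) * 2 / (moment ho n / (om.Bm * Co))"
      proof (intro frac_le mult_mono)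
        show "U (Suc k) \<le> 3 * measure_moment \<mu> n" by (rule measure_moment_lower[OF nk(2)])
        show "2 ^ k \<le> real (n + 1)" by (rule real_blk[OF n])
        have "moment ho n \<le> om.Bm * om.W k" by (rule om.moment_upper[OF nk(1)])
        also have "\<dots> \<le> om.Bm * (Co * om.W (Suc k))" using om.Bm_pos by (intro mult_left_mono om.W_double) auto
        finally show "moment ho n / (om.Bm * Co) \<le> om.W (Suc k)" using om.Bm_pos Co by (simp add: divide_le_eq mult_ac)
        show "0 < moment ho n / (om.Bm * Co)" using om.moment_pos[of n] om.Bm_pos Co by simp
      qed (use measure_moment_nonneg[of n] U_nonneg[of "Suc k"] in auto)
      also have "\<dots> = (6 * om.Bm * Co) * (measure_moment \<mu> n * real (n + 1) / moment ho n)" by simp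
      finally have "lam \<mu> (Suc k) powr s \<le> ((6 * om.Bm * Co) * (measure_moment \<mu> n * real (n + 1) / moment ho n)) powr s"
        using s lam_nonneg by (intro powr_mono2) auto
      also have "\<dots> = (6 * om.Bm * Co) powr s * (measure_moment \<mu> n * real (n + 1) / moment ho n) powr s"
        using om.Bm_pos Co om.moment_pos[of n] measure_moment_nonneg[of n] by (subst powr_mult) auto
      finally have 1: "lam \<mu> (Suc k) powr s \<le> (6 * om.Bm * Co) powr s * (measure_moment \<mu> n * real (n + 1) / moment ho n) powr s" .
      have "W (Suc k) \<le> 3 * C * moment h n" using moment_lower[OF nk(2)] W_antimono[of k "Suc k"] by linarith
      then have "W (Suc k) / (2 * (2 ^ k)\<^sup>2) \<le> 3 * C * moment h n / (2 * (real (n + 1) / 2)\<^sup>2)"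
        using real_blk(2)[OF n] C moment_pos[of n] W_pos[of "Suc k"] by (intro frac_le mult_left_mono power_mono) auto
      then have 2: "m (Suc k) / 2 ^ k \<le> 6 * C * (moment h n / (real (n + 1))\<^sup>2)"
        by (simp add: m_def power2_eq_square)
      have "lam \<mu> (Suc k) powr s * (m (Suc k) / 2 ^ k) \<le>
          ((6 * om.Bm * Co) powr s * (measure_moment \<mu> n * real (n + 1) / moment ho n) powr s) * (6 * C * (moment h n / (real (n + 1))\<^sup>2))"
        using m_pos[of "Suc k"] by (intro mult_mono 1 2) auto
      also have "\<dots> = a2 * v \<mu> n" by (simp add: a2_def v_def mult_ac)
      finally show ?thesis by simp
    qed
    have head: "lam \<mu> 0 powr s * m 0 \<le> a2 * v \<mu> 0"
    proof -
      have "lam \<mu> 0 = U 0 / om.W 0" by (simp add: lam_def U_hat om.kd_def)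
      also have "\<dots> \<le> (6 * Co * measure_moment \<mu> 0) / (moment ho 0 / om.Bm)"
      proof (intro frac_le)
        have "U 0 \<le> 3 * measure_moment \<mu> 0" by (rule measure_moment_lower) simp
        also have "\<dots> \<le> 6 * Co * measure_moment \<mu> 0" using Co measure_moment_nonneg[of 0] by (intro mult_right_mono) auto
        finally show "U 0 \<le> 6 * Co * measure_moment \<mu> 0" .
        show "moment ho 0 / om.Bm \<le> om.W 0" using om.moment_upper[of 0 0] om.Bm_pos by (simp add: divide_le_eq mult.commute)
      qed (use om.moment_pos[of 0] om.Bm_pos Co measure_moment_nonneg[of 0] in auto)
      also have "\<dots> = (6 * om.Bm * Co) * (measure_moment \<mu> 0 / moment ho 0)" by simp
      finally have "lam \<mu> 0 powr s \<le> ((6 * om.Bm * Co) * (measure_moment \<mu> 0 / moment ho 0)) powr s"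
        using s lam_nonneg by (intro powr_mono2) auto
      also have "\<dots> = (6 * om.Bm * Co) powr s * (measure_moment \<mu> 0 / moment ho 0) powr s"
        using om.Bm_pos Co om.moment_pos[of 0] measure_moment_nonneg[of 0] by (subst powr_mult) auto
      finally have 1: "lam \<mu> 0 powr s \<le> (6 * om.Bm * Co) powr s * (measure_moment \<mu> 0 / moment ho 0) powr s" .
      have "W 0 \<le> 3 * C * moment h 0" by (rule moment_lower) simp
      also have "\<dots> \<le> 6 * C * moment h 0" using C moment_pos[of 0] by (intro mult_right_mono) auto
      finally have 2: "m 0 \<le> 6 * C * moment h 0" by (simp add: m_def)
      have "lam \<mu> 0 powr s * m 0 \<le> ((6 * om.Bm * Co) powr s * (measure_moment \<mu> 0 / moment ho 0) powr s) * (6 * C * moment h 0)"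
        using m_pos[of 0] by (intro mult_mono 1 2) auto
      also have "\<dots> = a2 * v \<mu> 0" by (simp add: a2_def v_def mult_ac)
      finally show ?thesis .
    qed
    have "Dsum s \<mu> \<le> ennreal (lam \<mu> 0 powr s * m 0) + (\<Sum>k. ennreal (lam \<mu> (Suc k) powr s * m (Suc k)))"
      unfolding Dsum_def by (rule suminf_le_head_tail)
    also have "\<dots> \<le> ennreal a2 * (\<Sum>n. ennreal (v \<mu> n)) + ennreal a2 * (\<Sum>n. ennreal (v \<mu> n))"
    proof (rule add_mono)
      have "ennreal (lam \<mu> 0 powr s * m 0) \<le> ennreal (a2 * v \<mu> 0)" by (rule ennreal_leI[OF head])
      also have "\<dots> = ennreal a2 * ennreal (v \<mu> 0)" using a2 by (intro ennreal_mult') simp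
      also have "\<dots> \<le> ennreal a2 * (\<Sum>n. ennreal (v \<mu> n))" by (intro mult_left_mono term_le_suminf) auto
      finally show "ennreal (lam \<mu> 0 powr s * m 0) \<le> ennreal a2 * (\<Sum>n. ennreal (v \<mu> n))" .
      have "(\<Sum>k. ennreal (lam \<mu> (Suc k) powr s * m (Suc k))) \<le> (\<Sum>k. ennreal a2 * (\<Sum>n\<in>blk k. ennreal (v \<mu> n)))"
      proof (intro suminf_le)
        fix k
        have "lam \<mu> (Suc k) powr s * m (Suc k) = (\<Sum>n\<in>blk k. lam \<mu> (Suc k) powr s * m (Suc k) / 2 ^ k)" by simp
        also have "\<dots> \<le> (\<Sum>n\<in>blk k. a2 * v \<mu> n)" by (intro sum_mono lower)
        finally have "ennreal (lam \<mu> (Suc k) powr s * m (Suc k)) \<le> ennreal (a2 * (\<Sum>n\<in>blk k. v \<mu> n))"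
          by (intro ennreal_leI) (simp only: sum_distrib_left)
        also have "\<dots> = ennreal a2 * ennreal (\<Sum>n\<in>blk k. v \<mu> n)" using a2 by (intro ennreal_mult') simp
        also have "ennreal (\<Sum>n\<in>blk k. v \<mu> n) = (\<Sum>n\<in>blk k. ennreal (v \<mu> n))" by (rule sum_ennreal[symmetric]) (rule v0)
        finally show "ennreal (lam \<mu> (Suc k) powr s * m (Suc k)) \<le> ennreal a2 * (\<Sum>n\<in>blk k. ennreal (v \<mu> n))" .
      qed auto
      also have "\<dots> = ennreal a2 * (\<Sum>n. ennreal (v \<mu> n))" by (subst suminf_blk) simp
      finally show "(\<Sum>k. ennreal (lam \<mu> (Suc k) powr s * m (Suc k))) \<le> ennreal a2 * (\<Sum>n. ennreal (v \<mu> n))" .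
    qed
    finally show "Dsum s \<mu> \<le> ennreal (a2 + a2) * (\<Sum>n. ennreal (v \<mu> n))"
      using a2 by (subst ennreal_plus) (simp_all only: less_imp_le distrib_right)
  qed (use a1 a2 H in auto)
  then have "comparable (\<lambda>\<mu>. epowr (\<Sum>n. ennreal (v \<mu> n)) (1 / s)) (\<lambda>\<mu>. epowr (Dsum s \<mu>) (1 / s))"
    using s by (intro comparable_epowr) auto
  then show ?thesis unfolding mu_ls_def v_def om_moment nu_moment .
qed

end

section \<open>Fractional derivatives of the fundamental function\<close>

text \<open>Stable under products and nonnegative powers and sufficient for convergence in the whole
  disc; it ensures that the series of the fractional derivatives converge.\<close>

definition poly_growth :: "(nat \<Rightarrow> real) \<Rightarrow> bool" where
  "poly_growth f \<longleftrightarrow> (\<exists>B N. \<forall>n. 0 \<le> f n \<and> f n \<le> B * real (n + 1) ^ N)"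

lemma poly_growthI: "(\<And>n. 0 \<le> f n) \<Longrightarrow> (\<And>n. f n \<le> B * real (n + 1) ^ N) \<Longrightarrow> poly_growth f"
  unfolding poly_growth_def by blast

lemma poly_growthE:
  assumes "poly_growth f"
  obtains B N where "0 \<le> B" "\<And>n. 0 \<le> f n" "\<And>n. f n \<le> B * real (n + 1) ^ N"
proof -
  obtain B N where *: "\<And>n. 0 \<le> f n \<and> f n \<le> B * real (n + 1) ^ N" using assms unfolding poly_growth_def by blast
  moreover have "0 \<le> B" using *[of 0] by simp
  ultimately show thesis using that by blast
qed

lemma poly_growth_mult:
  assumes "poly_growth f" "poly_growth g"
  shows "poly_growth (\<lambda>n. f n * g n)"
proof -
  obtain B N where f: "0 \<le> B" "\<And>n. 0 \<le> f n" "\<And>n. f n \<le> B * real (n + 1) ^ N" using assms(1) by (rule poly_growthE) blast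
  obtain B' N' where g: "0 \<le> B'" "\<And>n. 0 \<le> g n" "\<And>n. g n \<le> B' * real (n + 1) ^ N'" using assms(2) by (rule poly_growthE) blast
  show ?thesis
  proof (rule poly_growthI)
    fix n
    have "f n * g n \<le> (B * real (n + 1) ^ N) * (B' * real (n + 1) ^ N')" using f g by (intro mult_mono) auto
    also have "\<dots> = (B * B') * real (n + 1) ^ (N + N')" by (simp add: power_add mult_ac)
    finally show "f n * g n \<le> (B * B') * real (n + 1) ^ (N + N')" .
  qed (use f g in auto)
qed

lemma poly_growth_powr:
  assumes "poly_growth f" "0 \<le> \<sigma>"
  shows "poly_growth (\<lambda>n. f n powr \<sigma>)"
proof -
  obtain B N where f: "0 \<le> B" "\<And>n. 0 \<le> f n" "\<And>n. f n \<le> B * real (n + 1) ^ N" using assms(1) by (rule poly_growthE) blast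
  define l where "l = nat \<lceil>\<sigma>\<rceil>"
  have l: "\<sigma> \<le> real l" unfolding l_def by (rule real_nat_ceiling_ge)
  show ?thesis
  proof (rule poly_growthI)
    fix n
    define X where "X = (1 + B) * real (n + 1) ^ N"
    have "(1::real) ^ N \<le> real (n + 1) ^ N" by (rule power_mono) auto
    then have "1 * 1 \<le> X" unfolding X_def using f(1) by (intro mult_mono) auto
    then have X: "1 \<le> X" by simp
    have "f n \<le> X" by (rule order_trans[OF f(3)]) (simp add: X_def mult_right_mono)
    then have "f n powr \<sigma> \<le> X powr \<sigma>" using f(2) assms(2) by (intro powr_mono2) auto
    also have "\<dots> \<le> X powr real l" using X l by (intro powr_mono) auto
    also have "\<dots> = X ^ l" using X by (intro powr_realpow) auto
    also have "\<dots> = (1 + B) ^ l * real (n + 1) ^ (N * l)" by (simp only: X_def power_mult_distrib power_mult)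
    finally show "f n powr \<sigma> \<le> (1 + B) ^ l * real (n + 1) ^ (N * l)" .
  qed simp
qed

lemma poly_growth_summable:
  assumes "poly_growth f" "norm z < 1"
  shows "summable (\<lambda>n. f n * norm z ^ n)" "summable (\<lambda>n. complex_of_real (f n) * z ^ n)"
proof -
  obtain B N where f: "0 \<le> B" "\<And>n. 0 \<le> f n" "\<And>n. f n \<le> B * real (n + 1) ^ N" using assms(1) by (rule poly_growthE) blast
  have "summable (\<lambda>n. B * (real (n + 1) ^ N * norm z ^ n))"
    using assms(2) by (intro summable_mult summable_poly_geometric) auto
  then show 1: "summable (\<lambda>n. f n * norm z ^ n)"
  proof (rule summable_comparison_test'[of _ 0])
    fix n
    have "f n * norm z ^ n \<le> (B * real (n + 1) ^ N) * norm z ^ n" by (intro mult_right_mono f) simp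
    then show "norm (f n * norm z ^ n) \<le> B * (real (n + 1) ^ N * norm z ^ n)" using f(2)[of n] by (simp add: mult.assoc)
  qed
  show "summable (\<lambda>n. complex_of_real (f n) * z ^ n)"
    by (rule summable_norm_cancel) (use 1 f(2) in \<open>simp add: norm_mult norm_power\<close>)
qed

text \<open>The fractional derivatives are defined by \<open>suminf\<close>, which carries
  information only if the series converges; polynomial growth of \<open>a\<close> and of
  \<open>1 / d\<close> ensures this.\<close>

lemma coefficient_division_sums:
  assumes f: "\<And>z. norm z < 1 \<Longrightarrow> (\<lambda>n. complex_of_real (a n) * z ^ n) sums f z"
    and pa: "poly_growth a" and pd: "poly_growth (\<lambda>n. 1 / d n)" and z: "norm z < 1"
  shows "(\<lambda>n. complex_of_real (a n / d n) * z ^ n) sums (\<Sum>k. taylor_coeff f k / complex_of_real (d k) * z ^ k)"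
proof -
  have "taylor_coeff f n = complex_of_real (a n)" for n by (rule taylor_coeff_sums[OF f])
  moreover have "poly_growth (\<lambda>n. a n * (1 / d n))" by (rule poly_growth_mult[OF pa pd])
  ultimately show ?thesis using poly_growth_summable(2)[OF _ z, of "\<lambda>n. a n * (1 / d n)"] by (simp add: summable_sums)
qed

text \<open>A dyadic substitute for the binomial series of \<open>(1 - r) powr (- \<beta>)\<close>.
  For \<open>r\<close> in \<open>dI j\<close>, block \<open>k\<close> is bounded by a multiple of
  \<open>(2 ^ k) powr \<beta>\<close> while \<open>k \<le> j\<close>, and the decay of
  \<open>r ^ n\<close> makes the later blocks geometrically small.\<close>

lemma weighted_geometric_bound:
  assumes \<beta>: "0 < \<beta>"
  shows "\<exists>K>0. \<forall>r. 0 \<le> r \<longrightarrow> r < 1 \<longrightarrow>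
    ennreal ((1 - r) powr \<beta>) * (\<Sum>n. ennreal (real (n + 1) powr (\<beta> - 1) * r ^ n)) \<le> ennreal K"
proof -
  define x where "x = (2::real) powr (- \<beta>)"
  have "x < 2 powr 0" unfolding x_def using \<beta> by (intro powr_less_mono) auto
  then have x: "0 < x" "x < 1" by (simp_all add: x_def)
  \<comment> \<open>Beyond level \<open>j\<close> a block costs \<open>2 powr \<beta>\<close> and
    gains \<open>2 ^ M\<close>. The doubled exponent leaves at most the ratio
    \<open>x = 2 powr (- \<beta>)\<close>, the same as below level \<open>j\<close>.\<close>
  obtain M where M: "2 powr (2 * \<beta>) < 2 ^ M" using real_arch_pow[of 2 "2 powr (2 * \<beta>)"] by auto
  define D where "D = (2 * real M) ^ M + 1"
  have D: "1 \<le> D" by (simp add: D_def)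
  define E where "E = (2::real) powr \<bar>\<beta> - 1\<bar>"
  have E: "0 < E" by (simp add: E_def)
  define K where "K = E * D * (2 / (1 - x))"
  have K: "0 < K" using E D x by (simp add: K_def)
  have xp: "x ^ i = 1 / (2 ^ i) powr \<beta>" for i
    by (subst power_powr_commute) (auto simp: x_def powr_minus power_inverse inverse_eq_divide power_divide)
  show ?thesis
  proof (intro exI conjI allI impI)
    show "0 < K" by fact
    fix r :: real assume r: "0 \<le> r" "r < 1"
    obtain j where j: "r \<in> dI j" using dI_level[OF r] by auto
    have rj: "1 - r \<le> 1 / 2 ^ j" "r \<le> dy (Suc j)" using j by (auto simp: dI_def dy_def)
    have bt: "real (n + 1) powr (\<beta> - 1) * r ^ n \<le> E * D * (2 ^ j) powr \<beta> * x ^ ndist k j / 2 ^ k" if n: "n \<in> blk k" for n k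
    proof -
      have nk: "2 ^ k \<le> n + 1" using n by (auto simp: blk_iff)
      have 1: "real (n + 1) powr (\<beta> - 1) \<le> E * (2 ^ k) powr (\<beta> - 1)"
      proof -
        define y where "y = real (n + 1) / 2 ^ k"
        have y: "1 \<le> y" "y \<le> 2" using real_blk[OF n] by (simp_all add: y_def divide_le_eq le_divide_eq)
        have "y powr (\<beta> - 1) \<le> y powr \<bar>\<beta> - 1\<bar>" using y by (intro powr_mono) auto
        also have "\<dots> \<le> E" unfolding E_def using y by (intro powr_mono2) auto
        finally have "y powr (\<beta> - 1) * (2 ^ k) powr (\<beta> - 1) \<le> E * (2 ^ k) powr (\<beta> - 1)" by (rule mult_right_mono) simp
        moreover have "y powr (\<beta> - 1) * (2 ^ k) powr (\<beta> - 1) = real (n + 1) powr (\<beta> - 1)"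
          using y by (subst powr_mult[symmetric]) (auto simp: y_def)
        ultimately show ?thesis by simp
      qed
      have 2: "(2 ^ k) powr \<beta> * r ^ n \<le> D * ((2 ^ j) powr \<beta> * x ^ ndist k j)"
      proof (cases "k \<le> j")
        case True
        define i where "i = j - k"
        have ji: "j = k + i" using True by (simp add: i_def)
        have e: "(2 ^ k) powr \<beta> = (2 ^ j) powr \<beta> * x ^ ndist k j"
          unfolding xp by (simp add: ji power_add powr_mult)
        have "(2 ^ k) powr \<beta> * r ^ n \<le> (2 ^ k) powr \<beta> * 1" using r by (intro mult_left_mono power_le_one) auto
        also have "\<dots> \<le> (2 ^ k) powr \<beta> * D" using D by (intro mult_left_mono) auto
        also have "\<dots> = D * ((2 ^ j) powr \<beta> * x ^ ndist k j)" unfolding e by (rule mult.commute)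
        finally show ?thesis .
      next
        case False
        define i where "i = k - j"
        have ki: "k = j + i" using False by (simp add: i_def)
        have "r ^ n \<le> (2 * real M) ^ M * (2 ^ j / 2 ^ k) ^ M" by (rule power_le_dyadic[OF r(1) rj(2) nk])
        also have "\<dots> \<le> D * (2 ^ j / 2 ^ k) ^ M" by (intro mult_right_mono) (auto simp: D_def)
        also have "(2 ^ j / 2 ^ k :: real) ^ M = (1 / 2 ^ M) ^ i"
          unfolding ki by (simp add: power_add power_one_over power_mult[symmetric] mult.commute)
        finally have "(2 ^ k) powr \<beta> * r ^ n \<le> (2 ^ k) powr \<beta> * (D * (1 / 2 ^ M) ^ i)" by (rule mult_left_mono) simp
        also have "\<dots> = D * ((2 ^ j) powr \<beta> * (2 powr \<beta> / 2 ^ M) ^ i)"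
          by (simp add: ki power_add powr_mult power_powr_commute power_divide)
        also have "\<dots> \<le> D * ((2 ^ j) powr \<beta> * x ^ i)"
        proof (intro mult_left_mono power_mono)
          have "2 powr \<beta> * 2 powr \<beta> \<le> (2::real) ^ M" using M by (simp add: powr_add[symmetric])
          then show "2 powr \<beta> / 2 ^ M \<le> x" by (simp add: x_def powr_minus field_simps)
        qed (use D in auto)
        finally show ?thesis using False by (simp add: i_def)
      qed
      have "real (n + 1) powr (\<beta> - 1) * r ^ n \<le> E * (2 ^ k) powr (\<beta> - 1) * r ^ n" using 1 r by (intro mult_right_mono) auto
      also have "\<dots> = E * ((2 ^ k) powr \<beta> * r ^ n) / 2 ^ k" by (simp add: powr_diff)
      also have "\<dots> \<le> E * (D * ((2 ^ j) powr \<beta> * x ^ ndist k j)) / 2 ^ k"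
        using E 2 by (intro divide_right_mono mult_left_mono) auto
      finally show ?thesis by (simp only: mult.assoc)
    qed
    have "(\<Sum>n. ennreal (real (n + 1) powr (\<beta> - 1) * r ^ n)) = (\<Sum>k. \<Sum>n\<in>blk k. ennreal (real (n + 1) powr (\<beta> - 1) * r ^ n))"
      by (rule suminf_blk)
    also have "\<dots> \<le> (\<Sum>k. ennreal (E * D * (2 ^ j) powr \<beta>) * ennreal (x ^ ndist k j))"
    proof (intro suminf_le)
      fix k
      have "(\<Sum>n\<in>blk k. ennreal (real (n + 1) powr (\<beta> - 1) * r ^ n)) \<le> (\<Sum>n\<in>blk k. ennreal (E * D * (2 ^ j) powr \<beta> * x ^ ndist k j / 2 ^ k))"
        by (intro sum_mono ennreal_leI bt)
      also have "\<dots> = ennreal (\<Sum>n\<in>blk k. E * D * (2 ^ j) powr \<beta> * x ^ ndist k j / 2 ^ k)"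
        using E D x by (intro sum_ennreal) auto
      also have "(\<Sum>n\<in>blk k. E * D * (2 ^ j) powr \<beta> * x ^ ndist k j / 2 ^ k) = E * D * (2 ^ j) powr \<beta> * x ^ ndist k j" by simp
      also have "ennreal \<dots> = ennreal (E * D * (2 ^ j) powr \<beta>) * ennreal (x ^ ndist k j)"
        using E D by (intro ennreal_mult') auto
      finally show "(\<Sum>n\<in>blk k. ennreal (real (n + 1) powr (\<beta> - 1) * r ^ n)) \<le> ennreal (E * D * (2 ^ j) powr \<beta>) * ennreal (x ^ ndist k j)" .
    qed auto
    also have "\<dots> = ennreal (E * D * (2 ^ j) powr \<beta>) * (\<Sum>k. ennreal (x ^ ndist k j))" by simp
    also have "\<dots> \<le> ennreal (E * D * (2 ^ j) powr \<beta>) * ennreal (2 / (1 - x))"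
      by (intro mult_left_mono suminf_power_ndist x) auto
    also have "\<dots> = ennreal ((2 ^ j) powr \<beta> * K)"
      using E D x by (subst ennreal_mult[symmetric]) (auto simp: K_def mult_ac)
    finally have "ennreal ((1 - r) powr \<beta>) * (\<Sum>n. ennreal (real (n + 1) powr (\<beta> - 1) * r ^ n)) \<le> ennreal ((1 / 2 ^ j) powr \<beta>) * ennreal ((2 ^ j) powr \<beta> * K)"
      using rj r \<beta> by (intro mult_mono ennreal_leI powr_mono2) auto
    also have "\<dots> = ennreal ((1 / 2 ^ j) powr \<beta> * ((2 ^ j) powr \<beta> * K))"
      using K by (subst ennreal_mult) auto
    also have "(1 / 2 ^ j) powr \<beta> * ((2 ^ j) powr \<beta> * K) = K" by (simp add: powr_divide)
    finally show "ennreal ((1 - r) powr \<beta>) * (\<Sum>n. ennreal (real (n + 1) powr (\<beta> - 1) * r ^ n)) \<le> ennreal K" .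
  qed
qed

context doubling
begin

lemma poly_growth_kc: "poly_growth kc"
  using kc_growth[of 0] kc_pos by (intro poly_growthI[of _ "2 * C ^ 2 / W 0" Mo]) (auto simp: less_imp_le)

lemma poly_growth_inverse_moment: "poly_growth (\<lambda>n. 1 / moment h (2 * n + 1))"
proof -
  have "poly_growth (\<lambda>n. 2 * kc n)"
    by (rule poly_growth_mult[OF _ poly_growth_kc]) (rule poly_growthI[of _ 2 0], auto)
  then show ?thesis by (simp add: kc_def)
qed

lemma moment_le_moment_double: "moment h n \<le> Ba * moment h (2 * n + 1)"
proof -
  obtain k where "n \<in> blk k" using ex_blk by blast
  then have k: "2 ^ k \<le> n + 1" "n + 1 < 2 ^ Suc k" by (auto simp: blk_iff)
  have "moment h n \<le> Bm * W k" by (rule moment_upper[OF k(1)])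
  also have "\<dots> \<le> Bm * (C * W (Suc k))" using Bm_pos by (intro mult_left_mono W_double) auto
  also have "\<dots> \<le> Bm * (C * (3 * C * moment h (2 * n + 1)))"
    using Bm_pos C_ge_1 k(2) by (intro mult_left_mono moment_lower) auto
  finally show ?thesis by (simp add: Ba_def power2_eq_square mult_ac)
qed

end

text \<open>Both bounds are the moment comparison for \<open>std_profile\<close>, whose tail at
  \<open>dy k\<close> is of order \<open>(1 / 2 ^ k) powr \<alpha>\<close>. The upper bound keeps a
  free level \<open>k\<close> because it is used uniformly on a block of indices.\<close>

lemma std_moment_bounds:
  assumes \<alpha>: "0 < \<alpha>"
  obtains K where "0 < K" "\<And>n. (1 / real (n + 1)) powr \<alpha> \<le> K * weight_moment (standard_weight \<alpha>) (2 * n + 1)"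
    "\<And>n k. 2 ^ k \<le> 2 * n + 2 \<Longrightarrow> weight_moment (standard_weight \<alpha>) (2 * n + 1) \<le> K * (1 / 2 ^ k) powr \<alpha>"
proof -
  define E where "E = (2::real) powr \<bar>\<alpha> - 1\<bar>"
  have E: "0 < E" by (simp add: E_def)
  define Cs where "Cs = (2::real) powr \<bar>\<alpha> - 1\<bar> * 2 powr \<alpha> * 2 powr \<bar>\<alpha> - 1\<bar>"
  interpret st: doubling "std_profile \<alpha>" Cs unfolding Cs_def by (rule doubling_std[OF \<alpha>])
  have dk: "1 - dy k = 1 / 2 ^ k" for k by (simp add: dy_def)
  have Wu: "st.W k \<le> E * (1 / 2 ^ k) powr \<alpha>" and Wl: "(1 / 2 ^ k) powr \<alpha> \<le> E * st.W k" for k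
    using std_tail(1,2)[OF \<alpha> dy_nonneg[of k]] unfolding st.W_def E_def dk by auto
  define K where "K = max (st.Bm * E) (2 powr \<alpha> * E * (3 * Cs))"
  have Cs: "1 \<le> Cs" by (rule st.C_ge_1)
  have K: "st.Bm * E \<le> K" "2 powr \<alpha> * E * (3 * Cs) \<le> K" by (auto simp: K_def)
  have K0: "0 < K" using K(1) E st.Bm_pos by (meson less_le_trans mult_pos_pos)
  show thesis
  proof (rule that[OF K0])
    fix n
    obtain k where "n \<in> blk k" using ex_blk by blast
    then have k: "2 ^ k \<le> real (n + 1)" "n + 1 < 2 ^ Suc k" using real_blk by (auto simp: blk_iff)
    have "(1 / real (n + 1)) powr \<alpha> \<le> (2 * (1 / 2 ^ Suc k)) powr \<alpha>"
      using k(1) \<alpha> by (intro powr_mono2) (auto intro!: divide_left_mono simp: divide_simps)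
    also have "\<dots> = 2 powr \<alpha> * (1 / 2 ^ Suc k) powr \<alpha>" by (rule powr_mult)
    also have "\<dots> \<le> 2 powr \<alpha> * (E * st.W (Suc k))" by (intro mult_left_mono Wl) auto
    also have "\<dots> \<le> 2 powr \<alpha> * (E * (3 * Cs * moment (std_profile \<alpha>) (2 * n + 1)))"
      using E k(2) by (intro mult_left_mono st.moment_lower) auto
    also have "\<dots> = 2 powr \<alpha> * E * (3 * Cs) * moment (std_profile \<alpha>) (2 * n + 1)" by simp
    also have "\<dots> \<le> K * moment (std_profile \<alpha>) (2 * n + 1)"
      using st.moment_pos[of "2 * n + 1"] by (intro mult_right_mono K) auto
    finally show "(1 / real (n + 1)) powr \<alpha> \<le> K * weight_moment (standard_weight \<alpha>) (2 * n + 1)"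
      by (simp add: standard_weight_moment[OF \<alpha>])
  next
    fix n k :: nat assume "2 ^ k \<le> 2 * n + 2"
    then have "moment (std_profile \<alpha>) (2 * n + 1) \<le> st.Bm * st.W k" by (intro st.moment_upper) simp
    also have "\<dots> \<le> st.Bm * (E * (1 / 2 ^ k) powr \<alpha>)" using st.Bm_pos by (intro mult_left_mono Wu) auto
    also have "\<dots> = st.Bm * E * (1 / 2 ^ k) powr \<alpha>" by simp
    also have "\<dots> \<le> K * (1 / 2 ^ k) powr \<alpha>" by (intro mult_right_mono K) auto
    finally show "weight_moment (standard_weight \<alpha>) (2 * n + 1) \<le> K * (1 / 2 ^ k) powr \<alpha>"
      by (simp add: standard_weight_moment[OF \<alpha>])
  qed
qed

context cesaro_full
begin

definition frac_coeff :: "real \<Rightarrow> real \<Rightarrow> real measure \<Rightarrow> nat \<Rightarrow> real" where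
  "frac_coeff \<alpha> \<sigma> \<mu> n = om.kc n * measure_moment \<mu> n / moment h (2 * n + 1) powr \<sigma> / weight_moment (standard_weight \<alpha>) (2 * n + 1)"

lemma poly_growth_fundamental:
  assumes \<mu>: "\<mu> \<in> M_plus"
  shows "poly_growth (\<lambda>n. om.kc n * measure_moment \<mu> n)"
proof -
  interpret disc_measure \<mu> by unfold_locales (rule \<mu>)
  have "poly_growth (measure_moment \<mu>)"
    by (rule poly_growthI[of _ "measure_moment \<mu> 0" 0]) (auto simp: measure_moment_nonneg measure_moment_antimono)
  then show ?thesis by (rule poly_growth_mult[OF om.poly_growth_kc])
qed

lemma poly_growth_inverse_moment_powr: "0 \<le> \<sigma> \<Longrightarrow> poly_growth (\<lambda>n. 1 / moment h (2 * n + 1) powr \<sigma>)"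
  using poly_growth_powr[OF poly_growth_inverse_moment, of \<sigma>] moment_pos by (simp add: powr_divide less_imp_le)

lemma poly_growth_inverse_std:
  assumes "0 < \<alpha>" shows "poly_growth (\<lambda>n. 1 / weight_moment (standard_weight \<alpha>) (2 * n + 1))"
proof -
  interpret st: doubling "std_profile \<alpha>" "2 powr \<bar>\<alpha> - 1\<bar> * 2 powr \<alpha> * 2 powr \<bar>\<alpha> - 1\<bar>" by (rule doubling_std[OF assms])
  show ?thesis unfolding standard_weight_moment[OF assms] by (rule st.poly_growth_inverse_moment)
qed

lemma frac_coeff_growth:
  assumes "\<mu> \<in> M_plus" "0 < \<alpha>" "0 \<le> \<sigma>"
  shows "poly_growth (frac_coeff \<alpha> \<sigma> \<mu>)"
  using poly_growth_mult[OF poly_growth_mult[OF poly_growth_fundamental[OF assms(1)] poly_growth_inverse_moment_powr[OF assms(3)]] poly_growth_inverse_std[OF assms(2)]]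
  by (simp add: frac_coeff_def[abs_def])

lemma frac_sums:
  assumes \<mu>: "\<mu> \<in> M_plus" and \<alpha>: "0 < \<alpha>" and \<sigma>: "0 \<le> \<sigma>" and z: "norm z < 1"
  shows "(\<lambda>n. complex_of_real (frac_coeff \<alpha> \<sigma> \<mu> n) * z ^ n) sums std_frac_deriv \<alpha> (frac_deriv_pow \<nu> \<sigma> (fundamental_fun \<mu> \<omega>)) z"
proof -
  have 1: "(\<lambda>n. complex_of_real (om.kc n * measure_moment \<mu> n / moment h (2 * n + 1) powr \<sigma>) * u ^ n) sums frac_deriv_pow \<nu> \<sigma> (fundamental_fun \<mu> \<omega>) u"
    if "norm u < 1" for u
    unfolding frac_deriv_pow_def nu_moment
    by (rule coefficient_division_sums[OF fundamental_sums[OF \<mu>] poly_growth_fundamental[OF \<mu>] poly_growth_inverse_moment_powr[OF \<sigma>] that])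
  have 2: "poly_growth (\<lambda>n. om.kc n * measure_moment \<mu> n / moment h (2 * n + 1) powr \<sigma>)"
    using poly_growth_mult[OF poly_growth_fundamental[OF \<mu>] poly_growth_inverse_moment_powr[OF \<sigma>]] by simp
  show ?thesis
    unfolding std_frac_deriv_def frac_deriv_def frac_coeff_def
    by (rule coefficient_division_sums[OF 1 2 poly_growth_inverse_std[OF \<alpha>] z])
qed

lemma frac_holomorphic:
  assumes "\<mu> \<in> M_plus" "0 < \<alpha>" "0 \<le> \<sigma>"
  shows "std_frac_deriv \<alpha> (frac_deriv_pow \<nu> \<sigma> (fundamental_fun \<mu> \<omega>)) holomorphic_on ball 0 1"
  by (rule holomorphic_sums[OF frac_sums[OF assms]])

text \<open>The Taylor coefficients are nonnegative, so the positive radius decides. At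
  \<open>dy k\<close> the indices between about \<open>2 ^ k / 2\<close> and \<open>2 ^ k\<close>
  already produce the dyadic quotient of \<open>Dinf\<close>. Conversely the \<open>n\<close>-th
  coefficient is at most a multiple of
  \<open>cval \<sigma> \<mu> n * real (n + 1) powr (\<beta> - 1)\<close>, and
  \<open>weighted_geometric_bound\<close> sums these powers.\<close>

lemma growth_comparable:
  assumes \<beta>: "0 < \<beta>" and \<sigma>0: "0 \<le> 1 / p - 1 / q"
  shows "comparable (mu_linf p q \<omega> \<nu>)
    (\<lambda>\<mu>. growth_norm \<beta> (std_frac_deriv (\<beta> + 1 / p - 1 / q) (frac_deriv_pow \<nu> (1 / p - 1 / q) (fundamental_fun \<mu> \<omega>))))"
proof -
  define \<sigma> where "\<sigma> = 1 / p - 1 / q"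
  define \<alpha> where "\<alpha> = \<beta> + \<sigma>"
  have \<sigma>: "0 \<le> \<sigma>" using \<sigma>0 by (simp add: \<sigma>_def)
  have \<alpha>: "0 < \<alpha>" using \<sigma> \<beta> by (simp add: \<alpha>_def)
  have e: "\<beta> + 1 / p - 1 / q = \<alpha>" by (simp add: \<alpha>_def \<sigma>_def)
  define st where "st n = weight_moment (standard_weight \<alpha>) (2 * n + 1)" for n
  obtain K where K: "0 < K" "\<And>n. (1 / real (n + 1)) powr \<alpha> \<le> K * st n" "\<And>n k. 2 ^ k \<le> 2 * n + 2 \<Longrightarrow> st n \<le> K * (1 / 2 ^ k) powr \<alpha>"
    unfolding st_def by (rule std_moment_bounds[OF \<alpha>]) blast
  have st: "0 < st n" for n
  proof -
    have "0 < (1 / real (n + 1)) powr \<alpha>" by simp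
    also have "\<dots> \<le> K * st n" by (rule K)
    finally show ?thesis using K(1) by (simp add: zero_less_mult_iff)
  qed
  define H where "H \<mu> = std_frac_deriv \<alpha> (frac_deriv_pow \<nu> \<sigma> (fundamental_fun \<mu> \<omega>))" for \<mu>
  define ec where "ec \<mu> = frac_coeff \<alpha> \<sigma> \<mu>" for \<mu>
  have ec: "ec \<mu> n = measure_moment \<mu> n / (2 * moment ho (2 * n + 1)) / moment h (2 * n + 1) powr \<sigma> / st n" for \<mu> n
    unfolding ec_def frac_coeff_def st_def om.kc_def by simp
  define b where "b = 36 * om.Bm * Bm powr \<sigma> * K"
  have b: "0 < b" using om.Bm_pos Bm_pos K by (simp add: b_def)
  have low: "Dinf \<sigma> \<mu> \<le> ennreal b * growth_norm \<beta> (H \<mu>)" if \<mu>: "\<mu> \<in> M_plus" for \<mu>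
    unfolding Dinf_def
  proof (rule SUP_least)
    fix k
    interpret disc_measure \<mu> by unfold_locales (rule \<mu>)
    \<comment> \<open>Written with \<open>div\<close> so that the block is \<open>{0}\<close> for
      \<open>k = 0\<close>. In every case it has at least \<open>2 ^ k / 2\<close> elements, and
      \<open>2 ^ k \<le> 2 * n + 2\<close> holds on it.\<close>
    define A :: "nat set" where "A = {2 ^ k div 2..<2 ^ k}"
    have cA: "2 ^ k / 2 \<le> real (card A)" by (cases k) (auto simp: A_def)
    define t where "t = U k / 9 / (2 * om.Bm * om.W k) / (Bm * W k) powr \<sigma> / (K * (1 / 2 ^ k) powr \<alpha>)"
    have t0: "0 \<le> t" unfolding t_def using U_nonneg[of k] om.Bm_pos om.W_pos[of k] K(1) by simp
    have tn: "t \<le> ec \<mu> n * dy k ^ n" if n: "n \<in> A" for n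
    proof -
      have n1: "n + 1 \<le> 2 ^ k" "2 ^ k \<le> 2 * n + 1 + 1" using n by (auto simp: A_def)
      have "t \<le> (measure_moment \<mu> n * dy k ^ n) / (2 * moment ho (2 * n + 1)) / moment h (2 * n + 1) powr \<sigma> / st n"
        unfolding t_def
      proof (intro frac_le divide_nonneg_nonneg powr_mono2 \<sigma>)
        have "U k / 3 * (1 / 3) \<le> measure_moment \<mu> n * dy k ^ n"
          using measure_moment_lower[OF n1(1)] dy_power_lower[OF n1(1)] measure_moment_nonneg[of n] by (intro mult_mono) auto
        then show "U k / 9 \<le> measure_moment \<mu> n * dy k ^ n" by simp
        show "2 * moment ho (2 * n + 1) \<le> 2 * om.Bm * om.W k" using om.moment_upper[OF n1(2)] by simp
        show "moment h (2 * n + 1) \<le> Bm * W k" by (rule moment_upper[OF n1(2)])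
        show "st n \<le> K * (1 / 2 ^ k) powr \<alpha>" using n1(2) by (intro K) simp
        show "0 \<le> measure_moment \<mu> n * dy k ^ n" using measure_moment_nonneg[of n] dy_nonneg[of k] by simp
      qed (use om.moment_pos[of "2 * n + 1"] moment_pos[of "2 * n + 1"] st[of n] measure_moment_nonneg[of n] dy_nonneg[of k] in \<open>auto simp: less_imp_le\<close>)
      also have "\<dots> = ec \<mu> n * dy k ^ n" by (simp add: ec)
      finally show ?thesis .
    qed
    have nz: "norm (complex_of_real (dy k)) < 1" using dy_nonneg[of k] by simp
    have pg: "poly_growth (ec \<mu>)" unfolding ec_def by (rule frac_coeff_growth[OF \<mu> \<alpha> \<sigma>])
    have e0: "0 \<le> ec \<mu> n" for n using pg by (auto elim: poly_growthE)
    have sm: "summable (\<lambda>n. ec \<mu> n * dy k ^ n)" using poly_growth_summable(1)[OF pg nz] dy_nonneg[of k] by simp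
    have "complex_of_real (\<Sum>n. ec \<mu> n * dy k ^ n) = H \<mu> (complex_of_real (dy k))"
      using frac_sums[OF \<mu> \<alpha> \<sigma> nz] sums_of_real[OF summable_sums[OF sm], where 'a = complex] by (simp add: H_def ec_def sums_unique2)
    then have "norm (H \<mu> (complex_of_real (dy k))) = (\<Sum>n. ec \<mu> n * dy k ^ n)"
      using suminf_nonneg[OF sm] e0 dy_nonneg[of k] by (metis abs_of_nonneg mult_nonneg_nonneg norm_of_real zero_le_power)
    moreover have "2 ^ k / 2 * t \<le> (\<Sum>n. ec \<mu> n * dy k ^ n)"
    proof -
      have "2 ^ k / 2 * t \<le> real (card A) * t" using cA t0 by (rule mult_right_mono)
      also have "\<dots> = (\<Sum>n\<in>A. t)" by simp
      also have "\<dots> \<le> (\<Sum>n\<in>A. ec \<mu> n * dy k ^ n)" by (intro sum_mono tn)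
      also have "\<dots> \<le> (\<Sum>n. ec \<mu> n * dy k ^ n)" using sm e0 dy_nonneg[of k] by (intro sum_le_suminf) (auto simp: A_def)
      finally show ?thesis .
    qed
    ultimately have lH: "2 ^ k / 2 * t \<le> norm (H \<mu> (complex_of_real (dy k)))" by simp
    have "lam \<mu> k / m k powr \<sigma> = b * ((1 / 2 ^ k) powr \<beta> * (2 ^ k / 2 * t))"
    proof -
      have "(1 / 2 ^ k :: real) powr \<beta> = 1 / (2 ^ k) powr \<beta>" "(1 / 2 ^ k :: real) powr \<alpha> = 1 / ((2 ^ k) powr \<beta> * (2 ^ k) powr \<sigma>)"
        by (simp_all add: powr_divide \<alpha>_def powr_add)
      moreover have "(Bm * W k) powr \<sigma> = Bm powr \<sigma> * W k powr \<sigma>" by (rule powr_mult)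
      ultimately show ?thesis
        using om.Bm_pos Bm_pos K(1) by (simp add: t_def b_def lam_def U_hat om.kd_def m_powr)
    qed
    also have "\<dots> \<le> b * ((1 / 2 ^ k) powr \<beta> * norm (H \<mu> (complex_of_real (dy k))))"
      using b lH by (intro mult_left_mono) auto
    finally have "ennreal (lam \<mu> k / m k powr \<sigma>) \<le> ennreal (b * ((1 / 2 ^ k) powr \<beta> * norm (H \<mu> (complex_of_real (dy k)))))"
      by (rule ennreal_leI)
    also have "\<dots> = ennreal b * (ennreal ((1 - dy k) powr \<beta>) * ennreal (norm (H \<mu> (complex_of_real (dy k)))))"
      using b by (simp add: dy_def ennreal_mult)
    also have "\<dots> \<le> ennreal b * growth_norm \<beta> (H \<mu>)"
      unfolding growth_norm_def
    proof (intro mult_left_mono)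
      have "ennreal ((1 - dy k) powr \<beta>) * ennreal (norm (H \<mu> (complex_of_real (dy k)))) \<le> ennreal ((1 - dy k) powr \<beta>) * (SUP z\<in>sphere 0 (dy k). ennreal (norm (H \<mu> z)))"
        using dy_nonneg[of k] by (intro mult_left_mono SUP_upper) auto
      also have "\<dots> \<le> (SUP r\<in>{0..<1}. ennreal ((1 - r) powr \<beta>) * (SUP z\<in>sphere 0 r. ennreal (norm (H \<mu> z))))"
        by (rule SUP_upper) (auto simp: dy_nonneg)
      finally show "ennreal ((1 - dy k) powr \<beta>) * ennreal (norm (H \<mu> (complex_of_real (dy k)))) \<le> (SUP r\<in>{0..<1}. ennreal ((1 - r) powr \<beta>) * (SUP z\<in>sphere 0 r. ennreal (norm (H \<mu> z))))" .
    qed simp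
    finally show "ennreal (lam \<mu> k / m k powr \<sigma>) \<le> ennreal b * growth_norm \<beta> (H \<mu>)" .
  qed
  obtain G where G: "0 < G" and geo: "\<And>r. 0 \<le> r \<Longrightarrow> r < 1 \<Longrightarrow>
      ennreal ((1 - r) powr \<beta>) * (\<Sum>n. ennreal (real (n + 1) powr (\<beta> - 1) * r ^ n)) \<le> ennreal G"
    using weighted_geometric_bound[OF \<beta>] by blast
  define a where "a = om.Ba * Ba powr \<sigma> * K"
  have a: "0 < a" using om.Ba_ge_1 Ba_ge_1 K by (simp add: a_def)
  have up: "growth_norm \<beta> (H \<mu>) \<le> ennreal (a * G) * mu_linf p q \<omega> \<nu> \<mu>" if \<mu>: "\<mu> \<in> M_plus" for \<mu>
    unfolding growth_norm_def
  proof (rule SUP_least)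
    fix r :: real assume "r \<in> {0..<1}"
    then have r: "0 \<le> r" "r < 1" by auto
    interpret disc_measure \<mu> by unfold_locales (rule \<mu>)
    have pg: "poly_growth (ec \<mu>)" unfolding ec_def by (rule frac_coeff_growth[OF \<mu> \<alpha> \<sigma>])
    have e0: "0 \<le> ec \<mu> n" for n using pg by (auto elim: poly_growthE)
    have ecle: "ec \<mu> n \<le> a * (cval \<sigma> \<mu> n * real (n + 1) powr (\<beta> - 1))" for n
    proof -
      have "ec \<mu> n \<le> measure_moment \<mu> n / (moment ho n / om.Ba) / (moment h n / Ba) powr \<sigma> / ((1 / real (n + 1)) powr \<alpha> / K)"
        unfolding ec
      proof (intro frac_le divide_nonneg_nonneg powr_mono2 \<sigma> order_refl measure_moment_nonneg)
        have "moment ho n \<le> om.Ba * moment ho (2 * n + 1)" by (rule om.moment_le_moment_double)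
        also have "\<dots> \<le> om.Ba * (2 * moment ho (2 * n + 1))" using om.Ba_ge_1 om.moment_pos[of "2 * n + 1"] by simp
        finally show "moment ho n / om.Ba \<le> 2 * moment ho (2 * n + 1)" using om.Ba_ge_1 by (simp add: divide_le_eq mult.commute)
        show "moment h n / Ba \<le> moment h (2 * n + 1)" using moment_le_moment_double[of n] Ba_ge_1 by (simp add: divide_le_eq mult.commute)
        show "(1 / real (n + 1)) powr \<alpha> / K \<le> st n" using K(2)[of n] K(1) by (simp add: divide_le_eq mult.commute)
        show "0 < moment ho n / om.Ba" using om.moment_pos[of n] om.Ba_ge_1 by simp
        show "0 < (moment h n / Ba) powr \<sigma>" using moment_pos[of n] Ba_ge_1 by simp
        show "0 < (1 / real (n + 1)) powr \<alpha> / K" using K(1) by simp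
      qed (use om.moment_pos[of n] moment_pos[of n] om.Ba_ge_1 Ba_ge_1 in auto)
      also have "\<dots> = a * (cval \<sigma> \<mu> n * real (n + 1) powr (\<beta> - 1))"
      proof -
        have "(1 / real (n + 1)) powr \<alpha> = 1 / (real (n + 1) powr (1 + \<sigma>) * real (n + 1) powr (\<beta> - 1))"
          by (simp add: powr_divide powr_add[symmetric] \<alpha>_def add.commute)
        moreover have "(moment h n / Ba) powr \<sigma> = moment h n powr \<sigma> / Ba powr \<sigma>" by (rule powr_divide) 
        ultimately show ?thesis unfolding cval_def a_def by simp
      qed
      finally show ?thesis .
    qed
    have term_le: "ennreal (ec \<mu> n * r ^ n) \<le> ennreal a * mu_linf p q \<omega> \<nu> \<mu> * ennreal (real (n + 1) powr (\<beta> - 1) * r ^ n)" for n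
    proof -
      have "ec \<mu> n * r ^ n \<le> a * (cval \<sigma> \<mu> n * real (n + 1) powr (\<beta> - 1)) * r ^ n" using r by (intro mult_right_mono ecle) auto
      also have "\<dots> = a * cval \<sigma> \<mu> n * (real (n + 1) powr (\<beta> - 1) * r ^ n)" by simp
      finally have "ennreal (ec \<mu> n * r ^ n) \<le> ennreal (a * cval \<sigma> \<mu> n * (real (n + 1) powr (\<beta> - 1) * r ^ n))" by (rule ennreal_leI)
      also have "\<dots> = ennreal (a * cval \<sigma> \<mu> n) * ennreal (real (n + 1) powr (\<beta> - 1) * r ^ n)" using r by (intro ennreal_mult'') simp
      also have "ennreal (a * cval \<sigma> \<mu> n) = ennreal a * ennreal (cval \<sigma> \<mu> n)" using a by (intro ennreal_mult') simp
      also have "ennreal a * ennreal (cval \<sigma> \<mu> n) * ennreal (real (n + 1) powr (\<beta> - 1) * r ^ n) \<le>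
          ennreal a * mu_linf p q \<omega> \<nu> \<mu> * ennreal (real (n + 1) powr (\<beta> - 1) * r ^ n)"
        unfolding mu_linf_cval \<sigma>_def by (intro mult_right_mono mult_left_mono SUP_upper) auto
      finally show ?thesis .
    qed
    have Hz: "ennreal (norm (H \<mu> z)) \<le> ennreal a * mu_linf p q \<omega> \<nu> \<mu> * (\<Sum>n. ennreal (real (n + 1) powr (\<beta> - 1) * r ^ n))"
      if z: "z \<in> sphere 0 r" for z
    proof -
      have nz: "norm z = r" "norm z < 1" using z r by auto
      have sm: "summable (\<lambda>n. ec \<mu> n * r ^ n)" using poly_growth_summable(1)[OF pg nz(2)] nz by simp
      have "H \<mu> z = (\<Sum>n. complex_of_real (ec \<mu> n) * z ^ n)"
        using frac_sums[OF \<mu> \<alpha> \<sigma> nz(2)] by (simp add: H_def ec_def sums_unique)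
      moreover have ne: "norm (complex_of_real (ec \<mu> n) * z ^ n) = ec \<mu> n * r ^ n" for n using e0[of n] nz by (simp add: norm_mult norm_power)
      ultimately have "norm (H \<mu> z) \<le> (\<Sum>n. ec \<mu> n * r ^ n)"
        using summable_norm[of "\<lambda>n. complex_of_real (ec \<mu> n) * z ^ n"] sm by simp
      then have "ennreal (norm (H \<mu> z)) \<le> ennreal (\<Sum>n. ec \<mu> n * r ^ n)" by (rule ennreal_leI)
      also have "\<dots> = (\<Sum>n. ennreal (ec \<mu> n * r ^ n))" using e0 r sm by (intro suminf_ennreal2[symmetric]) auto
      also have "\<dots> \<le> (\<Sum>n. ennreal a * mu_linf p q \<omega> \<nu> \<mu> * ennreal (real (n + 1) powr (\<beta> - 1) * r ^ n))"
        by (intro suminf_le term_le) auto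
      also have "\<dots> = ennreal a * mu_linf p q \<omega> \<nu> \<mu> * (\<Sum>n. ennreal (real (n + 1) powr (\<beta> - 1) * r ^ n))" by simp
      finally show ?thesis .
    qed
    have "ennreal ((1 - r) powr \<beta>) * (SUP z\<in>sphere 0 r. ennreal (norm (H \<mu> z))) \<le>
        ennreal ((1 - r) powr \<beta>) * (ennreal a * mu_linf p q \<omega> \<nu> \<mu> * (\<Sum>n. ennreal (real (n + 1) powr (\<beta> - 1) * r ^ n)))"
      by (intro mult_left_mono SUP_least Hz) auto
    also have "\<dots> = ennreal a * mu_linf p q \<omega> \<nu> \<mu> * (ennreal ((1 - r) powr \<beta>) * (\<Sum>n. ennreal (real (n + 1) powr (\<beta> - 1) * r ^ n)))"
      by (simp only: mult_ac)
    also have "\<dots> \<le> ennreal a * mu_linf p q \<omega> \<nu> \<mu> * ennreal G" by (intro mult_left_mono geo r) simp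
    also have "\<dots> = ennreal (a * G) * mu_linf p q \<omega> \<nu> \<mu>" using a G by (simp add: ennreal_mult mult_ac)
    finally show "ennreal ((1 - r) powr \<beta>) * (SUP z\<in>sphere 0 r. ennreal (norm (H \<mu> z))) \<le> ennreal (a * G) * mu_linf p q \<omega> \<nu> \<mu>" .
  qed
  obtain d where d: "0 < d" "\<And>\<mu>. \<mu> \<in> M_plus \<Longrightarrow> mu_linf p q \<omega> \<nu> \<mu> \<le> ennreal d * Dinf \<sigma> \<mu>"
    unfolding \<sigma>_def by (rule comparableD[OF mu_linf_comparable[OF \<sigma>0]]) blast
  have "comparable (mu_linf p q \<omega> \<nu>) (\<lambda>\<mu>. growth_norm \<beta> (H \<mu>))"
  proof (rule comparableI)
    show "0 < d * b" "0 < a * G" using d a b G by auto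
    fix \<mu> assume \<mu>: "\<mu> \<in> M_plus"
    have "mu_linf p q \<omega> \<nu> \<mu> \<le> ennreal d * (ennreal b * growth_norm \<beta> (H \<mu>))"
      by (rule order_trans[OF d(2)[OF \<mu>]]) (intro mult_left_mono low \<mu>, simp)
    then show "mu_linf p q \<omega> \<nu> \<mu> \<le> ennreal (d * b) * growth_norm \<beta> (H \<mu>)" using d(1) b by (simp add: ennreal_mult mult.assoc)
    show "growth_norm \<beta> (H \<mu>) \<le> ennreal (a * G) * mu_linf p q \<omega> \<nu> \<mu>" by (rule up[OF \<mu>])
  qed
  then show ?thesis unfolding H_def e \<sigma>_def .
qed

end

text \<open>Every quantity has been compared with \<open>Dinf\<close> or with the root of
  \<open>Dsum\<close>, so the norm equivalences follow by transitivity and the boundedness criteria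
  by finiteness. The growth condition occurs both for all \<beta> together and for each single
  \<beta>, covering both readings of a fixed but arbitrary parameter.\<close>

theorem theorem2:
  fixes p q :: real and \<omega> \<nu> :: "complex \<Rightarrow> real"
  assumes "0 < p" and "0 < q" and "\<omega> \<in> D_hat" and "\<nu> \<in> D_reg"
  shows
    "(p \<le> q \<longrightarrow>
       (\<forall>\<mu>\<in>M_plus.
          (bergman_bounded \<nu> p q (cesaro_op \<mu> \<omega>) \<longleftrightarrow> mu_Linf p q \<omega> \<nu> \<mu> < \<infinity>) \<and>
          (bergman_bounded \<nu> p q (cesaro_op \<mu> \<omega>) \<longleftrightarrow> mu_linf p q \<omega> \<nu> \<mu> < \<infinity>) \<and>
          (bergman_bounded \<nu> p q (cesaro_op \<mu> \<omega>) \<longleftrightarrow>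
             (\<forall>\<beta>>0. std_frac_deriv (\<beta> + 1 / p - 1 / q)
                (frac_deriv_pow \<nu> (1 / p - 1 / q) (fundamental_fun \<mu> \<omega>)) \<in> growth_space \<beta>)) \<and>
          (\<forall>\<beta>>0. bergman_bounded \<nu> p q (cesaro_op \<mu> \<omega>) \<longleftrightarrow>
             std_frac_deriv (\<beta> + 1 / p - 1 / q)
                (frac_deriv_pow \<nu> (1 / p - 1 / q) (fundamental_fun \<mu> \<omega>)) \<in> growth_space \<beta>)) \<and>
       comparable (\<lambda>\<mu>. bergman_opnorm \<nu> p q (cesaro_op \<mu> \<omega>)) (mu_Linf p q \<omega> \<nu>) \<and>
       comparable (mu_Linf p q \<omega> \<nu>) (mu_linf p q \<omega> \<nu>) \<and>
       (\<forall>\<beta>>0. comparable (mu_linf p q \<omega> \<nu>)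
          (\<lambda>\<mu>. growth_norm \<beta> (std_frac_deriv (\<beta> + 1 / p - 1 / q)
             (frac_deriv_pow \<nu> (1 / p - 1 / q) (fundamental_fun \<mu> \<omega>))))))
     \<and>
     (q < p \<longrightarrow>
       (\<forall>\<mu>\<in>M_plus.
          (bergman_bounded \<nu> p q (cesaro_op \<mu> \<omega>) \<longleftrightarrow> mu_Ls (q * p / (p - q)) \<omega> \<nu> \<mu> < \<infinity>) \<and>
          (bergman_bounded \<nu> p q (cesaro_op \<mu> \<omega>) \<longleftrightarrow> mu_ls (q * p / (p - q)) \<omega> \<nu> \<mu> < \<infinity>) \<and>
          (bergman_bounded \<nu> p q (cesaro_op \<mu> \<omega>) \<longleftrightarrow>
             fundamental_fun \<mu> \<omega> \<in> bergman_space \<nu> (q * p / (p - q)))) \<and>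
       comparable (\<lambda>\<mu>. bergman_opnorm \<nu> p q (cesaro_op \<mu> \<omega>)) (mu_Ls (q * p / (p - q)) \<omega> \<nu>) \<and>
       comparable (mu_Ls (q * p / (p - q)) \<omega> \<nu>) (mu_ls (q * p / (p - q)) \<omega> \<nu>) \<and>
       comparable (mu_ls (q * p / (p - q)) \<omega> \<nu>)
         (\<lambda>\<mu>. bergman_norm \<nu> (q * p / (p - q)) (fundamental_fun \<mu> \<omega>)))"
proof -
  obtain h C L c ho Co where cs: "cesaro_setting h C \<nu> L c ho Co \<omega>"
    and moments: "\<And>n. weight_moment \<nu> n = moment h n"
    and hats: "\<And>r. 0 \<le> r \<Longrightarrow> weight_hat \<nu> r = ennreal (tail h r)" "\<And>r. 0 \<le> r \<Longrightarrow> weight_hat \<omega> r = ennreal (tail ho r)"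
    by (rule cesaro_setting_exists[OF assms(3,4)]) blast
  interpret cesaro_setting h C \<nu> L c ho Co \<omega> by (rule cs)
  interpret cesaro_full h C \<nu> L c ho Co \<omega> by unfold_locales (use moments hats in auto)
  note fin = comparable_finite_iff
  show ?thesis
  proof (intro conjI impI)
    assume pq: "p \<le> q"
    define \<sigma> where "\<sigma> = 1 / p - 1 / q"
    have \<sigma>: "0 \<le> 1 / p - 1 / q" using pq assms(1) by (simp add: frac_le)
    define D where "D \<beta> \<mu> = std_frac_deriv (\<beta> + 1 / p - 1 / q) (frac_deriv_pow \<nu> (1 / p - 1 / q) (fundamental_fun \<mu> \<omega>))" for \<beta> \<mu>
    show 1: "comparable (\<lambda>\<mu>. bergman_opnorm \<nu> p q (cesaro_op \<mu> \<omega>)) (mu_Linf p q \<omega> \<nu>)"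
      by (rule comparable_trans[OF opnorm_comparable_le[OF assms(1) pq] comparable_sym[OF mu_Linf_comparable[OF \<sigma>]]])
    show 2: "comparable (mu_Linf p q \<omega> \<nu>) (mu_linf p q \<omega> \<nu>)"
      by (rule comparable_trans[OF mu_Linf_comparable[OF \<sigma>] comparable_sym[OF mu_linf_comparable[OF \<sigma>]]])
    have 3: "comparable (mu_linf p q \<omega> \<nu>) (\<lambda>\<mu>. growth_norm \<beta> (D \<beta> \<mu>))" if "0 < \<beta>" for \<beta>
      unfolding D_def by (rule growth_comparable[OF that \<sigma>])
    then show "\<forall>\<beta>>0. comparable (mu_linf p q \<omega> \<nu>) (\<lambda>\<mu>. growth_norm \<beta> (std_frac_deriv (\<beta> + 1 / p - 1 / q)
             (frac_deriv_pow \<nu> (1 / p - 1 / q) (fundamental_fun \<mu> \<omega>))))" unfolding D_def by blast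
    have ab: "bergman_bounded \<nu> p q (cesaro_op \<mu> \<omega>) \<longleftrightarrow> mu_Linf p q \<omega> \<nu> \<mu> < \<infinity>" if "\<mu> \<in> M_plus" for \<mu>
      using fin[OF 1 that] by (simp add: bergman_bounded_iff)
    have ac: "bergman_bounded \<nu> p q (cesaro_op \<mu> \<omega>) \<longleftrightarrow> mu_linf p q \<omega> \<nu> \<mu> < \<infinity>" if "\<mu> \<in> M_plus" for \<mu>
      using ab[OF that] fin[OF 2 that] by simp
    have ad: "bergman_bounded \<nu> p q (cesaro_op \<mu> \<omega>) \<longleftrightarrow> D \<beta> \<mu> \<in> growth_space \<beta>" if \<mu>: "\<mu> \<in> M_plus" and \<beta>: "0 < \<beta>" for \<mu> \<beta>
    proof -
      have "0 < \<beta> + 1 / p - 1 / q" using \<beta> \<sigma> by linarith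
      then have "D \<beta> \<mu> holomorphic_on ball 0 1" unfolding D_def by (rule frac_holomorphic[OF \<mu> _ \<sigma>])
      then show ?thesis using ac[OF \<mu>] fin[OF 3[OF \<beta>] \<mu>] by (simp add: growth_space_def)
    qed
    \<comment> \<open>A positive \<beta> must exist for the condition quantified over all \<beta> to
      imply boundedness.\<close>
    have "\<exists>\<beta>::real. 0 < \<beta>" by (rule exI[of _ 1]) simp
    then have ad': "bergman_bounded \<nu> p q (cesaro_op \<mu> \<omega>) \<longleftrightarrow> (\<forall>\<beta>>0. D \<beta> \<mu> \<in> growth_space \<beta>)" if "\<mu> \<in> M_plus" for \<mu>
      using ad[OF that] by blast
    show "\<forall>\<mu>\<in>M_plus.
          (bergman_bounded \<nu> p q (cesaro_op \<mu> \<omega>) \<longleftrightarrow> mu_Linf p q \<omega> \<nu> \<mu> < \<infinity>) \<and>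
          (bergman_bounded \<nu> p q (cesaro_op \<mu> \<omega>) \<longleftrightarrow> mu_linf p q \<omega> \<nu> \<mu> < \<infinity>) \<and>
          (bergman_bounded \<nu> p q (cesaro_op \<mu> \<omega>) \<longleftrightarrow>
             (\<forall>\<beta>>0. std_frac_deriv (\<beta> + 1 / p - 1 / q)
                (frac_deriv_pow \<nu> (1 / p - 1 / q) (fundamental_fun \<mu> \<omega>)) \<in> growth_space \<beta>)) \<and>
          (\<forall>\<beta>>0. bergman_bounded \<nu> p q (cesaro_op \<mu> \<omega>) \<longleftrightarrow>
             std_frac_deriv (\<beta> + 1 / p - 1 / q)
                (frac_deriv_pow \<nu> (1 / p - 1 / q) (fundamental_fun \<mu> \<omega>)) \<in> growth_space \<beta>)"
      unfolding D_def[symmetric] by (intro ballI conjI allI impI ab ac ad ad')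
  next
    assume qp: "q < p"
    define s where "s = q * p / (p - q)"
    have s: "0 < s" using qp assms(1,2) by (simp add: s_def)
    show 1: "comparable (\<lambda>\<mu>. bergman_opnorm \<nu> p q (cesaro_op \<mu> \<omega>)) (mu_Ls (q * p / (p - q)) \<omega> \<nu>)"
      by (rule comparable_trans[OF opnorm_comparable_gt[OF assms(2) qp] comparable_sym[OF mu_Ls_comparable[OF s, unfolded s_def]]])
    show 2: "comparable (mu_Ls (q * p / (p - q)) \<omega> \<nu>) (mu_ls (q * p / (p - q)) \<omega> \<nu>)"
      unfolding s_def[symmetric] by (rule comparable_trans[OF mu_Ls_comparable[OF s] comparable_sym[OF mu_ls_comparable[OF s]]])
    show 3: "comparable (mu_ls (q * p / (p - q)) \<omega> \<nu>) (\<lambda>\<mu>. bergman_norm \<nu> (q * p / (p - q)) (fundamental_fun \<mu> \<omega>))"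
      unfolding s_def[symmetric] by (rule comparable_trans[OF mu_ls_comparable[OF s] fundamental_comparable[OF s]])
    have hol: "fundamental_fun \<mu> \<omega> holomorphic_on ball 0 1" if "\<mu> \<in> M_plus" for \<mu>
      unfolding fundamental_fun_def by (rule cesaro_holomorphic[OF that]) simp
    show "\<forall>\<mu>\<in>M_plus.
          (bergman_bounded \<nu> p q (cesaro_op \<mu> \<omega>) \<longleftrightarrow> mu_Ls (q * p / (p - q)) \<omega> \<nu> \<mu> < \<infinity>) \<and>
          (bergman_bounded \<nu> p q (cesaro_op \<mu> \<omega>) \<longleftrightarrow> mu_ls (q * p / (p - q)) \<omega> \<nu> \<mu> < \<infinity>) \<and>
          (bergman_bounded \<nu> p q (cesaro_op \<mu> \<omega>) \<longleftrightarrow> fundamental_fun \<mu> \<omega> \<in> bergman_space \<nu> (q * p / (p - q)))"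
    proof
      fix \<mu> assume \<mu>: "\<mu> \<in> M_plus"
      show "(bergman_bounded \<nu> p q (cesaro_op \<mu> \<omega>) \<longleftrightarrow> mu_Ls (q * p / (p - q)) \<omega> \<nu> \<mu> < \<infinity>) \<and>
          (bergman_bounded \<nu> p q (cesaro_op \<mu> \<omega>) \<longleftrightarrow> mu_ls (q * p / (p - q)) \<omega> \<nu> \<mu> < \<infinity>) \<and>
          (bergman_bounded \<nu> p q (cesaro_op \<mu> \<omega>) \<longleftrightarrow> fundamental_fun \<mu> \<omega> \<in> bergman_space \<nu> (q * p / (p - q)))"
        using fin[OF 1 \<mu>] fin[OF 2 \<mu>] fin[OF 3 \<mu>] hol[OF \<mu>] by (simp add: bergman_bounded_iff bergman_space_def)
    qed
  qed
qed

end
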